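(* Let $\widehat H_{dd}=\{\sigma\in\widetilde H^{-1}\otimes\mathbb S:\operatorname{div}\sigma\in\widetilde H^{-1}\otimes\mathbb V,\ \operatorname{div}\operatorname{div}\sigma\in\widetilde H^{-1}\}$ with norm $\|\sigma\|_{dd}$. There exist continuous linear operators $S^{dd}_0:\widehat H_{dd}\to\mathring H^1\otimes\mathbb S$, $S^{dd}_1:\widehat H_{dd}\to\mathring H^1\otimes\mathbb T$, $S^{dd}_2:\widehat H_{dd}\to\mathring H^1\otimes\mathbb S$ such that every $\sigma\in\widehat H_{dd}$ satisfies \[ \sigma=S^{dd}_0\sigma+\operatorname{sym}\operatorname{curl}S^{dd}_1\sigma+\operatorname{inc}S^{dd}_2\sigma . \] Consequently $\widehat H_{dd}=\widetilde H_{dd}$.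
   Context: $\Omega\subset\mathbb R^3$ is bounded, open, connected and simply connected, with Lipschitz boundary, and $\partial\Omega$ is connected. $\mathbb V=\mathbb R^3$, $\mathbb S$ and $\mathbb T$ are the symmetric and trace-free $3\times3$ real matrices, $\operatorname{sym}\tau=\frac12(\tau+\tau^\top)$; div and curl of matrix fields act row-wise; $\operatorname{inc}g=\operatorname{curl}((\operatorname{curl}g)^\top)$; derivatives are distributional on $\mathbb R^3$. $\mathring H^1$ is the closure of $\mathcal D(\Omega)$ (smooth functions compactly supported in $\Omega$) in $H^1(\Omega)$. $\widetilde H^{-1}=\{u\in H^{-1}(\mathbb R^3):\operatorname{supp}u\subset\overline\Omega\}$ with the $H^{-1}(\mathbb R^3)$ norm (componentwise). $\|\sigma\|_{dd}^2=\|\sigma\|_{\widetilde H^{-1}}^2+\|\operatorname{div}\sigma\|_{\widetilde H^{-1}}^2+\|\operatorname{div}\operatorname{div}\sigma\|_{\widetilde H^{-1}}^2$, and $\widetilde H_{dd}$ is the closure of $\mathcal D(\Omega)\otimes\mathbb S$ (extended by zero) in this norm. *)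

theory Defs
  imports "HOL-Analysis.Analysis"
begin

type_synonym pt = "real^3"
type_synonym fn = "pt \<Rightarrow> real"
(* a distribution on R^3, acting on (smooth compactly supported) test functions *)
type_synonym distr = "fn \<Rightarrow> real"

definition lipschitz_boundary :: "pt set \<Rightarrow> bool" where
  "lipschitz_boundary \<Omega> \<longleftrightarrow>
     (\<forall>x\<in>frontier \<Omega>. \<exists>r>0. \<exists>Q::real^3^3. \<exists>\<gamma>::real\<times>real \<Rightarrow> real. \<exists>L.
        orthogonal_matrix Q \<and> L-lipschitz_on UNIV \<gamma> \<and>
        (\<forall>y\<in>ball x r. y \<in> \<Omega> \<longleftrightarrow> (Q *v y) $ 3 < \<gamma> ((Q *v y) $ 1, (Q *v y) $ 2)))"

definition pd :: "3 \<Rightarrow> fn \<Rightarrow> fn" where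
  "pd i f = (\<lambda>x. frechet_derivative f (at x) (axis i 1))"

definition dpart :: "3 list \<Rightarrow> fn \<Rightarrow> fn" where
  "dpart ks f = fold pd ks f"

definition smooth_fn :: "fn \<Rightarrow> bool" where
  "smooth_fn f \<longleftrightarrow> (\<forall>ks. dpart ks f differentiable_on UNIV)"

definition tsupp :: "fn \<Rightarrow> pt set" where
  "tsupp f = closure {x. f x \<noteq> 0}"

definition test :: "fn \<Rightarrow> bool" where
  "test f \<longleftrightarrow> smooth_fn f \<and> compact (tsupp f)"

definition test_on :: "pt set \<Rightarrow> fn \<Rightarrow> bool" where
  "test_on \<Omega> f \<longleftrightarrow> test f \<and> tsupp f \<subseteq> \<Omega>"

definition L2 :: "fn \<Rightarrow> bool" where
  "L2 u \<longleftrightarrow> u \<in> borel_measurable lborel \<and> integrable lborel (\<lambda>x. (u x)\<^sup>2)"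

definition l2sq :: "fn \<Rightarrow> real" where
  "l2sq u = integral\<^sup>L lborel (\<lambda>x. (u x)\<^sup>2)"

definition h1t :: "fn \<Rightarrow> real" where
  "h1t \<phi> = sqrt (l2sq \<phi> + (\<Sum>i\<in>UNIV. l2sq (pd i \<phi>)))"

definition weak_pd :: "3 \<Rightarrow> fn \<Rightarrow> fn \<Rightarrow> bool" where
  "weak_pd i u g \<longleftrightarrow> (\<forall>\<phi>. test \<phi> \<longrightarrow>
      integral\<^sup>L lborel (\<lambda>x. u x * pd i \<phi> x) = - integral\<^sup>L lborel (\<lambda>x. g x * \<phi> x))"

definition H1 :: "fn \<Rightarrow> bool" where
  "H1 u \<longleftrightarrow> L2 u \<and> (\<forall>i. \<exists>g. L2 g \<and> weak_pd i u g)"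

definition wgrad :: "3 \<Rightarrow> fn \<Rightarrow> fn" where
  "wgrad i u = (SOME g. L2 g \<and> weak_pd i u g)"

definition h1norm :: "fn \<Rightarrow> real" where
  "h1norm u = sqrt (l2sq u + (\<Sum>i\<in>UNIV. l2sq (wgrad i u)))"

(* \<mathring>H^1(Omega): closure of D(Omega) in H^1, functions extended by zero to R^3 *)
definition H01 :: "pt set \<Rightarrow> fn \<Rightarrow> bool" where
  "H01 \<Omega> u \<longleftrightarrow> H1 u \<and>
     (\<exists>\<phi>::nat \<Rightarrow> fn. (\<forall>n. test_on \<Omega> (\<phi> n)) \<and>
        (\<lambda>n. h1norm (\<lambda>x. u x - \<phi> n x)) \<longlonglongrightarrow> 0)"

definition hm1_le :: "distr \<Rightarrow> real \<Rightarrow> bool" where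
  "hm1_le u C \<longleftrightarrow> (\<forall>\<phi>. test \<phi> \<longrightarrow> \<bar>u \<phi>\<bar> \<le> C * h1t \<phi>)"

definition Hm1 :: "distr \<Rightarrow> bool" where
  "Hm1 u \<longleftrightarrow>
     (\<forall>\<phi> \<psi> a b. test \<phi> \<longrightarrow> test \<psi> \<longrightarrow>
        u (\<lambda>x. a * \<phi> x + b * \<psi> x) = a * u \<phi> + b * u \<psi>) \<and>
     (\<exists>C. hm1_le u C)"

definition hm1norm :: "distr \<Rightarrow> real" where
  "hm1norm u = Inf {C. 0 \<le> C \<and> hm1_le u C}"

definition supp_in :: "distr \<Rightarrow> pt set \<Rightarrow> bool" where
  "supp_in u F \<longleftrightarrow> (\<forall>\<phi>. test \<phi> \<longrightarrow> tsupp \<phi> \<inter> F = {} \<longrightarrow> u \<phi> = 0)"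

definition Htm1 :: "pt set \<Rightarrow> distr \<Rightarrow> bool" where
  "Htm1 \<Omega> u \<longleftrightarrow> Hm1 u \<and> supp_in u (closure \<Omega>)"

definition fdist :: "fn \<Rightarrow> distr" where
  "fdist u = (\<lambda>\<phi>. integral\<^sup>L lborel (\<lambda>x. u x * \<phi> x))"

definition dderiv :: "3 \<Rightarrow> distr \<Rightarrow> distr" where
  "dderiv k u = (\<lambda>\<phi>. - u (pd k \<phi>))"

definition ddiv :: "(3 \<Rightarrow> 3 \<Rightarrow> distr) \<Rightarrow> 3 \<Rightarrow> distr" where
  "ddiv \<sigma> i = (\<lambda>\<phi>. \<Sum>j\<in>UNIV. dderiv j (\<sigma> i j) \<phi>)"

definition ddivdiv :: "(3 \<Rightarrow> 3 \<Rightarrow> distr) \<Rightarrow> distr" where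
  "ddivdiv \<sigma> = (\<lambda>\<phi>. \<Sum>i\<in>UNIV. dderiv i (ddiv \<sigma> i) \<phi>)"

definition levi :: "3 \<Rightarrow> 3 \<Rightarrow> 3 \<Rightarrow> real" where
  "levi i j k =
     (if (i, j, k) \<in> {(1, 2, 3), (2, 3, 1), (3, 1, 2)} then 1
      else if (i, j, k) \<in> {(1, 3, 2), (3, 2, 1), (2, 1, 3)} then -1 else 0)"

definition dcurl :: "(3 \<Rightarrow> 3 \<Rightarrow> distr) \<Rightarrow> 3 \<Rightarrow> 3 \<Rightarrow> distr" where
  "dcurl T i j = (\<lambda>\<phi>. \<Sum>k\<in>UNIV. \<Sum>l\<in>UNIV. levi j k l * dderiv k (T i l) \<phi>)"

definition dtrans :: "(3 \<Rightarrow> 3 \<Rightarrow> distr) \<Rightarrow> 3 \<Rightarrow> 3 \<Rightarrow> distr" where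
  "dtrans T i j = T j i"

definition dsym :: "(3 \<Rightarrow> 3 \<Rightarrow> distr) \<Rightarrow> 3 \<Rightarrow> 3 \<Rightarrow> distr" where
  "dsym T i j = (\<lambda>\<phi>. (T i j \<phi> + T j i \<phi>) / 2)"

definition dinc :: "(3 \<Rightarrow> 3 \<Rightarrow> distr) \<Rightarrow> 3 \<Rightarrow> 3 \<Rightarrow> distr" where
  "dinc g = dcurl (dtrans (dcurl g))"

definition matdist :: "(3 \<Rightarrow> 3 \<Rightarrow> fn) \<Rightarrow> 3 \<Rightarrow> 3 \<Rightarrow> distr" where
  "matdist F i j = fdist (F i j)"

definition Hhat_dd :: "pt set \<Rightarrow> (3 \<Rightarrow> 3 \<Rightarrow> distr) \<Rightarrow> bool" where
  "Hhat_dd \<Omega> \<sigma> \<longleftrightarrow>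
     (\<forall>i j \<phi>. test \<phi> \<longrightarrow> \<sigma> i j \<phi> = \<sigma> j i \<phi>) \<and>
     (\<forall>i j. Htm1 \<Omega> (\<sigma> i j)) \<and> (\<forall>i. Htm1 \<Omega> (ddiv \<sigma> i)) \<and> Htm1 \<Omega> (ddivdiv \<sigma>)"

definition dd_norm :: "(3 \<Rightarrow> 3 \<Rightarrow> distr) \<Rightarrow> real" where
  "dd_norm \<sigma> = sqrt ((\<Sum>i\<in>UNIV. \<Sum>j\<in>UNIV. (hm1norm (\<sigma> i j))\<^sup>2)
                     + (\<Sum>i\<in>UNIV. (hm1norm (ddiv \<sigma> i))\<^sup>2) + (hm1norm (ddivdiv \<sigma>))\<^sup>2)"

(* ||tau||_dd \<le> eps, written without presupposing finiteness of the norms *)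
definition dd_within :: "(3 \<Rightarrow> 3 \<Rightarrow> distr) \<Rightarrow> real \<Rightarrow> bool" where
  "dd_within \<tau> \<epsilon> \<longleftrightarrow> (\<exists>a b c. (\<forall>i j. 0 \<le> a i j \<and> hm1_le (\<tau> i j) (a i j)) \<and>
       (\<forall>i. 0 \<le> b i \<and> hm1_le (ddiv \<tau> i) (b i)) \<and> 0 \<le> c \<and> hm1_le (ddivdiv \<tau>) c \<and>
       (\<Sum>i\<in>UNIV. \<Sum>j\<in>UNIV. (a i j)\<^sup>2) + (\<Sum>i\<in>UNIV. (b i)\<^sup>2) + c\<^sup>2 \<le> \<epsilon>\<^sup>2)"

definition test_sym_on :: "pt set \<Rightarrow> (3 \<Rightarrow> 3 \<Rightarrow> fn) \<Rightarrow> bool" where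
  "test_sym_on \<Omega> \<Phi> \<longleftrightarrow> (\<forall>i j. test_on \<Omega> (\<Phi> i j) \<and> \<Phi> i j = \<Phi> j i)"

(* closure of D(Omega) \<otimes> S in the dd-norm, realised inside distributions on R^3 *)
definition Htilde_dd :: "pt set \<Rightarrow> (3 \<Rightarrow> 3 \<Rightarrow> distr) \<Rightarrow> bool" where
  "Htilde_dd \<Omega> \<sigma> \<longleftrightarrow> (\<forall>\<epsilon>>0. \<exists>\<Phi>. test_sym_on \<Omega> \<Phi> \<and>
       dd_within (\<lambda>i j \<phi>. \<sigma> i j \<phi> - matdist \<Phi> i j \<phi>) \<epsilon>)"

definition mlin :: "real \<Rightarrow> (3 \<Rightarrow> 3 \<Rightarrow> distr) \<Rightarrow> real \<Rightarrow> (3 \<Rightarrow> 3 \<Rightarrow> distr) \<Rightarrow> 3 \<Rightarrow> 3 \<Rightarrow> distr" where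
  "mlin a \<sigma> b \<tau> = (\<lambda>i j \<phi>. a * \<sigma> i j \<phi> + b * \<tau> i j \<phi>)"

definition bdd_lin_op :: "pt set \<Rightarrow> ((3 \<Rightarrow> 3 \<Rightarrow> real) \<Rightarrow> bool)
      \<Rightarrow> ((3 \<Rightarrow> 3 \<Rightarrow> distr) \<Rightarrow> 3 \<Rightarrow> 3 \<Rightarrow> fn) \<Rightarrow> bool" where
  "bdd_lin_op \<Omega> P S \<longleftrightarrow>
     (\<forall>\<sigma>. Hhat_dd \<Omega> \<sigma> \<longrightarrow> (\<forall>i j. H01 \<Omega> (S \<sigma> i j)) \<and>
          (AE x in lborel. P (\<lambda>i j. S \<sigma> i j x))) \<and>
     (\<forall>\<sigma> \<tau> a b. Hhat_dd \<Omega> \<sigma> \<longrightarrow> Hhat_dd \<Omega> \<tau> \<longrightarrow> (\<forall>i j.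
          AE x in lborel. S (mlin a \<sigma> b \<tau>) i j x = a * S \<sigma> i j x + b * S \<tau> i j x)) \<and>
     (\<exists>C. \<forall>\<sigma>. Hhat_dd \<Omega> \<sigma> \<longrightarrow> (\<forall>i j. h1norm (S \<sigma> i j) \<le> C * dd_norm \<sigma>))"

definition is_sym :: "(3 \<Rightarrow> 3 \<Rightarrow> real) \<Rightarrow> bool" where
  "is_sym M \<longleftrightarrow> (\<forall>i j. M i j = M j i)"

definition is_tracefree :: "(3 \<Rightarrow> 3 \<Rightarrow> real) \<Rightarrow> bool" where
  "is_tracefree M \<longleftrightarrow> (\<Sum>i\<in>UNIV. M i i) = 0"

end

(* Near each boundary point the Lipschitz condition provides an open cone of directions pointing into
   Omega. Translations and segment averages along finitely many directions d_i of that cone generate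
   operators P_h that commute with derivatives, tend to the identity as h -> 0 and satisfy
   P_h - P_2h = h^2 sum_i d_i d_i : grad grad F_i,h. Summing over dyadic scales gives
   u = P_h u + sum_i (d_i . grad)^2 G_i u, where P_h and G_i map supports into Omega along the cone.
   G_i is bounded from H^-1 to H^1: two derivatives consume two averages at each scale, and the
   parallelogram law gives a square function bound for the averages that are left over.
   For symmetric u and any vector d,
     (d . grad)^2 u = (div div u) d d^T + sym curl (2 d (div u x d)^T) + inc (d x u x d),
   so with theta from a partition of unity, P_h and G_i applied to theta sigma, div (theta sigma) and
   div div (theta sigma), all of which are in H^-1, give the three operators. Mollifying along the
   cone approximates the resulting H^1 functions by test functions on Omega, and the decomposition
   then transports this approximation to sigma itself. *)
theory Submission
  imports Defs "HOL-Probability.Probability_Measure"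
begin

section \<open>Smooth functions and test functions\<close>

lemma dpart_Cons: "dpart (k # ks) f = dpart ks (pd k f)"
  by (simp add: dpart_def)

lemma smooth_fn_iff: "smooth_fn f \<longleftrightarrow> f differentiable_on UNIV \<and> (\<forall>k. smooth_fn (pd k f))"
proof
  assume f: "smooth_fn f"
  have "dpart [] f differentiable_on UNIV" using f unfolding smooth_fn_def by blast
  moreover have "dpart (k # ks) f differentiable_on UNIV" for k ks
    using f unfolding smooth_fn_def by blast
  ultimately show "f differentiable_on UNIV \<and> (\<forall>k. smooth_fn (pd k f))"
    by (simp add: dpart_Cons smooth_fn_def) (simp add: dpart_def)
next
  assume f: "f differentiable_on UNIV \<and> (\<forall>k. smooth_fn (pd k f))"
  have "dpart ks f differentiable_on UNIV" for ks
    using f by (cases ks) (auto simp: dpart_Cons smooth_fn_def, simp add: dpart_def)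
  thus "smooth_fn f" by (simp add: smooth_fn_def)
qed

lemma smooth_fn_coinduct:
  assumes "X f" "\<And>f. X f \<Longrightarrow> f differentiable_on UNIV" "\<And>f k. X f \<Longrightarrow> X (pd k f)"
  shows "smooth_fn f"
proof -
  have "dpart ks f differentiable_on UNIV" for ks
    using assms(1)
  proof (induction ks arbitrary: f)
    case Nil thus ?case using assms(2) by (simp add: dpart_def)
  next
    case (Cons k ks) thus ?case using assms(3) by (simp add: dpart_Cons)
  qed
  thus ?thesis by (simp add: smooth_fn_def)
qed

lemma smooth_pd: "smooth_fn f \<Longrightarrow> smooth_fn (pd k f)"
  using smooth_fn_iff by blast

lemma smooth_differentiable: "smooth_fn f \<Longrightarrow> f differentiable (at x)"
  using smooth_fn_iff[of f] by (auto simp: differentiable_on_def)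

lemma smooth_has_derivative:
  "smooth_fn f \<Longrightarrow> (f has_derivative frechet_derivative f (at x)) (at x)"
  using smooth_differentiable frechet_derivative_works by blast

lemma smooth_continuous_on: "smooth_fn f \<Longrightarrow> continuous_on A f"
  by (meson continuous_on_subset differentiable_imp_continuous_on smooth_fn_iff subset_UNIV)

lemma smooth_borel [measurable_dest]: "smooth_fn f \<Longrightarrow> f \<in> borel_measurable borel"
  by (simp add: borel_measurable_continuous_onI smooth_continuous_on)

lemma pd_eqI: "(f has_derivative f') (at x) \<Longrightarrow> pd i f x = f' (axis i 1)"
  by (metis frechet_derivative_at pd_def)

lemma frechet_pd:
  assumes "f differentiable (at x)"
  shows "frechet_derivative f (at x) v = (\<Sum>i\<in>UNIV. v $ i * pd i f x)"
proof -
  have L: "linear (frechet_derivative f (at x))"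
    using assms linear_frechet_derivative by blast
  have "v = (\<Sum>i\<in>UNIV. (v $ i) *\<^sub>R axis i 1)"
    by (metis basis_expansion scalar_mult_eq_scaleR)
  hence "frechet_derivative f (at x) v = (\<Sum>i\<in>UNIV. frechet_derivative f (at x) ((v $ i) *\<^sub>R axis i 1))"
    using linear_sum[OF L] by metis
  thus ?thesis by (simp add: linear_scale[OF L] pd_def)
qed

lemma smooth_pd_derivative:
  "smooth_fn f \<Longrightarrow> (f has_derivative (\<lambda>v. \<Sum>i\<in>UNIV. v $ i * pd i f x)) (at x)"
proof -
  assume f: "smooth_fn f"
  have "frechet_derivative f (at x) = (\<lambda>v. \<Sum>i\<in>UNIV. v $ i * pd i f x)"
    using frechet_pd[OF smooth_differentiable[OF f]] by blast
  thus ?thesis using smooth_has_derivative[OF f, of x] by simp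
qed

lemma pd_const: "pd i (\<lambda>_. c) = (\<lambda>_. 0)"
  by (rule ext, rule pd_eqI[THEN trans], rule has_derivative_const) simp

lemma pd_add_diff:
  assumes "f differentiable (at x)" "g differentiable (at x)"
  shows "pd i (\<lambda>x. f x + g x) x = pd i f x + pd i g x"
  using pd_eqI[OF has_derivative_add[OF assms[unfolded frechet_derivative_works]]]
  by (simp add: pd_def)

lemma pd_mult_diff:
  assumes "f differentiable (at x)" "g differentiable (at x)"
  shows "pd i (\<lambda>x. f x * g x) x = f x * pd i g x + pd i f x * g x"
  using pd_eqI[OF has_derivative_mult[OF assms[unfolded frechet_derivative_works]]]
  by (simp add: pd_def)

lemma pd_chain_diff:
  assumes "f differentiable (at x)" "(h has_real_derivative d) (at (f x))"
  shows "pd i (\<lambda>x. h (f x)) x = d * pd i f x"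
  using pd_eqI[OF has_derivative_compose[OF assms(1)[unfolded frechet_derivative_works]
      assms(2)[unfolded has_field_derivative_def]]]
  by (simp add: pd_def)

lemma chain_differentiable:
  assumes "f differentiable (at x)" "(h has_real_derivative d) (at (f x))"
  shows "(\<lambda>x. h (f x)) differentiable (at x)"
  using has_derivative_compose[OF assms(1)[unfolded frechet_derivative_works]
      assms(2)[unfolded has_field_derivative_def]] by (auto simp: differentiable_def)

definition flat :: "nat \<Rightarrow> real \<Rightarrow> real" where
  "flat n s = (if s > 0 then inverse s ^ n * exp (- inverse s) else 0)"

lemma flat_nonneg: "flat n s \<ge> 0" by (simp add: flat_def)

lemma flat_pos_iff: "flat n s > 0 \<longleftrightarrow> s > 0" by (simp add: flat_def)

lemma flat_right: "((\<lambda>s. inverse s ^ n * exp (- inverse s)) \<longlongrightarrow> 0) (at_right (0::real))"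
proof -
  have "((\<lambda>x::real. x ^ n / exp x) \<longlongrightarrow> 0) at_top" by (rule tendsto_power_div_exp_0)
  hence "((\<lambda>s::real. inverse s ^ n / exp (inverse s)) \<longlongrightarrow> 0) (at_right 0)"
    by (rule filterlim_compose[OF _ filterlim_inverse_at_top_right])
  thus ?thesis by (simp add: exp_minus divide_inverse)
qed

lemma flat_deriv: "(flat n has_real_derivative (flat (n+2) s - real n * flat (n+1) s)) (at s)"
proof -
  consider "s > 0" | "s < 0" | "s = 0" by linarith
  thus ?thesis
  proof cases
    case 1
    have "((\<lambda>s. inverse s ^ n * exp (- inverse s)) has_real_derivative
        (flat (n+2) s - real n * flat (n+1) s)) (at s)"
    proof -
      have e: "real n * inverse s ^ (n - 1) * (inverse s * inverse s) = real n * inverse s ^ (n + 1)"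
        by (cases n) (auto simp: algebra_simps)
      have "((\<lambda>s. inverse s ^ n) has_real_derivative (- (real n * inverse s ^ (n + 1)))) (at s)"
        by (rule DERIV_cong[OF DERIV_power[OF DERIV_inverse]])
           (use 1 e in \<open>auto simp: power2_eq_square algebra_simps\<close>)
      moreover have "((\<lambda>s. exp (- inverse s)) has_real_derivative (exp (- inverse s) * inverse s ^ 2)) (at s)"
        by (rule DERIV_cong[OF DERIV_chain'[OF DERIV_minus[OF DERIV_inverse] DERIV_exp]])
           (use 1 in \<open>auto simp: power2_eq_square\<close>)
      ultimately show ?thesis
        by (rule DERIV_cong[OF DERIV_mult]) (use 1 in \<open>auto simp: flat_def algebra_simps power2_eq_square\<close>)
    qed
    thus ?thesis
      by (rule has_field_derivative_transform_within_open[where S="{0<..}"])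
         (use 1 in \<open>auto simp: flat_def\<close>)
  next
    case 2
    have "((\<lambda>s. 0) has_real_derivative (flat (n+2) s - real n * flat (n+1) s)) (at s)"
      using 2 by (simp add: flat_def)
    thus ?thesis
      by (rule has_field_derivative_transform_within_open[where S="{..<0}"])
         (use 2 in \<open>auto simp: flat_def\<close>)
  next
    case 3
    have R: "((\<lambda>h. (flat n h) / h) \<longlongrightarrow> 0) (at_right 0)"
      by (rule Lim_transform_eventually[OF flat_right[of "Suc n"]])
         (auto simp: flat_def eventually_at_filter field_simps)
    have L: "((\<lambda>h. (flat n h) / h) \<longlongrightarrow> 0) (at_left 0)"
      by (rule Lim_transform_eventually[OF tendsto_const])
         (auto simp: flat_def eventually_at_filter)
    show ?thesis
      using filterlim_split_at[OF L R] 3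
      by (simp add: has_field_derivative_iff) (simp add: flat_def)
  qed
qed

inductive sm :: "fn \<Rightarrow> bool" where
  sm_base: "smooth_fn f \<Longrightarrow> sm f"
| sm_add: "sm f \<Longrightarrow> sm g \<Longrightarrow> sm (\<lambda>x. f x + g x)"
| sm_mult: "sm f \<Longrightarrow> sm g \<Longrightarrow> sm (\<lambda>x. f x * g x)"
| sm_flat: "sm f \<Longrightarrow> sm (\<lambda>x. flat n (f x))"
| sm_inv: "sm f \<Longrightarrow> (\<And>x. f x \<noteq> 0) \<Longrightarrow> sm (\<lambda>x. inverse (f x))"

lemma smooth_const: "smooth_fn (\<lambda>_. c)"
  by (rule smooth_fn_coinduct[where X="\<lambda>f. \<exists>c. f = (\<lambda>_. c)"]) (auto simp: pd_const)

lemma sm_pd: "sm f \<Longrightarrow> f differentiable_on UNIV \<and> (\<forall>k. sm (pd k f))"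
proof (induction rule: sm.induct)
  case (sm_base f)
  thus ?case using smooth_fn_iff sm.sm_base by blast
next
  case (sm_add f g)
  have d: "f differentiable (at x)" "g differentiable (at x)" for x
    using sm_add by (auto simp: differentiable_on_def)
  have "pd k (\<lambda>x. f x + g x) = (\<lambda>x. pd k f x + pd k g x)" for k
    using pd_add_diff[OF d] by auto
  thus ?case using sm_add d by (auto simp: differentiable_on_def intro: sm.intros)
next
  case (sm_mult f g)
  have d: "f differentiable (at x)" "g differentiable (at x)" for x
    using sm_mult by (auto simp: differentiable_on_def)
  have "pd k (\<lambda>x. f x * g x) = (\<lambda>x. f x * pd k g x + pd k f x * g x)" for k
    using pd_mult_diff[OF d] by auto
  moreover have "sm (\<lambda>x. f x * pd k g x + pd k f x * g x)" for k
    using sm_mult by (intro sm.sm_add sm.sm_mult) auto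
  ultimately show ?case using d by (auto simp: differentiable_on_def)
next
  case (sm_flat f n)
  have d: "f differentiable (at x)" for x
    using sm_flat by (auto simp: differentiable_on_def)
  have "pd k (\<lambda>x. flat n (f x)) = (\<lambda>x. (flat (n+2) (f x) + (- real n) * flat (n+1) (f x)) * pd k f x)" for k
    using pd_chain_diff[OF d flat_deriv] by auto
  moreover have "sm (\<lambda>x. (flat (n+2) (f x) + (- real n) * flat (n+1) (f x)) * pd k f x)" for k
    using sm_flat by (intro sm.sm_mult sm.sm_add sm.sm_flat sm.sm_base[OF smooth_const]) auto
  ultimately show ?case using chain_differentiable[OF d flat_deriv] by (auto simp: differentiable_on_def)
next
  case (sm_inv f)
  have d: "f differentiable (at x)" for x
    using sm_inv by (auto simp: differentiable_on_def)
  have i: "(inverse has_real_derivative (- 1 * (inverse (f x) * inverse (f x)))) (at (f x))" for x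
    using DERIV_inverse[of "f x"] sm_inv(2)[of x] by (simp add: power2_eq_square)
  have "pd k (\<lambda>x. inverse (f x)) = (\<lambda>x. (- 1 * (inverse (f x) * inverse (f x))) * pd k f x)" for k
    using pd_chain_diff[OF d i] by auto
  moreover have "sm (\<lambda>x. (- 1 * (inverse (f x) * inverse (f x))) * pd k f x)" for k
    using sm_inv by (intro sm.sm_mult sm.sm_base[OF smooth_const] sm.sm_inv) auto
  ultimately show ?case using chain_differentiable[OF d i] by (auto simp: differentiable_on_def)
qed

lemma sm_smooth: "sm f \<Longrightarrow> smooth_fn f"
  by (rule smooth_fn_coinduct[where X=sm]) (use sm_pd in auto)

lemma smooth_add: "smooth_fn f \<Longrightarrow> smooth_fn g \<Longrightarrow> smooth_fn (\<lambda>x. f x + g x)"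
  and smooth_mult: "smooth_fn f \<Longrightarrow> smooth_fn g \<Longrightarrow> smooth_fn (\<lambda>x. f x * g x)"
  and smooth_flat: "smooth_fn f \<Longrightarrow> smooth_fn (\<lambda>x. flat n (f x))"
  and smooth_inverse: "smooth_fn f \<Longrightarrow> (\<And>x. f x \<noteq> 0) \<Longrightarrow> smooth_fn (\<lambda>x. inverse (f x))"
  by (auto intro!: sm_smooth intro: sm.intros)

lemma smooth_cmult: "smooth_fn f \<Longrightarrow> smooth_fn (\<lambda>x. c * f x)"
  by (rule smooth_mult[OF smooth_const])

lemma smooth_diff: "smooth_fn f \<Longrightarrow> smooth_fn g \<Longrightarrow> smooth_fn (\<lambda>x. f x - g x)"
  using smooth_add[OF _ smooth_cmult[of g "-1"], of f] by simp

lemma smooth_sum: "(\<And>i. i \<in> I \<Longrightarrow> smooth_fn (f i)) \<Longrightarrow> smooth_fn (\<lambda>x. \<Sum>i\<in>I. f i x)"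
  by (induction I rule: infinite_finite_induct) (auto intro: smooth_const smooth_add)

lemma smooth_nth: "smooth_fn (\<lambda>x. x $ i)"
proof (subst smooth_fn_iff, intro conjI allI)
  have d: "((\<lambda>x::pt. x $ i) has_derivative (\<lambda>x. x $ i)) (at x)" for x
    by (rule bounded_linear.has_derivative[OF bounded_linear_vec_nth]) simp
  show "(\<lambda>x::pt. x $ i) differentiable_on UNIV"
    using d by (auto simp: differentiable_on_def differentiable_def)
  fix k have "pd k (\<lambda>x::pt. x $ i) = (\<lambda>x. axis k 1 $ i)"
    using pd_eqI[OF d] by auto
  thus "smooth_fn (pd k (\<lambda>x::pt. x $ i))" by (simp add: smooth_const)
qed

lemma pd_lin:
  assumes "smooth_fn f" "smooth_fn g"
  shows "pd i (\<lambda>x. a * f x + b * g x) = (\<lambda>x. a * pd i f x + b * pd i g x)"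
proof
  fix x
  show "pd i (\<lambda>x. a * f x + b * g x) x = a * pd i f x + b * pd i g x"
    using pd_add_diff[of "\<lambda>x. a * f x" x "\<lambda>x. b * g x"]
      pd_mult_diff[of "\<lambda>x. a" x f] pd_mult_diff[of "\<lambda>x. b" x g] assms
    by (simp add: smooth_differentiable smooth_cmult smooth_const pd_const)
qed

lemma pd_cmult: "smooth_fn f \<Longrightarrow> pd i (\<lambda>x. a * f x) = (\<lambda>x. a * pd i f x)"
  using pd_lin[of f f i a 0] by simp

lemma pd_sum:
  assumes "\<And>k. k \<in> I \<Longrightarrow> smooth_fn (f k)"
  shows "pd i (\<lambda>x. \<Sum>k\<in>I. f k x) = (\<lambda>x. \<Sum>k\<in>I. pd i (f k) x)"
  using assms
proof (induction I rule: infinite_finite_induct)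
  case (insert k I)
  thus ?case using pd_lin[of "f k" "\<lambda>x. \<Sum>k\<in>I. f k x" i 1 1] by (simp add: smooth_sum)
qed (auto simp: pd_const)

lemma pd_mult:
  assumes "smooth_fn f" "smooth_fn g"
  shows "pd i (\<lambda>x. f x * g x) = (\<lambda>x. f x * pd i g x + pd i f x * g x)"
  using pd_mult_diff assms by (auto simp: smooth_differentiable)

lemma tsupp_outside: "x \<notin> tsupp f \<Longrightarrow> f x = 0"
  unfolding tsupp_def using closure_subset[of "{x. f x \<noteq> 0}"] by blast

lemma tsupp_subsetI: "closed S \<Longrightarrow> (\<And>x. x \<notin> S \<Longrightarrow> f x = 0) \<Longrightarrow> tsupp f \<subseteq> S"
  unfolding tsupp_def by (rule closure_minimal) auto

lemma closed_tsupp: "closed (tsupp f)" by (simp add: tsupp_def)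

lemma test_iff: "test f \<longleftrightarrow> smooth_fn f \<and> (\<exists>R. \<forall>x. norm x > R \<longrightarrow> f x = 0)"
proof -
  have "compact (tsupp f) \<longleftrightarrow> (\<exists>R. \<forall>x. norm x > R \<longrightarrow> f x = 0)"
  proof
    assume "compact (tsupp f)"
    then obtain R where "\<forall>x\<in>tsupp f. norm x \<le> R"
      using compact_imp_bounded bounded_iff by blast
    thus "\<exists>R. \<forall>x. norm x > R \<longrightarrow> f x = 0" using tsupp_outside by (metis not_less)
  next
    assume "\<exists>R. \<forall>x. norm x > R \<longrightarrow> f x = 0"
    then obtain R where R: "\<forall>x. norm x > R \<longrightarrow> f x = 0" by blast
    have "tsupp f \<subseteq> cball 0 R"
      by (rule tsupp_subsetI[OF closed_cball]) (use R in auto)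
    thus "compact (tsupp f)"
      by (meson bounded_cball bounded_subset closed_tsupp compact_eq_bounded_closed)
  qed
  thus ?thesis by (simp add: test_def)
qed

lemma test_smooth: "test f \<Longrightarrow> smooth_fn f" by (simp add: test_def)

lemma testI: "smooth_fn f \<Longrightarrow> (\<And>x. norm x > R \<Longrightarrow> f x = 0) \<Longrightarrow> test f"
  using test_iff by blast

lemma test_outside:
  assumes "test f" obtains R where "\<And>x. norm x > R \<Longrightarrow> f x = 0" "R > 0"
proof -
  obtain R where "\<forall>x. norm x > R \<longrightarrow> f x = 0" using assms test_iff by blast
  thus ?thesis using that[of "max R 1"] by auto
qed

lemma pd_zero_outside:
  assumes "x \<notin> tsupp f" shows "pd i f x = 0"
proof -
  have "((\<lambda>_. 0) has_derivative (\<lambda>_. 0)) (at x)" by simp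
  hence "(f has_derivative (\<lambda>_. 0)) (at x)"
    by (rule has_derivative_transform_within_open[where s="- tsupp f"])
       (use assms closed_tsupp in \<open>auto simp: tsupp_outside\<close>)
  thus ?thesis using pd_eqI by fastforce
qed

lemma tsupp_pd: "tsupp (pd i f) \<subseteq> tsupp f"
  by (rule tsupp_subsetI[OF closed_tsupp]) (rule pd_zero_outside)

lemma test_pd: "test f \<Longrightarrow> test (pd i f)"
  unfolding test_def compact_eq_bounded_closed using smooth_pd closed_tsupp
  by (metis bounded_subset tsupp_pd)

lemma test_lin: "test f \<Longrightarrow> test g \<Longrightarrow> test (\<lambda>x. a * f x + b * g x)"
proof -
  assume f: "test f" and g: "test g"
  obtain R S where "\<And>x. norm x > R \<Longrightarrow> f x = 0" "\<And>x. norm x > S \<Longrightarrow> g x = 0"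
    using f g test_outside by metis
  thus ?thesis
    by (intro testI[where R="max R S"]) (auto simp: f g test_smooth smooth_add smooth_cmult)
qed

lemma test_add: "test f \<Longrightarrow> test g \<Longrightarrow> test (\<lambda>x. f x + g x)"
  using test_lin[of f g 1 1] by simp

lemma test_diff: "test f \<Longrightarrow> test g \<Longrightarrow> test (\<lambda>x. f x - g x)"
  using test_lin[of f g 1 "-1"] by simp

lemma test_zero: "test (\<lambda>_. 0)"
  by (intro testI smooth_const) auto

lemma test_cmult: "test f \<Longrightarrow> test (\<lambda>x. c * f x)"
  using test_lin[of f f c 0] by simp

lemma test_sum: "(\<And>i. i \<in> I \<Longrightarrow> test (f i)) \<Longrightarrow> test (\<lambda>x. \<Sum>i\<in>I. f i x)"
  by (induction I rule: infinite_finite_induct) (auto intro: test_zero test_add)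

lemma test_mult: "smooth_fn f \<Longrightarrow> test g \<Longrightarrow> test (\<lambda>x. f x * g x)"
  by (auto simp: smooth_mult test_iff)

lemma test_continuous: "test f \<Longrightarrow> continuous_on A f"
  by (simp add: smooth_continuous_on test_smooth)

lemma test_borel: "test f \<Longrightarrow> f \<in> borel_measurable borel"
  by (simp add: smooth_borel test_smooth)

lemma test_bounded:
  assumes "test f" obtains B where "\<And>x. \<bar>f x\<bar> \<le> B" "B > 0"
proof -
  have "bounded (f ` tsupp f)"
    using assms test_continuous by (simp add: compact_continuous_image compact_imp_bounded test_def)
  then obtain B where B: "\<forall>x\<in>tsupp f. \<bar>f x\<bar> \<le> B" unfolding bounded_iff by auto
  have "\<bar>f x\<bar> \<le> max B 1" for x
    using B tsupp_outside[of x f] by (cases "x \<in> tsupp f") auto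
  thus ?thesis using that[of "max B 1"] by auto
qed

definition bump :: "pt \<Rightarrow> real \<Rightarrow> fn" where
  "bump a r x = flat 0 (r\<^sup>2 - (\<Sum>i\<in>UNIV. (x $ i - a $ i)\<^sup>2))"

lemma bump_arg: "(\<Sum>i\<in>UNIV. (x $ i - a $ i)\<^sup>2) = (dist x a)\<^sup>2" for x a :: pt
  by (simp add: dist_vec_def L2_set_def sum_nonneg dist_real_def)

lemma bump_nonneg: "bump a r x \<ge> 0" by (simp add: bump_def flat_nonneg)

lemma bump_pos_iff: "r > 0 \<Longrightarrow> bump a r x > 0 \<longleftrightarrow> x \<in> ball a r"
  unfolding bump_def flat_pos_iff bump_arg
  by (auto simp: dist_commute abs_le_square_iff[symmetric] not_le[symmetric])

lemma test_bump: "r > 0 \<Longrightarrow> test (bump a r)"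
proof (rule testI[where R="norm a + r"])
  have "smooth_fn (\<lambda>x. r\<^sup>2 - (\<Sum>i\<in>UNIV. (x $ i - a $ i)\<^sup>2))"
    unfolding power2_eq_square
    by (intro smooth_diff smooth_sum smooth_mult smooth_nth smooth_const)
  thus "smooth_fn (bump a r)" unfolding bump_def[abs_def] by (rule smooth_flat)
next
  fix x :: pt assume r: "r > 0" and x: "norm x > norm a + r"
  have "norm x \<le> norm a + dist a x" by (metis dist_norm norm_minus_commute norm_triangle_sub)
  hence "x \<notin> ball a r" using x by auto
  thus "bump a r x = 0" using bump_pos_iff[OF r, of a x] bump_nonneg[of a r x] by linarith
qed

lemma tsupp_bump: "r > 0 \<Longrightarrow> tsupp (bump a r) \<subseteq> cball a r"
proof (rule tsupp_subsetI[OF closed_cball])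
  fix x assume "r > 0" "x \<notin> cball a r"
  thus "bump a r x = 0" using bump_pos_iff[of r a x] bump_nonneg[of a r x] by auto
qed

section \<open>Square-integrable functions\<close>

definition ip :: "fn \<Rightarrow> fn \<Rightarrow> real" where "ip f g = integral\<^sup>L lborel (\<lambda>x. f x * g x)"

definition n2 :: "fn \<Rightarrow> real" where "n2 f = sqrt (l2sq f)"

lemma L2_measurable: "L2 f \<Longrightarrow> f \<in> borel_measurable lborel" by (simp add: L2_def)

lemma L2_integrable: "L2 f \<Longrightarrow> integrable lborel (\<lambda>x. (f x)\<^sup>2)" by (simp add: L2_def)

lemma L2_mult_integrable:
  assumes "L2 f" "L2 g" shows "integrable lborel (\<lambda>x. f x * g x)"
proof (rule Bochner_Integration.integrable_bound)
  show "integrable lborel (\<lambda>x. (f x)\<^sup>2 + (g x)\<^sup>2)" using assms by (simp add: L2_def)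
  show "(\<lambda>x. f x * g x) \<in> borel_measurable lborel"
    using assms L2_measurable by measurable
  have "\<bar>a * b\<bar> \<le> a\<^sup>2 + b\<^sup>2" for a b :: real
  proof -
    have "2 * \<bar>a * b\<bar> \<le> a\<^sup>2 + b\<^sup>2"
      using sum_squares_bound[of "\<bar>a\<bar>" "\<bar>b\<bar>"] by (simp add: abs_mult)
    thus ?thesis using abs_ge_zero[of "a * b"] by linarith
  qed
  thus "AE x in lborel. norm (f x * g x) \<le> norm ((f x)\<^sup>2 + (g x)\<^sup>2)" by simp
qed

lemma L2_lin:
  assumes "L2 f" "L2 g" shows "L2 (\<lambda>x. a * f x + b * g x)"
proof -
  have "integrable lborel (\<lambda>x. a\<^sup>2 * (f x)\<^sup>2 + (2 * a * b) * (f x * g x) + b\<^sup>2 * (g x)\<^sup>2)"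
    using assms L2_mult_integrable[OF assms] by (auto simp: L2_def)
  moreover have "(\<lambda>x. a * f x + b * g x) \<in> borel_measurable lborel"
    using assms L2_measurable by measurable
  ultimately show ?thesis by (simp add: L2_def power2_eq_square algebra_simps)
qed

lemma L2_cmult: "L2 f \<Longrightarrow> L2 (\<lambda>x. a * f x)"
  using L2_lin[of f f a 0] by simp

lemma L2_add: "L2 f \<Longrightarrow> L2 g \<Longrightarrow> L2 (\<lambda>x. f x + g x)"
  using L2_lin[of f g 1 1] by simp

lemma L2_diff: "L2 f \<Longrightarrow> L2 g \<Longrightarrow> L2 (\<lambda>x. f x - g x)"
  using L2_lin[of f g 1 "-1"] by simp

lemma L2_zero: "L2 (\<lambda>_. 0)" by (simp add: L2_def)

lemma L2_sum: "(\<And>i. i \<in> I \<Longrightarrow> L2 (f i)) \<Longrightarrow> L2 (\<lambda>x. \<Sum>i\<in>I. f i x)"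
  by (induction I rule: infinite_finite_induct) (auto intro: L2_zero L2_add)

lemma ip_lin_left:
  assumes "L2 f" "L2 g" "L2 h"
  shows "ip (\<lambda>x. a * f x + b * g x) h = a * ip f h + b * ip g h"
proof -
  have "(\<lambda>x. (a * f x + b * g x) * h x) = (\<lambda>x. a * (f x * h x) + b * (g x * h x))"
    by (auto simp: algebra_simps)
  thus ?thesis using L2_mult_integrable[OF assms(1,3)] L2_mult_integrable[OF assms(2,3)]
    by (simp add: ip_def)
qed

lemma ip_commute: "ip f g = ip g f" by (simp add: ip_def mult.commute)

lemma ip_lin_right:
  "L2 f \<Longrightarrow> L2 g \<Longrightarrow> L2 h \<Longrightarrow> ip h (\<lambda>x. a * f x + b * g x) = a * ip h f + b * ip h g"
  using ip_lin_left[of f g h a b] by (simp add: ip_commute)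

lemma ip_sum_right:
  assumes "\<And>i. i \<in> I \<Longrightarrow> L2 (f i)" "L2 g"
  shows "ip g (\<lambda>x. \<Sum>i\<in>I. f i x) = (\<Sum>i\<in>I. ip g (f i))"
  using assms(1)
proof (induction I rule: infinite_finite_induct)
  case (insert k I)
  thus ?case using ip_lin_right[of "f k" "\<lambda>x. \<Sum>i\<in>I. f i x" g 1 1] by (simp add: L2_sum assms)
qed (auto simp: ip_def)

lemma l2sq_ip: "l2sq f = ip f f" by (simp add: l2sq_def ip_def power2_eq_square)

lemma l2sq_nonneg: "l2sq f \<ge> 0" by (simp add: l2sq_def)

lemma n2_nonneg [simp]: "n2 f \<ge> 0" by (simp add: n2_def l2sq_nonneg)

lemma n2_sq: "(n2 f)\<^sup>2 = l2sq f" by (simp add: n2_def l2sq_nonneg)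

lemma l2sq_lin:
  assumes "L2 f" "L2 g"
  shows "l2sq (\<lambda>x. a * f x + b * g x) = a\<^sup>2 * l2sq f + 2 * a * b * ip f g + b\<^sup>2 * l2sq g"
proof -
  have "l2sq (\<lambda>x. a * f x + b * g x) = a * ip f (\<lambda>x. a * f x + b * g x) + b * ip g (\<lambda>x. a * f x + b * g x)"
    using ip_lin_left[OF assms L2_lin[OF assms], of a b a b] by (simp add: l2sq_ip)
  also have "\<dots> = a * (a * ip f f + b * ip f g) + b * (a * ip g f + b * ip g g)"
    using ip_lin_right assms by simp
  finally show ?thesis by (simp add: l2sq_ip ip_commute[of g f] power2_eq_square algebra_simps)
qed

lemma ip_bound:
  assumes "L2 f" "L2 g" shows "\<bar>ip f g\<bar> \<le> n2 f * n2 g"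
proof -
  have q: "0 \<le> l2sq f - 2 * t * ip f g + t\<^sup>2 * l2sq g" for t
    using l2sq_lin[OF assms, of 1 "-t"] l2sq_nonneg[of "\<lambda>x. 1 * f x + (-t) * g x"] by simp
  have "(ip f g)\<^sup>2 \<le> l2sq f * l2sq g"
  proof (cases "l2sq g = 0")
    case True
    have "ip f g = 0"
    proof (rule ccontr)
      assume n: "ip f g \<noteq> 0"
      show False using q[of "(l2sq f + 1) / (2 * ip f g)"] n True by simp
    qed
    thus ?thesis using True by simp
  next
    case False
    hence p: "l2sq g > 0" using l2sq_nonneg[of g] by linarith
    show ?thesis using q[of "ip f g / l2sq g"] p
      by (simp add: field_simps power2_eq_square)
  qed
  hence "sqrt ((ip f g)\<^sup>2) \<le> sqrt (l2sq f * l2sq g)" by (rule real_sqrt_le_mono)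
  thus ?thesis by (simp add: n2_def real_sqrt_mult)
qed

lemma n2_cmult: "n2 (\<lambda>x. c * f x) = \<bar>c\<bar> * n2 f"
  by (simp add: n2_def l2sq_def power_mult_distrib real_sqrt_mult)

lemma n2_triangle:
  assumes "L2 f" "L2 g" shows "n2 (\<lambda>x. f x + g x) \<le> n2 f + n2 g"
proof (rule power2_le_imp_le)
  have "(n2 (\<lambda>x. f x + g x))\<^sup>2 = l2sq f + 2 * ip f g + l2sq g"
    using l2sq_lin[OF assms, of 1 1] by (simp add: n2_sq)
  also have "\<dots> \<le> (n2 f)\<^sup>2 + 2 * (n2 f * n2 g) + (n2 g)\<^sup>2"
    using ip_bound[OF assms] by (simp add: n2_sq)
  also have "\<dots> = (n2 f + n2 g)\<^sup>2" by (simp add: power2_eq_square algebra_simps)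
  finally show "(n2 (\<lambda>x. f x + g x))\<^sup>2 \<le> (n2 f + n2 g)\<^sup>2" .
qed simp

lemma n2_diff_triangle:
  assumes "L2 f" "L2 g" "L2 h" shows "n2 (\<lambda>x. f x - h x) \<le> n2 (\<lambda>x. f x - g x) + n2 (\<lambda>x. g x - h x)"
  using n2_triangle[OF L2_diff[OF assms(1,2)] L2_diff[OF assms(2,3)]] by simp

lemma n2_sub_le: "L2 f \<Longrightarrow> L2 g \<Longrightarrow> n2 (\<lambda>x. f x - g x) \<le> n2 f + n2 g"
  using n2_triangle[of f "\<lambda>x. -1 * g x"] n2_cmult[of "-1" g] L2_cmult[of g "-1"] by simp

lemma n2_minus_commute: "n2 (\<lambda>x. f x - g x) = n2 (\<lambda>x. g x - f x)"
  by (simp add: n2_def l2sq_def power2_commute)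

lemma n2_zero [simp]: "n2 (\<lambda>_. 0) = 0" by (simp add: n2_def l2sq_def)

lemma n2_sum:
  "(\<And>i. i \<in> I \<Longrightarrow> L2 (f i)) \<Longrightarrow> n2 (\<lambda>x. \<Sum>i\<in>I. f i x) \<le> (\<Sum>i\<in>I. n2 (f i))"
proof (induction I rule: infinite_finite_induct)
  case (insert k I)
  thus ?case using n2_triangle[of "f k" "\<lambda>x. \<Sum>i\<in>I. f i x"] by (force simp: L2_sum)
qed auto

lemma test_integrable: assumes "test f" shows "integrable lborel f"
proof -
  have "integrable lborel (\<lambda>x. indicator (tsupp f) x *\<^sub>R f x)"
    using assms by (intro borel_integrable_compact test_continuous) (auto simp: test_def)
  moreover have "(\<lambda>x. indicator (tsupp f) x *\<^sub>R f x) = f"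
    using tsupp_outside[of _ f] by (auto simp: indicator_def fun_eq_iff)
  ultimately show ?thesis by simp
qed

lemma test_L2: "test f \<Longrightarrow> L2 f"
  using test_integrable[OF test_mult[of f f]] test_borel[of f] test_smooth[of f]
  by (simp add: L2_def power2_eq_square)

lemma n2_AE_cong:
  assumes "f \<in> borel_measurable lborel" "g \<in> borel_measurable lborel" "AE x in lborel. f x = g x"
  shows "n2 f = n2 g"
  unfolding n2_def l2sq_def
  by (rule arg_cong[where f=sqrt], rule integral_cong_AE) (use assms in auto)

text \<open>Riesz--Fischer. Along a rapidly converging subsequence the weighted series
  \<open>\<Sum> 2\<^sup>k d\<^sub>k\<^sup>2\<close> of the squared increments is integrable, hence finite almost everywhere,
  which makes the increments summable at almost every point.\<close>

lemma L2_complete_fast: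
  assumes f: "\<And>n. L2 (f n)" and c: "\<And>m n. n \<le> m \<Longrightarrow> n2 (\<lambda>x. f m x - f n x) \<le> (1/2) ^ n"
  shows "\<exists>g. L2 g \<and> (\<forall>n. n2 (\<lambda>x. f n x - g x) \<le> (1/2) ^ n)"
proof -
  define d where "d n x = f (Suc n) x - f n x" for n x
  have fm [measurable]: "f n \<in> borel_measurable lborel" for n using f L2_measurable by blast
  have dL: "L2 (d n)" for n unfolding d_def using f by (intro L2_diff)
  have dm [measurable]: "d n \<in> borel_measurable lborel" for n using dL L2_measurable by blast
  have dn: "l2sq (d n) \<le> (1/4) ^ n" for n
  proof -
    have "(n2 (d n))\<^sup>2 \<le> ((1/2) ^ n)\<^sup>2"
      using c[of n "Suc n"] by (intro power_mono) (auto simp: d_def[abs_def])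
    thus ?thesis by (simp add: n2_sq power_mult[symmetric] power_mult_distrib mult.commute[of n])
        (simp add: power_mult power2_eq_square)
  qed
  have nn: "(\<integral>\<^sup>+x. ennreal ((h x)\<^sup>2) \<partial>lborel) = ennreal (l2sq h)" if "L2 h" for h
    unfolding l2sq_def using that L2_integrable by (intro nn_integral_eq_integral) auto
  have "(\<integral>\<^sup>+x. (\<Sum>n. ennreal (2 ^ n * (d n x)\<^sup>2)) \<partial>lborel) = (\<Sum>n. \<integral>\<^sup>+x. ennreal (2 ^ n * (d n x)\<^sup>2) \<partial>lborel)"
    by (rule nn_integral_suminf) measurable
  also have "\<dots> \<le> (\<Sum>n. ennreal ((1/2) ^ n))"
  proof (rule suminf_le)
    fix n
    have "(\<integral>\<^sup>+x. ennreal (2 ^ n * (d n x)\<^sup>2) \<partial>lborel) = ennreal (2 ^ n) * ennreal (l2sq (d n))"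
      by (simp add: ennreal_mult nn_integral_cmult nn[OF dL])
    also have "\<dots> = ennreal (2 ^ n * l2sq (d n))" by (simp add: ennreal_mult l2sq_nonneg)
    also have "\<dots> \<le> ennreal (2 ^ n * (1/4) ^ n)" using dn by (intro ennreal_leI) simp
    also have "2 ^ n * (1/4) ^ n = (1/2::real) ^ n" by (simp add: power_mult_distrib[symmetric])
    finally show "(\<integral>\<^sup>+x. ennreal (2 ^ n * (d n x)\<^sup>2) \<partial>lborel) \<le> ennreal ((1/2) ^ n)" .
  qed auto
  also have "\<dots> = ennreal 2"
    by (rule suminf_ennreal_eq) (use geometric_sums[of "1/2::real"] in auto)
  finally have fin: "(\<integral>\<^sup>+x. (\<Sum>n. ennreal (2 ^ n * (d n x)\<^sup>2)) \<partial>lborel) \<noteq> \<infinity>"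
    by (auto simp: top_unique)
  have "AE x in lborel. (\<Sum>n. ennreal (2 ^ n * (d n x)\<^sup>2)) \<noteq> \<infinity>"
    by (rule nn_integral_PInf_AE[OF _ fin]) measurable
  hence conv: "AE x in lborel. (\<lambda>n. f n x) \<longlonglongrightarrow> lim (\<lambda>n. f n x)"
  proof eventually_elim
    case (elim x)
    have "summable (\<lambda>n. 2 ^ n * (d n x)\<^sup>2)"
      using elim by (intro summable_suminf_not_top) auto
    hence "(\<lambda>n. 2 ^ n * (d n x)\<^sup>2) \<longlonglongrightarrow> 0" by (rule summable_LIMSEQ_zero)
    hence "\<forall>\<^sub>F n in sequentially. 2 ^ n * (d n x)\<^sup>2 < 1" by (rule order_tendstoD) simp
    hence "\<forall>\<^sub>F n in sequentially. norm (d n x) \<le> (sqrt (1/2)) ^ n"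
    proof eventually_elim
      case (elim n)
      hence "(d n x)\<^sup>2 \<le> (1/2) ^ n" by (simp add: field_simps power_divide)
      hence "sqrt ((d n x)\<^sup>2) \<le> sqrt ((1/2) ^ n)" by (rule real_sqrt_le_mono)
      thus ?case by (simp only: real_sqrt_abs real_norm_def real_sqrt_power[of "1/2"])
    qed
    moreover have "sqrt (1/2) < 1" by simp
    hence "summable (\<lambda>n. (sqrt (1/2)) ^ n)" by (intro summable_geometric) simp
    ultimately have "summable (\<lambda>n. d n x)" by (rule summable_comparison_test_ev)
    hence "summable (\<lambda>n. f (Suc n) x - f n x)" by (simp add: d_def)
    then obtain s where "(\<lambda>n. \<Sum>i<n. f (Suc i) x - f i x) \<longlonglongrightarrow> s"
      by (auto simp: summable_def sums_def)
    hence "(\<lambda>n. f n x - f 0 x) \<longlonglongrightarrow> s" by (simp only: sum_lessThan_telescope[of "\<lambda>i. f i x"])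
    hence "(\<lambda>n. (f n x - f 0 x) + f 0 x) \<longlonglongrightarrow> s + f 0 x" by (intro tendsto_intros)
    hence "convergent (\<lambda>n. f n x)" by (auto simp: convergent_def)
    thus ?case by (simp add: convergent_LIMSEQ_iff)
  qed
  define g where "g x = lim (\<lambda>n. f n x)" for x
  have gm [measurable]: "g \<in> borel_measurable lborel" unfolding g_def by measurable
  have B: "(\<integral>\<^sup>+x. ennreal ((f n x - g x)\<^sup>2) \<partial>lborel) \<le> ennreal (((1/2) ^ n)\<^sup>2)" for n
  proof -
    have "(\<integral>\<^sup>+x. ennreal ((f n x - g x)\<^sup>2) \<partial>lborel)
        = (\<integral>\<^sup>+x. liminf (\<lambda>m. ennreal ((f n x - f m x)\<^sup>2)) \<partial>lborel)"
    proof (rule nn_integral_cong_AE)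
      show "AE x in lborel. ennreal ((f n x - g x)\<^sup>2) = liminf (\<lambda>m. ennreal ((f n x - f m x)\<^sup>2))"
        using conv
      proof eventually_elim
        case (elim x)
        have "(\<lambda>m. ennreal ((f n x - f m x)\<^sup>2)) \<longlonglongrightarrow> ennreal ((f n x - g x)\<^sup>2)"
          unfolding g_def using elim by (intro tendsto_intros)
        thus ?case by (rule lim_imp_Liminf[symmetric, rotated]) simp
      qed
    qed
    also have "\<dots> \<le> liminf (\<lambda>m. \<integral>\<^sup>+x. ennreal ((f n x - f m x)\<^sup>2) \<partial>lborel)"
      by (rule nn_integral_liminf) measurable
    also have "\<dots> \<le> ennreal (((1/2) ^ n)\<^sup>2)"
    proof (rule order_trans[OF Liminf_le_Limsup Limsup_bounded], simp, rule eventually_sequentiallyI[of n])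
      fix m assume "n \<le> m"
      hence "(n2 (\<lambda>x. f n x - f m x))\<^sup>2 \<le> ((1/2) ^ n)\<^sup>2"
        using c[of n m] by (intro power_mono) (auto simp: n2_minus_commute[of "f n" "f m"])
      thus "(\<integral>\<^sup>+x. ennreal ((f n x - f m x)\<^sup>2) \<partial>lborel) \<le> ennreal (((1/2) ^ n)\<^sup>2)"
        by (simp add: nn L2_diff f n2_sq ennreal_leI)
    qed
    finally show ?thesis .
  qed
  have L: "L2 (\<lambda>x. f n x - g x)" for n
  proof -
    have "integrable lborel (\<lambda>x. (f n x - g x)\<^sup>2)"
      using B[of n] by (intro integrableI_bounded) (auto simp: le_less_trans)
    thus ?thesis by (simp add: L2_def)
  qed
  have "L2 g" using L2_diff[OF f[of 0] L[of 0]] by simp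
  moreover have "n2 (\<lambda>x. f n x - g x) \<le> (1/2) ^ n" for n
  proof -
    have "l2sq (\<lambda>x. f n x - g x) \<le> ((1/2) ^ n)\<^sup>2"
      using B[of n] unfolding nn[OF L] by (subst (asm) ennreal_le_iff) auto
    thus ?thesis unfolding n2_def by (intro real_le_lsqrt) auto
  qed
  ultimately show ?thesis by blast
qed

lemma L2_complete:
  assumes f: "\<And>n. L2 (f n)" and c: "\<And>e. e > 0 \<Longrightarrow> \<exists>N. \<forall>m\<ge>N. \<forall>n\<ge>N. n2 (\<lambda>x. f m x - f n x) < e"
  shows "\<exists>g. L2 g \<and> (\<lambda>n. n2 (\<lambda>x. f n x - g x)) \<longlonglongrightarrow> 0"
proof -
  have "\<exists>N. \<forall>m\<ge>N. \<forall>n\<ge>N. n2 (\<lambda>x. f m x - f n x) < (1/2) ^ k" for k :: nat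
    by (rule c) simp
  then obtain N where N: "\<And>k m n. m \<ge> N k \<Longrightarrow> n \<ge> N k \<Longrightarrow> n2 (\<lambda>x. f m x - f n x) < (1/2) ^ k"
    by metis
  define r where "r k = Max (N ` {..k})" for k :: nat
  have rN: "N j \<le> r k" if "j \<le> k" for j k unfolding r_def using that by (intro Max_ge) auto
  have "\<exists>g. L2 g \<and> (\<forall>k. n2 (\<lambda>x. f (r k) x - g x) \<le> (1/2) ^ k)"
  proof (rule L2_complete_fast)
    fix m n :: nat assume "n \<le> m"
    thus "n2 (\<lambda>x. f (r m) x - f (r n) x) \<le> (1/2) ^ n"
      using N[of n "r m" "r n"] rN[of n m] rN[of n n] by simp
  qed (rule f)
  then obtain g where g: "L2 g" "\<And>k. n2 (\<lambda>x. f (r k) x - g x) \<le> (1/2) ^ k" by blast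
  have "(\<lambda>n. n2 (\<lambda>x. f n x - g x)) \<longlonglongrightarrow> 0"
  proof (rule LIMSEQ_I)
    fix e :: real assume "e > 0"
    then obtain k where k: "(1/2) ^ k < e / 2" using real_arch_pow_inv[of "e/2" "1/2"] by auto
    have "norm (n2 (\<lambda>x. f n x - g x) - 0) < e" if "n \<ge> r k" for n
    proof -
      have "n2 (\<lambda>x. f n x - g x) \<le> n2 (\<lambda>x. f n x - f (r k) x) + n2 (\<lambda>x. f (r k) x - g x)"
        by (rule n2_diff_triangle) (use f g in auto)
      also have "\<dots> < e" using N[of k n "r k"] rN[of k k] that g(2)[of k] k by force
      finally show ?thesis by simp
    qed
    thus "\<exists>no. \<forall>n\<ge>no. norm (n2 (\<lambda>x. f n x - g x) - 0) < e" by blast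
  qed
  thus ?thesis using g by blast
qed

section \<open>The fundamental lemma of the calculus of variations\<close>

lemma box_test:
  obtains b where "test b" "\<And>x. b x \<ge> 0" "\<And>x. b x > 0 \<longleftrightarrow> x \<in> box p (q::pt)"
proof -
  define h where "h i = (\<lambda>x::pt. flat 0 (x $ i - p $ i) * flat 0 (q $ i - x $ i))" for i
  define b where "b = (\<lambda>x::pt. h 1 x * (h 2 x * h 3 x))"
  have h0: "h i x \<ge> 0" for i x by (simp add: h_def flat_nonneg)
  have hp: "h i x > 0 \<longleftrightarrow> p $ i < x $ i \<and> x $ i < q $ i" for i x
    using flat_nonneg[of 0 "x $ i - p $ i"] flat_nonneg[of 0 "q $ i - x $ i"]
    by (auto simp: h_def zero_less_mult_iff flat_pos_iff)
  have "smooth_fn (h i)" for i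
    unfolding h_def by (intro smooth_mult smooth_flat smooth_diff smooth_nth smooth_const)
  hence s: "smooth_fn b" unfolding b_def by (intro smooth_mult)
  have bp: "b x > 0 \<longleftrightarrow> x \<in> box p q" for x
    using h0[of 1 x] h0[of 2 x] h0[of 3 x]
    by (auto simp: b_def zero_less_mult_iff hp mem_box_cart forall_3)
  have b0: "b x \<ge> 0" for x by (simp add: b_def h0)
  have "bounded (box p q)" by (rule bounded_box)
  then obtain R where R: "\<And>x. x \<in> box p q \<Longrightarrow> norm x \<le> R" unfolding bounded_iff by blast
  have "test b"
    by (rule testI[OF s, of R]) (metis R b0 bp less_eq_real_def not_le)
  thus ?thesis using that b0 bp by blast
qed

lemma L2_integrable_finite:
  assumes "L2 g" "A \<in> sets lborel" "emeasure lborel A < \<infinity>"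
  shows "integrable lborel (\<lambda>x. indicator A x * g x)"
proof (rule Bochner_Integration.integrable_bound)
  show "integrable lborel (\<lambda>x. indicator A x + (g x)\<^sup>2)"
    using assms by (intro Bochner_Integration.integrable_add L2_integrable) auto
  show "(\<lambda>x. indicator A x * g x) \<in> borel_measurable lborel"
    using assms L2_measurable by measurable
  have "\<bar>t\<bar> \<le> 1 + t\<^sup>2" for t :: real
    using sum_squares_bound[of 1 "\<bar>t\<bar>"] abs_ge_zero[of t] by simp
  moreover have "\<bar>1 + t\<^sup>2\<bar> = 1 + t\<^sup>2" for t :: real by (simp add: add_nonneg_nonneg)
  ultimately show "AE x in lborel. norm (indicator A x * g x) \<le> norm (indicator A x + (g x)\<^sup>2)"
    by (intro AE_I2) (simp add: indicator_def)
qed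

lemma box_integral_zero:
  assumes g: "L2 g" and o: "\<And>\<phi>. test \<phi> \<Longrightarrow> ip g \<phi> = 0"
  shows "integral\<^sup>L lborel (\<lambda>x. indicator (box p q) x * g x) = 0"
proof -
  obtain b where b: "test b" "\<And>x. b x \<ge> 0" "\<And>x. b x > 0 \<longleftrightarrow> x \<in> box p q"
    using box_test[of p q] by blast
  define \<phi> where "\<phi> n x = inverse (b x + inverse (Suc n)) * b x" for n :: nat and x
  have [simp]: "b x + inverse (1 + real n) > 0" for n x using b(2)[of x] by (simp add: add_nonneg_pos)
  have t: "test (\<phi> n)" for n unfolding \<phi>_def
    by (intro test_mult smooth_inverse smooth_add smooth_const test_smooth b)
       (use b(2) in \<open>simp add: less_imp_neq[symmetric]\<close>)
  have [measurable]: "g \<in> borel_measurable borel" "b \<in> borel_measurable borel"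
    using g L2_measurable test_borel b by auto
  have "(\<lambda>n. ip g (\<phi> n)) \<longlonglongrightarrow> integral\<^sup>L lborel (\<lambda>x. indicator (box p q) x * g x)"
    unfolding ip_def
  proof (rule integral_dominated_convergence)
    show "integrable lborel (\<lambda>x. \<bar>indicator (box p q) x * g x\<bar>)"
      by (intro integrable_abs L2_integrable_finite[OF g]) (auto simp: emeasure_lborel_box_finite[simplified])
    show "AE x in lborel. (\<lambda>n. g x * \<phi> n x) \<longlonglongrightarrow> indicator (box p q) x * g x"
    proof (rule AE_I2)
      fix x
      show "(\<lambda>n. g x * \<phi> n x) \<longlonglongrightarrow> indicator (box p q) x * g x"
      proof (cases "x \<in> box p q")
        case True
        hence p: "b x > 0" using b by blast
        have "(\<lambda>n. g x * \<phi> n x) \<longlonglongrightarrow> g x * (inverse (b x + 0) * b x)"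
          unfolding \<phi>_def using p by (intro tendsto_intros LIMSEQ_inverse_real_of_nat) auto
        thus ?thesis using p True by simp
      next
        case False
        hence "b x = 0" using b by (metis less_eq_real_def)
        thus ?thesis using False by (simp add: \<phi>_def)
      qed
    qed
    show "AE x in lborel. norm (g x * \<phi> n x) \<le> \<bar>indicator (box p q) x * g x\<bar>" for n
    proof (rule AE_I2)
      fix x
      have "b x = 0" if "x \<notin> box p q" using b that by (metis less_eq_real_def)
      moreover have "\<bar>\<phi> n x\<bar> \<le> 1"
        using b(2)[of x] by (simp add: \<phi>_def abs_mult divide_simps add_nonneg_pos)
      ultimately show "norm (g x * \<phi> n x) \<le> \<bar>indicator (box p q) x * g x\<bar>"
        by (cases "x \<in> box p q") (auto simp: abs_mult \<phi>_def intro: mult_left_le)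
    qed
  qed (auto simp: \<phi>_def)
  moreover have "(\<lambda>n. ip g (\<phi> n)) = (\<lambda>n. 0)" using o t by auto
  ultimately show ?thesis using LIMSEQ_unique tendsto_const by metis
qed

lemma fundamental_lemma:
  assumes g: "L2 g" and o: "\<And>\<phi>. test \<phi> \<Longrightarrow> ip g \<phi> = 0"
  shows "AE x in lborel. g x = 0"
proof -
  have gm [measurable]: "g \<in> borel_measurable borel" using L2_measurable[OF g] by simp
  define P where "P = density lborel (\<lambda>x. ennreal (max 0 (g x)))"
  define N where "N = density lborel (\<lambda>x. ennreal (max 0 (- g x)))"
  have pm: "L2 (\<lambda>x. max 0 (s * g x))" if s: "\<bar>s\<bar> = 1" for s
    unfolding L2_def
  proof
    show "integrable lborel (\<lambda>x. (max 0 (s * g x))\<^sup>2)"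
    proof (rule Bochner_Integration.integrable_bound[OF L2_integrable[OF g]])
      have "\<bar>max 0 (s * t)\<bar> \<le> \<bar>t\<bar>" for t using s by (auto simp: max_def abs_if split: if_splits)
      hence "(max 0 (s * t))\<^sup>2 \<le> t\<^sup>2" for t by (simp only: abs_le_square_iff)
      thus "AE x in lborel. norm ((max 0 (s * g x))\<^sup>2) \<le> norm ((g x)\<^sup>2)" by simp
    qed measurable
  qed measurable
  have em: "(\<integral>\<^sup>+x. ennreal (max 0 (s * g x)) * indicator (box p q) x \<partial>lborel)
      = ennreal (\<integral>x. indicator (box p q) x * max 0 (s * g x) \<partial>lborel)" if "\<bar>s\<bar> = 1" for s p q
  proof -
    have "(\<integral>\<^sup>+x. ennreal (max 0 (s * g x)) * indicator (box p q) x \<partial>lborel)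
      = (\<integral>\<^sup>+x. ennreal (indicator (box p q) x * max 0 (s * g x)) \<partial>lborel)"
      by (intro nn_integral_cong) (auto simp: indicator_def)
    also have "\<dots> = ennreal (\<integral>x. indicator (box p q) x * max 0 (s * g x) \<partial>lborel)"
      by (intro nn_integral_eq_integral L2_integrable_finite pm that)
         (auto simp: emeasure_lborel_box_finite[simplified])
    finally show ?thesis .
  qed
  have eP: "emeasure P (box p q) = ennreal (\<integral>x. indicator (box p q) x * max 0 (1 * g x) \<partial>lborel)" for p q
    unfolding P_def by (subst emeasure_density) (auto simp: em[of 1, simplified])
  have eN: "emeasure N (box p q) = ennreal (\<integral>x. indicator (box p q) x * max 0 (-1 * g x) \<partial>lborel)" for p q
    unfolding N_def by (subst emeasure_density) (auto simp: em[of "-1", simplified])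
  have eq: "emeasure P (box p q) = emeasure N (box p q)" for p q
  proof -
    have "(\<integral>x. indicator (box p q) x * max 0 (1 * g x) \<partial>lborel) - (\<integral>x. indicator (box p q) x * max 0 (-1 * g x) \<partial>lborel)
      = (\<integral>x. indicator (box p q) x * max 0 (1 * g x) - indicator (box p q) x * max 0 (-1 * g x) \<partial>lborel)"
      by (intro Bochner_Integration.integral_diff[symmetric] L2_integrable_finite pm)
         (auto simp: emeasure_lborel_box_finite[simplified])
    also have "\<dots> = (\<integral>x. indicator (box p q) x * g x \<partial>lborel)"
      by (intro Bochner_Integration.integral_cong) (auto simp: indicator_def max_def)
    also have "\<dots> = 0" by (rule box_integral_zero[OF g o])
    finally show ?thesis unfolding eP eN by simp
  qed
  have "P = N"
  proof (rule measure_eqI_generator_eq)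
    show "Int_stable (range (\<lambda>(a, b). box a b :: pt set))" by (auto simp: Int_stable_def box_Int_box)
    show "sets P = sigma_sets UNIV (range (\<lambda>(a, b). box a b))" "sets N = sigma_sets UNIV (range (\<lambda>(a, b). box a b))"
      by (simp_all add: P_def N_def borel_eq_box)
    let ?A = "\<lambda>n::nat. box (- (real n *\<^sub>R One)) (real n *\<^sub>R One) :: pt set"
    show "range ?A \<subseteq> range (\<lambda>(a, b). box a b)" "(\<Union>i. ?A i) = UNIV"
      unfolding UN_box_eq_UNIV by auto
    show "emeasure P (?A i) \<noteq> \<infinity>" for i unfolding eP by simp
  qed (use eq in auto)
  hence "AE x in lborel. ennreal (max 0 (g x)) = ennreal (max 0 (- g x))"
    unfolding P_def N_def by (intro sigma_finite_measure.density_unique[OF sigma_finite_lborel]) auto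
  thus ?thesis by eventually_elim (auto simp: max_def split: if_splits)
qed

section \<open>Representation of functionals that are bounded on test functions\<close>

definition tlin :: "distr \<Rightarrow> bool" where
  "tlin u \<longleftrightarrow> (\<forall>\<phi> \<psi> a b. test \<phi> \<longrightarrow> test \<psi> \<longrightarrow> u (\<lambda>x. a * \<phi> x + b * \<psi> x) = a * u \<phi> + b * u \<psi>)"

lemma tlinD: "tlin u \<Longrightarrow> test \<phi> \<Longrightarrow> test \<psi> \<Longrightarrow> u (\<lambda>x. a * \<phi> x + b * \<psi> x) = a * u \<phi> + b * u \<psi>"
  by (simp add: tlin_def)

lemma tlin_cmult: "tlin u \<Longrightarrow> test \<phi> \<Longrightarrow> u (\<lambda>x. a * \<phi> x) = a * u \<phi>"
  using tlinD[of u \<phi> \<phi> a 0] by simp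

lemma tlin_zero: "tlin u \<Longrightarrow> u (\<lambda>_. 0) = 0"
  using tlin_cmult[of u "\<lambda>_. 0" 0] test_zero by simp

lemma tlin_add: "tlin u \<Longrightarrow> test \<phi> \<Longrightarrow> test \<psi> \<Longrightarrow> u (\<lambda>x. \<phi> x + \<psi> x) = u \<phi> + u \<psi>"
  using tlinD[of u \<phi> \<psi> 1 1] by simp

lemma tlin_diff: "tlin u \<Longrightarrow> test \<phi> \<Longrightarrow> test \<psi> \<Longrightarrow> u (\<lambda>x. \<phi> x - \<psi> x) = u \<phi> - u \<psi>"
  using tlinD[of u \<phi> \<psi> 1 "-1"] by simp

lemma tlin_sum: "tlin u \<Longrightarrow> (\<And>i. i \<in> I \<Longrightarrow> test (\<phi> i)) \<Longrightarrow> u (\<lambda>x. \<Sum>i\<in>I. \<phi> i x) = (\<Sum>i\<in>I. u (\<phi> i))"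
proof (induction I rule: infinite_finite_induct)
  case (insert k I)
  have "u (\<lambda>x. \<phi> k x + (\<Sum>i\<in>I. \<phi> i x)) = u (\<phi> k) + u (\<lambda>x. \<Sum>i\<in>I. \<phi> i x)"
    using insert by (intro tlin_add test_sum) auto
  thus ?case using insert by simp
qed (auto simp: tlin_zero)

lemma riesz_test:
  assumes v: "tlin v" and C: "C \<ge> 0" and b: "\<And>\<phi>. test \<phi> \<Longrightarrow> \<bar>v \<phi>\<bar> \<le> C * n2 \<phi>"
  shows "\<exists>g \<phi>. L2 g \<and> n2 g \<le> C \<and> (\<forall>\<psi>. test \<psi> \<longrightarrow> v \<psi> = ip g \<psi>) \<and>
    (\<forall>n::nat. test (\<phi> n)) \<and> (\<lambda>n. n2 (\<lambda>x. \<phi> n x - g x)) \<longlonglongrightarrow> 0"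
proof -
  define J where "J \<phi> = l2sq \<phi> - 2 * v \<phi>" for \<phi>
  have Jlow: "J \<phi> \<ge> - C\<^sup>2" if "test \<phi>" for \<phi>
  proof -
    have "J \<phi> \<ge> (n2 \<phi>)\<^sup>2 - 2 * (C * n2 \<phi>)" using b[OF that] by (simp add: J_def n2_sq)
    moreover have "(n2 \<phi> - C)\<^sup>2 \<ge> 0" by simp
    ultimately show ?thesis by (simp add: power2_eq_square algebra_simps)
  qed
  define m where "m = Inf (J ` Collect test)"
  have bb: "bdd_below (J ` Collect test)" using Jlow by (auto simp: bdd_below_def)
  have mle: "m \<le> J \<phi>" if "test \<phi>" for \<phi>
    unfolding m_def using bb that by (intro cInf_lower) auto
  have "\<exists>\<phi>. test \<phi> \<and> J \<phi> < m + inverse (Suc n)" for n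
    using cInf_lessD[of "J ` Collect test" "m + inverse (Suc n)"] test_zero by (auto simp: m_def)
  then obtain \<phi> where t: "\<And>n. test (\<phi> n)" and Jn: "\<And>n. J (\<phi> n) < m + inverse (Suc n)"
    by metis
  have L: "L2 (\<phi> n)" for n using t test_L2 by blast
  have cau: "l2sq (\<lambda>x. \<phi> i x - \<phi> j x) \<le> 2 * (inverse (Suc i) + inverse (Suc j))" for i j
  proof -
    have 1: "l2sq (\<lambda>x. \<phi> i x - \<phi> j x) = l2sq (\<phi> i) - 2 * ip (\<phi> i) (\<phi> j) + l2sq (\<phi> j)"
      using l2sq_lin[OF L[of i] L[of j], of 1 "-1"] by simp
    have 2: "l2sq (\<lambda>x. 1/2 * \<phi> i x + 1/2 * \<phi> j x) = (l2sq (\<phi> i) + 2 * ip (\<phi> i) (\<phi> j) + l2sq (\<phi> j)) / 4"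
      using l2sq_lin[OF L[of i] L[of j], of "1/2" "1/2"] by (simp add: power2_eq_square)
    have 3: "v (\<lambda>x. 1/2 * \<phi> i x + 1/2 * \<phi> j x) = (v (\<phi> i) + v (\<phi> j)) / 2"
      using tlinD[OF v t[of i] t[of j], of "1/2" "1/2"] by simp
    have "m \<le> J (\<lambda>x. 1/2 * \<phi> i x + 1/2 * \<phi> j x)" by (intro mle test_lin t)
    hence "m \<le> (l2sq (\<phi> i) + 2 * ip (\<phi> i) (\<phi> j) + l2sq (\<phi> j)) / 4 - (v (\<phi> i) + v (\<phi> j))"
      unfolding J_def 2 3 by (simp add: add_divide_distrib)
    moreover have "m \<le> (a + 2 * p + b) / 4 - (s + t) \<Longrightarrow> a - 2 * s < m + c \<Longrightarrow> b - 2 * t < m + d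
      \<Longrightarrow> a - 2 * p + b \<le> 2 * (c + d)" for a b c d p s t :: real
      by (simp add: field_simps)
    ultimately show ?thesis using Jn[of i] Jn[of j] unfolding 1 J_def by blast
  qed
  have "\<exists>g. L2 g \<and> (\<lambda>n. n2 (\<lambda>x. \<phi> n x - g x)) \<longlonglongrightarrow> 0"
  proof (rule L2_complete[OF L])
    fix e :: real assume e: "e > 0"
    hence "e\<^sup>2 / 4 > 0" by simp
    then obtain N where N: "inverse (Suc N) < e\<^sup>2 / 4" using reals_Archimedean by blast
    have "n2 (\<lambda>x. \<phi> i x - \<phi> j x) < e" if "i \<ge> N" "j \<ge> N" for i j
    proof -
      have "inverse (Suc i) \<le> inverse (real (Suc N))" "inverse (Suc j) \<le> inverse (real (Suc N))"
        using that by (auto intro!: le_imp_inverse_le)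
      moreover have "x \<le> c \<Longrightarrow> y \<le> c \<Longrightarrow> z \<le> 2 * (x + y) \<Longrightarrow> c < q / 4 \<Longrightarrow> z < q" for x y z c q :: real
        by (simp add: field_simps)
      ultimately have "l2sq (\<lambda>x. \<phi> i x - \<phi> j x) < e\<^sup>2" using cau[of i j] N by blast
      thus ?thesis unfolding n2_def using e by (intro real_less_lsqrt) auto
    qed
    thus "\<exists>N. \<forall>i\<ge>N. \<forall>j\<ge>N. n2 (\<lambda>x. \<phi> i x - \<phi> j x) < e" by blast
  qed
  then obtain g where g: "L2 g" and lim: "(\<lambda>n. n2 (\<lambda>x. \<phi> n x - g x)) \<longlonglongrightarrow> 0" by blast
  have iplim: "(\<lambda>n. ip (\<phi> n) \<psi>) \<longlonglongrightarrow> ip g \<psi>" if "L2 \<psi>" for \<psi>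
  proof -
    have "(\<lambda>n. ip (\<phi> n) \<psi> - ip g \<psi>) \<longlonglongrightarrow> 0"
    proof (rule tendsto_0_le[OF lim, where K="n2 \<psi>"], rule eventuallyI)
      fix n
      have "ip (\<lambda>x. \<phi> n x - g x) \<psi> = ip (\<phi> n) \<psi> - ip g \<psi>"
        using ip_lin_left[OF L[of n] g that, of 1 "-1"] by simp
      thus "norm (ip (\<phi> n) \<psi> - ip g \<psi>) \<le> norm (n2 (\<lambda>x. \<phi> n x - g x)) * n2 \<psi>"
        using ip_bound[OF L2_diff[OF L[of n] g] that] by simp
    qed
    thus ?thesis by (simp add: Lim_null[symmetric] LIM_zero_iff)
  qed
  have rep: "v \<psi> = ip g \<psi>" if p: "test \<psi>" for \<psi>
  proof -
    define \<beta> where "\<beta> = ip g \<psi> - v \<psi>"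
    have q: "0 \<le> s\<^sup>2 * l2sq \<psi> + 2 * s * \<beta>" for s
    proof (rule LIMSEQ_le_const)
      show "(\<lambda>n. s\<^sup>2 * l2sq \<psi> + 2 * s * (ip (\<phi> n) \<psi> - v \<psi>) + inverse (Suc n))
          \<longlonglongrightarrow> s\<^sup>2 * l2sq \<psi> + 2 * s * \<beta>"
        unfolding \<beta>_def
        by (rule tendsto_eq_intros iplim test_L2 p LIMSEQ_inverse_real_of_nat refl | simp)+
      have "0 \<le> s\<^sup>2 * l2sq \<psi> + 2 * s * (ip (\<phi> n) \<psi> - v \<psi>) + inverse (Suc n)" for n
      proof -
        have "m \<le> J (\<lambda>x. 1 * \<phi> n x + s * \<psi> x)" by (intro mle test_lin t p)
        also have "\<dots> = l2sq (\<phi> n) + 2 * s * ip (\<phi> n) \<psi> + s\<^sup>2 * l2sq \<psi> - 2 * (v (\<phi> n) + s * v \<psi>)"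
          unfolding J_def tlinD[OF v t p] l2sq_lin[OF L test_L2[OF p]] by simp
        finally show ?thesis using Jn[of n] by (simp add: J_def algebra_simps)
      qed
      thus "\<exists>N. \<forall>n\<ge>N. 0 \<le> s\<^sup>2 * l2sq \<psi> + 2 * s * (ip (\<phi> n) \<psi> - v \<psi>) + inverse (Suc n)" by blast
    qed
    have "\<beta> = 0"
    proof (rule ccontr)
      assume n: "\<beta> \<noteq> 0"
      define s where "s = - \<beta> / (l2sq \<psi> + 1)"
      have p: "l2sq \<psi> + 1 > 0" using l2sq_nonneg[of \<psi>] by linarith
      have "s\<^sup>2 * l2sq \<psi> + 2 * s * \<beta> = s\<^sup>2 * (l2sq \<psi> + 1) - s\<^sup>2 + 2 * s * \<beta>" by (simp add: algebra_simps)
      also have "s\<^sup>2 * (l2sq \<psi> + 1) = - s * \<beta>" using p by (simp add: s_def power2_eq_square)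
      finally have "0 \<le> - s * \<beta> - s\<^sup>2 + 2 * s * \<beta>" using q[of s] by (simp only:)
      hence "0 \<le> s * \<beta> - s\<^sup>2" by (simp add: algebra_simps)
      moreover have "\<beta> * \<beta> > 0" using n by (auto simp: zero_less_mult_iff)
      hence "s * \<beta> < 0" using p by (simp add: s_def divide_neg_pos)
      moreover have "s\<^sup>2 \<ge> 0" by simp
      ultimately show False by linarith
    qed
    thus ?thesis by (simp add: \<beta>_def)
  qed
  have nl: "n2 g \<le> C"
  proof (cases "n2 g = 0")
    case True
    thus ?thesis using C by simp
  next
    case False
    have n2lim: "(\<lambda>n. n2 (\<phi> n)) \<longlonglongrightarrow> n2 g"
    proof -
      have "(\<lambda>n. n2 (\<phi> n) - n2 g) \<longlonglongrightarrow> 0"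
      proof (rule tendsto_0_le[OF lim, where K=1], rule eventuallyI)
        fix n
        have "n2 (\<phi> n) \<le> n2 (\<lambda>x. \<phi> n x - g x) + n2 g"
          using n2_triangle[OF L2_diff[OF L[of n] g] g] by simp
        moreover have "n2 g \<le> n2 (\<lambda>x. \<phi> n x - g x) + n2 (\<phi> n)"
          using n2_triangle[OF L2_diff[OF g L[of n]] L[of n]] n2_minus_commute[of g "\<phi> n"] by simp
        ultimately show "norm (n2 (\<phi> n) - n2 g) \<le> norm (n2 (\<lambda>x. \<phi> n x - g x)) * 1" by simp
      qed
      thus ?thesis by (simp add: LIM_zero_iff)
    qed
    have "ip g g \<le> C * n2 g"
    proof (rule LIMSEQ_le)
      show "(\<lambda>n. ip (\<phi> n) g) \<longlonglongrightarrow> ip g g" by (rule iplim[OF g])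
      show "(\<lambda>n. C * n2 (\<phi> n)) \<longlonglongrightarrow> C * n2 g" by (intro tendsto_intros n2lim)
      show "\<exists>N. \<forall>n\<ge>N. ip (\<phi> n) g \<le> C * n2 (\<phi> n)"
        using b[OF t] rep[OF t] by (metis ip_commute abs_le_D1)
    qed
    hence "(n2 g)\<^sup>2 \<le> C * n2 g" by (simp add: n2_sq l2sq_ip)
    thus ?thesis using False n2_nonneg[of g]
      by (simp add: power2_eq_square mult_le_cancel_right)
  qed
  show ?thesis using g nl rep t lim by blast
qed

lemma test_dense:
  assumes g: "L2 g" and e: "e > 0"
  obtains \<phi> where "test \<phi>" "n2 (\<lambda>x. \<phi> x - g x) < e"
proof -
  have "tlin (ip g)" by (simp add: tlin_def ip_lin_right test_L2 g)
  from riesz_test[OF this n2_nonneg[of g]] ip_bound[OF g test_L2]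
  obtain h \<phi> where h: "L2 h" "\<And>\<psi>. test \<psi> \<Longrightarrow> ip g \<psi> = ip h \<psi>" "\<And>n::nat. test (\<phi> n)"
    "(\<lambda>n. n2 (\<lambda>x. \<phi> n x - h x)) \<longlonglongrightarrow> 0" by blast
  have "AE x in lborel. g x - h x = 0"
  proof (rule fundamental_lemma[OF L2_diff[OF g h(1)]])
    fix \<psi> assume "test \<psi>"
    thus "ip (\<lambda>x. g x - h x) \<psi> = 0"
      using ip_lin_left[OF g h(1), of \<psi> 1 "-1"] h(2) test_L2 by simp
  qed
  hence "n2 (\<lambda>x. \<phi> n x - h x) = n2 (\<lambda>x. \<phi> n x - g x)" for n
    using L2_measurable[OF L2_diff[OF test_L2[OF h(3)] h(1)]] L2_measurable[OF L2_diff[OF test_L2[OF h(3)] g]]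
    by (intro n2_AE_cong) auto
  hence "(\<lambda>n. n2 (\<lambda>x. \<phi> n x - g x)) \<longlonglongrightarrow> 0" using h(4) by simp
  hence "\<forall>\<^sub>F n in sequentially. n2 (\<lambda>x. \<phi> n x - g x) < e" using e by (rule order_tendstoD)
  then obtain n where "n2 (\<lambda>x. \<phi> n x - g x) < e" by (auto simp: eventually_sequentially)
  thus ?thesis using that h(3) by blast
qed

section \<open>Weak derivatives\<close>

lemma weak_pd_ip: "weak_pd i u g \<longleftrightarrow> (\<forall>\<phi>. test \<phi> \<longrightarrow> ip u (pd i \<phi>) = - ip g \<phi>)"
  by (simp add: weak_pd_def ip_def)

lemma L2_AE_eqI:
  assumes "L2 f" "L2 g" "\<And>\<phi>. test \<phi> \<Longrightarrow> ip f \<phi> = ip g \<phi>"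
  shows "AE x in lborel. f x = g x"
proof -
  have "AE x in lborel. f x - g x = 0"
  proof (rule fundamental_lemma[OF L2_diff[OF assms(1,2)]])
    fix \<psi> assume "test \<psi>"
    thus "ip (\<lambda>x. f x - g x) \<psi> = 0"
      using ip_lin_left[OF assms(1,2), of \<psi> 1 "-1"] assms(3) test_L2 by simp
  qed
  thus ?thesis by eventually_elim simp
qed

lemma wgrad_AE:
  assumes "L2 g" "weak_pd i u g" shows "L2 (wgrad i u)" "weak_pd i u (wgrad i u)" "n2 (wgrad i u) = n2 g"
proof -
  have *: "L2 (wgrad i u) \<and> weak_pd i u (wgrad i u)"
    unfolding wgrad_def by (rule someI[where x=g]) (use assms in simp)
  thus "L2 (wgrad i u)" "weak_pd i u (wgrad i u)" by auto
  have "AE x in lborel. wgrad i u x = g x"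
    by (rule L2_AE_eqI) (use * assms in \<open>auto simp: weak_pd_ip\<close>)
  thus "n2 (wgrad i u) = n2 g" using * assms L2_measurable by (intro n2_AE_cong) auto
qed

lemma H1I: "L2 u \<Longrightarrow> (\<And>i. L2 (g i)) \<Longrightarrow> (\<And>i. weak_pd i u (g i)) \<Longrightarrow> H1 u"
  unfolding H1_def by blast

lemma h1norm_eq:
  assumes "\<And>i. L2 (g i)" "\<And>i. weak_pd i u (g i)"
  shows "h1norm u = sqrt ((n2 u)\<^sup>2 + (\<Sum>i\<in>UNIV. (n2 (g i))\<^sup>2))"
proof -
  have "l2sq (wgrad i u) = (n2 (g i))\<^sup>2" for i
    using wgrad_AE(3)[OF assms(1)[of i] assms(2)[of i]] by (metis n2_sq)
  thus ?thesis by (simp add: h1norm_def n2_sq)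
qed

lemma sqrt_sum4_le:
  fixes a :: real and b :: "3 \<Rightarrow> real"
  assumes "a \<ge> 0" "\<And>i. b i \<ge> 0"
  shows "sqrt (a\<^sup>2 + (\<Sum>i\<in>UNIV. (b i)\<^sup>2)) \<le> a + (\<Sum>i\<in>UNIV. b i)"
proof (rule real_le_lsqrt)
  show "0 \<le> a + (\<Sum>i\<in>UNIV. b i)" using assms by (simp add: sum_nonneg)
  have "a\<^sup>2 + (\<Sum>i\<in>UNIV. (b i)\<^sup>2) \<le> a\<^sup>2 + (\<Sum>i\<in>UNIV. b i)\<^sup>2"
    using assms by (simp add: sum_3 power2_eq_square algebra_simps)
  also have "\<dots> \<le> (a + (\<Sum>i\<in>UNIV. b i))\<^sup>2"
    using assms by (simp add: power2_eq_square algebra_simps sum_nonneg)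
  finally show "a\<^sup>2 + (\<Sum>i\<in>UNIV. (b i)\<^sup>2) \<le> (a + (\<Sum>i\<in>UNIV. b i))\<^sup>2" .
qed

lemma h1norm_le:
  assumes "\<And>i. L2 (g i)" "\<And>i. weak_pd i u (g i)"
  shows "h1norm u \<le> n2 u + (\<Sum>i\<in>UNIV. n2 (g i))"
  unfolding h1norm_eq[OF assms] by (rule sqrt_sum4_le) auto

lemma n2_le_h1norm: "n2 u \<le> h1norm u"
  unfolding n2_def h1norm_def by (intro real_sqrt_le_mono) (simp add: sum_nonneg l2sq_nonneg)

lemma h1t_le: "h1t \<phi> \<le> n2 \<phi> + (\<Sum>i\<in>UNIV. n2 (pd i \<phi>))"
  unfolding h1t_def n2_sq[symmetric] by (rule sqrt_sum4_le) auto

lemma h1t_nonneg: "h1t \<phi> \<ge> 0"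
  by (simp add: h1t_def sum_nonneg l2sq_nonneg)

lemma n2_le_h1t: "n2 u \<le> h1t u"
  unfolding n2_def h1t_def by (intro real_sqrt_le_mono) (simp add: sum_nonneg l2sq_nonneg)

lemma n2_pd_le_h1t: "n2 (pd i u) \<le> h1t u"
  unfolding n2_def h1t_def
proof (intro real_sqrt_le_mono)
  have "l2sq (pd i u) \<le> (\<Sum>i\<in>UNIV. l2sq (pd i u))"
    by (rule member_le_sum) (auto simp: l2sq_nonneg)
  thus "l2sq (pd i u) \<le> l2sq u + (\<Sum>i\<in>UNIV. l2sq (pd i u))" using l2sq_nonneg[of u] by linarith
qed

section \<open>Averages of translates\<close>

lemma abs_integral_le:
  fixes f :: "'a \<Rightarrow> real"
  assumes "integrable M f" "integrable M g" "\<And>x. x \<in> space M \<Longrightarrow> \<bar>f x\<bar> \<le> g x"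
  shows "\<bar>\<integral>x. f x \<partial>M\<bar> \<le> (\<integral>x. g x \<partial>M)"
  by (rule order_trans[OF integral_abs_bound integral_mono]) (use assms in auto)

lemma lin_bound: "\<bar>\<Sum>i\<in>UNIV. v $ i * p i\<bar> \<le> norm (v::pt) * (\<Sum>i\<in>UNIV. \<bar>p i\<bar>)"
proof -
  have "\<bar>\<Sum>i\<in>UNIV. v $ i * p i\<bar> \<le> (\<Sum>i\<in>UNIV. \<bar>v $ i * p i\<bar>)" by (rule sum_abs)
  also have "\<dots> \<le> (\<Sum>i\<in>UNIV. norm v * \<bar>p i\<bar>)"
    by (intro sum_mono) (auto simp: abs_mult component_le_norm_cart intro!: mult_right_mono)
  finally show ?thesis by (simp add: sum_distrib_left)
qed

lemma bounded_linear_coords: "bounded_linear (\<lambda>v::pt. \<Sum>i\<in>UNIV. v $ i * p i)"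
  by (intro bounded_linear_sum bounded_linear_mult_left[THEN bounded_linear_compose] bounded_linear_vec_nth)

lemma test_lipschitz:
  assumes "test f" obtains L where "L > 0" "\<And>x y. \<bar>f y - f x\<bar> \<le> L * norm (y - x)"
proof -
  have "\<exists>B. \<forall>x. \<bar>pd i f x\<bar> \<le> B" for i using test_bounded[OF test_pd[OF assms]] by metis
  then obtain B where B: "\<And>i x. \<bar>pd i f x\<bar> \<le> B i" by metis
  define L where "L = (\<Sum>i\<in>UNIV. B i)"
  have "\<bar>f y - f x\<bar> \<le> L * norm (y - x)" for x y
  proof -
    have "norm (f y - f x) \<le> L * norm (y - x)"
    proof (rule differentiable_bound[OF convex_UNIV])
      fix z show "(f has_derivative (\<lambda>v. \<Sum>i\<in>UNIV. v $ i * pd i f z)) (at z within UNIV)"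
        using smooth_pd_derivative[OF test_smooth[OF assms]] by simp
      show "onorm (\<lambda>v. \<Sum>i\<in>UNIV. v $ i * pd i f z) \<le> L"
      proof (rule onorm_le)
        fix v :: pt
        have "\<bar>\<Sum>i\<in>UNIV. v $ i * pd i f z\<bar> \<le> norm v * (\<Sum>i\<in>UNIV. \<bar>pd i f z\<bar>)" by (rule lin_bound)
        also have "\<dots> \<le> norm v * L" unfolding L_def by (intro mult_left_mono sum_mono B) auto
        finally show "norm (\<Sum>i\<in>UNIV. v $ i * pd i f z) \<le> L * norm v" by (simp add: mult.commute)
      qed
    qed auto
    thus ?thesis by simp
  qed
  moreover have "L * norm (y - x) \<le> max L 1 * norm (y - x)" for x y :: pt by (rule mult_right_mono) auto
  ultimately show ?thesis using that[of "max L 1"] by (meson less_max_iff_disj order_trans zero_less_one)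
qed

lemma test_taylor:
  assumes "test f" obtains C where "C \<ge> 0"
    "\<And>x v. \<bar>f (x + v) - f x - (\<Sum>i\<in>UNIV. v $ i * pd i f x)\<bar> \<le> C * (norm v)\<^sup>2"
proof -
  have "\<exists>L>0. \<forall>x y. \<bar>pd i f y - pd i f x\<bar> \<le> L * norm (y - x)" for i
    using test_lipschitz[OF test_pd[OF assms]] by metis
  then obtain L where L: "\<And>i. L i > 0" "\<And>i x y. \<bar>pd i f y - pd i f x\<bar> \<le> L i * norm (y - x)" by metis
  define C where "C = (\<Sum>i\<in>UNIV. L i)"
  have C0: "C \<ge> 0" unfolding C_def using L(1) by (intro sum_nonneg) (simp add: less_imp_le)
  have "\<bar>f (x + v) - f x - (\<Sum>i\<in>UNIV. v $ i * pd i f x)\<bar> \<le> C * (norm v)\<^sup>2" for x v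
  proof -
    define g where "g y = f y - (\<Sum>i\<in>UNIV. y $ i * pd i f x)" for y
    have "norm (g (x + v) - g x) \<le> (C * norm v) * norm (x + v - x)"
    proof (rule differentiable_bound[OF convex_cball])
      fix y assume y: "y \<in> cball x (norm v)"
      have "(g has_derivative (\<lambda>h. (\<Sum>i\<in>UNIV. h $ i * pd i f y) - (\<Sum>i\<in>UNIV. h $ i * pd i f x))) (at y)"
        unfolding g_def
        by (intro has_derivative_diff smooth_pd_derivative test_smooth assms
            bounded_linear.has_derivative[OF bounded_linear_coords] has_derivative_ident)
      thus "(g has_derivative (\<lambda>h. \<Sum>i\<in>UNIV. h $ i * (pd i f y - pd i f x))) (at y within cball x (norm v))"
        by (simp add: sum_subtractf right_diff_distrib has_derivative_at_withinI)
      show "onorm (\<lambda>h. \<Sum>i\<in>UNIV. h $ i * (pd i f y - pd i f x)) \<le> C * norm v"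
      proof (rule onorm_le)
        fix h :: pt
        have "\<bar>\<Sum>i\<in>UNIV. h $ i * (pd i f y - pd i f x)\<bar> \<le> norm h * (\<Sum>i\<in>UNIV. \<bar>pd i f y - pd i f x\<bar>)"
          by (rule lin_bound)
        also have "\<dots> \<le> norm h * (\<Sum>i\<in>UNIV. L i * norm v)"
        proof (intro mult_left_mono sum_mono)
          fix i
          have "\<bar>pd i f y - pd i f x\<bar> \<le> L i * norm (y - x)" by (rule L)
          also have "\<dots> \<le> L i * norm v"
            using y L(1)[of i] by (intro mult_left_mono) (auto simp: dist_norm norm_minus_commute)
          finally show "\<bar>pd i f y - pd i f x\<bar> \<le> L i * norm v" .
        qed auto
        finally show "norm (\<Sum>i\<in>UNIV. h $ i * (pd i f y - pd i f x)) \<le> C * norm v * norm h"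
          by (simp add: C_def sum_distrib_right[symmetric] mult_ac)
      qed
    qed (auto simp: dist_norm)
    thus ?thesis by (simp add: g_def power2_eq_square distrib_right sum.distrib algebra_simps)
  qed
  thus ?thesis using that C0 by blast
qed

lemma quadratic_has_derivative:
  fixes F :: fn
  assumes "bounded_linear A" "\<And>v. \<bar>F (x + v) - F x - A v\<bar> \<le> C * (norm v)\<^sup>2"
  shows "(F has_derivative A) (at x)"
  unfolding has_derivative_at
proof
  have "((\<lambda>h::pt. C * norm h) \<longlongrightarrow> C * norm (0::pt)) (at 0)" by (intro tendsto_intros)
  hence l: "((\<lambda>h::pt. C * norm h) \<longlongrightarrow> 0) (at 0)" by simp
  show "(\<lambda>h. norm (F (x + h) - F x - A h) / norm h) \<midarrow>0\<rightarrow> 0"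
  proof (rule tendsto_sandwich[OF _ _ tendsto_const l])
    show "\<forall>\<^sub>F h in at 0. norm (F (x + h) - F x - A h) / norm h \<le> C * norm h"
      unfolding eventually_at_filter
      by (intro always_eventually allI impI)
         (use assms(2) in \<open>auto simp: field_simps power2_eq_square\<close>)
  qed auto
qed (rule assms)

definition wavg :: "'a measure \<Rightarrow> ('a \<Rightarrow> real) \<Rightarrow> ('a \<Rightarrow> pt) \<Rightarrow> fn \<Rightarrow> fn" where
  "wavg N w k f x = (\<integral>s. w s * f (x + k s) \<partial>N)"

definition avg :: "'a measure \<Rightarrow> ('a \<Rightarrow> pt) \<Rightarrow> fn \<Rightarrow> fn" where
  "avg N k f x = (\<integral>s. f (x + k s) \<partial>N)"

definition kern :: "'a measure \<Rightarrow> ('a \<Rightarrow> pt) \<Rightarrow> real \<Rightarrow> bool" where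
  "kern N k R \<longleftrightarrow> prob_space N \<and> k \<in> borel_measurable N \<and> (\<forall>s\<in>space N. norm (k s) \<le> R)"

lemma kernD: "kern N k R \<Longrightarrow> prob_space N" "kern N k R \<Longrightarrow> k \<in> borel_measurable N"
  "kern N k R \<Longrightarrow> s \<in> space N \<Longrightarrow> norm (k s) \<le> R"
  by (auto simp: kern_def)

lemma kern_uminus: "kern N k R \<Longrightarrow> kern N (\<lambda>s. - k s) R"
  by (simp add: kern_def)

lemma avg_wavg: "avg N k = wavg N (\<lambda>_. 1) k"
  by (auto simp: avg_def wavg_def fun_eq_iff)

lemma wavg_integrable:
  assumes "test f" "integrable N w" "k \<in> borel_measurable N"
  shows "integrable N (\<lambda>s. w s * f (x + k s))"
proof -
  obtain B where B: "\<And>x. \<bar>f x\<bar> \<le> B" "B > 0" using test_bounded[OF assms(1)] by blast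
  have [measurable]: "f \<in> borel_measurable borel" "k \<in> borel_measurable N" using assms test_borel by auto
  show ?thesis
  proof (rule Bochner_Integration.integrable_bound)
    show "integrable N (\<lambda>s. B * \<bar>w s\<bar>)" using assms by auto
    show "(\<lambda>s. w s * f (x + k s)) \<in> borel_measurable N" using assms(2) by measurable
    show "AE s in N. norm (w s * f (x + k s)) \<le> norm (B * \<bar>w s\<bar>)"
      using B by (intro AE_I2) (auto simp: abs_mult mult.commute[of B] intro!: mult_left_mono)
  qed
qed

lemma wavg_has_derivative:
  assumes f: "test f" and w: "integrable N w" and k: "k \<in> borel_measurable N"
  shows "(wavg N w k f has_derivative (\<lambda>v. \<Sum>i\<in>UNIV. v $ i * wavg N w k (pd i f) x)) (at x)"
proof -
  obtain C where C: "C \<ge> 0" "\<And>x v. \<bar>f (x + v) - f x - (\<Sum>i\<in>UNIV. v $ i * pd i f x)\<bar> \<le> C * (norm v)\<^sup>2"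
    using test_taylor[OF f] by blast
  show ?thesis
  proof (rule quadratic_has_derivative[OF bounded_linear_coords])
    fix v
    note int = wavg_integrable[OF _ w k]
    have "wavg N w k f (x + v) - wavg N w k f x - (\<Sum>i\<in>UNIV. v $ i * wavg N w k (pd i f) x)
      = (\<integral>s. w s * f (x + v + k s) - w s * f (x + k s) - (\<Sum>i\<in>UNIV. v $ i * (w s * pd i f (x + k s))) \<partial>N)"
      unfolding wavg_def
      by (subst Bochner_Integration.integral_diff; (intro Bochner_Integration.integrable_diff Bochner_Integration.integrable_sum int integrable_mult_right f test_pd)?)
         (simp add: int f test_pd)
    also have "\<bar>\<dots>\<bar> \<le> (\<integral>s. \<bar>w s\<bar> * (C * (norm v)\<^sup>2) \<partial>N)"
    proof (rule abs_integral_le)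
      fix s
      have "w s * f (x + v + k s) - w s * f (x + k s) - (\<Sum>i\<in>UNIV. v $ i * (w s * pd i f (x + k s)))
        = w s * (f ((x + k s) + v) - f (x + k s) - (\<Sum>i\<in>UNIV. v $ i * pd i f (x + k s)))"
        by (simp add: algebra_simps sum_distrib_left)
      thus "\<bar>w s * f (x + v + k s) - w s * f (x + k s) - (\<Sum>i\<in>UNIV. v $ i * (w s * pd i f (x + k s)))\<bar>
        \<le> \<bar>w s\<bar> * (C * (norm v)\<^sup>2)"
        using C(2)[of "x + k s" v] by (auto simp: abs_mult intro!: mult_left_mono)
    qed (use w in \<open>auto intro!: Bochner_Integration.integrable_diff Bochner_Integration.integrable_sum int f test_pd\<close>)
    also have "\<dots> = ((\<integral>s. \<bar>w s\<bar> \<partial>N) * C) * (norm v)\<^sup>2" by simp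
    finally show "\<bar>wavg N w k f (x + v) - wavg N w k f x - (\<Sum>i\<in>UNIV. v $ i * wavg N w k (pd i f) x)\<bar>
      \<le> ((\<integral>s. \<bar>w s\<bar> \<partial>N) * C) * (norm v)\<^sup>2" .
  qed
qed

lemma pd_wavg:
  assumes "test f" "integrable N w" "k \<in> borel_measurable N"
  shows "pd i (wavg N w k f) = wavg N w k (pd i f)"
proof
  fix x
  have "pd i (wavg N w k f) x = (\<Sum>j\<in>UNIV. axis i 1 $ j * wavg N w k (pd j f) x)"
    by (rule pd_eqI[OF wavg_has_derivative[OF assms]])
  also have "\<dots> = wavg N w k (pd i f) x"
    by (simp add: axis_def if_distrib[where f="\<lambda>t. t * _"] cong: if_cong)
  finally show "pd i (wavg N w k f) x = wavg N w k (pd i f) x" .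
qed

lemma smooth_wavg:
  assumes "test f" "integrable N w" "k \<in> borel_measurable N"
  shows "smooth_fn (wavg N w k f)"
proof (rule smooth_fn_coinduct[where X="\<lambda>h. \<exists>f. test f \<and> h = wavg N w k f"])
  show "h differentiable_on UNIV" if "\<exists>f. test f \<and> h = wavg N w k f" for h
    using that wavg_has_derivative[OF _ assms(2,3)]
    by (auto simp: differentiable_on_def differentiable_def)
  show "\<exists>f. test f \<and> pd i h = wavg N w k f" if "\<exists>f. test f \<and> h = wavg N w k f" for h i
    using that pd_wavg[OF _ assms(2,3)] test_pd by blast
qed (use assms in blast)

lemma avg_nonzero: "avg N k f x \<noteq> 0 \<Longrightarrow> \<exists>s\<in>space N. f (x + k s) \<noteq> 0"
  unfolding avg_def by (metis (mono_tags, lifting) integral_zero Bochner_Integration.integral_cong)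

context
  fixes N :: "'a measure" and k R assumes kern: "kern N k R"
begin

interpretation N: prob_space N using kern by (rule kernD)

lemma kern_measurable [measurable]: "k \<in> borel_measurable N" using kern by (rule kernD)

lemma avg_integrable: "test f \<Longrightarrow> integrable N (\<lambda>s. f (x + k s))"
  using wavg_integrable[of f N "\<lambda>_. 1" k x] by simp

lemma test_avg: assumes f: "test f" shows "test (avg N k f)"
proof -
  obtain S where S: "\<And>x. norm x > S \<Longrightarrow> f x = 0" using test_outside[OF f] by blast
  show ?thesis
  proof (rule testI[where R="S + R"])
    show "smooth_fn (avg N k f)" unfolding avg_wavg by (rule smooth_wavg[OF f]) auto
    fix x :: pt assume x: "norm x > S + R"
    show "avg N k f x = 0"
    proof (rule ccontr)
      assume "avg N k f x \<noteq> 0"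
      then obtain s where s: "s \<in> space N" "f (x + k s) \<noteq> 0" using avg_nonzero by blast
      have "norm x \<le> norm (x + k s) + norm (k s)" by (metis add_diff_cancel_right' norm_triangle_ineq4)
      thus False using S[of "x + k s"] s kernD(3)[OF kern s(1)] x by force
    qed
  qed
qed

lemma pd_avg: "test f \<Longrightarrow> pd i (avg N k f) = avg N k (pd i f)"
  unfolding avg_wavg by (rule pd_wavg) auto

lemma avg_lin: "test f \<Longrightarrow> test g \<Longrightarrow> avg N k (\<lambda>x. a * f x + b * g x) = (\<lambda>x. a * avg N k f x + b * avg N k g x)"
  unfolding avg_def by (simp add: avg_integrable)

lemma nn_translate: 
  fixes h :: "pt \<Rightarrow> ennreal"
  assumes [measurable]: "h \<in> borel_measurable borel"
  shows "(\<integral>\<^sup>+x. h (x + c) \<partial>lborel) = (\<integral>\<^sup>+x. h x \<partial>lborel)"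
  by (subst (2) lborel_distr_plus[symmetric, of c]) (simp add: nn_integral_distr add.commute)

lemma nn_avg_sq:
  assumes f: "L2 f"
  shows "(\<integral>\<^sup>+x. (\<integral>\<^sup>+s. ennreal ((f (x + k s))\<^sup>2) \<partial>N) \<partial>lborel) = ennreal (l2sq f)"
proof -
  interpret pair_sigma_finite lborel N ..
  have [measurable]: "f \<in> borel_measurable borel" using L2_measurable[OF f] by simp
  have "(\<integral>\<^sup>+x. (\<integral>\<^sup>+s. ennreal ((f (x + k s))\<^sup>2) \<partial>N) \<partial>lborel)
      = (\<integral>\<^sup>+s. (\<integral>\<^sup>+x. ennreal ((f (x + k s))\<^sup>2) \<partial>lborel) \<partial>N)"
    by (rule Fubini'[symmetric]) measurable
  also have "\<dots> = (\<integral>\<^sup>+s. (\<integral>\<^sup>+x. ennreal ((f x)\<^sup>2) \<partial>lborel) \<partial>N)"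
    by (intro nn_integral_cong nn_translate[of "\<lambda>x. ennreal ((f x)\<^sup>2)"]) measurable
  also have "\<dots> = (\<integral>\<^sup>+x. ennreal ((f x)\<^sup>2) \<partial>lborel)" by (simp add: N.emeasure_space_1)
  also have "\<dots> = ennreal (l2sq f)"
    unfolding l2sq_def using L2_integrable[OF f] by (intro nn_integral_eq_integral) auto
  finally show ?thesis .
qed

lemma avg_sq_le:
  assumes [measurable]: "h \<in> borel_measurable N"
  shows "ennreal ((\<integral>s. h s \<partial>N)\<^sup>2) \<le> (\<integral>\<^sup>+s. ennreal ((h s)\<^sup>2) \<partial>N)"
proof (cases "(\<integral>\<^sup>+s. ennreal ((h s)\<^sup>2) \<partial>N) = \<infinity>")
  case False
  hence i2: "integrable N (\<lambda>s. (h s)\<^sup>2)"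
    by (intro integrableI_bounded) (auto simp: less_top)
  have i1: "integrable N h"
  proof (rule Bochner_Integration.integrable_bound)
    show "integrable N (\<lambda>s. 1 + (h s)\<^sup>2)" using i2 by simp
    have "\<bar>t\<bar> \<le> 1 + t\<^sup>2" for t :: real
      using sum_squares_bound[of 1 "\<bar>t\<bar>"] abs_ge_zero[of t] by simp
    moreover have "\<bar>1 + t\<^sup>2\<bar> = 1 + t\<^sup>2" for t :: real by (simp add: add_nonneg_nonneg)
    ultimately show "AE s in N. norm (h s) \<le> norm (1 + (h s)\<^sup>2)" by (intro AE_I2) simp
  qed simp
  define m where "m = (\<integral>s. h s \<partial>N)"
  have "0 \<le> (\<integral>s. (h s - m)\<^sup>2 \<partial>N)" by simp
  also have "\<dots> = (\<integral>s. (h s)\<^sup>2 - 2 * m * h s + m\<^sup>2 \<partial>N)"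
    by (simp add: power2_eq_square algebra_simps)
  also have "\<dots> = (\<integral>s. (h s)\<^sup>2 \<partial>N) - m\<^sup>2"
    using i1 i2 by (simp add: m_def[symmetric] N.prob_space power2_eq_square)
  finally have "m\<^sup>2 \<le> (\<integral>s. (h s)\<^sup>2 \<partial>N)" by simp
  thus ?thesis unfolding m_def by (subst nn_integral_eq_integral[OF i2]) (auto intro: ennreal_leI)
qed simp

lemma L2_avg:
  assumes f: "L2 f" shows "L2 (avg N k f)" "n2 (avg N k f) \<le> n2 f"
proof -
  have [measurable]: "f \<in> borel_measurable borel" using L2_measurable[OF f] by simp
  have m [measurable]: "avg N k f \<in> borel_measurable lborel"
    unfolding avg_def[abs_def] by measurable
  have le: "(\<integral>\<^sup>+x. ennreal ((avg N k f x)\<^sup>2) \<partial>lborel) \<le> ennreal (l2sq f)"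
    unfolding nn_avg_sq[OF f, symmetric] avg_def
    by (intro nn_integral_mono avg_sq_le) measurable
  have i: "integrable lborel (\<lambda>x. (avg N k f x)\<^sup>2)"
    using le by (intro integrableI_bounded) (auto intro: le_less_trans)
  thus "L2 (avg N k f)" by (simp add: L2_def)
  have "ennreal (l2sq (avg N k f)) \<le> ennreal (l2sq f)"
    using le unfolding l2sq_def[of "avg N k f"] by (subst (asm) nn_integral_eq_integral[OF i]) auto
  thus "n2 (avg N k f) \<le> n2 f" by (simp add: n2_def l2sq_nonneg)
qed

lemma avg_prod_integrable:
  assumes f: "L2 f" and g: "L2 g"
  shows "integrable (lborel \<Otimes>\<^sub>M N) (\<lambda>(x, s). f (x + k s) * g x)"
proof -
  interpret pair_sigma_finite lborel N ..
  have [measurable]: "f \<in> borel_measurable borel" "g \<in> borel_measurable borel"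
    using L2_measurable f g by auto
  have m: "(\<lambda>(x, s). f (x + k s) * g x) \<in> borel_measurable (lborel \<Otimes>\<^sub>M N)" by measurable
  have "(\<integral>\<^sup>+p. ennreal (norm (case p of (x, s) \<Rightarrow> f (x + k s) * g x)) \<partial>(lborel \<Otimes>\<^sub>M N))
    = (\<integral>\<^sup>+x. (\<integral>\<^sup>+s. ennreal \<bar>f (x + k s) * g x\<bar> \<partial>N) \<partial>lborel)"
    by (subst N.nn_integral_fst[symmetric]) auto
  also have "\<dots> \<le> (\<integral>\<^sup>+x. (\<integral>\<^sup>+s. ennreal ((f (x + k s))\<^sup>2) + ennreal ((g x)\<^sup>2) \<partial>N) \<partial>lborel)"
  proof (intro nn_integral_mono)
    fix x s
    have "\<bar>a * b\<bar> \<le> a\<^sup>2 + b\<^sup>2" for a b :: real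
    proof -
      have "2 * \<bar>a * b\<bar> \<le> a\<^sup>2 + b\<^sup>2"
        using sum_squares_bound[of "\<bar>a\<bar>" "\<bar>b\<bar>"] by (simp add: abs_mult)
      thus ?thesis using abs_ge_zero[of "a * b"] by linarith
    qed
    thus "ennreal \<bar>f (x + k s) * g x\<bar> \<le> ennreal ((f (x + k s))\<^sup>2) + ennreal ((g x)\<^sup>2)"
      by (simp add: ennreal_plus[symmetric] ennreal_leI del: ennreal_plus)
  qed
  also have "\<dots> = (\<integral>\<^sup>+x. (\<integral>\<^sup>+s. ennreal ((f (x + k s))\<^sup>2) \<partial>N) + ennreal ((g x)\<^sup>2) \<partial>lborel)"
    by (intro nn_integral_cong) (simp add: nn_integral_add N.emeasure_space_1)
  also have "\<dots> = ennreal (l2sq f) + (\<integral>\<^sup>+x. ennreal ((g x)\<^sup>2) \<partial>lborel)"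
    by (subst nn_integral_add) (auto simp: nn_avg_sq[OF f])
  also have "\<dots> = ennreal (l2sq f) + ennreal (l2sq g)"
    unfolding l2sq_def[of g] using L2_integrable[OF g] by (subst nn_integral_eq_integral) auto
  also have "\<dots> < \<infinity>" by simp
  finally show ?thesis by (intro integrableI_bounded m)
qed

end

declare kern_measurable [measurable del]

lemma integral_translate:
  fixes h :: fn
  assumes [measurable]: "h \<in> borel_measurable borel"
  shows "(\<integral>x. h (x + c) \<partial>lborel) = (\<integral>x. h x \<partial>lborel)"
  by (subst (2) lborel_distr_plus[symmetric, of c]) (simp add: integral_distr add.commute)

lemma avg_adjoint:
  assumes kern: "kern N k R" and f: "L2 f" and g: "L2 g"
  shows "ip (avg N k f) g = ip f (avg N (\<lambda>s. - k s) g)"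
proof -
  interpret N: prob_space N using kern by (rule kernD)
  interpret pair_sigma_finite lborel N ..
  have [measurable]: "f \<in> borel_measurable borel" "g \<in> borel_measurable borel"
    using L2_measurable f g by auto
  have "ip (avg N k f) g = (\<integral>x. (\<integral>s. f (x + k s) * g x \<partial>N) \<partial>lborel)"
    by (simp add: ip_def avg_def)
  also have "\<dots> = (\<integral>s. (\<integral>x. f (x + k s) * g x \<partial>lborel) \<partial>N)"
    by (rule Fubini_integral[OF avg_prod_integrable[OF kern f g], symmetric])
  also have "\<dots> = (\<integral>s. (\<integral>x. g (x + - k s) * f x \<partial>lborel) \<partial>N)"
  proof (rule Bochner_Integration.integral_cong[OF refl])
    fix s
    show "(\<integral>x. f (x + k s) * g x \<partial>lborel) = (\<integral>x. g (x + - k s) * f x \<partial>lborel)"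
      using integral_translate[of "\<lambda>x. g (x + - k s) * f x" "k s"] by (simp add: mult.commute)
  qed
  also have "\<dots> = (\<integral>x. (\<integral>s. g (x + - k s) * f x \<partial>N) \<partial>lborel)"
    by (rule Fubini_integral[OF avg_prod_integrable[OF kern_uminus[OF kern] g f]])
  also have "\<dots> = ip f (avg N (\<lambda>s. - k s) g)"
    by (simp add: ip_def avg_def mult.commute)
  finally show ?thesis .
qed

lemma avg_diff_AE:
  assumes kern: "kern N k R" and f: "L2 f" and g: "L2 g"
  shows "AE x in lborel. avg N k (\<lambda>x. f x - g x) x = avg N k f x - avg N k g x"
proof (rule L2_AE_eqI)
  show "L2 (avg N k (\<lambda>x. f x - g x))" "L2 (\<lambda>x. avg N k f x - avg N k g x)"
    using kern f g by (auto intro!: L2_avg L2_diff)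
  fix \<phi> assume t: "test \<phi>"
  have A: "L2 (avg N (\<lambda>s. - k s) \<phi>)" by (rule L2_avg[OF kern_uminus[OF kern] test_L2[OF t]])
  have "ip (avg N k (\<lambda>x. f x - g x)) \<phi> = ip f (avg N (\<lambda>s. - k s) \<phi>) - ip g (avg N (\<lambda>s. - k s) \<phi>)"
    using ip_lin_left[OF f g A, of 1 "-1"] by (simp add: avg_adjoint[OF kern L2_diff[OF f g] test_L2[OF t]])
  also have "\<dots> = ip (\<lambda>x. avg N k f x - avg N k g x) \<phi>"
    using ip_lin_left[OF L2_avg(1)[OF kern f] L2_avg(1)[OF kern g] test_L2[OF t], of 1 "-1"]
    by (simp add: avg_adjoint[OF kern _ test_L2[OF t]] f g)
  finally show "ip (avg N k (\<lambda>x. f x - g x)) \<phi> = ip (\<lambda>x. avg N k f x - avg N k g x) \<phi>" .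
qed

lemma weak_pd_avg:
  assumes kern: "kern N k R" and f: "L2 f" and g: "L2 g" and w: "weak_pd i f g"
  shows "weak_pd i (avg N k f) (avg N k g)"
  unfolding weak_pd_ip
proof (intro allI impI)
  fix \<phi> assume t: "test \<phi>"
  note k' = kern_uminus[OF kern]
  show "ip (avg N k f) (pd i \<phi>) = - ip (avg N k g) \<phi>"
    using w test_avg[OF k' t]
    by (simp add: avg_adjoint[OF kern] f g t test_L2 test_pd pd_avg[OF k', symmetric] weak_pd_ip)
qed

lemma kern_nonneg: "kern N k R \<Longrightarrow> R \<ge> 0"
  using prob_space.not_empty[OF kernD(1)] kernD(3) norm_ge_zero order_trans by (metis ex_in_conv)

lemma avg_close_pt:
  assumes f: "test f"
  shows "\<exists>L>0. \<forall>(N :: 'a measure) k R x. kern N k R \<longrightarrow> \<bar>avg N k f x - f x\<bar> \<le> L * R"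
proof -
  obtain L where L: "L > 0" "\<And>x y. \<bar>f y - f x\<bar> \<le> L * norm (y - x)" using test_lipschitz[OF f] by blast
  have "\<bar>avg N k f x - f x\<bar> \<le> L * R" if kern: "kern N k R" for N :: "'a measure" and k R x
  proof -
    interpret N: prob_space N using kern by (rule kernD)
    have "avg N k f x - f x = (\<integral>s. f (x + k s) - f x \<partial>N)"
      by (simp add: avg_def avg_integrable[OF kern f] N.prob_space)
    also have "\<bar>\<dots>\<bar> \<le> (\<integral>s. L * R \<partial>N)"
    proof (rule abs_integral_le)
      fix s assume "s \<in> space N"
      hence "\<bar>f (x + k s) - f x\<bar> \<le> L * norm (k s)" "norm (k s) \<le> R"
        using L(2)[of "x + k s" x] kernD(3)[OF kern] by auto
      thus "\<bar>f (x + k s) - f x\<bar> \<le> L * R" using L(1) by (meson mult_left_mono less_imp_le order_trans)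
    qed (auto simp: avg_integrable[OF kern f])
    finally show ?thesis by (simp add: N.prob_space)
  qed
  thus ?thesis using L(1) by blast
qed

lemma avg_close:
  assumes f: "test f"
  shows "\<exists>C\<ge>0. \<forall>(N :: 'a measure) k R. kern N k R \<longrightarrow> R \<le> 1 \<longrightarrow> n2 (\<lambda>x. avg N k f x - f x) \<le> C * R"
proof -
  obtain L where L: "L > 0" "\<And>(N :: 'a measure) k R x. kern N k R \<Longrightarrow> \<bar>avg N k f x - f x\<bar> \<le> L * R"
    using avg_close_pt[OF f] by blast
  obtain S where S: "\<And>x. norm x > S \<Longrightarrow> f x = 0" "S > 0" using test_outside[OF f] by blast
  define V where "V = measure lborel (cball (0::pt) (S + 1))"
  have "n2 (\<lambda>x. avg N k f x - f x) \<le> (L * sqrt V) * R"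
    if kern: "kern N k R" and R: "R \<le> 1" for N :: "'a measure" and k R
  proof -
    have R0: "R \<ge> 0" using kern by (rule kern_nonneg)
    have p: "\<bar>avg N k f x - f x\<bar> \<le> L * R" for x by (rule L(2)[OF kern])
    have z: "avg N k f x - f x = 0" if "x \<notin> cball 0 (S + 1)" for x
    proof -
      have "avg N k f x = 0"
      proof (rule ccontr)
        assume "avg N k f x \<noteq> 0"
        then obtain s where s: "s \<in> space N" "f (x + k s) \<noteq> 0" using avg_nonzero by blast
        have "norm x \<le> norm (x + k s) + norm (k s)" by (metis add_diff_cancel_right' norm_triangle_ineq4)
        thus False using S(1)[of "x + k s"] s kernD(3)[OF kern s(1)] that R by force
      qed
      thus ?thesis using S(1)[of x] that by auto
    qed
    have "l2sq (\<lambda>x. avg N k f x - f x) \<le> (\<integral>x. indicator (cball (0::pt) (S + 1)) x * (L * R)\<^sup>2 \<partial>lborel)"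
      unfolding l2sq_def
    proof (rule integral_mono)
      show "integrable lborel (\<lambda>x. (avg N k f x - f x)\<^sup>2)"
        by (intro L2_integrable L2_diff L2_avg(1)[OF kern] test_L2 f)
      show "integrable lborel (\<lambda>x::pt. indicator (cball 0 (S + 1)) x * (L * R)\<^sup>2)"
        by (intro integrable_mult_left integrable_real_indicator) (auto simp: emeasure_lborel_cball_finite[simplified])
      fix x
      have "(avg N k f x - f x)\<^sup>2 \<le> (L * R)\<^sup>2"
        using p[of x] by (metis abs_ge_zero power2_abs power_mono)
      thus "(avg N k f x - f x)\<^sup>2 \<le> indicator (cball 0 (S + 1)) x * (L * R)\<^sup>2"
        using z[of x] by (cases "x \<in> cball 0 (S + 1)") auto
    qed
    also have "\<dots> = V * (L * R)\<^sup>2" by (simp add: V_def)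
    finally have "n2 (\<lambda>x. avg N k f x - f x) \<le> sqrt (V * (L * R)\<^sup>2)"
      unfolding n2_def by (rule real_sqrt_le_mono)
    also have "\<dots> = (L * sqrt V) * R" using L(1) R0 by (simp add: real_sqrt_mult)
    finally show ?thesis .
  qed
  moreover have "L * sqrt V \<ge> 0" using L(1) by (simp add: V_def)
  ultimately show ?thesis by blast
qed

lemma avg_commute:
  fixes N :: "'a measure" and N' :: "'b measure"
  assumes kern: "kern N k R" and kern': "kern N' k' R'" and f: "test f"
  shows "avg N k (avg N' k' f) = avg N' k' (avg N k f)"
proof
  fix x
  interpret N: prob_space N using kern by (rule kernD)
  interpret N': prob_space N' using kern' by (rule kernD)
  interpret pair_prob_space N N' ..
  note [measurable] = kernD(2)[OF kern] kernD(2)[OF kern'] test_borel[OF f]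
  obtain B where B: "\<And>x. \<bar>f x\<bar> \<le> B" "B > 0" using test_bounded[OF f] by blast
  have i: "integrable (N \<Otimes>\<^sub>M N') (\<lambda>(s, t). f (x + k s + k' t))"
    by (rule integrable_const_bound[where B=B]) (use B in auto)
  show "avg N k (avg N' k' f) x = avg N' k' (avg N k f) x"
    using Fubini_integral[OF i] by (simp add: avg_def add.assoc add.left_commute add.commute)
qed

section \<open>Translations and segment averages\<close>

definition tr :: "pt \<Rightarrow> fn \<Rightarrow> fn" where "tr v f x = f (x + v)"

abbreviation unit_measure :: "real measure" where
  "unit_measure \<equiv> restrict_space lborel {0..1}"

definition mv :: "pt \<Rightarrow> fn \<Rightarrow> fn" where "mv v = avg unit_measure (\<lambda>s. s *\<^sub>R v)"

definition dd :: "pt \<Rightarrow> fn \<Rightarrow> fn" where "dd v f x = (\<Sum>i\<in>UNIV. v $ i * pd i f x)"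

lemma prob_unit: "prob_space unit_measure"
  by (rule prob_spaceI) (simp add: emeasure_restrict_space)

lemma tr_avg: "tr v = avg unit_measure (\<lambda>_. v)"
  using prob_space.prob_space[OF prob_unit] by (auto simp: fun_eq_iff tr_def avg_def space_restrict_space)

lemma kern_tr: "kern unit_measure (\<lambda>_. v) (norm v)"
  by (simp add: kern_def prob_unit)

lemma kern_mv: "kern unit_measure (\<lambda>s. s *\<^sub>R v) (norm v)"
  unfolding kern_def
proof (intro conjI ballI prob_unit)
  show "(\<lambda>s. s *\<^sub>R v) \<in> borel_measurable unit_measure"
    by (rule measurable_restrict_space1) simp
  fix s assume "s \<in> space unit_measure"
  hence "0 \<le> s" "s \<le> 1" by (auto simp: space_restrict_space)
  thus "norm (s *\<^sub>R v) \<le> norm v" by (simp add: mult_left_le_one_le)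
qed

lemma mv_integral: "mv v f x = (\<integral>s. indicator {0..1} s *\<^sub>R f (x + s *\<^sub>R v) \<partial>lborel)"
  by (simp add: mv_def avg_def integral_restrict_space)

lemma test_tr: "test f \<Longrightarrow> test (tr v f)"
  and test_mv: "test f \<Longrightarrow> test (mv v f)"
  by (auto simp: tr_avg mv_def intro: test_avg kern_tr kern_mv)

lemma test_dd: "test f \<Longrightarrow> test (dd v f)"
  unfolding dd_def[abs_def] by (intro test_sum test_cmult test_pd)

lemma pd_tr: "test f \<Longrightarrow> pd i (tr v f) = tr v (pd i f)"
  and pd_mv: "test f \<Longrightarrow> pd i (mv v f) = mv v (pd i f)"
  by (auto simp: tr_avg mv_def pd_avg[OF kern_tr] pd_avg[OF kern_mv])

lemma tr_lin: "tr v (\<lambda>x. a * f x + b * g x) = (\<lambda>x. a * tr v f x + b * tr v g x)"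
  by (simp add: tr_def fun_eq_iff)

lemma mv_lin: "test f \<Longrightarrow> test g \<Longrightarrow> mv v (\<lambda>x. a * f x + b * g x) = (\<lambda>x. a * mv v f x + b * mv v g x)"
  unfolding mv_def by (rule avg_lin[OF kern_mv])

lemma mv_sum:
  "(\<And>i. i \<in> I \<Longrightarrow> test (f i)) \<Longrightarrow> mv v (\<lambda>x. \<Sum>i\<in>I. c i * f i x) = (\<lambda>x. \<Sum>i\<in>I. c i * mv v (f i) x)"
proof (induction I rule: infinite_finite_induct)
  case (insert k I)
  have "mv v (\<lambda>x. c k * f k x + 1 * (\<Sum>i\<in>I. c i * f i x)) = (\<lambda>x. c k * mv v (f k) x + 1 * mv v (\<lambda>x. \<Sum>i\<in>I. c i * f i x) x)"
    using insert by (intro mv_lin test_sum test_cmult) auto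
  thus ?case using insert by simp
qed (auto simp: mv_def avg_def)

lemma dd_mv: "test f \<Longrightarrow> dd w (mv v f) = mv v (dd w f)"
  unfolding dd_def[abs_def] by (simp add: pd_mv mv_sum test_pd)

lemma dd_tr: "test f \<Longrightarrow> dd w (tr v f) = tr v (dd w f)"
  unfolding dd_def[abs_def] by (simp add: pd_tr tr_def fun_eq_iff)

lemma tr_mv: "test f \<Longrightarrow> tr v (mv w f) = mv w (tr v f)"
  unfolding tr_avg mv_def by (rule avg_commute[OF kern_tr kern_mv])

lemma mv_mv: "test f \<Longrightarrow> mv v (mv w f) = mv w (mv v f)"
  unfolding mv_def by (rule avg_commute[OF kern_mv kern_mv])

lemma tr_tr: "tr v (tr w f) = tr (v + w) f"
  by (simp add: tr_def fun_eq_iff add_ac)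

lemma smooth_along:
  assumes "test f" shows "((\<lambda>s. f (x + s *\<^sub>R v)) has_real_derivative dd v f (x + s *\<^sub>R v)) (at s)"
proof -
  have 1: "((\<lambda>s. x + s *\<^sub>R v) has_derivative (\<lambda>t. t *\<^sub>R v)) (at s)"
    by (auto intro!: derivative_eq_intros)
  have "((\<lambda>s. f (x + s *\<^sub>R v)) has_derivative (\<lambda>t. \<Sum>i\<in>UNIV. (t *\<^sub>R v) $ i * pd i f (x + s *\<^sub>R v))) (at s)"
    by (rule has_derivative_compose[OF 1 smooth_pd_derivative[OF test_smooth[OF assms]]])
  moreover have "(\<lambda>t. \<Sum>i\<in>UNIV. (t *\<^sub>R v) $ i * pd i f (x + s *\<^sub>R v)) = (*) (dd v f (x + s *\<^sub>R v))"
    by (auto simp: fun_eq_iff dd_def sum_distrib_left mult_ac)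
  ultimately show ?thesis by (simp add: has_field_derivative_def)
qed

lemma FTC_unit:
  assumes "\<And>s. s \<in> {0..1} \<Longrightarrow> (G has_real_derivative F s) (at s)" "continuous_on {0..1} F"
  shows "(\<integral>s. indicator {0..1::real} s *\<^sub>R F s \<partial>lborel) = G 1 - G 0"
  by (rule integral_FTC_atLeastAtMost)
     (use assms in \<open>auto simp: has_real_derivative_iff_has_vector_derivative[symmetric] intro: has_field_derivative_at_within\<close>)

lemma test_along_continuous: "test f \<Longrightarrow> continuous_on A (\<lambda>s. f (x + (a * s + b) *\<^sub>R v))"
  by (rule continuous_on_compose2[OF test_continuous[of f UNIV]]) (auto intro!: continuous_intros)

lemma mv_dd: assumes f: "test f" shows "mv v (dd v f) = (\<lambda>x. tr v f x - f x)"
proof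
  fix x
  have "mv v (dd v f) x = f (x + 1 *\<^sub>R v) - f (x + 0 *\<^sub>R v)"
    unfolding mv_integral
    by (rule FTC_unit[OF smooth_along[OF f]]) (use test_along_continuous[OF test_dd[OF f, of v], of "{0..1}" x 1 0 v] in simp)
  thus "mv v (dd v f) x = tr v f x - f x" by (simp add: tr_def)
qed

lemma mv_double:
  assumes f: "test f"
  shows "mv (2 *\<^sub>R v) f = (\<lambda>x. 1/2 * mv v f x + 1/2 * tr v (mv v f) x)"
proof
  fix x
  define F where "F s = f (x + s *\<^sub>R v)" for s
  have cF: "continuous_on A F" for A
    using test_along_continuous[OF f, of A x 1 0 v] by (simp add: F_def[abs_def])
  obtain G where G: "\<And>s. s \<in> {-1..3} \<Longrightarrow> (G has_vector_derivative F s) (at s within {-1..3})"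
    using antiderivative_continuous[OF cF, of "-1" 3] by blast
  have G': "(G has_real_derivative F s) (at s)" if "0 \<le> s" "s \<le> 2" for s
  proof -
    have "at s within {-1..3} = at s"
      by (rule at_within_interior) (use that in \<open>auto simp: interior_atLeastAtMost_real\<close>)
    thus ?thesis using G[of s] that by (simp add: has_real_derivative_iff_has_vector_derivative)
  qed
  have 1: "mv (2 *\<^sub>R v) f x = G (2 * 1) / 2 - G (2 * 0) / 2"
  proof -
    have "(\<integral>s. indicator {0..1::real} s *\<^sub>R F (2 * s) \<partial>lborel) = G (2 * 1) / 2 - G (2 * 0) / 2"
    proof (rule FTC_unit)
      fix s :: real assume "s \<in> {0..1}"
      hence "(G has_real_derivative F (2 * s)) (at (2 * s))" by (intro G') auto
      from DERIV_chain'[OF DERIV_cmult[OF DERIV_ident] this]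
      show "((\<lambda>s. G (2 * s) / 2) has_real_derivative F (2 * s)) (at s)"
        by (auto intro!: derivative_eq_intros)
    qed (use test_along_continuous[OF f, of "{0..1}" x 2 0 v] in \<open>simp add: F_def\<close>)
    thus ?thesis by (simp add: mv_integral F_def mult.commute)
  qed
  have 2: "mv v f x = G 1 - G 0"
    unfolding mv_integral F_def[symmetric] by (rule FTC_unit[OF _ cF]) (auto intro: G')
  have 3: "tr v (mv v f) x = G (1 + 1) - G (0 + 1)"
  proof -
    have "(\<integral>s. indicator {0..1::real} s *\<^sub>R F (s + 1) \<partial>lborel) = G (1 + 1) - G (0 + 1)"
    proof (rule FTC_unit)
      fix s :: real assume "s \<in> {0..1}"
      hence "(G has_real_derivative F (s + 1)) (at (s + 1))" by (intro G') auto
      thus "((\<lambda>s. G (s + 1)) has_real_derivative F (s + 1)) (at s)" by (simp add: DERIV_shift)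
    qed (use test_along_continuous[OF f, of "{0..1}" x 1 1 v] in \<open>simp add: F_def\<close>)
    thus ?thesis by (simp add: tr_def mv_integral F_def algebra_simps)
  qed
  show "mv (2 *\<^sub>R v) f x = 1/2 * mv v f x + 1/2 * tr v (mv v f) x"
    unfolding 1 2 3 by (simp add: field_simps)
qed

lemma dd_scale: "dd (c *\<^sub>R v) f x = c * dd v f x"
  by (simp add: dd_def sum_distrib_left mult_ac)

lemma dd_axis: "dd (axis i 1) f = pd i f"
  by (simp add: fun_eq_iff dd_def axis_def if_distrib[where f="\<lambda>t. t * _"] cong: if_cong)

lemma mv_pd:
  assumes u: "test u" and c: "c \<noteq> 0"
  shows "mv (c *\<^sub>R axis i 1) (pd i u) = (\<lambda>x. inverse c * tr (c *\<^sub>R axis i 1) u x + (- inverse c) * u x)"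
proof
  fix x
  have e: "dd (c *\<^sub>R axis i 1) u = (\<lambda>x. c * pd i u x + 0 * u x)" by (simp add: fun_eq_iff dd_scale dd_axis)
  have "c * mv (c *\<^sub>R axis i 1) (pd i u) x = tr (c *\<^sub>R axis i 1) u x - u x"
    using fun_cong[OF mv_dd[OF u, of "c *\<^sub>R axis i 1"], of x] unfolding e mv_lin[OF test_pd[OF u] u] by simp
  thus "mv (c *\<^sub>R axis i 1) (pd i u) x = inverse c * tr (c *\<^sub>R axis i 1) u x + (- inverse c) * u x"
    using c by (simp add: field_simps)
qed

lemma n2_tr: "f \<in> borel_measurable borel \<Longrightarrow> n2 (tr v f) = n2 f"
  using integral_translate[of "\<lambda>x. (f x)\<^sup>2" v] by (simp add: n2_def l2sq_def tr_def)

lemma n2_mv: "L2 f \<Longrightarrow> n2 (mv v f) \<le> n2 f"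
  unfolding mv_def by (rule L2_avg[OF kern_mv])

lemma tr_adjoint: "L2 f \<Longrightarrow> L2 g \<Longrightarrow> ip (tr v f) g = ip f (tr (- v) g)"
  using avg_adjoint[OF kern_tr] by (simp add: tr_avg)

lemma mv_adjoint: "L2 f \<Longrightarrow> L2 g \<Longrightarrow> ip (mv v f) g = ip f (mv (- v) g)"
  using avg_adjoint[OF kern_mv] by (simp add: mv_def)

lemma mv_eq_0_imp:
  assumes f: "test f" and z: "\<And>h. h > 0 \<Longrightarrow> mv (h *\<^sub>R v) f = (\<lambda>_. 0)"
  shows "f = (\<lambda>_. 0)"
proof
  fix x
  obtain L where L: "L > 0" "\<And>h. \<bar>mv (h *\<^sub>R v) f x - f x\<bar> \<le> L * norm (h *\<^sub>R v)"
    using avg_close_pt[OF f] kern_mv unfolding mv_def by metis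
  have b: "\<bar>f x\<bar> \<le> L * norm v * inverse (real (Suc n))" for n
    using L(2)[of "inverse (real (Suc n))"] z[of "inverse (real (Suc n))"] by (simp add: mult_ac)
  have "(\<lambda>n. L * norm v * inverse (real (Suc n))) \<longlonglongrightarrow> L * norm v * 0"
    by (intro tendsto_intros LIMSEQ_inverse_real_of_nat)
  hence "\<bar>f x\<bar> \<le> L * norm v * 0" by (rule LIMSEQ_le_const) (use b in blast)
  thus "f x = 0" by simp
qed

lemma pd_commute:
  assumes f: "test f" shows "pd i (pd j f) = pd j (pd i f)"
proof -
  define q where "q = (\<lambda>x. pd i (pd j f) x - pd j (pd i f) x)"
  have q: "test q" unfolding q_def by (intro test_diff test_pd f)
  have D: "mv (h *\<^sub>R axis a 1) (pd a g) = (\<lambda>x. (tr (h *\<^sub>R axis a 1) g x - g x) / h)" if "test g" "h > 0" for h a g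
    using mv_pd[OF that(1), of h a] that by (simp add: field_simps)
  have E: "mv (h *\<^sub>R axis i 1) (mv (h' *\<^sub>R axis j 1) (pd a (pd b f)))
    = (\<lambda>x. (f (x + h *\<^sub>R axis i 1 + h' *\<^sub>R axis j 1) - f (x + h *\<^sub>R axis i 1) - f (x + h' *\<^sub>R axis j 1) + f x) / (h * h'))"
    if h: "h > 0" "h' > 0" and ab: "(a, b) = (i, j) \<or> (a, b) = (j, i)" for h h' a b
    using ab
  proof
    assume "(a, b) = (i, j)"
    hence [simp]: "a = i" "b = j" by auto
    have e: "mv (h' *\<^sub>R axis j 1) (pd i (pd j f)) = pd i (\<lambda>x. inverse h' * tr (h' *\<^sub>R axis j 1) f x + (- inverse h') * f x)"
      using h(2) by (simp only: pd_mv[symmetric, OF test_pd[OF f]] mv_pd[OF f less_imp_neq[OF h(2), symmetric]])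
    show ?thesis unfolding \<open>a = i\<close> \<open>b = j\<close> e D[OF test_lin[OF test_tr[OF f] f] h(1)]
      using h by (simp add: fun_eq_iff tr_def field_simps add_ac)
  next
    assume "(a, b) = (j, i)"
    hence [simp]: "a = j" "b = i" by auto
    have "mv (h *\<^sub>R axis i 1) (mv (h' *\<^sub>R axis j 1) (pd j (pd i f)))
        = mv (h' *\<^sub>R axis j 1) (pd j (mv (h *\<^sub>R axis i 1) (pd i f)))"
      by (simp add: mv_mv[of _ "h *\<^sub>R axis i 1"] test_pd f pd_mv)
    also have "mv (h *\<^sub>R axis i 1) (pd i f) = (\<lambda>x. inverse h * tr (h *\<^sub>R axis i 1) f x + (- inverse h) * f x)"
      by (rule mv_pd[OF f less_imp_neq[OF h(1), symmetric]])
    finally have e: "mv (h *\<^sub>R axis i 1) (mv (h' *\<^sub>R axis j 1) (pd j (pd i f)))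
      = mv (h' *\<^sub>R axis j 1) (pd j (\<lambda>x. inverse h * tr (h *\<^sub>R axis i 1) f x + (- inverse h) * f x))" .
    show ?thesis unfolding \<open>a = j\<close> \<open>b = i\<close> e D[OF test_lin[OF test_tr[OF f] f] h(2)]
      using h by (simp add: fun_eq_iff tr_def field_simps add_ac)
  qed
  have z: "mv (h *\<^sub>R axis i 1) (mv (h' *\<^sub>R axis j 1) q) = (\<lambda>_. 0)" if h: "h > 0" "h' > 0" for h h'
  proof -
    have "q = (\<lambda>x. 1 * pd i (pd j f) x + (-1) * pd j (pd i f) x)" by (simp add: q_def)
    hence "mv (h *\<^sub>R axis i 1) (mv (h' *\<^sub>R axis j 1) q)
      = (\<lambda>x. 1 * mv (h *\<^sub>R axis i 1) (mv (h' *\<^sub>R axis j 1) (pd i (pd j f))) x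
         + (-1) * mv (h *\<^sub>R axis i 1) (mv (h' *\<^sub>R axis j 1) (pd j (pd i f))) x)"
      by (simp only: mv_lin test_pd f test_mv)
    thus ?thesis by (simp add: E[OF h] fun_eq_iff add_divide_distrib[symmetric])
  qed
  have "mv (h' *\<^sub>R axis j 1) q = (\<lambda>_. 0)" if "h' > 0" for h'
    by (rule mv_eq_0_imp[OF test_mv[OF q], of "axis i 1"]) (use z that in blast)
  hence "q = (\<lambda>_. 0)" by (rule mv_eq_0_imp[OF q])
  thus ?thesis by (auto simp: q_def fun_eq_iff)
qed

lemma mv_close:
  assumes "test f" obtains C where "C \<ge> 0" "\<And>v. norm v \<le> 1 \<Longrightarrow> n2 (\<lambda>x. mv v f x - f x) \<le> C * norm v"
proof -
  from avg_close[OF assms, where 'a=real] obtain C where "C \<ge> 0"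
    "\<And>(N :: real measure) k R. kern N k R \<Longrightarrow> R \<le> 1 \<Longrightarrow> n2 (\<lambda>x. avg N k f x - f x) \<le> C * R" by blast
  from this(1) this(2)[OF kern_mv] show ?thesis using that by (simp add: mv_def)
qed

lemma tr_close:
  assumes "test f" obtains C where "C \<ge> 0" "\<And>v. norm v \<le> 1 \<Longrightarrow> n2 (\<lambda>x. tr v f x - f x) \<le> C * norm v"
proof -
  from avg_close[OF assms, where 'a=real] obtain C where "C \<ge> 0"
    "\<And>(N :: real measure) k R. kern N k R \<Longrightarrow> R \<le> 1 \<Longrightarrow> n2 (\<lambda>x. avg N k f x - f x) \<le> C * R" by blast
  from this(1) this(2)[OF kern_tr] show ?thesis using that by (simp add: tr_avg)
qed

lemma ip_mv_lim:
  assumes f: "L2 f" and g: "test g"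
  shows "(\<lambda>n. ip f (mv (inverse (real (Suc n)) *\<^sub>R axis i 1) g)) \<longlonglongrightarrow> ip f g"
proof -
  obtain C where C: "C \<ge> 0" "\<And>v. norm v \<le> 1 \<Longrightarrow> n2 (\<lambda>x. mv v g x - g x) \<le> C * norm v"
    using mv_close[OF g] by blast
  let ?v = "\<lambda>n. inverse (real (Suc n)) *\<^sub>R axis i 1 :: pt"
  have "(\<lambda>n. ip f (mv (?v n) g) - ip f g) \<longlonglongrightarrow> 0"
  proof (rule tendsto_0_le[OF LIMSEQ_inverse_real_of_nat, where K="n2 f * C"], rule eventuallyI)
    fix n
    have "ip f (mv (?v n) g) - ip f g = ip f (\<lambda>x. mv (?v n) g x - g x)"
      using ip_lin_right[OF test_L2[OF test_mv[OF g]] test_L2[OF g] f, of 1 "?v n" "-1"] by simp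
    also have "\<bar>\<dots>\<bar> \<le> n2 f * n2 (\<lambda>x. mv (?v n) g x - g x)"
      by (rule ip_bound[OF f test_L2]) (intro test_diff test_mv g)
    also have "\<dots> \<le> n2 f * (C * norm (?v n))"
      by (intro mult_left_mono C(2)) (auto simp: inverse_le_1_iff)
    finally show "norm (ip f (mv (?v n) g) - ip f g) \<le> norm (inverse (real (Suc n))) * (n2 f * C)"
      by (simp add: mult_ac)
  qed
  thus ?thesis by (simp add: LIM_zero_iff)
qed

lemma test_weak_pd:
  assumes f: "test f" shows "weak_pd i f (pd i f)"
  unfolding weak_pd_ip
proof (intro allI impI)
  fix g assume g: "test g"
  have eq: "ip f (mv (h *\<^sub>R axis i 1) (pd i g)) = - ip g (mv ((-h) *\<^sub>R axis i 1) (pd i f))" if h: "h > 0" for h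
  proof -
    have mh: "- h \<noteq> 0" using h by simp
    show ?thesis
      unfolding mv_pd[OF g less_imp_neq[OF h, symmetric]] mv_pd[OF f mh]
      ip_lin_right[OF test_L2[OF test_tr[OF g]] test_L2[OF g] test_L2[OF f]]
      ip_lin_right[OF test_L2[OF test_tr[OF f]] test_L2[OF f] test_L2[OF g]]
      using h tr_adjoint[OF test_L2[OF f] test_L2[OF g], of "(-h) *\<^sub>R axis i 1"]
      by (simp add: ip_commute[of g] algebra_simps)
  qed
  have "(\<lambda>n. ip f (mv (inverse (real (Suc n)) *\<^sub>R axis i 1) (pd i g))) \<longlonglongrightarrow> ip f (pd i g)"
    by (intro ip_mv_lim test_L2 test_pd f g)
  moreover have "(\<lambda>n. - ip g (mv ((- inverse (real (Suc n))) *\<^sub>R axis i 1) (pd i f))) \<longlonglongrightarrow> - ip g (pd i f)"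
  proof (intro tendsto_minus)
    have "ip g (mv ((- inverse (real (Suc n))) *\<^sub>R axis i 1) (pd i f)) = ip (pd i f) (mv (inverse (real (Suc n)) *\<^sub>R axis i 1) g)" for n
      using mv_adjoint[OF test_L2[OF g] test_L2[OF test_pd[OF f, of i]], of "inverse (real (Suc n)) *\<^sub>R axis i 1"]
      by (simp add: ip_commute[of "pd i f"])
    thus "(\<lambda>n. ip g (mv ((- inverse (real (Suc n))) *\<^sub>R axis i 1) (pd i f))) \<longlonglongrightarrow> ip g (pd i f)"
      using ip_mv_lim[OF test_L2[OF test_pd[OF f]] g, of i i] by (simp add: ip_commute[of g])
  qed
  ultimately show "ip f (pd i g) = - ip (pd i f) g"
    using eq by (subst ip_commute[of _ g], intro LIMSEQ_unique) auto
qed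

section \<open>The square function\<close>

definition df :: "pt \<Rightarrow> fn \<Rightarrow> fn" where "df v f x = tr v f x - f x"

lemma test_df: "test f \<Longrightarrow> test (df v f)"
  unfolding df_def[abs_def] by (intro test_diff test_tr)

text \<open>The parallelogram identity for \<open>g = mv v f\<close> and its translate, whose mean is \<open>mv (2 v) f\<close>.\<close>

lemma square_step:
  assumes f: "test f"
  shows "l2sq (df v (mv v f)) = 4 * (l2sq (mv v f) - l2sq (mv (2 *\<^sub>R v) f))"
proof -
  define g where "g = mv v f"
  have g: "L2 g" "L2 (tr v g)" "test g" unfolding g_def by (auto intro!: test_L2 test_tr test_mv f)
  have t: "l2sq (tr v g) = l2sq g"
    using n2_tr[OF test_borel[OF g(3)]] by (metis n2_sq)
  have "l2sq (df v g) = l2sq g - 2 * ip (tr v g) g + l2sq g"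
    using l2sq_lin[OF g(2,1), of 1 "-1"] t by (simp add: df_def[abs_def])
  moreover have "l2sq (mv (2 *\<^sub>R v) f) = (l2sq g + 2 * ip (tr v g) g + l2sq g) / 4"
    using l2sq_lin[OF g(1,2), of "1/2" "1/2"] t mv_double[OF f, of v]
    by (simp add: g_def[symmetric] power2_eq_square ip_commute[of g])
  ultimately show ?thesis by (simp add: g_def[symmetric])
qed

lemma square_function:
  assumes f: "test f"
  shows "(\<Sum>k<n. l2sq (df ((h / 2 ^ k) *\<^sub>R v) (mv ((h / 2 ^ k) *\<^sub>R v) f))) \<le> 4 * l2sq f"
proof -
  define a where "a k = l2sq (mv ((2 * h / 2 ^ k) *\<^sub>R v) f)" for k :: nat
  have "(\<Sum>k<n. l2sq (df ((h / 2 ^ k) *\<^sub>R v) (mv ((h / 2 ^ k) *\<^sub>R v) f))) = (\<Sum>k<n. 4 * (a (Suc k) - a k))"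
    by (intro sum.cong refl) (simp add: square_step[OF f] a_def)
  also have "\<dots> = 4 * (a n - a 0)" by (simp only: sum_distrib_left[symmetric] sum_lessThan_telescope)
  also have "\<dots> \<le> 4 * l2sq f"
  proof -
    have "(n2 (mv ((2 * h / 2 ^ n) *\<^sub>R v) f))\<^sup>2 \<le> (n2 f)\<^sup>2"
      by (intro power_mono n2_mv test_L2 f) simp
    thus ?thesis using l2sq_nonneg[of "mv ((2 * h / 2 ^ 0) *\<^sub>R v) f"] by (simp add: a_def n2_sq)
  qed
  finally show ?thesis .
qed

section \<open>Scale families of averaging operators\<close>

text \<open>Families \<open>O h\<close> generated by translations along \<open>h e\<close>, linear combinations and segment averages
  over \<open>[0, h e]\<close>; the function argument counts the segment averages present in each direction.\<close>

inductive scf :: "pt set \<Rightarrow> (pt \<Rightarrow> nat) \<Rightarrow> (real \<Rightarrow> fn \<Rightarrow> fn) \<Rightarrow> bool" for D where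
  scf_id: "scf D (\<lambda>_. 0) (\<lambda>h f. f)"
| scf_tr: "scf D c A \<Longrightarrow> e \<in> D \<Longrightarrow> scf D c (\<lambda>h f. tr (h *\<^sub>R e) (A h f))"
| scf_mv: "scf D c A \<Longrightarrow> e \<in> D \<Longrightarrow> scf D (c(e := Suc (c e))) (\<lambda>h f. mv (h *\<^sub>R e) (A h f))"
| scf_lin: "scf D c A \<Longrightarrow> scf D c B \<Longrightarrow> scf D c (\<lambda>h f x. a * A h f x + b * B h f x)"

lemma scf_test: "scf D c A \<Longrightarrow> test f \<Longrightarrow> test (A h f)"
  by (induction rule: scf.induct) (auto intro: test_tr test_mv test_lin)

lemma scf_pd: "scf D c A \<Longrightarrow> test f \<Longrightarrow> pd i (A h f) = A h (pd i f)"
  by (induction rule: scf.induct) (auto simp: pd_tr pd_mv pd_lin scf_test test_smooth)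

lemma scf_arg_lin:
  "scf D c A \<Longrightarrow> test f \<Longrightarrow> test g \<Longrightarrow> A h (\<lambda>x. s * f x + t * g x) = (\<lambda>x. s * A h f x + t * A h g x)"
proof (induction rule: scf.induct)
  case (scf_lin c A B a b)
  thus ?case by (simp add: fun_eq_iff algebra_simps)
qed (auto simp: tr_lin mv_lin scf_test)

lemma scf_arg_sum:
  assumes A: "scf D c A" and t: "\<And>i. i \<in> I \<Longrightarrow> test (f i)"
  shows "A h (\<lambda>x. \<Sum>i\<in>I. s i * f i x) = (\<lambda>x. \<Sum>i\<in>I. s i * A h (f i) x)"
  using t
proof (induction I rule: infinite_finite_induct)
  case (insert k I)
  have "A h (\<lambda>x. s k * f k x + 1 * (\<Sum>i\<in>I. s i * f i x)) = (\<lambda>x. s k * A h (f k) x + 1 * A h (\<lambda>x. \<Sum>i\<in>I. s i * f i x) x)"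
    using insert by (intro scf_arg_lin[OF A] test_sum test_cmult) auto
  thus ?case using insert by simp
next
  case empty
  show ?case using scf_arg_lin[OF A test_zero test_zero, of h 0 0] by simp
next
  case (infinite I)
  show ?case using scf_arg_lin[OF A test_zero test_zero, of h 0 0] infinite by simp
qed

lemma scf_dd: "scf D c A \<Longrightarrow> test f \<Longrightarrow> dd v (A h f) = A h (dd v f)"
  unfolding dd_def[abs_def]
  by (simp add: scf_pd scf_arg_sum[of D c A UNIV "\<lambda>i. pd i f" h "\<lambda>i. v $ i"] test_pd)

lemma scf_tr_commute: "scf D c A \<Longrightarrow> test f \<Longrightarrow> tr v (A h f) = A h (tr v f)"
proof (induction rule: scf.induct)
  case (scf_tr c A e)
  have "tr v (tr w g) = tr w (tr v g)" for w g by (simp add: tr_tr add.commute)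
  thus ?case using scf_tr by metis
qed (auto simp: tr_lin tr_mv scf_test)

lemma scf_mv_commute: "scf D c A \<Longrightarrow> test f \<Longrightarrow> mv v (A h f) = A h (mv v f)"
proof (induction rule: scf.induct)
  case (scf_tr c A e)
  thus ?case using tr_mv[OF scf_test] by metis
next
  case (scf_mv c A e)
  thus ?case using mv_mv[OF scf_test] by metis
next
  case (scf_lin c A B a b)
  thus ?case by (simp add: mv_lin scf_test)
qed auto

lemma scf_df_commute: "scf D c A \<Longrightarrow> test f \<Longrightarrow> df v (A h f) = A h (df v f)"
  using scf_arg_lin[of D c A "tr v f" f h 1 "-1"] scf_tr_commute[of D c A f v h]
  by (simp add: df_def[abs_def] test_tr)

lemma scf_bound: "scf D c A \<Longrightarrow> \<exists>C\<ge>0. \<forall>h f. test f \<longrightarrow> n2 (A h f) \<le> C * n2 f"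
proof (induction rule: scf.induct)
  case scf_id
  show ?case by (rule exI[of _ 1]) simp
next
  case (scf_tr c A e)
  then obtain C where C: "C \<ge> 0" "\<And>h f. test f \<Longrightarrow> n2 (A h f) \<le> C * n2 f" by blast
  have "n2 (tr (h *\<^sub>R e) (A h f)) \<le> C * n2 f" if "test f" for h f
    using C(2)[OF that] n2_tr[OF test_borel[OF scf_test[OF scf_tr.hyps(1) that]]] by simp
  thus ?case using C(1) by blast
next
  case (scf_mv c A e)
  then obtain C where C: "C \<ge> 0" "\<And>h f. test f \<Longrightarrow> n2 (A h f) \<le> C * n2 f" by blast
  have "n2 (mv (h *\<^sub>R e) (A h f)) \<le> C * n2 f" if "test f" for h f
    using C(2)[OF that, of h] n2_mv[OF test_L2[OF scf_test[OF scf_mv.hyps(1) that]], of "h *\<^sub>R e" h]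
    by linarith
  thus ?case using C(1) by blast
next
  case (scf_lin c A B a b)
  then obtain C C' where C: "C \<ge> 0" "\<And>h f. test f \<Longrightarrow> n2 (A h f) \<le> C * n2 f"
    and C': "C' \<ge> 0" "\<And>h f. test f \<Longrightarrow> n2 (B h f) \<le> C' * n2 f" by metis
  have "n2 (\<lambda>x. a * A h f x + b * B h f x) \<le> (\<bar>a\<bar> * C + \<bar>b\<bar> * C') * n2 f" if f: "test f" for h f
  proof -
    have "n2 (\<lambda>x. a * A h f x + b * B h f x) \<le> n2 (\<lambda>x. a * A h f x) + n2 (\<lambda>x. b * B h f x)"
      by (rule n2_triangle) (auto intro!: test_L2 test_cmult scf_test[OF scf_lin.hyps(1) f] scf_test[OF scf_lin.hyps(2) f])
    also have "\<dots> \<le> \<bar>a\<bar> * (C * n2 f) + \<bar>b\<bar> * (C' * n2 f)"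
      unfolding n2_cmult using C(2)[OF f] C'(2)[OF f] by (intro add_mono mult_left_mono) auto
    finally show ?thesis by (simp add: algebra_simps)
  qed
  moreover have "\<bar>a\<bar> * C + \<bar>b\<bar> * C' \<ge> 0" using C C' by simp
  ultimately show ?case by blast
qed

definition reach :: "pt set \<Rightarrow> real \<Rightarrow> pt set" where
  "reach D r = {\<Sum>e\<in>D. w e *\<^sub>R e | w. \<forall>e. 0 \<le> w e \<and> w e \<le> r}"

lemma reach_zero: "r \<ge> 0 \<Longrightarrow> 0 \<in> reach D r"
  unfolding reach_def by (rule CollectI, rule exI[of _ "\<lambda>_. 0"]) auto

lemma reach_mono: "r \<le> r' \<Longrightarrow> reach D r \<subseteq> reach D r'"
  unfolding reach_def by (blast intro: order_trans)

lemma reach_add: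
  assumes D: "finite D" "e \<in> D" and s: "0 \<le> s" "s \<le> 1" and t: "t \<in> reach D r"
  shows "s *\<^sub>R e + t \<in> reach D (r + 1)"
proof -
  obtain w where w: "t = (\<Sum>e\<in>D. w e *\<^sub>R e)" "\<And>e. 0 \<le> w e \<and> w e \<le> r" using t by (auto simp: reach_def)
  define w' where "w' = w(e := s + w e)"
  have "(\<Sum>e\<in>D. w' e *\<^sub>R e) = (s + w e) *\<^sub>R e + (\<Sum>e\<in>D - {e}. w e *\<^sub>R e)"
    using D by (subst sum.remove[of D e]) (auto simp: w'_def intro!: sum.cong)
  also have "\<dots> = s *\<^sub>R e + t" using D w(1) by (simp add: sum.remove[of D e] algebra_simps)
  finally have "s *\<^sub>R e + t = (\<Sum>e\<in>D. w' e *\<^sub>R e)" by simp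
  moreover have "0 \<le> w' a \<and> w' a \<le> r + 1" for a
    using w(2)[of a] s by (auto simp: w'_def)
  ultimately show ?thesis unfolding reach_def by blast
qed

lemma scf_supp:
  assumes "scf D c A" and D: "finite D"
  shows "\<exists>r\<ge>0. \<forall>h f x. A h f x \<noteq> 0 \<longrightarrow> (\<exists>t\<in>reach D r. f (x + h *\<^sub>R t) \<noteq> 0)"
  using assms(1)
proof (induction rule: scf.induct)
  case scf_id
  show ?case by (rule exI[of _ 0]) (auto intro!: bexI[OF _ reach_zero])
next
  case (scf_tr c A e)
  then obtain r where r: "r \<ge> 0" "\<And>h f x. A h f x \<noteq> 0 \<Longrightarrow> \<exists>t\<in>reach D r. f (x + h *\<^sub>R t) \<noteq> 0" by blast
  have "\<exists>t\<in>reach D (r + 1). f (x + h *\<^sub>R t) \<noteq> 0" if "tr (h *\<^sub>R e) (A h f) x \<noteq> 0" for h f x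
  proof -
    have "A h f (x + h *\<^sub>R e) \<noteq> 0" using that by (simp add: tr_def)
    then obtain t where t: "t \<in> reach D r" "f (x + h *\<^sub>R e + h *\<^sub>R t) \<noteq> 0" using r(2) by blast
    show ?thesis using reach_add[OF D scf_tr.hyps(2) _ _ t(1), of 1] t(2)
      by (intro bexI[of _ "1 *\<^sub>R e + t"]) (auto simp: algebra_simps)
  qed
  thus ?case using r(1) by (intro exI[of _ "r + 1"]) auto
next
  case (scf_mv c A e)
  then obtain r where r: "r \<ge> 0" "\<And>h f x. A h f x \<noteq> 0 \<Longrightarrow> \<exists>t\<in>reach D r. f (x + h *\<^sub>R t) \<noteq> 0" by blast
  have "\<exists>t\<in>reach D (r + 1). f (x + h *\<^sub>R t) \<noteq> 0" if "mv (h *\<^sub>R e) (A h f) x \<noteq> 0" for h f x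
  proof -
    from avg_nonzero[OF that[unfolded mv_def]]
    obtain s where s: "s \<in> space unit_measure" "A h f (x + s *\<^sub>R h *\<^sub>R e) \<noteq> 0" by blast
    then obtain t where t: "t \<in> reach D r" "f (x + s *\<^sub>R h *\<^sub>R e + h *\<^sub>R t) \<noteq> 0" using r(2) by blast
    have "0 \<le> s" "s \<le> 1" using s(1) by (auto simp: space_restrict_space)
    thus ?thesis using reach_add[OF D scf_mv.hyps(2) _ _ t(1), of s] t(2)
      by (intro bexI[of _ "s *\<^sub>R e + t"]) (auto simp: algebra_simps)
  qed
  thus ?case using r(1) by (intro exI[of _ "r + 1"]) auto
next
  case (scf_lin c A B a b)
  then obtain r r' where r: "r \<ge> 0" "\<And>h f x. A h f x \<noteq> 0 \<Longrightarrow> \<exists>t\<in>reach D r. f (x + h *\<^sub>R t) \<noteq> 0"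
    and r': "r' \<ge> 0" "\<And>h f x. B h f x \<noteq> 0 \<Longrightarrow> \<exists>t\<in>reach D r'. f (x + h *\<^sub>R t) \<noteq> 0" by metis
  have "\<exists>t\<in>reach D (max r r'). f (x + h *\<^sub>R t) \<noteq> 0" if "a * A h f x + b * B h f x \<noteq> 0" for h f x
  proof -
    have "A h f x \<noteq> 0 \<or> B h f x \<noteq> 0" using that by auto
    thus ?thesis using r(2) r'(2) reach_mono[of r "max r r'" D] reach_mono[of r' "max r r'" D]
      by (meson max.cobounded1 max.cobounded2 subsetD)
  qed
  thus ?case using r(1) by (intro exI[of _ "max r r'"]) auto
qed

lemma scf_extract:
  assumes "scf D c A" "c e \<ge> 1"
  shows "\<exists>B. scf D (c(e := c e - 1)) B \<and> (\<forall>h f. test f \<longrightarrow> A h f = mv (h *\<^sub>R e) (B h f))"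
  using assms
proof (induction rule: scf.induct)
  case (scf_tr c A e')
  then obtain B where B: "scf D (c(e := c e - 1)) B" "\<And>h f. test f \<Longrightarrow> A h f = mv (h *\<^sub>R e) (B h f)" by blast
  have "tr (h *\<^sub>R e') (A h f) = mv (h *\<^sub>R e) (tr (h *\<^sub>R e') (B h f))" if "test f" for h f
    using B(2)[OF that] tr_mv[OF scf_test[OF B(1) that]] by simp
  thus ?case using scf.scf_tr[OF B(1) scf_tr.hyps(2)] by blast
next
  case (scf_mv c A e')
  show ?case
  proof (cases "e' = e")
    case True
    hence "(c(e' := Suc (c e')))(e := (c(e' := Suc (c e'))) e - 1) = c" by (auto simp: fun_eq_iff)
    thus ?thesis using scf_mv.hyps(1) True by metis
  next
    case False
    hence "c e \<ge> 1" using scf_mv.prems by simp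
    then obtain B where B: "scf D (c(e := c e - 1)) B" "\<And>h f. test f \<Longrightarrow> A h f = mv (h *\<^sub>R e) (B h f)"
      using scf_mv.IH by blast
    have "mv (h *\<^sub>R e') (A h f) = mv (h *\<^sub>R e) (mv (h *\<^sub>R e') (B h f))" if "test f" for h f
      using B(2)[OF that] mv_mv[OF scf_test[OF B(1) that]] by simp
    moreover have *: "(c(e := c e - 1))(e' := Suc ((c(e := c e - 1)) e')) = (c(e' := Suc (c e')))(e := (c(e' := Suc (c e'))) e - 1)"
      using False by (auto simp: fun_eq_iff)
    ultimately show ?thesis using scf.scf_mv[OF B(1) scf_mv.hyps(2)] unfolding *
      by (intro exI[of _ "\<lambda>h f. mv (h *\<^sub>R e') (B h f)"]) blast
  qed
next
  case (scf_lin c A B a b)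
  then obtain A' B' where B: "scf D (c(e := c e - 1)) A'" "\<And>h f. test f \<Longrightarrow> A h f = mv (h *\<^sub>R e) (A' h f)"
     "scf D (c(e := c e - 1)) B'" "\<And>h f. test f \<Longrightarrow> B h f = mv (h *\<^sub>R e) (B' h f)" by metis
  have "(\<lambda>x. a * A h f x + b * B h f x) = mv (h *\<^sub>R e) (\<lambda>x. a * A' h f x + b * B' h f x)" if "test f" for h f
    using B(2,4)[OF that] mv_lin[OF scf_test[OF B(1) that] scf_test[OF B(3) that]] by simp
  thus ?case using scf.scf_lin[OF B(1,3)] by blast
qed auto

lemma dd_mv_df: "test f \<Longrightarrow> h * dd e (mv (h *\<^sub>R e) f) x = df (h *\<^sub>R e) f x"
  using fun_cong[OF mv_dd[of f "h *\<^sub>R e"], of x] dd_mv[of f "h *\<^sub>R e" "h *\<^sub>R e"]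
  by (metis dd_scale df_def)

lemma scf_first_order:
  assumes A: "scf D c A" and c: "c e \<ge> 1"
  shows "\<exists>C\<ge>0. \<forall>h f. test f \<longrightarrow> \<bar>h\<bar> * n2 (dd e (A h f)) \<le> C * n2 f"
proof -
  obtain B where B: "scf D (c(e := c e - 1)) B" "\<And>h f. test f \<Longrightarrow> A h f = mv (h *\<^sub>R e) (B h f)"
    using scf_extract[OF A c] by blast
  obtain C where C: "C \<ge> 0" "\<And>h f. test f \<Longrightarrow> n2 (B h f) \<le> C * n2 f" using scf_bound[OF B(1)] by blast
  have "\<bar>h\<bar> * n2 (dd e (A h f)) \<le> (2 * C) * n2 f" if f: "test f" for h f
  proof -
    have t: "test (B h f)" by (rule scf_test[OF B(1) f])
    have "\<bar>h\<bar> * n2 (dd e (A h f)) = n2 (df (h *\<^sub>R e) (B h f))"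
      unfolding n2_cmult[symmetric] B(2)[OF f] dd_mv_df[OF t] by simp
    also have "\<dots> \<le> n2 (tr (h *\<^sub>R e) (B h f)) + n2 (B h f)"
      unfolding df_def[abs_def] by (intro n2_sub_le test_L2 test_tr t)
    also have "\<dots> = 2 * n2 (B h f)" using n2_tr[OF test_borel[OF t]] by simp
    finally show ?thesis using C(2)[OF f, of h] by simp
  qed
  thus ?thesis using C(1) by (intro exI[of _ "2 * C"]) auto
qed

lemma n2_le_cancel: "(n2 g)\<^sup>2 \<le> K * n2 g \<Longrightarrow> 0 \<le> K \<Longrightarrow> n2 g \<le> K"
  using n2_nonneg[of g] by (cases "n2 g = 0") (auto simp: power2_eq_square mult_le_cancel_right)

text \<open>The order \<open>-2\<close> property: two derivatives consume two averages, and one further average in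
  each direction is left over, so that both factors of the duality pairing carry a square function.\<close>

lemma scf_second_order:
  assumes A: "scf D c A" and c: "c a \<ge> 4" "c b \<ge> 4"
  shows "\<exists>C\<ge>0. \<forall>n h f. test f \<longrightarrow>
     n2 (\<lambda>x. \<Sum>k<n. (h / 2 ^ k)\<^sup>2 * dd a (dd b (A (h / 2 ^ k) f)) x) \<le> C * n2 f"
proof -
  obtain A1 where A1: "scf D (c(a := c a - 1)) A1" "\<And>h f. test f \<Longrightarrow> A h f = mv (h *\<^sub>R a) (A1 h f)"
    using scf_extract[OF A, of a] c by auto
  define c1 where "c1 = c(a := c a - 1)"
  have c1: "c1 a \<ge> 3" "c1 b \<ge> 3" using c by (auto simp: c1_def)
  obtain A2 where A2: "scf D (c1(b := c1 b - 1)) A2" "\<And>h f. test f \<Longrightarrow> A1 h f = mv (h *\<^sub>R b) (A2 h f)"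
    using scf_extract[OF A1(1)[folded c1_def], of b] c1 by auto
  define c2 where "c2 = c1(b := c1 b - 1)"
  have c2: "c2 a \<ge> 2" "c2 b \<ge> 2" using c1 by (auto simp: c2_def)
  obtain A3 where A3: "scf D (c2(a := c2 a - 1)) A3" "\<And>h f. test f \<Longrightarrow> A2 h f = mv (h *\<^sub>R a) (A3 h f)"
    using scf_extract[OF A2(1)[folded c2_def], of a] c2 by auto
  define c3 where "c3 = c2(a := c2 a - 1)"
  have c3: "c3 b \<ge> 1" using c2 by (auto simp: c3_def)
  obtain B where B: "scf D (c3(b := c3 b - 1)) B" "\<And>h f. test f \<Longrightarrow> A3 h f = mv (h *\<^sub>R b) (B h f)"
    using scf_extract[OF A3(1)[folded c3_def], of b] c3 by auto
  obtain C where C: "C \<ge> 0" "\<And>h f. test f \<Longrightarrow> n2 (B h f) \<le> C * n2 f" using scf_bound[OF B(1)] by blast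
  let ?W = "\<lambda>h f. df (h *\<^sub>R b) (mv (h *\<^sub>R b) f)"
  have eq: "(\<lambda>x. h\<^sup>2 * dd a (dd b (A h f)) x) = df (h *\<^sub>R a) (mv (h *\<^sub>R a) (B h (?W h f)))"
    if f: "test f" for h f
  proof -
    define g where "g = mv (h *\<^sub>R a) (mv (h *\<^sub>R b) (B h f))"
    have g: "test g" unfolding g_def by (intro test_mv scf_test[OF B(1)] f)
    have Af: "A h f = mv (h *\<^sub>R a) (mv (h *\<^sub>R b) g)"
      using A1(2)[OF f] A2(2)[OF f] A3(2)[OF f] B(2)[OF f] by (simp add: g_def)
    have 1: "dd b (A h f) = mv (h *\<^sub>R a) (dd b (mv (h *\<^sub>R b) g))"
      unfolding Af by (rule dd_mv[OF test_mv[OF g]])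
    have "h\<^sup>2 * dd a (dd b (A h f)) x = h * df (h *\<^sub>R a) (dd b (mv (h *\<^sub>R b) g)) x" for x
      using dd_mv_df[OF test_dd[OF test_mv[OF g]], of h a b "h *\<^sub>R b" x] by (simp add: 1 power2_eq_square)
    moreover have "h * df (h *\<^sub>R a) (dd b (mv (h *\<^sub>R b) g)) x = df (h *\<^sub>R a) (df (h *\<^sub>R b) g) x" for x
      unfolding df_def[of "h *\<^sub>R a"] tr_def right_diff_distrib dd_mv_df[OF g] ..
    moreover have "df (h *\<^sub>R b) g = mv (h *\<^sub>R a) (B h (?W h f))"
    proof -
      have "df (h *\<^sub>R b) g = mv (h *\<^sub>R a) (df (h *\<^sub>R b) (mv (h *\<^sub>R b) (B h f)))"
        unfolding g_def df_def[abs_def]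
        using mv_lin[OF test_tr[OF test_mv[OF scf_test[OF B(1) f]]] test_mv[OF scf_test[OF B(1) f]],
            of "h *\<^sub>R a" 1 "h *\<^sub>R b" "h *\<^sub>R b" h "-1" "h *\<^sub>R b" h]
        by (simp add: tr_mv test_mv scf_test[OF B(1) f])
      also have "\<dots> = mv (h *\<^sub>R a) (B h (?W h f))"
        by (simp add: scf_mv_commute[OF B(1) f] scf_df_commute[OF B(1) test_mv[OF f]])
      finally show ?thesis .
    qed
    ultimately show ?thesis by (simp add: fun_eq_iff)
  qed
  have "n2 (\<lambda>x. \<Sum>k<n. (h / 2 ^ k)\<^sup>2 * dd a (dd b (A (h / 2 ^ k) f)) x) \<le> (4 * C) * n2 f"
    if f: "test f" for n h f
  proof -
    define hk where "hk k = h / 2 ^ k" for k :: nat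
    define T where "T k = (\<lambda>x. (hk k)\<^sup>2 * dd a (dd b (A (hk k) f)) x)" for k
    have Tt: "test (T k)" for k unfolding T_def by (intro test_cmult test_dd scf_test[OF A] f)
    define g where "g = (\<lambda>x. \<Sum>k<n. T k x)"
    have g: "test g" unfolding g_def by (intro test_sum Tt)
    let ?V = "\<lambda>k. df (hk k *\<^sub>R (- a)) (mv (hk k *\<^sub>R (- a)) g)"
    have tW: "test (?W (hk k) f)" for k by (intro test_df test_mv f)
    have one: "\<bar>ip g (T k)\<bar> \<le> C * (n2 (?V k) * n2 (?W (hk k) f))" for k
    proof -
      define u where "u = B (hk k) (?W (hk k) f)"
      have u: "test u" unfolding u_def by (rule scf_test[OF B(1) tW])
      have mu: "test (mv (hk k *\<^sub>R a) u)" by (rule test_mv[OF u])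
      have "ip g (T k) = ip g (df (hk k *\<^sub>R a) (mv (hk k *\<^sub>R a) u))"
        unfolding T_def eq[OF f] u_def ..
      also have "\<dots> = ip g (tr (hk k *\<^sub>R a) (mv (hk k *\<^sub>R a) u)) - ip g (mv (hk k *\<^sub>R a) u)"
        using ip_lin_right[OF test_L2[OF test_tr[OF mu]] test_L2[OF mu] test_L2[OF g], of 1 "hk k *\<^sub>R a" "-1"]
        by (simp add: df_def[abs_def])
      also have "\<dots> = ip (tr (- (hk k *\<^sub>R a)) g) (mv (hk k *\<^sub>R a) u) - ip g (mv (hk k *\<^sub>R a) u)"
        using tr_adjoint[OF test_L2[OF mu] test_L2[OF g], of "hk k *\<^sub>R a"] by (simp add: ip_commute[of g] ip_commute[of "tr _ g"])
      also have "\<dots> = ip (df (- (hk k *\<^sub>R a)) g) (mv (hk k *\<^sub>R a) u)"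
        using ip_lin_left[OF test_L2[OF test_tr[OF g]] test_L2[OF g] test_L2[OF mu], of 1 "- (hk k *\<^sub>R a)" "-1"]
        by (simp add: df_def[abs_def])
      also have "\<dots> = ip (mv (- (hk k *\<^sub>R a)) (df (- (hk k *\<^sub>R a)) g)) u"
        using mv_adjoint[OF test_L2[OF u] test_L2[OF test_df[OF g]], of "hk k *\<^sub>R a"] by (metis ip_commute)
      also have "mv (- (hk k *\<^sub>R a)) (df (- (hk k *\<^sub>R a)) g) = ?V k"
        using mv_lin[OF test_tr[OF g] g, of "- (hk k *\<^sub>R a)" 1 "- (hk k *\<^sub>R a)" "-1"]
        by (simp add: df_def[abs_def] tr_mv g)
      finally have "\<bar>ip g (T k)\<bar> \<le> n2 (?V k) * n2 u"
        using ip_bound[OF test_L2[OF test_df[OF test_mv[OF g]]] test_L2[OF u]] by simp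
      also have "\<dots> \<le> n2 (?V k) * (C * n2 (?W (hk k) f))"
        unfolding u_def by (intro mult_left_mono C(2) tW) simp
      finally show ?thesis by (simp add: mult_ac)
    qed
    have sq: "(\<Sum>k<n. (n2 (?V k))\<^sup>2) \<le> 4 * (n2 g)\<^sup>2" "(\<Sum>k<n. (n2 (?W (hk k) f))\<^sup>2) \<le> 4 * (n2 f)\<^sup>2"
      using square_function[OF g, of h "- a" n] square_function[OF f, of h b n] by (simp_all add: n2_sq hk_def)
    have "(\<Sum>k<n. n2 (?V k) * n2 (?W (hk k) f))\<^sup>2 \<le> (\<Sum>k<n. (n2 (?V k))\<^sup>2) * (\<Sum>k<n. (n2 (?W (hk k) f))\<^sup>2)"
      by (rule Cauchy_Schwarz_ineq_sum)
    also have "\<dots> \<le> (4 * (n2 g)\<^sup>2) * (4 * (n2 f)\<^sup>2)"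
      by (intro mult_mono sq) (auto intro: sum_nonneg)
    also have "\<dots> = (4 * (n2 g * n2 f))\<^sup>2" by (simp add: power2_eq_square)
    finally have cs: "(\<Sum>k<n. n2 (?V k) * n2 (?W (hk k) f)) \<le> 4 * (n2 g * n2 f)"
      by (rule power2_le_imp_le) simp
    have "(n2 g)\<^sup>2 = ip g g" by (simp add: n2_sq l2sq_ip)
    also have "\<dots> = (\<Sum>k<n. ip g (T k))"
      by (subst (2) g_def) (rule ip_sum_right[OF test_L2[OF Tt] test_L2[OF g]])
    also have "\<dots> \<le> (\<Sum>k<n. C * (n2 (?V k) * n2 (?W (hk k) f)))"
      using one by (intro sum_mono) (auto intro: order_trans[OF abs_ge_self])
    also have "\<dots> = C * (\<Sum>k<n. n2 (?V k) * n2 (?W (hk k) f))" by (simp add: sum_distrib_left)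
    also have "\<dots> \<le> C * (4 * (n2 g * n2 f))" by (intro mult_left_mono cs C)
    finally have "(n2 g)\<^sup>2 \<le> (4 * C * n2 f) * n2 g" by (simp add: mult_ac)
    hence "n2 g \<le> 4 * C * n2 f" by (rule n2_le_cancel) (use C in simp)
    thus ?thesis by (simp add: g_def T_def hk_def)
  qed
  thus ?thesis using C(1) by (intro exI[of _ "4 * C"]) auto
qed

section \<open>A parametrix for pure second directional derivatives\<close>

text \<open>\<open>Lop e h = 2 mv (h e) - mv (2 h e)\<close>, expressed at scale \<open>h\<close>; \<open>Lop2 e h\<close> is \<open>Lop e (2 h)\<close> expressed at
  scale \<open>h\<close>. In terms of \<open>M = mv (h e)\<close> and \<open>T = tr (h e)\<close> one has
  \<open>Lop - Lop2 = M (1 - T)\<^sup>2 (3 + T) / 4\<close>, a second difference.\<close>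

definition Lop :: "pt \<Rightarrow> real \<Rightarrow> fn \<Rightarrow> fn" where
  "Lop e h f = (\<lambda>x. 3/2 * mv (h *\<^sub>R e) f x + (-1/2) * tr (h *\<^sub>R e) (mv (h *\<^sub>R e) f) x)"

definition Lop2 :: "pt \<Rightarrow> real \<Rightarrow> fn \<Rightarrow> fn" where
  "Lop2 e h f = (\<lambda>x. 1 * (3/4 * mv (h *\<^sub>R e) f x + 3/4 * tr (h *\<^sub>R e) (mv (h *\<^sub>R e) f) x)
     + 1 * (-1/4 * tr (h *\<^sub>R e) (tr (h *\<^sub>R e) (mv (h *\<^sub>R e) f)) x
        + (-1/4) * tr (h *\<^sub>R e) (tr (h *\<^sub>R e) (tr (h *\<^sub>R e) (mv (h *\<^sub>R e) f))) x))"

definition Rop :: "pt \<Rightarrow> real \<Rightarrow> fn \<Rightarrow> fn" where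
  "Rop e h f = (\<lambda>x. 3/4 * mv (h *\<^sub>R e) (mv (h *\<^sub>R e) (mv (h *\<^sub>R e) f)) x
     + 1/4 * tr (h *\<^sub>R e) (mv (h *\<^sub>R e) (mv (h *\<^sub>R e) (mv (h *\<^sub>R e) f))) x)"

lemma scf_Lop: "scf D c A \<Longrightarrow> e \<in> D \<Longrightarrow> scf D (c(e := Suc (c e))) (\<lambda>h f. Lop e h (A h f))"
  unfolding Lop_def by (intro scf_lin scf_tr scf_mv)

lemma scf_Lop2: "scf D c A \<Longrightarrow> e \<in> D \<Longrightarrow> scf D (c(e := Suc (c e))) (\<lambda>h f. Lop2 e h (A h f))"
  unfolding Lop2_def by (intro scf_lin scf_tr scf_mv)

lemma scf_Rop:
  assumes "scf D c A" "e \<in> D" shows "scf D (c(e := c e + 3)) (\<lambda>h f. Rop e h (A h f))"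
proof -
  have "scf D (((c(e := Suc (c e)))(e := Suc ((c(e := Suc (c e))) e)))(e := Suc (((c(e := Suc (c e)))(e := Suc ((c(e := Suc (c e))) e))) e)))
    (\<lambda>h f. Rop e h (A h f))"
    unfolding Rop_def using assms by (intro scf_lin scf_tr scf_mv)
  thus ?thesis by (simp add: numeral_3_eq_3)
qed

lemma Lop_double:
  assumes f: "test f" shows "Lop e (2 * h) f = Lop2 e h f"
proof -
  have m: "mv ((2 * h) *\<^sub>R e) f = (\<lambda>x. 1/2 * mv (h *\<^sub>R e) f x + 1/2 * tr (h *\<^sub>R e) (mv (h *\<^sub>R e) f) x)"
    using mv_double[OF f, of "h *\<^sub>R e"] by simp
  have e2: "(2 * h) *\<^sub>R e = h *\<^sub>R e + h *\<^sub>R e" by (simp add: scaleR_add_left[symmetric])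
  have "3/2 * (1/2 * p + 1/2 * q) + (-1/2) * (1/2 * r + 1/2 * s)
    = 1 * (3/4 * p + 3/4 * q) + 1 * (-1/4 * r + (-1/4) * s)" for p q r s :: real by (simp add: field_simps)
  thus ?thesis
    unfolding Lop_def Lop2_def m unfolding tr_def e2 add.assoc[symmetric] by (intro ext)
qed

lemma Lop_diff:
  assumes f: "test f" shows "Lop e h f x - Lop2 e h f x = h\<^sup>2 * dd e (dd e (Rop e h f)) x"
proof -
  define g where "g = mv (h *\<^sub>R e) f"
  have g: "test g" unfolding g_def by (rule test_mv[OF f])
  let ?M = "mv (h *\<^sub>R e)"
  have t2: "test (?M (?M g))" by (intro test_mv g)
  have dd2: "h\<^sup>2 * dd e (dd e (?M (?M g))) y = df (h *\<^sub>R e) (df (h *\<^sub>R e) g) y" for y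
  proof -
    have "dd e (dd e (?M (?M g))) = dd e (?M (dd e (?M g)))"
      by (simp add: dd_mv test_mv g)
    hence "h\<^sup>2 * dd e (dd e (?M (?M g))) y = h * df (h *\<^sub>R e) (dd e (?M g)) y"
      using dd_mv_df[OF test_dd[OF test_mv[OF g]], of h e e "h *\<^sub>R e" y] by (simp add: power2_eq_square)
    thus ?thesis unfolding df_def[of "h *\<^sub>R e"] tr_def right_diff_distrib dd_mv_df[OF g] df_def tr_def .
  qed
  have R: "Rop e h f = (\<lambda>x. 3/4 * ?M (?M g) x + 1/4 * tr (h *\<^sub>R e) (?M (?M g)) x)"
    by (simp add: Rop_def g_def)
  have lin: "dd e (\<lambda>x. a * u x + b * v x) = (\<lambda>x. a * dd e u x + b * dd e v x)" if "test u" "test v" for a b u v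
    using that by (simp add: dd_def[abs_def] pd_lin test_smooth sum.distrib sum_distrib_left algebra_simps)
  have "h\<^sup>2 * dd e (dd e (Rop e h f)) x = 3/4 * (h\<^sup>2 * dd e (dd e (?M (?M g))) x)
      + 1/4 * (h\<^sup>2 * dd e (dd e (?M (?M g))) (x + h *\<^sub>R e))"
    unfolding R lin[OF t2 test_tr[OF t2]] lin[OF test_dd[OF t2] test_tr[OF test_dd[OF t2]]]
      dd_tr[OF t2] dd_tr[OF test_dd[OF t2]] unfolding tr_def by (simp add: algebra_simps)
  thus ?thesis unfolding dd2 by (simp add: Lop_def Lop2_def g_def[symmetric] df_def tr_def algebra_simps)
qed

primrec PL :: "pt list \<Rightarrow> real \<Rightarrow> fn \<Rightarrow> fn" where
  "PL [] h f = f"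
| "PL (e # ds) h f = Lop e h (PL ds h f)"

lemma scf_PL: "set ds \<subseteq> D \<Longrightarrow> scf D (count_list ds) (PL ds)"
proof (induction ds)
  case Nil
  have *: "PL [] = (\<lambda>h f. f)" "count_list [] = (\<lambda>_. 0::nat)" by (auto simp: fun_eq_iff)
  show ?case unfolding * by (rule scf_id)
next
  case (Cons e ds)
  have *: "PL (e # ds) = (\<lambda>h f. Lop e h (PL ds h f))"
    "count_list (e # ds) = (count_list ds)(e := Suc (count_list ds e))" by (auto simp: fun_eq_iff)
  show ?case unfolding * by (rule scf_Lop) (use Cons in auto)
qed

lemma Lop_linear:
  assumes "test f" "test g" shows "Lop e h (\<lambda>x. a * f x + b * g x) = (\<lambda>x. a * Lop e h f x + b * Lop e h g x)"
  using scf_arg_lin[OF scf_Lop[OF scf_id, of e "{e}"] assms] by simp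

lemma test_Lop: "test f \<Longrightarrow> test (Lop e h f)"
  using scf_test[OF scf_Lop[OF scf_id, of e "{e}"]] by simp

lemma telescoping:
  "set ds \<subseteq> D \<Longrightarrow> \<exists>F. (\<forall>i<length ds. \<exists>c. scf D c (F i) \<and> (\<forall>e. count_list ds e \<le> Suc (c e))) \<and>
    (\<forall>h f x. test f \<longrightarrow> PL ds h f x - PL ds (2 * h) f x =
       (\<Sum>i<length ds. h\<^sup>2 * dd (ds ! i) (dd (ds ! i) (F i h f)) x))"
proof (induction ds)
  case Nil
  show ?case by simp
next
  case (Cons e ds)
  have e: "e \<in> D" and ds: "set ds \<subseteq> D" using Cons.prems by auto
  obtain F where F: "\<And>i. i < length ds \<Longrightarrow> \<exists>c. scf D c (F i) \<and> (\<forall>e. count_list ds e \<le> Suc (c e))"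
    "\<And>h f x. test f \<Longrightarrow> PL ds h f x - PL ds (2 * h) f x =
       (\<Sum>i<length ds. h\<^sup>2 * dd (ds ! i) (dd (ds ! i) (F i h f)) x)" using Cons.IH[OF ds] by blast
  define F' where "F' i = (case i of 0 \<Rightarrow> (\<lambda>h f. Rop e h (PL ds h f)) | Suc i \<Rightarrow> (\<lambda>h f. Lop2 e h (F i h f)))" for i
  have "\<exists>c. scf D c (F' i) \<and> (\<forall>a. count_list (e # ds) a \<le> Suc (c a))" if "i < length (e # ds)" for i
  proof (cases i)
    case 0
    show ?thesis using scf_Rop[OF scf_PL[OF ds] e] unfolding 0 F'_def
      by (intro exI[of _ "(count_list ds)(e := count_list ds e + 3)"]) auto
  next
    case (Suc j)
    then obtain c where c: "scf D c (F j)" "\<And>e. count_list ds e \<le> Suc (c e)" using F(1)[of j] \<open>i < length (e # ds)\<close> by auto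
    show ?thesis using scf_Lop2[OF c(1) e] c(2) unfolding Suc F'_def
      by (intro exI[of _ "c(e := Suc (c e))"]) auto
  qed
  moreover have "PL (e # ds) h f x - PL (e # ds) (2 * h) f x =
       (\<Sum>i<length (e # ds). h\<^sup>2 * dd ((e # ds) ! i) (dd ((e # ds) ! i) (F' i h f)) x)" if f: "test f" for h f x
  proof -
    define u where "u = PL ds h f"
    define v where "v = PL ds (2 * h) f"
    have u: "test u" and v: "test v" unfolding u_def v_def using scf_test[OF scf_PL[OF ds] f] by auto
    have Ft: "test (F i h f)" if "i < length ds" for i using F(1)[OF that] scf_test f by blast
    have L2: "scf D (\<lambda>a. if a = e then Suc 0 else 0) (\<lambda>h f. Lop2 e h f)"
      using scf_Lop2[OF scf_id e] by (simp add: fun_upd_def)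
    have "PL (e # ds) h f x - PL (e # ds) (2 * h) f x = (Lop e h u x - Lop2 e h u x) + (Lop2 e h u x - Lop2 e h v x)"
      using Lop_double[OF v] by (simp add: u_def v_def)
    also have "Lop2 e h u x - Lop2 e h v x = Lop2 e h (\<lambda>x. 1 * u x + (-1) * v x) x"
      using scf_arg_lin[OF L2 u v, of h 1 "-1"] by simp
    also have "(\<lambda>x. 1 * u x + (-1) * v x) = (\<lambda>x. \<Sum>i<length ds. h\<^sup>2 * dd (ds ! i) (dd (ds ! i) (F i h f)) x)"
      using F(2)[OF f] by (simp add: u_def v_def fun_eq_iff)
    also have "Lop2 e h \<dots> x = (\<Sum>i<length ds. h\<^sup>2 * Lop2 e h (dd (ds ! i) (dd (ds ! i) (F i h f))) x)"
      by (subst scf_arg_sum[OF L2, where s="\<lambda>_. h\<^sup>2"]) (auto intro!: test_dd Ft)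
    also have "\<dots> = (\<Sum>i<length ds. h\<^sup>2 * dd (ds ! i) (dd (ds ! i) (Lop2 e h (F i h f))) x)"
      using scf_dd[OF L2] by (intro sum.cong refl) (simp add: Ft test_dd)
    also have "(Lop e h u x - Lop2 e h u x) = h\<^sup>2 * dd e (dd e (Rop e h u)) x" by (rule Lop_diff[OF u])
    also have "\<dots> + (\<Sum>i<length ds. h\<^sup>2 * dd (ds ! i) (dd (ds ! i) (Lop2 e h (F i h f))) x)
      = (\<Sum>i<length (e # ds). h\<^sup>2 * dd ((e # ds) ! i) (dd ((e # ds) ! i) (F' i h f)) x)"
      by (simp add: sum.lessThan_Suc_shift F'_def u_def del: sum.lessThan_Suc)
    finally show ?thesis .
  qed
  ultimately show ?case by blast
qed

lemma small_scale: "(\<lambda>k. norm ((h / 2 ^ k) *\<^sub>R (e::pt))) \<longlonglongrightarrow> 0"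
proof -
  have "(\<lambda>k. \<bar>h\<bar> * norm e * (1/2) ^ k) \<longlonglongrightarrow> \<bar>h\<bar> * norm e * 0"
    by (intro tendsto_intros LIMSEQ_power_zero) simp
  thus ?thesis by (simp add: power_divide field_simps)
qed

lemma mv_lim: 
  assumes f: "test f" shows "(\<lambda>k. n2 (\<lambda>x. mv ((h / 2 ^ k) *\<^sub>R e) f x - f x)) \<longlonglongrightarrow> 0"
proof -
  obtain C where C: "C \<ge> 0" "\<And>v. norm v \<le> 1 \<Longrightarrow> n2 (\<lambda>x. mv v f x - f x) \<le> C * norm v"
    using mv_close[OF f] by blast
  have "\<forall>\<^sub>F k in sequentially. norm ((h / 2 ^ k) *\<^sub>R e) < 1"
    by (rule order_tendstoD[OF small_scale]) simp
  hence "\<forall>\<^sub>F k in sequentially. norm (n2 (\<lambda>x. mv ((h / 2 ^ k) *\<^sub>R e) f x - f x)) \<le> norm (norm ((h / 2 ^ k) *\<^sub>R e)) * C"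
  proof eventually_elim
    case (elim k)
    thus ?case using C(2)[of "(h / 2 ^ k) *\<^sub>R e"] by (simp add: mult.commute)
  qed
  thus ?thesis by (rule tendsto_0_le[OF small_scale])
qed

lemma tr_lim: 
  assumes f: "test f" shows "(\<lambda>k. n2 (\<lambda>x. tr ((h / 2 ^ k) *\<^sub>R e) f x - f x)) \<longlonglongrightarrow> 0"
proof -
  obtain C where C: "C \<ge> 0" "\<And>v. norm v \<le> 1 \<Longrightarrow> n2 (\<lambda>x. tr v f x - f x) \<le> C * norm v"
    using tr_close[OF f] by blast
  have "\<forall>\<^sub>F k in sequentially. norm ((h / 2 ^ k) *\<^sub>R e) < 1"
    by (rule order_tendstoD[OF small_scale]) simp
  hence "\<forall>\<^sub>F k in sequentially. norm (n2 (\<lambda>x. tr ((h / 2 ^ k) *\<^sub>R e) f x - f x)) \<le> norm (norm ((h / 2 ^ k) *\<^sub>R e)) * C"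
  proof eventually_elim
    case (elim k)
    thus ?case using C(2)[of "(h / 2 ^ k) *\<^sub>R e"] by (simp add: mult.commute)
  qed
  thus ?thesis by (rule tendsto_0_le[OF small_scale])
qed

lemma n2_Lop: assumes f: "test f" shows "n2 (Lop e h f) \<le> 2 * n2 f"
proof -
  let ?M = "mv (h *\<^sub>R e) f"
  have t: "test ?M" by (rule test_mv[OF f])
  have "n2 (Lop e h f) \<le> n2 (\<lambda>x. 3/2 * ?M x) + n2 (\<lambda>x. (-1/2) * tr (h *\<^sub>R e) ?M x)"
    unfolding Lop_def by (intro n2_triangle test_L2 test_cmult test_tr t)
  also have "\<dots> = 2 * n2 ?M" unfolding n2_cmult n2_tr[OF test_borel[OF t]] by simp
  also have "\<dots> \<le> 2 * n2 f" using n2_mv[OF test_L2[OF f]] by simp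
  finally show ?thesis .
qed

lemma PL_lim:
  assumes f: "test f" shows "(\<lambda>k. n2 (\<lambda>x. PL ds (h / 2 ^ k) f x - f x)) \<longlonglongrightarrow> 0"
proof (induction ds)
  case (Cons e ds)
  let ?h = "\<lambda>k. h / 2 ^ k"
  let ?b = "\<lambda>k. 2 * n2 (\<lambda>x. PL ds (?h k) f x - f x) + (2 * n2 (\<lambda>x. mv (?h k *\<^sub>R e) f x - f x)
     + n2 (\<lambda>x. tr (?h k *\<^sub>R e) f x - f x))"
  have "?b \<longlonglongrightarrow> 2 * 0 + (2 * 0 + 0)"
    by (intro tendsto_intros Cons.IH mv_lim[OF f] tr_lim[OF f])
  hence b0: "?b \<longlonglongrightarrow> 0" by simp
  have "n2 (\<lambda>x. PL (e # ds) (?h k) f x - f x) \<le> ?b k" for k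
  proof -
    define u where "u = PL ds (?h k) f"
    have u: "test u" unfolding u_def by (rule scf_test[OF scf_PL[OF order_refl] f])
    let ?M = "mv (?h k *\<^sub>R e) f" and ?T = "tr (?h k *\<^sub>R e)"
    have M: "test ?M" by (rule test_mv[OF f])
    have uf: "test (\<lambda>x. u x - f x)" by (intro test_diff u f)
    have Mf: "test (\<lambda>x. ?M x - f x)" by (intro test_diff M f)
    have 1: "n2 (\<lambda>x. PL (e # ds) (?h k) f x - f x)
      \<le> n2 (\<lambda>x. Lop e (?h k) u x - Lop e (?h k) f x) + n2 (\<lambda>x. Lop e (?h k) f x - f x)"
      unfolding PL.simps u_def[symmetric] by (intro n2_diff_triangle test_L2 test_Lop u f)
    have "(\<lambda>x. Lop e (?h k) u x - Lop e (?h k) f x) = Lop e (?h k) (\<lambda>x. u x - f x)"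
      using Lop_linear[OF u f, of e "?h k" 1 "-1"] by (simp add: fun_eq_iff)
    hence 2: "n2 (\<lambda>x. Lop e (?h k) u x - Lop e (?h k) f x) \<le> 2 * n2 (\<lambda>x. u x - f x)"
      using n2_Lop[OF uf, of e "?h k"] by simp
    have eq: "(\<lambda>x. Lop e (?h k) f x - f x) = (\<lambda>x. 3/2 * (?M x - f x) + (-1/2) * (?T (\<lambda>x. ?M x - f x) x + (?T f x - f x)))"
      by (simp add: Lop_def tr_def fun_eq_iff field_simps)
    have T1: "test (?T (\<lambda>x. ?M x - f x))" by (rule test_tr[OF Mf])
    have T2: "test (\<lambda>x. ?T f x - f x)" by (intro test_diff test_tr f)
    have "n2 (\<lambda>x. Lop e (?h k) f x - f x)
      \<le> n2 (\<lambda>x. 3/2 * (?M x - f x)) + n2 (\<lambda>x. (-1/2) * (?T (\<lambda>x. ?M x - f x) x + (?T f x - f x)))"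
      unfolding eq using Mf T1 T2
      by (intro n2_triangle test_L2 test_cmult[of "\<lambda>x. ?M x - f x"] test_cmult[of "\<lambda>x. ?T (\<lambda>x. ?M x - f x) x + (?T f x - f x)"] test_add)
    also have "\<dots> = 3/2 * n2 (\<lambda>x. ?M x - f x) + 1/2 * n2 (\<lambda>x. ?T (\<lambda>x. ?M x - f x) x + (?T f x - f x))"
      unfolding n2_cmult by simp
    also have "\<dots> \<le> 3/2 * n2 (\<lambda>x. ?M x - f x) + 1/2 * (n2 (\<lambda>x. ?M x - f x) + n2 (\<lambda>x. ?T f x - f x))"
      using n2_triangle[OF test_L2[OF T1] test_L2[OF T2]] n2_tr[OF test_borel[OF Mf], of "?h k *\<^sub>R e"] by simp
    finally have l: "n2 (\<lambda>x. Lop e (?h k) f x - f x) \<le> 3/2 * n2 (\<lambda>x. ?M x - f x) + 1/2 * (n2 (\<lambda>x. ?M x - f x) + n2 (\<lambda>x. ?T f x - f x))" .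
    have "y \<le> 3/2 * a + 1/2 * (a + b) \<Longrightarrow> 0 \<le> b \<Longrightarrow> y \<le> 2 * a + b" for y a b :: real by (simp add: field_simps)
    from this[OF l n2_nonneg] have 3: "n2 (\<lambda>x. Lop e (?h k) f x - f x) \<le> 2 * n2 (\<lambda>x. ?M x - f x) + n2 (\<lambda>x. ?T f x - f x)" .
    show ?thesis using 1 2 3 unfolding u_def by linarith
  qed
  thus ?case by (intro tendsto_0_le[OF b0, where K=1] always_eventually allI) (simp add: abs_of_nonneg order_trans[OF n2_nonneg])
qed simp

lemma parametrix:
  assumes "finite D"
  shows "\<exists>m d P F cP cF. (\<forall>i<m::nat. d i \<in> D) \<and> scf D cP P \<and> (\<forall>e\<in>D. cP e \<ge> 4) \<and>
    (\<forall>i<m. scf D (cF i) (F i) \<and> (\<forall>e\<in>D. cF i e \<ge> 4)) \<and>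
    (\<forall>h f x. test f \<longrightarrow> P h f x - P (2 * h) f x = (\<Sum>i<m. h\<^sup>2 * dd (d i) (dd (d i) (F i h f)) x)) \<and>
    (\<forall>h f. test f \<longrightarrow> (\<lambda>k. n2 (\<lambda>x. P (h / 2 ^ k) f x - f x)) \<longlonglongrightarrow> 0)"
proof -
  obtain es where es: "set es = D" "distinct es" using finite_distinct_list[OF assms] by blast
  define ds where "ds = es @ es @ es @ es @ es"
  have c: "count_list ds e \<ge> 5" if "e \<in> D" for e
  proof -
    have "count_list es e \<noteq> 0" using that es by (simp add: count_list_0_iff)
    thus ?thesis by (simp add: ds_def)
  qed
  have sd: "set ds \<subseteq> D" using es by (auto simp: ds_def)
  obtain F where F: "\<And>i. i < length ds \<Longrightarrow> \<exists>c. scf D c (F i) \<and> (\<forall>e. count_list ds e \<le> Suc (c e))"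
    "\<And>h f x. test f \<Longrightarrow> PL ds h f x - PL ds (2 * h) f x =
       (\<Sum>i<length ds. h\<^sup>2 * dd (ds ! i) (dd (ds ! i) (F i h f)) x)" using telescoping[OF sd] by blast
  obtain cF where cF: "\<And>i. i < length ds \<Longrightarrow> scf D (cF i) (F i) \<and> (\<forall>e. count_list ds e \<le> Suc (cF i e))"
    using F(1) by metis
  have "\<forall>e\<in>D. cF i e \<ge> 4" if "i < length ds" for i
  proof
    fix e assume "e \<in> D"
    thus "cF i e \<ge> 4" using cF[OF that] c[of e] by (metis Suc_le_mono eval_nat_numeral(3) numeral_eq_Suc order_trans pred_numeral_simps(2,3) semiring_norm(26,27))
  qed
  moreover have "\<forall>e\<in>D. count_list ds e \<ge> 4" using c by fastforce
  moreover have "\<forall>i<length ds. ds ! i \<in> D" using sd nth_mem by blast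
  ultimately show ?thesis using F(2) cF scf_PL[OF sd] PL_lim[of _ ds] by blast
qed

section \<open>Potentials of order \<open>-2\<close> acting on \<open>H\<^sup>-\<^sup>1\<close>\<close>

definition ms :: "(real \<Rightarrow> fn \<Rightarrow> fn) \<Rightarrow> real \<Rightarrow> nat \<Rightarrow> fn \<Rightarrow> fn" where
  "ms F h N f x = (\<Sum>k<N. (h / 2 ^ k)\<^sup>2 * F (h / 2 ^ k) f x)"

definition spanning :: "pt set \<Rightarrow> bool" where
  "spanning D \<longleftrightarrow> (\<forall>i. \<exists>w. axis i 1 = (\<Sum>e\<in>D. w e *\<^sub>R e))"

lemma dd_sum_dir: "dd (\<Sum>e\<in>D. w e *\<^sub>R e) f x = (\<Sum>e\<in>D. w e * dd e f x)"
  unfolding dd_def by (simp add: sum_distrib_left sum_distrib_right mult.assoc) (rule sum.swap)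

lemma sum_swap_mult:
  fixes a :: "'a \<Rightarrow> real"
  shows "(\<Sum>k\<in>A. a k * (\<Sum>e\<in>D. w e * x e k)) = (\<Sum>e\<in>D. w e * (\<Sum>k\<in>A. a k * x e k))"
proof -
  have "(\<Sum>k\<in>A. a k * (\<Sum>e\<in>D. w e * x e k)) = (\<Sum>k\<in>A. \<Sum>e\<in>D. w e * (a k * x e k))"
    by (simp add: sum_distrib_left mult.left_commute)
  also have "\<dots> = (\<Sum>e\<in>D. \<Sum>k\<in>A. w e * (a k * x e k))" by (rule sum.swap)
  finally show ?thesis by (simp add: sum_distrib_left)
qed

definition bounded_ops :: "(nat \<Rightarrow> fn \<Rightarrow> fn) \<Rightarrow> bool" where
  "bounded_ops Q \<longleftrightarrow> (\<exists>K\<ge>0. \<forall>N f. test f \<longrightarrow> test (Q N f) \<and> n2 (Q N f) \<le> K * n2 f)"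

lemma bounded_ops_sum:
  assumes "finite I" "\<And>i. i \<in> I \<Longrightarrow> bounded_ops (Q i)" shows "bounded_ops (\<lambda>N f x. \<Sum>i\<in>I. w i * Q i N f x)"
proof -
  obtain K where K: "\<And>i. i \<in> I \<Longrightarrow> K i \<ge> 0"
    "\<And>i N f. i \<in> I \<Longrightarrow> test f \<Longrightarrow> test (Q i N f) \<and> n2 (Q i N f) \<le> K i * n2 f"
    using assms(2) unfolding bounded_ops_def by metis
  have "test (\<lambda>x. \<Sum>i\<in>I. w i * Q i N f x) \<and> n2 (\<lambda>x. \<Sum>i\<in>I. w i * Q i N f x) \<le> (\<Sum>i\<in>I. \<bar>w i\<bar> * K i) * n2 f"
    if f: "test f" for N f
  proof
    show "test (\<lambda>x. \<Sum>i\<in>I. w i * Q i N f x)" using K(2)[OF _ f] by (intro test_sum test_cmult) auto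
    have "n2 (\<lambda>x. \<Sum>i\<in>I. w i * Q i N f x) \<le> (\<Sum>i\<in>I. n2 (\<lambda>x. w i * Q i N f x))"
      using K(2)[OF _ f] by (intro n2_sum test_L2 test_cmult) auto
    also have "\<dots> \<le> (\<Sum>i\<in>I. \<bar>w i\<bar> * (K i * n2 f))"
      unfolding n2_cmult using K(2)[OF _ f] by (intro sum_mono mult_left_mono) auto
    finally show "n2 (\<lambda>x. \<Sum>i\<in>I. w i * Q i N f x) \<le> (\<Sum>i\<in>I. \<bar>w i\<bar> * K i) * n2 f"
      by (simp only: sum_distrib_right mult.assoc)
  qed
  moreover have "(\<Sum>i\<in>I. \<bar>w i\<bar> * K i) \<ge> 0" using K(1) by (intro sum_nonneg) auto
  ultimately show ?thesis unfolding bounded_ops_def by blast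
qed

lemma geometric_bound: "0 \<le> q \<Longrightarrow> q \<le> 1/2 \<Longrightarrow> (\<Sum>k<N. q ^ k) \<le> (2::real)"
proof -
  assume q: "0 \<le> q" "q \<le> 1/2"
  have "(\<Sum>k<N. q ^ k) \<le> (\<Sum>k<N. (1/2) ^ k)" using q by (intro sum_mono power_mono) auto
  also have "\<dots> = 2 - 2 * (1/2) ^ N" by (induction N) (auto simp: field_simps)
  also have "\<dots> \<le> 2" by simp
  finally show ?thesis .
qed

lemma bounded_ops_scale_sum:
  assumes q: "\<And>k f. test f \<Longrightarrow> test (Q k f) \<and> n2 (Q k f) \<le> (1/2) ^ k * K * n2 f" and K: "K \<ge> 0"
  shows "bounded_ops (\<lambda>N f x. \<Sum>k<N. Q k f x)"
proof -
  have "test (\<lambda>x. \<Sum>k<N. Q k f x) \<and> n2 (\<lambda>x. \<Sum>k<N. Q k f x) \<le> (2 * K) * n2 f" if f: "test f" for N f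
  proof
    show "test (\<lambda>x. \<Sum>k<N. Q k f x)" using q[OF f] by (intro test_sum) auto
    have "n2 (\<lambda>x. \<Sum>k<N. Q k f x) \<le> (\<Sum>k<N. n2 (Q k f))" using q[OF f] by (intro n2_sum test_L2) auto
    also have "\<dots> \<le> (\<Sum>k<N. (1/2) ^ k * (K * n2 f))" using q[OF f] by (intro sum_mono) (simp add: mult.assoc)
    also have "\<dots> \<le> 2 * (K * n2 f)"
      unfolding sum_distrib_right[symmetric] by (intro mult_right_mono geometric_bound) (use K in auto)
    finally show "n2 (\<lambda>x. \<Sum>k<N. Q k f x) \<le> (2 * K) * n2 f" by simp
  qed
  thus ?thesis unfolding bounded_ops_def using K by (intro exI[of _ "2 * K"]) auto
qed

lemma ms_bop:
  assumes F: "scf D c F" shows "bounded_ops (ms F h)"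
proof -
  obtain C where C: "C \<ge> 0" "\<And>h f. test f \<Longrightarrow> n2 (F h f) \<le> C * n2 f" using scf_bound[OF F] by blast
  have "bounded_ops (\<lambda>N f x. \<Sum>k<N. (h / 2 ^ k)\<^sup>2 * F (h / 2 ^ k) f x)"
  proof (rule bounded_ops_scale_sum[where K="h\<^sup>2 * C"])
    fix k :: nat and f assume f: "test f"
    have "n2 (\<lambda>x. (h / 2 ^ k)\<^sup>2 * F (h / 2 ^ k) f x) \<le> (h / 2 ^ k)\<^sup>2 * (C * n2 f)"
      unfolding n2_cmult using C(2)[OF f] by (intro mult_mono) auto
    also have "\<dots> \<le> ((1/2) ^ k * h\<^sup>2) * (C * n2 f)"
    proof (intro mult_right_mono)
      have "(h / 2 ^ k)\<^sup>2 = (1/2) ^ k * ((1/2) ^ k * h\<^sup>2)" by (simp add: power2_eq_square power_divide)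
      also have "\<dots> \<le> (1/2) ^ k * (1 * h\<^sup>2)"
        by (intro mult_right_mono mult_left_mono) (auto simp: power_le_one)
      finally show "(h / 2 ^ k)\<^sup>2 \<le> (1/2) ^ k * h\<^sup>2" by simp
    qed (use C in simp)
    finally have "n2 (\<lambda>x. (h / 2 ^ k)\<^sup>2 * F (h / 2 ^ k) f x) \<le> ((1/2) ^ k * h\<^sup>2) * (C * n2 f)" .
    thus "test (\<lambda>x. (h / 2 ^ k)\<^sup>2 * F (h / 2 ^ k) f x) \<and>
      n2 (\<lambda>x. (h / 2 ^ k)\<^sup>2 * F (h / 2 ^ k) f x) \<le> (1/2) ^ k * (h\<^sup>2 * C) * n2 f"
      using test_cmult[OF scf_test[OF F f]] by (simp only: mult.assoc)
  qed (use C in simp)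
  thus ?thesis by (simp add: ms_def[abs_def])
qed

lemma dd_ms_bop:
  assumes F: "scf D c F" and e: "c e \<ge> 1"
  shows "bounded_ops (\<lambda>N f x. \<Sum>k<N. (h / 2 ^ k)\<^sup>2 * dd e (F (h / 2 ^ k) f) x)"
proof -
  obtain C where C: "C \<ge> 0" "\<And>h f. test f \<Longrightarrow> \<bar>h\<bar> * n2 (dd e (F h f)) \<le> C * n2 f"
    using scf_first_order[OF F e] by blast
  show ?thesis
  proof (rule bounded_ops_scale_sum[where K="\<bar>h\<bar> * C"])
    fix k :: nat and f assume f: "test f"
    have "n2 (\<lambda>x. (h / 2 ^ k)\<^sup>2 * dd e (F (h / 2 ^ k) f) x) = \<bar>h / 2 ^ k\<bar> * (\<bar>h / 2 ^ k\<bar> * n2 (dd e (F (h / 2 ^ k) f)))"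
      unfolding n2_cmult by (simp add: power2_eq_square)
    also have "\<dots> \<le> \<bar>h / 2 ^ k\<bar> * (C * n2 f)" by (intro mult_left_mono C(2) f) simp
    also have "\<dots> = (1/2) ^ k * (\<bar>h\<bar> * C) * n2 f" by (simp add: power_divide)
    finally show "test (\<lambda>x. (h / 2 ^ k)\<^sup>2 * dd e (F (h / 2 ^ k) f) x) \<and>
      n2 (\<lambda>x. (h / 2 ^ k)\<^sup>2 * dd e (F (h / 2 ^ k) f) x) \<le> (1/2) ^ k * (\<bar>h\<bar> * C) * n2 f"
      using test_cmult[OF test_dd[OF scf_test[OF F f]]] by blast
  qed (use C in simp)
qed

lemma dd_dd_ms_bop:
  assumes F: "scf D c F" and e: "c a \<ge> 4" "c b \<ge> 4"
  shows "bounded_ops (\<lambda>N f x. \<Sum>k<N. (h / 2 ^ k)\<^sup>2 * dd a (dd b (F (h / 2 ^ k) f)) x)"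
proof -
  have "test (\<lambda>x. \<Sum>k<N. (h / 2 ^ k)\<^sup>2 * dd a (dd b (F (h / 2 ^ k) f)) x)" if "test f" for N f
    by (intro test_sum test_cmult test_dd scf_test[OF F that])
  thus ?thesis using scf_second_order[OF F e] unfolding bounded_ops_def by blast
qed

lemma test_ms: "scf D c F \<Longrightarrow> test f \<Longrightarrow> test (ms F h N f)"
  unfolding ms_def[abs_def] by (rule test_sum, rule test_cmult, rule scf_test)

lemma pd_ms: "scf D c F \<Longrightarrow> test f \<Longrightarrow> pd i (ms F h N f) = ms F h N (pd i f)"
  unfolding ms_def[abs_def]
  by (simp add: pd_sum pd_cmult smooth_cmult test_smooth scf_test scf_pd)

lemma ms_lin: "scf D c F \<Longrightarrow> test f \<Longrightarrow> test g \<Longrightarrow>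
   ms F h N (\<lambda>x. a * f x + b * g x) = (\<lambda>x. a * ms F h N f x + b * ms F h N g x)"
  by (simp add: fun_eq_iff ms_def scf_arg_lin sum.distrib sum_distrib_left algebra_simps)

lemma ms_h1t_bound:
  assumes D: "finite D" "spanning D" and F: "scf D c F" and c: "\<And>e. e \<in> D \<Longrightarrow> c e \<ge> 4"
  shows "\<exists>K\<ge>0. \<forall>N f. test f \<longrightarrow> h1t (ms F h N f) \<le> K * n2 f \<and> (\<forall>j. h1t (ms F h N (pd j f)) \<le> K * n2 f)"
proof -
  obtain w where w: "\<And>i. axis i (1::real) = (\<Sum>e\<in>D. w i e *\<^sub>R e)" using D(2) unfolding spanning_def by metis
  have pdw: "pd i f x = (\<Sum>e\<in>D. w i e * dd e f x)" for i f x
    unfolding dd_axis[symmetric] w by (rule dd_sum_dir)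
  define Q1 where "Q1 i = (\<lambda>N f. pd i (ms F h N f))" for i
  define Q2 where "Q2 i j = (\<lambda>N f. pd i (ms F h N (pd j f)))" for i j
  have pdms: "pd i (ms F h N f) x = (\<Sum>k<N. (h / 2 ^ k)\<^sup>2 * pd i (F (h / 2 ^ k) f) x)" if "test f" for i N f x
    using pd_ms[OF F that] scf_pd[OF F that] by (simp add: ms_def)
  have bounded_ops_cong: "bounded_ops Q" if "bounded_ops Q'" "\<And>N f. test f \<Longrightarrow> Q N f = Q' N f" for Q Q'
    using that unfolding bounded_ops_def by simp
  have b1: "bounded_ops (Q1 i)" for i
  proof (rule bounded_ops_cong)
    show "bounded_ops (\<lambda>N f x. \<Sum>e\<in>D. w i e * (\<Sum>k<N. (h / 2 ^ k)\<^sup>2 * dd e (F (h / 2 ^ k) f) x))"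
      using c by (intro bounded_ops_sum D dd_ms_bop[OF F]) force
    show "Q1 i N f = (\<lambda>x. \<Sum>e\<in>D. w i e * (\<Sum>k<N. (h / 2 ^ k)\<^sup>2 * dd e (F (h / 2 ^ k) f) x))" if "test f" for N f
      unfolding Q1_def fun_eq_iff pdms[OF that] unfolding pdw by (auto intro: sum_swap_mult)
  qed
  have b2: "bounded_ops (Q2 i j)" for i j
  proof (rule bounded_ops_cong)
    show "bounded_ops (\<lambda>N f x. \<Sum>e\<in>D. w i e * (\<Sum>e'\<in>D. w j e' * (\<Sum>k<N. (h / 2 ^ k)\<^sup>2 * dd e (dd e' (F (h / 2 ^ k) f)) x)))"
      using c by (intro bounded_ops_sum D dd_dd_ms_bop[OF F])
    show "Q2 i j N f = (\<lambda>x. \<Sum>e\<in>D. w i e * (\<Sum>e'\<in>D. w j e' * (\<Sum>k<N. (h / 2 ^ k)\<^sup>2 * dd e (dd e' (F (h / 2 ^ k) f)) x)))"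
      if f: "test f" for N f
    proof
      fix x
      have e: "dd e (pd j (F s f)) x = (\<Sum>e'\<in>D. w j e' * dd e (dd e' (F s f)) x)" for s e
      proof -
        define g where "g = F s f"
        have g: "test g" unfolding g_def by (rule scf_test[OF F f])
        have "pd j g = (\<lambda>x. \<Sum>e'\<in>D. w j e' * dd e' g x)" using pdw by auto
        moreover have "dd e (\<lambda>x. \<Sum>e'\<in>D. w j e' * dd e' g x) x = (\<Sum>e'\<in>D. w j e' * dd e (dd e' g) x)"
          unfolding dd_def[of e]
          by (simp add: pd_sum pd_cmult smooth_cmult test_smooth test_dd g sum_distrib_left mult_ac) (rule sum.swap)
        ultimately show ?thesis by (simp add: g_def)
      qed
      have "Q2 i j N f x = (\<Sum>k<N. (h / 2 ^ k)\<^sup>2 * (\<Sum>e\<in>D. w i e * dd e (pd j (F (h / 2 ^ k) f)) x))"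
        unfolding Q2_def pdms[OF test_pd[OF f]] by (simp add: scf_pd[OF F f, symmetric] pdw)
      also have "\<dots> = (\<Sum>e\<in>D. w i e * (\<Sum>e'\<in>D. w j e' * (\<Sum>k<N. (h / 2 ^ k)\<^sup>2 * dd e (dd e' (F (h / 2 ^ k) f)) x)))"
        unfolding e by (subst sum_swap_mult, intro sum.cong refl arg_cong2[where f=times], rule sum_swap_mult)
      finally show "Q2 i j N f x = (\<Sum>e\<in>D. w i e * (\<Sum>e'\<in>D. w j e' * (\<Sum>k<N. (h / 2 ^ k)\<^sup>2 * dd e (dd e' (F (h / 2 ^ k) f)) x)))" .
    qed
  qed
  obtain K0 where K0: "K0 \<ge> 0" "\<And>N f. test f \<Longrightarrow> n2 (ms F h N f) \<le> K0 * n2 f"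
    using ms_bop[OF F, of h] unfolding bounded_ops_def by blast
  obtain K1 where K1: "\<And>i. K1 i \<ge> 0" "\<And>i N f. test f \<Longrightarrow> n2 (Q1 i N f) \<le> K1 i * n2 f"
    using b1 unfolding bounded_ops_def by metis
  obtain K2 where K2: "\<And>i j. K2 i j \<ge> 0" "\<And>i j N f. test f \<Longrightarrow> n2 (Q2 i j N f) \<le> K2 i j * n2 f"
    using b2 unfolding bounded_ops_def by metis
  define S1 where "S1 = (\<Sum>i\<in>UNIV. K1 i)"
  define S2 where "S2 = (\<Sum>i\<in>UNIV. \<Sum>j\<in>UNIV. K2 i j)"
  have S: "S1 \<ge> 0" "S2 \<ge> 0" unfolding S1_def S2_def using K1 K2 by (auto intro!: sum_nonneg)
  have "h1t (ms F h N f) \<le> (K0 + S1 + S2) * n2 f \<and> (\<forall>j. h1t (ms F h N (pd j f)) \<le> (K0 + S1 + S2) * n2 f)"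
    if f: "test f" for N f
  proof (intro conjI allI)
    have "h1t (ms F h N f) \<le> n2 (ms F h N f) + (\<Sum>i\<in>UNIV. n2 (Q1 i N f))"
      unfolding Q1_def by (rule h1t_le)
    also have "\<dots> \<le> K0 * n2 f + (\<Sum>i\<in>UNIV. K1 i * n2 f)" by (intro add_mono sum_mono K0(2) K1(2) f)
    also have "\<dots> = (K0 + S1) * n2 f" by (simp add: S1_def sum_distrib_right[symmetric] distrib_right)
    also have "\<dots> \<le> (K0 + S1 + S2) * n2 f" using S by (intro mult_right_mono) auto
    finally show "h1t (ms F h N f) \<le> (K0 + S1 + S2) * n2 f" .
    fix j
    have "h1t (ms F h N (pd j f)) \<le> n2 (Q1 j N f) + (\<Sum>i\<in>UNIV. n2 (Q2 i j N f))"
      unfolding Q2_def Q1_def pd_ms[OF F f] by (rule h1t_le)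
    also have "n2 (Q1 j N f) + (\<Sum>i\<in>UNIV. n2 (Q2 i j N f)) \<le> K1 j * n2 f + (\<Sum>i\<in>UNIV. K2 i j * n2 f)"
      by (intro add_mono sum_mono K2(2) K1(2) f)
    also have "\<dots> = (K1 j + (\<Sum>i\<in>UNIV. K2 i j)) * n2 f" by (simp add: sum_distrib_right[symmetric] distrib_right)
    also have "\<dots> \<le> (K0 + S1 + S2) * n2 f"
    proof (intro mult_right_mono)
      have "K1 j \<le> S1" unfolding S1_def by (rule member_le_sum) (use K1 in auto)
      moreover have "(\<Sum>i\<in>UNIV. K2 i j) \<le> S2"
        unfolding S2_def by (intro sum_mono member_le_sum) (use K2 in auto)
      ultimately show "K1 j + (\<Sum>i\<in>UNIV. K2 i j) \<le> K0 + S1 + S2" using K0 by linarith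
    qed simp
    finally show "h1t (ms F h N (pd j f)) \<le> (K0 + S1 + S2) * n2 f" .
  qed
  moreover have "K0 + S1 + S2 \<ge> 0" using K0 S by simp
  ultimately show ?thesis by blast
qed

definition hmd :: "distr \<Rightarrow> real \<Rightarrow> bool" where
  "hmd u C \<longleftrightarrow> tlin u \<and> 0 \<le> C \<and> hm1_le u C"

lemma hmdD: "hmd u C \<Longrightarrow> tlin u" "hmd u C \<Longrightarrow> 0 \<le> C" "hmd u C \<Longrightarrow> test \<phi> \<Longrightarrow> \<bar>u \<phi>\<bar> \<le> C * h1t \<phi>"
  by (auto simp: hmd_def hm1_le_def)

lemma Hm1_hmd:
  assumes "Hm1 u" shows "hmd u (hm1norm u)"
proof -
  have tl: "tlin u" using assms by (simp add: Hm1_def tlin_def)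
  define S where "S = {C. 0 \<le> C \<and> hm1_le u C}"
  obtain C where C: "hm1_le u C" using assms by (auto simp: Hm1_def)
  have "hm1_le u (max C 0)"
    using C unfolding hm1_le_def by (meson h1t_nonneg max.cobounded1 mult_right_mono order_trans)
  hence ne: "S \<noteq> {}" by (auto simp: S_def intro!: exI[of _ "max C 0"])
  have n: "hm1norm u = Inf S" by (simp add: hm1norm_def S_def)
  have 0: "0 \<le> Inf S" by (rule cInf_greatest[OF ne]) (simp add: S_def)
  have "hm1_le u (Inf S)" unfolding hm1_le_def
  proof (intro allI impI)
    fix \<phi> assume t: "test \<phi>"
    show "\<bar>u \<phi>\<bar> \<le> Inf S * h1t \<phi>"
    proof (cases "h1t \<phi> = 0")
      case True
      thus ?thesis using C t unfolding hm1_le_def by fastforce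
    next
      case False
      hence p: "h1t \<phi> > 0" using h1t_nonneg[of \<phi>] by linarith
      have "\<bar>u \<phi>\<bar> / h1t \<phi> \<le> Inf S"
        by (rule cInf_greatest[OF ne]) (use p t in \<open>auto simp: S_def hm1_le_def divide_simps\<close>)
      thus ?thesis using p by (simp add: divide_simps)
    qed
  qed
  thus ?thesis using tl 0 by (simp add: hmd_def n)
qed

definition pot :: "(real \<Rightarrow> fn \<Rightarrow> fn) \<Rightarrow> real \<Rightarrow> distr \<Rightarrow> distr" where
  "pot F h u \<phi> = lim (\<lambda>N. u (ms F h N \<phi>))"

lemma pot_lim:
  assumes F: "scf D c F" and u: "hmd u C" and f: "test \<phi>"
  shows "(\<lambda>N. u (ms F h N \<phi>)) \<longlonglongrightarrow> pot F h u \<phi>"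
proof -
  obtain B where B: "B \<ge> 0" "\<And>h f. test f \<Longrightarrow> n2 (F h f) \<le> B * n2 f" using scf_bound[OF F] by blast
  define E where "E = B * n2 \<phi> + (\<Sum>i\<in>UNIV. B * n2 (pd i \<phi>))"
  have E: "h1t (F s \<phi>) \<le> E" for s
  proof -
    have "h1t (F s \<phi>) \<le> n2 (F s \<phi>) + (\<Sum>i\<in>UNIV. n2 (pd i (F s \<phi>)))" by (rule h1t_le)
    also have "\<dots> \<le> E" unfolding E_def scf_pd[OF F f] by (intro add_mono sum_mono B(2) f test_pd)
    finally show ?thesis .
  qed
  have t: "test (\<lambda>x. (h / 2 ^ k)\<^sup>2 * F (h / 2 ^ k) \<phi> x)" for k :: nat
    by (intro test_cmult scf_test[OF F f])
  have eq: "u (ms F h N \<phi>) = (\<Sum>k<N. (h / 2 ^ k)\<^sup>2 * u (F (h / 2 ^ k) \<phi>))" for N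
    unfolding ms_def[abs_def] using tlin_sum[OF hmdD(1)[OF u] t] tlin_cmult[OF hmdD(1)[OF u] scf_test[OF F f]] by simp
  have "summable (\<lambda>k. (h / 2 ^ k)\<^sup>2 * u (F (h / 2 ^ k) \<phi>))"
  proof (rule summable_comparison_test')
    show "summable (\<lambda>k. (h\<^sup>2 * (C * E)) * (1/4) ^ k)" by (intro summable_mult summable_geometric) simp
    fix k :: nat
    have "\<bar>u (F (h / 2 ^ k) \<phi>)\<bar> \<le> C * E"
      using hmdD(3)[OF u scf_test[OF F f]] mult_left_mono[OF E hmdD(2)[OF u]] order_trans by blast
    hence "norm ((h / 2 ^ k)\<^sup>2 * u (F (h / 2 ^ k) \<phi>)) \<le> (h / 2 ^ k)\<^sup>2 * (C * E)"
      unfolding real_norm_def abs_mult by (intro mult_mono) auto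
    moreover have "(h / 2 ^ k)\<^sup>2 * (C * E) = (h\<^sup>2 * (C * E)) * (1/4) ^ k"
      by (simp add: power_divide power2_eq_square power_mult_distrib[symmetric])
    ultimately show "norm ((h / 2 ^ k)\<^sup>2 * u (F (h / 2 ^ k) \<phi>)) \<le> (h\<^sup>2 * (C * E)) * (1/4) ^ k" by (simp only:)
  qed
  hence "convergent (\<lambda>N. u (ms F h N \<phi>))" unfolding eq summable_iff_convergent .
  thus ?thesis by (simp add: convergent_LIMSEQ_iff pot_def)
qed

text \<open>\<open>regd v K\<close>: by Riesz representation \<open>v\<close> is an \<open>H\<^sup>1\<close> function whose \<open>L\<^sup>2\<close> norm and
  first weak derivatives are bounded by \<open>K\<close>.\<close>

definition regd :: "distr \<Rightarrow> real \<Rightarrow> bool" where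
  "regd v K \<longleftrightarrow> tlin v \<and> 0 \<le> K \<and> (\<forall>\<phi>. test \<phi> \<longrightarrow> \<bar>v \<phi>\<bar> \<le> K * n2 \<phi> \<and> (\<forall>j. \<bar>v (pd j \<phi>)\<bar> \<le> K * n2 \<phi>))"

lemma regdD: "regd v K \<Longrightarrow> tlin v" "regd v K \<Longrightarrow> 0 \<le> K" "regd v K \<Longrightarrow> test \<phi> \<Longrightarrow> \<bar>v \<phi>\<bar> \<le> K * n2 \<phi>"
  "regd v K \<Longrightarrow> test \<phi> \<Longrightarrow> \<bar>v (pd j \<phi>)\<bar> \<le> K * n2 \<phi>"
  by (auto simp: regd_def)

lemma regd_lin:
  assumes v: "regd v K" and w: "regd w L"
  shows "regd (\<lambda>\<phi>. a * v \<phi> + b * w \<phi>) (\<bar>a\<bar> * K + \<bar>b\<bar> * L)"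
proof -
  have "tlin (\<lambda>\<phi>. a * v \<phi> + b * w \<phi>)"
    using regdD(1)[OF v] regdD(1)[OF w] by (simp add: tlin_def algebra_simps)
  moreover have b: "\<bar>a * v \<phi> + b * w \<phi>\<bar> \<le> (\<bar>a\<bar> * K + \<bar>b\<bar> * L) * s" if "\<bar>v \<phi>\<bar> \<le> K * s" "\<bar>w \<phi>\<bar> \<le> L * s" for \<phi> s
  proof -
    have "\<bar>a * v \<phi> + b * w \<phi>\<bar> \<le> \<bar>a\<bar> * \<bar>v \<phi>\<bar> + \<bar>b\<bar> * \<bar>w \<phi>\<bar>" by (metis abs_mult abs_triangle_ineq)
    also have "\<dots> \<le> \<bar>a\<bar> * (K * s) + \<bar>b\<bar> * (L * s)" by (intro add_mono mult_left_mono that) auto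
    finally show ?thesis by (simp add: algebra_simps)
  qed
  ultimately show ?thesis using regdD[OF v] regdD[OF w] unfolding regd_def
    by (auto intro!: b)
qed

lemma regd_zero: "regd (\<lambda>_. 0) 0"
  by (simp add: regd_def tlin_def)

lemma pot_tlin:
  assumes F: "scf D c F" and u: "hmd u C" shows "tlin (pot F h u)"
  unfolding tlin_def
proof (intro allI impI)
  fix \<phi> \<psi> :: fn and a b assume t: "test \<phi>" "test \<psi>"
  have "(\<lambda>N. a * u (ms F h N \<phi>) + b * u (ms F h N \<psi>)) \<longlonglongrightarrow> a * pot F h u \<phi> + b * pot F h u \<psi>"
    by (intro tendsto_intros pot_lim[OF F u] t)
  moreover have "(\<lambda>N. a * u (ms F h N \<phi>) + b * u (ms F h N \<psi>)) = (\<lambda>N. u (ms F h N (\<lambda>x. a * \<phi> x + b * \<psi> x)))"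
    using tlinD[OF hmdD(1)[OF u] test_ms[OF F t(1)] test_ms[OF F t(2)]] ms_lin[OF F t] by simp
  ultimately show "pot F h u (\<lambda>x. a * \<phi> x + b * \<psi> x) = a * pot F h u \<phi> + b * pot F h u \<psi>"
    using LIMSEQ_unique[OF pot_lim[OF F u test_lin[OF t]]] by simp
qed

lemma pot_regd:
  assumes D: "finite D" "spanning D" and F: "scf D c F" and c: "\<And>e. e \<in> D \<Longrightarrow> c e \<ge> 4"
  shows "\<exists>K\<ge>0. \<forall>u C. hmd u C \<longrightarrow> regd (pot F h u) (K * C)"
proof -
  obtain K where K: "K \<ge> 0" "\<And>N f. test f \<Longrightarrow> h1t (ms F h N f) \<le> K * n2 f"
    "\<And>N f j. test f \<Longrightarrow> h1t (ms F h N (pd j f)) \<le> K * n2 f"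
    using ms_h1t_bound[OF D F c] by blast
  have "regd (pot F h u) (K * C)" if u: "hmd u C" for u C
    unfolding regd_def
  proof (intro conjI allI impI)
    show "tlin (pot F h u)" by (rule pot_tlin[OF F u])
    show "0 \<le> K * C" using K(1) hmdD(2)[OF u] by simp
    have b: "\<bar>pot F h u \<psi>\<bar> \<le> K * C * s" if "test \<psi>" "\<And>N. h1t (ms F h N \<psi>) \<le> K * s" for \<psi> s
    proof (rule LIMSEQ_le_const2)
      show "(\<lambda>N. \<bar>u (ms F h N \<psi>)\<bar>) \<longlonglongrightarrow> \<bar>pot F h u \<psi>\<bar>"
        by (intro tendsto_rabs pot_lim[OF F u] that)
      have "\<bar>u (ms F h N \<psi>)\<bar> \<le> K * C * s" for N
      proof -
        have "\<bar>u (ms F h N \<psi>)\<bar> \<le> C * h1t (ms F h N \<psi>)" by (intro hmdD(3)[OF u] test_ms[OF F] that)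
        also have "\<dots> \<le> C * (K * s)" by (intro mult_left_mono that hmdD(2)[OF u])
        finally show ?thesis by (simp add: mult_ac)
      qed
      thus "\<exists>N. \<forall>n\<ge>N. \<bar>u (ms F h n \<psi>)\<bar> \<le> K * C * s" by blast
    qed
    fix \<phi> assume t: "test \<phi>"
    show "\<bar>pot F h u \<phi>\<bar> \<le> K * C * n2 \<phi>" by (intro b t K(2))
    show "\<bar>pot F h u (pd j \<phi>)\<bar> \<le> K * C * n2 \<phi>" for j by (intro b test_pd t K(3))
  qed
  thus ?thesis using K(1) by blast
qed

lemma scf_regd:
  assumes D: "finite D" "spanning D" and P: "scf D c P" and c: "\<And>e. e \<in> D \<Longrightarrow> c e \<ge> 4" and h: "h \<noteq> 0"
  shows "\<exists>K\<ge>0. \<forall>u C. hmd u C \<longrightarrow> regd (\<lambda>\<phi>. u (P h \<phi>)) (K * C)"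
proof -
  obtain K where K: "K \<ge> 0" "\<And>N f. test f \<Longrightarrow> h1t (ms P h N f) \<le> K * n2 f"
    "\<And>N f j. test f \<Longrightarrow> h1t (ms P h N (pd j f)) \<le> K * n2 f"
    using ms_h1t_bound[OF D P c] by blast
  have "regd (\<lambda>\<phi>. u (P h \<phi>)) ((K / h\<^sup>2) * C)" if u: "hmd u C" for u C
    unfolding regd_def
  proof (intro conjI allI impI)
    show "tlin (\<lambda>\<phi>. u (P h \<phi>))" unfolding tlin_def
      by (auto simp: scf_arg_lin[OF P] tlinD[OF hmdD(1)[OF u]] scf_test[OF P])
    show "0 \<le> K / h\<^sup>2 * C" using K(1) hmdD(2)[OF u] by simp
    have b: "\<bar>u (P h \<psi>)\<bar> \<le> K / h\<^sup>2 * C * s" if t: "test \<psi>" and s: "h1t (ms P h 1 \<psi>) \<le> K * s" for \<psi> s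
    proof -
      have "u (ms P h 1 \<psi>) = h\<^sup>2 * u (P h \<psi>)"
        using tlin_cmult[OF hmdD(1)[OF u] scf_test[OF P t]] by (simp add: ms_def[abs_def])
      hence "h\<^sup>2 * \<bar>u (P h \<psi>)\<bar> = \<bar>u (ms P h 1 \<psi>)\<bar>" by (simp add: abs_mult)
      also have "\<dots> \<le> C * h1t (ms P h 1 \<psi>)" by (intro hmdD(3)[OF u] test_ms[OF P] t)
      also have "\<dots> \<le> C * (K * s)" by (intro mult_left_mono s hmdD(2)[OF u])
      finally show ?thesis using h by (simp add: field_simps)
    qed
    fix \<phi> assume t: "test \<phi>"
    show "\<bar>u (P h \<phi>)\<bar> \<le> K / h\<^sup>2 * C * n2 \<phi>" by (intro b t K(2))
    show "\<bar>u (P h (pd j \<phi>))\<bar> \<le> K / h\<^sup>2 * C * n2 \<phi>" for j by (intro b test_pd t K(3))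
  qed
  thus ?thesis using K(1) by (intro exI[of _ "K / h\<^sup>2"]) auto
qed

section \<open>Functionals represented by functions in \<open>H\<^sup>1\<close>\<close>

definition rep :: "distr \<Rightarrow> fn" where
  "rep v = (SOME g. H1 g \<and> (\<forall>\<phi>. test \<phi> \<longrightarrow> v \<phi> = ip g \<phi>))"

lemma regd_exists:
  assumes v: "regd v K"
  shows "\<exists>g G. L2 g \<and> n2 g \<le> K \<and> (\<forall>\<phi>. test \<phi> \<longrightarrow> v \<phi> = ip g \<phi>) \<and>
    (\<forall>i. L2 (G i) \<and> n2 (G i) \<le> K \<and> weak_pd i g (G i))"
proof -
  obtain g where g: "L2 g" "n2 g \<le> K" "\<And>\<phi>. test \<phi> \<Longrightarrow> v \<phi> = ip g \<phi>"
    using riesz_test[OF regdD(1,2)[OF v] regdD(3)[OF v]] by blast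
  have "\<exists>G. L2 G \<and> n2 G \<le> K \<and> (\<forall>\<phi>. test \<phi> \<longrightarrow> - v (pd i \<phi>) = ip G \<phi>)" for i
  proof -
    have "tlin (\<lambda>\<phi>. - v (pd i \<phi>))"
      using regdD(1)[OF v] by (simp add: tlin_def pd_lin test_smooth test_pd)
    from riesz_test[OF this regdD(2)[OF v]] regdD(4)[OF v] show ?thesis by (metis abs_minus_cancel)
  qed
  then obtain G where G: "\<And>i. L2 (G i) \<and> n2 (G i) \<le> K \<and> (\<forall>\<phi>. test \<phi> \<longrightarrow> - v (pd i \<phi>) = ip (G i) \<phi>)" by metis
  have "weak_pd i g (G i)" for i
    unfolding weak_pd_ip using G g(3) test_pd by (metis add.inverse_inverse)
  thus ?thesis using g G by blast
qed

lemma rep_props: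
  assumes v: "regd v K"
  shows "H1 (rep v)" "test \<phi> \<Longrightarrow> v \<phi> = ip (rep v) \<phi>" "L2 (rep v)" "h1norm (rep v) \<le> 2 * K"
proof -
  obtain g G where g: "L2 g" "n2 g \<le> K" "\<And>\<phi>. test \<phi> \<Longrightarrow> v \<phi> = ip g \<phi>"
    and G: "\<And>i. L2 (G i)" "\<And>i. n2 (G i) \<le> K" "\<And>i. weak_pd i g (G i)" using regd_exists[OF v] by blast
  have r: "H1 (rep v) \<and> (\<forall>\<phi>. test \<phi> \<longrightarrow> v \<phi> = ip (rep v) \<phi>)"
    unfolding rep_def by (rule someI[where x=g]) (use g(3) H1I[OF g(1) G(1) G(3)] in auto)
  thus "H1 (rep v)" "test \<phi> \<Longrightarrow> v \<phi> = ip (rep v) \<phi>" by auto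
  show L: "L2 (rep v)" using r by (simp add: H1_def)
  have "AE x in lborel. rep v x = g x" by (rule L2_AE_eqI[OF L g(1)]) (use r g in auto)
  hence n: "n2 (rep v) = n2 g" using L g L2_measurable by (intro n2_AE_cong) auto
  have w: "weak_pd i (rep v) (G i)" for i
    using G(3)[of i] r g(3) test_pd unfolding weak_pd_ip by metis
  have "h1norm (rep v) = sqrt ((n2 (rep v))\<^sup>2 + (\<Sum>i\<in>UNIV. (n2 (G i))\<^sup>2))" by (rule h1norm_eq[OF G(1) w])
  also have "\<dots> \<le> sqrt (K\<^sup>2 + (\<Sum>i\<in>(UNIV::3 set). K\<^sup>2))"
    unfolding n by (intro real_sqrt_le_mono add_mono sum_mono power_mono g G) auto
  also have "\<dots> = 2 * K" using regdD(2)[OF v] by (simp add: real_sqrt_mult) 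
  finally show "h1norm (rep v) \<le> 2 * K" .
qed

lemma rep_AE:
  assumes "regd v K" "regd w L" "\<And>\<phi>. test \<phi> \<Longrightarrow> v \<phi> = w \<phi>"
  shows "AE x in lborel. rep v x = rep w x"
  by (rule L2_AE_eqI) (use rep_props[OF assms(1)] rep_props[OF assms(2)] assms(3) in auto)

lemma rep_lin_AE:
  assumes v: "regd v K" and w: "regd w L" and z: "regd z M"
    and e: "\<And>\<phi>. test \<phi> \<Longrightarrow> z \<phi> = a * v \<phi> + b * w \<phi>"
  shows "AE x in lborel. rep z x = a * rep v x + b * rep w x"
  by (rule L2_AE_eqI)
     (use rep_props[OF v] rep_props[OF w] rep_props[OF z] e in \<open>auto simp: ip_lin_left test_L2 intro!: L2_lin\<close>)

definition appr :: "pt set \<Rightarrow> distr \<Rightarrow> bool" where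
  "appr \<Omega> v \<longleftrightarrow> (\<forall>\<epsilon>>0. \<exists>\<phi>. test_on \<Omega> \<phi> \<and> regd (\<lambda>\<psi>. v \<psi> - ip \<phi> \<psi>) \<epsilon>)"

lemma test_on_lin: "test_on \<Omega> f \<Longrightarrow> test_on \<Omega> g \<Longrightarrow> test_on \<Omega> (\<lambda>x. a * f x + b * g x)"
proof -
  assume f: "test_on \<Omega> f" and g: "test_on \<Omega> g"
  have "tsupp (\<lambda>x. a * f x + b * g x) \<subseteq> tsupp f \<union> tsupp g"
    by (rule tsupp_subsetI) (auto simp: closed_tsupp tsupp_outside)
  thus ?thesis using f g by (auto simp: test_on_def test_lin)
qed

lemma regd_mono: "regd v K \<Longrightarrow> K \<le> L \<Longrightarrow> regd v L"
  unfolding regd_def by (meson mult_right_mono n2_nonneg order_trans)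

lemma appr_lin:
  assumes v: "appr \<Omega> v" and w: "appr \<Omega> w" shows "appr \<Omega> (\<lambda>\<phi>. a * v \<phi> + b * w \<phi>)"
  unfolding appr_def
proof (intro allI impI)
  fix \<epsilon> :: real assume e: "\<epsilon> > 0"
  define d where "d = \<epsilon> / (\<bar>a\<bar> + \<bar>b\<bar> + 1)"
  have d: "d > 0" using e by (simp add: d_def add_nonneg_pos)
  obtain f g where f: "test_on \<Omega> f" "regd (\<lambda>\<psi>. v \<psi> - ip f \<psi>) d" and g: "test_on \<Omega> g" "regd (\<lambda>\<psi>. w \<psi> - ip g \<psi>) d"
    using v w d unfolding appr_def by metis
  have "regd (\<lambda>\<psi>. a * (v \<psi> - ip f \<psi>) + b * (w \<psi> - ip g \<psi>)) (\<bar>a\<bar> * d + \<bar>b\<bar> * d)"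
    by (rule regd_lin[OF f(2) g(2)])
  moreover have "\<bar>a\<bar> * d + \<bar>b\<bar> * d \<le> \<epsilon>"
  proof -
    have "(\<bar>a\<bar> + \<bar>b\<bar>) * d \<le> (\<bar>a\<bar> + \<bar>b\<bar> + 1) * d" using d by (intro mult_right_mono) auto
    also have "\<dots> = \<epsilon>" by (simp add: d_def add_nonneg_pos less_imp_neq[symmetric])
    finally show ?thesis by (simp add: algebra_simps)
  qed
  ultimately have r: "regd (\<lambda>\<psi>. a * (v \<psi> - ip f \<psi>) + b * (w \<psi> - ip g \<psi>)) \<epsilon>" by (rule regd_mono)
  have L: "L2 f" "L2 g" using f g test_L2 by (auto simp: test_on_def)
  have "regd (\<lambda>\<psi>. (a * v \<psi> + b * w \<psi>) - ip (\<lambda>x. a * f x + b * g x) \<psi>) \<epsilon>"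
    using r unfolding regd_def tlin_def
    by (simp add: ip_lin_left L test_L2 test_lin test_pd algebra_simps)
  thus "\<exists>\<phi>. test_on \<Omega> \<phi> \<and> regd (\<lambda>\<psi>. (a * v \<psi> + b * w \<psi>) - ip \<phi> \<psi>) \<epsilon>"
    using test_on_lin[OF f(1) g(1)] by blast
qed

lemma test_on_zero: "test_on \<Omega> (\<lambda>_. 0)"
  by (simp add: test_on_def test_zero tsupp_def)

lemma appr_zero: "appr \<Omega> (\<lambda>_. 0)"
  unfolding appr_def
proof (intro allI impI exI conjI)
  show "test_on \<Omega> (\<lambda>_. 0)" by (rule test_on_zero)
  show "regd (\<lambda>\<psi>. 0 - ip (\<lambda>_. 0) \<psi>) \<epsilon>" if "\<epsilon> > 0" for \<epsilon>
    using regd_mono[OF regd_zero, of \<epsilon>] that by (simp add: ip_def)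
qed

lemma appr_H01:
  assumes v: "regd v K" and a: "appr \<Omega> v" shows "H01 \<Omega> (rep v)"
proof -
  have "\<exists>\<phi>. test_on \<Omega> \<phi> \<and> regd (\<lambda>\<psi>. v \<psi> - ip \<phi> \<psi>) (inverse (real (Suc n)))" for n
    using a unfolding appr_def by (metis inverse_positive_iff_positive of_nat_0_less_iff zero_less_Suc)
  then obtain \<phi> where p: "\<And>n. test_on \<Omega> (\<phi> n)" "\<And>n. regd (\<lambda>\<psi>. v \<psi> - ip (\<phi> n) \<psi>) (inverse (real (Suc n)))"
    by metis
  have t: "test (\<phi> n)" for n using p(1) by (simp add: test_on_def)
  have "h1norm (\<lambda>x. rep v x - \<phi> n x) \<le> 4 * inverse (real (Suc n))" for n
  proof -
    obtain g G where g: "L2 g" "n2 g \<le> inverse (real (Suc n))" "\<And>\<psi>. test \<psi> \<Longrightarrow> v \<psi> - ip (\<phi> n) \<psi> = ip g \<psi>"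
      and G: "\<And>i. L2 (G i)" "\<And>i. n2 (G i) \<le> inverse (real (Suc n))" "\<And>i. weak_pd i g (G i)"
      using regd_exists[OF p(2)] by metis
    have L: "L2 (\<lambda>x. rep v x - \<phi> n x)" by (intro L2_diff rep_props[OF v] test_L2 t)
    have i: "ip (\<lambda>x. rep v x - \<phi> n x) \<psi> = ip g \<psi>" if "test \<psi>" for \<psi>
      using ip_lin_left[OF rep_props(3)[OF v] test_L2[OF t] test_L2[OF that], of 1 "-1" n] rep_props(2)[OF v that] g(3)[OF that] by simp
    have "AE x in lborel. rep v x - \<phi> n x = g x" by (rule L2_AE_eqI[OF L g(1) i])
    hence n: "n2 (\<lambda>x. rep v x - \<phi> n x) = n2 g" using L g L2_measurable by (intro n2_AE_cong) auto
    have "weak_pd i (\<lambda>x. rep v x - \<phi> n x) (G i)" for i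
      using G(3)[of i] i test_pd unfolding weak_pd_ip by metis
    hence "h1norm (\<lambda>x. rep v x - \<phi> n x) \<le> n2 g + (\<Sum>i\<in>UNIV. n2 (G i))"
      using h1norm_le[of G, OF G(1)] n by metis
    also have "\<dots> \<le> inverse (real (Suc n)) + (\<Sum>i\<in>(UNIV::3 set). inverse (real (Suc n)))"
      by (intro add_mono sum_mono g G)
    finally show ?thesis by simp
  qed
  moreover have "h1norm u \<ge> 0" for u using n2_le_h1norm[of u] n2_nonneg[of u] by linarith
  moreover have "(\<lambda>n. 4 * inverse (real (Suc n))) \<longlonglongrightarrow> 4 * 0"
    by (intro tendsto_intros LIMSEQ_inverse_real_of_nat)
  hence l0: "(\<lambda>n. 4 * inverse (real (Suc n))) \<longlonglongrightarrow> 0" by simp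
  ultimately have "(\<lambda>n. h1norm (\<lambda>x. rep v x - \<phi> n x)) \<longlonglongrightarrow> 0"
    by (intro real_tendsto_sandwich[OF _ _ tendsto_const l0] always_eventually) blast+
  thus ?thesis unfolding H01_def using rep_props(1)[OF v] p(1) by blast
qed

section \<open>Partitions of unity and mollification\<close>

lemma partition_of_unity:
  assumes K: "compact K" and r: "\<And>x. x \<in> K \<Longrightarrow> r x > 0"
  shows "\<exists>I \<theta> V. finite I \<and> I \<subseteq> K \<and> (\<forall>a\<in>I. test (\<theta> a) \<and> tsupp (\<theta> a) \<subseteq> cball a (r a)) \<and>
    open V \<and> K \<subseteq> V \<and> (\<forall>x\<in>V. (\<Sum>a\<in>I. \<theta> a x) = 1)"
proof (cases "K = {}")
  case True
  thus ?thesis by (intro exI[of _ "{}"]) auto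
next
  case False
  have cov: "K \<subseteq> (\<Union>a\<in>K. ball a (r a))" using r by force
  obtain I where I: "I \<subseteq> K" "finite I" "K \<subseteq> (\<Union>a\<in>I. ball a (r a))"
    by (rule compactE_image[OF K _ cov]) auto
  define s where "s x = (\<Sum>a\<in>I. bump a (r a) x)" for x
  have rI: "r a > 0" if "a \<in> I" for a using r I(1) that by blast
  have s0: "s x \<ge> 0" for x unfolding s_def by (intro sum_nonneg bump_nonneg)
  have sK: "s x > 0" if x: "x \<in> K" for x
  proof -
    obtain a where a: "a \<in> I" "x \<in> ball a (r a)" using I(3) x by blast
    have "0 < bump a (r a) x" using a rI bump_pos_iff by blast
    also have "\<dots> \<le> s x" unfolding s_def using a I(2) by (intro member_le_sum) (auto simp: bump_nonneg)
    finally show ?thesis .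
  qed
  have ss: "smooth_fn s" unfolding s_def[abs_def] by (intro smooth_sum test_smooth test_bump rI)
  obtain x0 where x0: "x0 \<in> K" "\<And>x. x \<in> K \<Longrightarrow> s x0 \<le> s x"
    using continuous_attains_inf[OF K False smooth_continuous_on[OF ss]] by blast
  define c where "c = s x0 / 2"
  have c: "c > 0" "\<And>x. x \<in> K \<Longrightarrow> c < s x" using sK[OF x0(1)] x0(2) by (auto simp: c_def) (smt (verit) field_sum_of_halves)
  define \<zeta> where "\<zeta> x = inverse (s x + flat 0 (c - s x))" for x
  have pos: "s x + flat 0 (c - s x) > 0" for x
  proof (cases "s x < c")
    case True
    thus ?thesis using flat_pos_iff[of 0 "c - s x"] s0[of x] by linarith
  next
    case False
    thus ?thesis using c(1) flat_nonneg[of 0 "c - s x"] by linarith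
  qed
  have sz: "smooth_fn \<zeta>" unfolding \<zeta>_def[abs_def]
    by (intro smooth_inverse smooth_add smooth_flat smooth_diff smooth_const ss) (use pos in \<open>simp add: less_imp_neq[symmetric]\<close>)
  define \<theta> where "\<theta> a x = \<zeta> x * bump a (r a) x" for a x
  have "test (\<theta> a) \<and> tsupp (\<theta> a) \<subseteq> cball a (r a)" if a: "a \<in> I" for a
  proof
    show "test (\<theta> a)" unfolding \<theta>_def[abs_def] by (intro test_mult sz test_bump rI a)
    have "\<theta> a x = 0" if "x \<notin> cball a (r a)" for x
    proof -
      have "x \<notin> tsupp (bump a (r a))" using tsupp_bump[OF rI[OF a], of a] that by blast
      thus ?thesis using tsupp_outside by (simp add: \<theta>_def)
    qed
    thus "tsupp (\<theta> a) \<subseteq> cball a (r a)" by (intro tsupp_subsetI closed_cball)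
  qed
  moreover have "open {x. c < s x}" by (rule open_Collect_less) (auto intro: smooth_continuous_on ss)
  moreover have "K \<subseteq> {x. c < s x}" using c by auto
  moreover have "(\<Sum>a\<in>I. \<theta> a x) = 1" if "x \<in> {x. c < s x}" for x
  proof -
    have "flat 0 (c - s x) = 0" using that by (simp add: flat_def)
    hence "\<zeta> x = inverse (s x)" by (simp add: \<zeta>_def)
    moreover have "(\<Sum>a\<in>I. \<theta> a x) = \<zeta> x * s x" by (simp add: \<theta>_def s_def sum_distrib_left)
    moreover have "s x > 0" using that c(1) by auto
    ultimately show ?thesis by simp
  qed
  ultimately show ?thesis using I by (intro exI[of _ I] exI[of _ \<theta>] exI[of _ "{x. c < s x}"]) blast
qed

lemma L2_test_mult:
  assumes \<theta>: "test \<theta>" and g: "L2 g" shows "L2 (\<lambda>x. \<theta> x * g x)"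
proof -
  obtain B where B: "\<And>x. \<bar>\<theta> x\<bar> \<le> B" using test_bounded[OF \<theta>] by blast
  have [measurable]: "\<theta> \<in> borel_measurable borel" "g \<in> borel_measurable borel" using test_borel[OF \<theta>] L2_measurable[OF g] by auto
  have "integrable lborel (\<lambda>x. (\<theta> x * g x)\<^sup>2)"
  proof (rule Bochner_Integration.integrable_bound)
    show "integrable lborel (\<lambda>x. B\<^sup>2 * (g x)\<^sup>2)" using L2_integrable[OF g] by simp
    have "(\<theta> x)\<^sup>2 \<le> B\<^sup>2" for x using B[of x] by (metis abs_ge_zero power2_abs power_mono)
    thus "AE x in lborel. norm ((\<theta> x * g x)\<^sup>2) \<le> norm (B\<^sup>2 * (g x)\<^sup>2)"
      by (intro AE_I2) (simp add: power_mult_distrib mult_right_mono)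
  qed measurable
  thus ?thesis by (simp add: L2_def)
qed

lemma avg_lim:
  fixes N :: "nat \<Rightarrow> 'a measure"
  assumes k: "\<And>n. kern (N n) (k n) (R n)" and R: "R \<longlonglongrightarrow> 0" and f: "L2 f"
  shows "(\<lambda>n. n2 (\<lambda>x. avg (N n) (k n) f x - f x)) \<longlonglongrightarrow> 0"
proof (rule LIMSEQ_I)
  fix \<epsilon> :: real assume e: "\<epsilon> > 0"
  obtain \<phi> where p: "test \<phi>" "n2 (\<lambda>x. \<phi> x - f x) < \<epsilon> / 4" using test_dense[OF f, of "\<epsilon> / 4"] e by auto
  from avg_close[OF p(1), where 'a='a] obtain C where C: "C \<ge> 0"
    "\<And>(N :: 'a measure) k R. kern N k R \<Longrightarrow> R \<le> 1 \<Longrightarrow> n2 (\<lambda>x. avg N k \<phi> x - \<phi> x) \<le> C * R" by blast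
  have "(\<lambda>n. C * R n) \<longlonglongrightarrow> C * 0" by (intro tendsto_intros R)
  hence "\<forall>\<^sub>F n in sequentially. C * R n < \<epsilon> / 4" by (rule order_tendstoD) (use e in simp)
  moreover have "\<forall>\<^sub>F n in sequentially. R n < 1" by (rule order_tendstoD[OF R]) simp
  ultimately have "\<forall>\<^sub>F n in sequentially. norm (n2 (\<lambda>x. avg (N n) (k n) f x - f x) - 0) < \<epsilon>"
  proof eventually_elim
    case (elim n)
    let ?A = "avg (N n) (k n)"
    have L: "L2 (?A f)" "L2 (?A \<phi>)" "L2 \<phi>" "L2 (?A (\<lambda>x. f x - \<phi> x))"
      using L2_avg(1)[OF k] f test_L2[OF p(1)] L2_diff by blast+
    have "n2 (\<lambda>x. ?A f x - ?A \<phi> x) = n2 (?A (\<lambda>x. f x - \<phi> x))"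
      using avg_diff_AE[OF k f L(3), of n] by (intro n2_AE_cong L2_measurable L L2_diff) auto
    also have "\<dots> \<le> n2 (\<lambda>x. f x - \<phi> x)" by (intro L2_avg(2)[OF k] L2_diff f L)
    finally have 1: "n2 (\<lambda>x. ?A f x - ?A \<phi> x) < \<epsilon> / 4" using p(2) by (simp add: n2_minus_commute[of f \<phi>])
    have "n2 (\<lambda>x. ?A f x - f x) \<le> n2 (\<lambda>x. ?A f x - ?A \<phi> x) + n2 (\<lambda>x. ?A \<phi> x - f x)"
      by (rule n2_diff_triangle[OF L(1,2) f])
    moreover have "n2 (\<lambda>x. ?A \<phi> x - f x) \<le> n2 (\<lambda>x. ?A \<phi> x - \<phi> x) + n2 (\<lambda>x. \<phi> x - f x)"
      by (rule n2_diff_triangle[OF L(2,3) f])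
    moreover have "n2 (\<lambda>x. ?A \<phi> x - \<phi> x) \<le> C * R n" by (rule C(2)[OF k]) (use elim in simp)
    ultimately have "n2 (\<lambda>x. ?A f x - f x) < \<epsilon>" using 1 p(2) elim(1) e by linarith
    thus ?case by simp
  qed
  thus "\<exists>no. \<forall>n\<ge>no. norm (n2 (\<lambda>x. avg (N n) (k n) f x - f x) - 0) < \<epsilon>"
    by (simp add: eventually_sequentially)
qed

lemma integral_reflect:
  fixes h :: fn
  assumes [measurable]: "h \<in> borel_measurable borel"
  shows "(\<integral>y. h y \<partial>lborel) = (\<integral>z. h (x - z) \<partial>lborel)"
proof -
  have "lborel = distr lborel borel (\<lambda>z. x + (-1) *\<^sub>R z)"
    using lborel_affine[of "-1" x] by (simp add: density_1)
  hence "(\<integral>y. h y \<partial>lborel) = (\<integral>y. h y \<partial>distr lborel borel (\<lambda>z. x + (-1) *\<^sub>R z))" by simp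
  also have "\<dots> = (\<integral>z. h (x - z) \<partial>lborel)" by (subst integral_distr) auto
  finally show ?thesis .
qed

lemma bump_integral_pos: assumes r: "r > 0" shows "integral\<^sup>L lborel (bump a r) > 0"
proof -
  have i: "integrable lborel (bump a r)" by (rule test_integrable[OF test_bump[OF r]])
  have "integral\<^sup>L lborel (bump a r) \<noteq> 0"
  proof
    assume "integral\<^sup>L lborel (bump a r) = 0"
    hence "AE x in lborel. bump a r x = 0"
      using integral_nonneg_eq_0_iff_AE[OF i] by (simp add: bump_nonneg)
    hence "AE x in lborel. x \<notin> ball a r"
      by eventually_elim (use bump_pos_iff[OF r, of a] in force)
    hence "ball a r \<in> null_sets lborel" by (subst (asm) AE_iff_null_sets[symmetric]) auto
    hence "negligible (ball a r)" by (simp add: negligible_iff_null_sets null_sets_completionI)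
    thus False using open_not_negligible[of "ball a r"] r by auto
  qed
  moreover have "integral\<^sup>L lborel (bump a r) \<ge> 0" by (simp add: bump_nonneg)
  ultimately show ?thesis by linarith
qed

definition mol :: "pt \<Rightarrow> real \<Rightarrow> fn" where "mol p q x = inverse (integral\<^sup>L lborel (bump p q)) * bump p q x"

lemma test_mol: "q > 0 \<Longrightarrow> test (mol p q)"
  unfolding mol_def[abs_def] by (intro test_cmult test_bump)

lemma mol_nonneg: "mol p q x \<ge> 0"
  by (simp add: mol_def bump_nonneg)

lemma mol_outside: "q > 0 \<Longrightarrow> x \<notin> ball p q \<Longrightarrow> mol p q x = 0"
  using bump_pos_iff[of q p x] bump_nonneg[of p q x] by (simp add: mol_def)

lemma kern_mol:
  assumes q: "q > 0"
  shows "kern (density lborel (\<lambda>x. ennreal (mol p q x))) (\<lambda>y. if y \<in> ball p q then - y else 0) (norm p + q)"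
  unfolding kern_def
proof (intro conjI ballI)
  have [measurable]: "mol p q \<in> borel_measurable borel" by (rule test_borel[OF test_mol[OF q]])
  have "(\<integral>\<^sup>+x. ennreal (mol p q x) \<partial>lborel) = ennreal (integral\<^sup>L lborel (mol p q))"
    by (intro nn_integral_eq_integral test_integrable test_mol q) (simp add: mol_nonneg)
  also have "integral\<^sup>L lborel (mol p q) = 1"
    using bump_integral_pos[OF q, of p] by (simp add: mol_def[abs_def])
  finally show "prob_space (density lborel (\<lambda>x. ennreal (mol p q x)))"
    by (intro prob_spaceI) (simp add: emeasure_density)
  show "(\<lambda>y. if y \<in> ball p q then - y else 0) \<in> borel_measurable (density lborel (\<lambda>x. ennreal (mol p q x)))"
    by (rule measurable_If_set) auto
  fix y
  have "norm y \<le> norm p + dist p y" by (metis dist_norm norm_minus_commute norm_triangle_sub)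
  thus "norm (if y \<in> ball p q then - y else 0) \<le> norm p + q" using q by auto
qed

lemma avg_mol:
  assumes q: "q > 0" and w: "w \<in> borel_measurable borel"
  shows "avg (density lborel (\<lambda>x. ennreal (mol p q x))) (\<lambda>y. if y \<in> ball p q then - y else 0) w
    = wavg lborel w uminus (mol p q)"
proof
  fix x
  have [measurable]: "mol p q \<in> borel_measurable borel" "w \<in> borel_measurable borel"
    using test_borel[OF test_mol[OF q]] w by auto
  have "avg (density lborel (\<lambda>x. ennreal (mol p q x))) (\<lambda>y. if y \<in> ball p q then - y else 0) w x
    = (\<integral>y. mol p q y * w (x + (if y \<in> ball p q then - y else 0)) \<partial>lborel)"
    unfolding avg_def by (subst integral_density) (auto simp: mol_nonneg)
  also have "\<dots> = (\<integral>y. mol p q y * w (x - y) \<partial>lborel)"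
    by (intro Bochner_Integration.integral_cong) (auto simp: mol_outside[OF q])
  also have "\<dots> = (\<integral>z. mol p q (x - z) * w (x - (x - z)) \<partial>lborel)" by (rule integral_reflect) measurable
  also have "\<dots> = wavg lborel w uminus (mol p q) x" by (simp add: wavg_def mult.commute)
  finally show "avg (density lborel (\<lambda>x. ennreal (mol p q x))) (\<lambda>y. if y \<in> ball p q then - y else 0) w x
    = wavg lborel w uminus (mol p q) x" .
qed

lemma bump_reflect: "bump p q (x - z) = bump (x - p) q z"
proof -
  have "((x - z) $ i - p $ i)\<^sup>2 = (z $ i - (x - p) $ i)\<^sup>2" for i
    by (simp add: power2_eq_square algebra_simps)
  thus ?thesis by (simp add: bump_def)
qed

lemma wavg_mol_ip: "wavg lborel w uminus (mol p q) x = inverse (integral\<^sup>L lborel (bump p q)) * ip w (bump (x - p) q)"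
  unfolding wavg_def ip_def
  by (subst Bochner_Integration.integral_mult_right_zero[symmetric], rule Bochner_Integration.integral_cong)
     (simp_all add: mol_def bump_reflect[symmetric] mult_ac)

text \<open>A functional supported in a compact set \<open>K\<close> that a cone of small translations moves into \<open>\<Omega>\<close> is
  approximated by convolving with mollifiers supported in that cone.\<close>

lemma appr_local:
  assumes v: "regd v C" and K: "compact K"
    and supp: "\<And>\<phi>. test \<phi> \<Longrightarrow> tsupp \<phi> \<inter> K = {} \<Longrightarrow> v \<phi> = 0"
    and \<rho>: "\<rho> > 0" and s0: "s0 > 0"
    and cone: "\<And>y s a. y \<in> K \<Longrightarrow> 0 < s \<Longrightarrow> s \<le> s0 \<Longrightarrow> a \<in> ball w \<rho> \<Longrightarrow> y + s *\<^sub>R a \<in> \<Omega>"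
  shows "appr \<Omega> v"
proof -
  have "\<exists>I \<theta> V. finite I \<and> I \<subseteq> K \<and> (\<forall>a\<in>I. test (\<theta> a) \<and> tsupp (\<theta> a) \<subseteq> cball a 1) \<and>
    open V \<and> K \<subseteq> V \<and> (\<forall>x\<in>V. (\<Sum>a\<in>I. \<theta> a x) = (1::real))"
    by (rule partition_of_unity[OF K]) simp
  then obtain I \<theta>' V where H: "finite I \<and> I \<subseteq> K \<and> (\<forall>a\<in>I. test (\<theta>' a) \<and> tsupp (\<theta>' a) \<subseteq> cball a 1) \<and>
    open V \<and> K \<subseteq> V \<and> (\<forall>x\<in>V. (\<Sum>a\<in>I. \<theta>' a x) = (1::real))" by (elim exE)
  have I: "\<forall>a\<in>I. test (\<theta>' a)" and V: "open V" "K \<subseteq> V" "\<And>x. x \<in> V \<Longrightarrow> (\<Sum>a\<in>I. \<theta>' a x) = 1"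
    using H by simp_all
  define \<theta> where "\<theta> x = (\<Sum>a\<in>I. \<theta>' a x)" for x
  have \<theta>: "test \<theta>" unfolding \<theta>_def[abs_def] using I by (intro test_sum) auto
  obtain g G where g: "L2 g" "\<And>\<phi>. test \<phi> \<Longrightarrow> v \<phi> = ip g \<phi>" and G: "\<And>i. L2 (G i)" "\<And>i. weak_pd i g (G i)"
    using regd_exists[OF v] by blast
  define f where "f = (\<lambda>x. \<theta> x * g x)"
  have f: "L2 f" unfolding f_def by (rule L2_test_mult[OF \<theta> g(1)])
  have fi: "integrable lborel f" unfolding f_def by (rule L2_mult_integrable[OF test_L2[OF \<theta>] g(1)])
  have fm: "f \<in> borel_measurable borel" using L2_measurable[OF f] by simp
  have ipf: "ip f \<phi> = v \<phi>" if t: "test \<phi>" for \<phi>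
  proof -
    have c: "test (\<lambda>x. \<theta> x * \<phi> x)" by (intro test_mult test_smooth \<theta> t)
    have "tsupp (\<lambda>x. \<phi> x - \<theta> x * \<phi> x) \<subseteq> - V"
      by (rule tsupp_subsetI) (use V in \<open>auto simp: \<theta>_def\<close>)
    hence "v (\<lambda>x. \<phi> x - \<theta> x * \<phi> x) = 0" using V(2) by (intro supp test_diff t c) auto
    hence "v \<phi> = v (\<lambda>x. \<theta> x * \<phi> x)" using tlin_diff[OF regdD(1)[OF v] t c] by simp
    also have "\<dots> = ip f \<phi>" unfolding g(2)[OF c] f_def by (simp add: ip_def mult_ac)
    finally show ?thesis ..
  qed
  have fw: "weak_pd i f (G i)" for i
    unfolding weak_pd_ip using G(2)[of i] ipf g(2) test_pd unfolding weak_pd_ip by metis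
  define s where "s n = s0 * inverse (real (Suc n))" for n
  have s: "0 < s n" "s n \<le> s0" for n using s0 by (auto simp: s_def mult_le_cancel_left1 inverse_le_1_iff)
  have slim: "s \<longlonglongrightarrow> s0 * 0" unfolding s_def by (intro tendsto_intros LIMSEQ_inverse_real_of_nat)
  define p where "p n = s n *\<^sub>R w" for n
  define q where "q n = s n * (\<rho> / 2)" for n
  have q: "q n > 0" for n using s \<rho> by (simp add: q_def)
  define N where "N n = density lborel (\<lambda>x. ennreal (mol (p n) (q n) x))" for n
  define k where "k n = (\<lambda>y. if y \<in> ball (p n) (q n) then - y else 0)" for n
  have kern: "kern (N n) (k n) (norm (p n) + q n)" for n unfolding N_def k_def by (rule kern_mol[OF q])
  have Rl: "(\<lambda>n. norm (p n) + q n) \<longlonglongrightarrow> 0"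
  proof -
    have "(\<lambda>n. norm (s n *\<^sub>R w) + s n * (\<rho> / 2)) \<longlonglongrightarrow> norm ((s0 * 0) *\<^sub>R w) + (s0 * 0) * (\<rho> / 2)"
      by (intro tendsto_intros slim)
    thus ?thesis by (simp add: p_def q_def)
  qed
  define h where "h n = avg (N n) (k n) f" for n
  have hw: "h n = wavg lborel f uminus (mol (p n) (q n))" for n
    unfolding h_def N_def k_def by (rule avg_mol[OF q fm])
  have hon: "test_on \<Omega> (h n)" for n
  proof -
    define S where "S = {x + y | x y. x \<in> K \<and> y \<in> cball (p n) (q n)}"
    have cS: "compact S" unfolding S_def by (rule compact_sums[OF K compact_cball])
    have z: "h n x = 0" if "x \<notin> S" for x
    proof -
      have "tsupp (bump (x - p n) (q n)) \<inter> K = {}"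
      proof (rule ccontr)
        assume "tsupp (bump (x - p n) (q n)) \<inter> K \<noteq> {}"
        then obtain y where y: "y \<in> K" "y \<in> cball (x - p n) (q n)" using tsupp_bump[OF q, of "x - p n" n] by blast
        have "x = y + (x - y)" "dist (p n) (x - y) \<le> q n"
          using y(2) by (auto simp: dist_norm norm_minus_commute algebra_simps)
        thus False using y(1) \<open>x \<notin> S\<close> unfolding S_def by force
      qed
      thus ?thesis unfolding hw wavg_mol_ip by (simp add: ipf test_bump q supp)
    qed
    have sm: "smooth_fn (h n)" unfolding hw by (rule smooth_wavg[OF test_mol[OF q] fi]) measurable
    have "tsupp (h n) \<subseteq> S" by (rule tsupp_subsetI[OF compact_imp_closed[OF cS] z])
    moreover have "S \<subseteq> \<Omega>"
    proof
      fix z assume "z \<in> S"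
      then obtain y e where y: "y \<in> K" "e \<in> cball (p n) (q n)" "z = y + e" by (auto simp: S_def)
      have "norm (e - p n) \<le> s n * (\<rho> / 2)"
        using y(2) by (simp add: dist_norm norm_minus_commute q_def)
      hence "\<bar>1 / s n\<bar> * norm (e - p n) \<le> \<rho> / 2" using s(1)[of n] by (simp add: field_simps)
      hence "norm ((1 / s n) *\<^sub>R (e - p n)) \<le> \<rho> / 2" by (simp only: norm_scaleR)
      moreover have "(1 / s n) *\<^sub>R (e - p n) = (1 / s n) *\<^sub>R e - w"
        using s(1)[of n] by (simp add: p_def scaleR_diff_right)
      ultimately have "(1 / s n) *\<^sub>R e \<in> ball w \<rho>" using \<rho> by (simp add: dist_norm norm_minus_commute)
      from cone[OF y(1) s(1)[of n] s(2)[of n] this] show "z \<in> \<Omega>" using y(3) s(1)[of n] by simp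
    qed
    moreover have "test (h n)" unfolding test_def
      using sm \<open>tsupp (h n) \<subseteq> S\<close> cS closed_tsupp by (meson bounded_subset compact_eq_bounded_closed)
    ultimately show ?thesis by (auto simp: test_on_def)
  qed
  show ?thesis unfolding appr_def
  proof (intro allI impI)
    fix \<epsilon> :: real assume e: "\<epsilon> > 0"
    have "\<forall>\<^sub>F n in sequentially. n2 (\<lambda>x. h n x - f x) < \<epsilon>"
      unfolding h_def by (rule order_tendstoD(2)[OF avg_lim[OF kern Rl f] e])
    moreover have "\<forall>\<^sub>F n in sequentially. \<forall>i\<in>UNIV. n2 (\<lambda>x. avg (N n) (k n) (G i) x - G i x) < \<epsilon>"
      by (intro eventually_ball_finite finite_class.finite_UNIV ballI order_tendstoD(2)[OF avg_lim[OF kern Rl G(1)] e])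
    ultimately have "\<forall>\<^sub>F n in sequentially. n2 (\<lambda>x. h n x - f x) < \<epsilon> \<and> (\<forall>i\<in>UNIV. n2 (\<lambda>x. avg (N n) (k n) (G i) x - G i x) < \<epsilon>)"
      by (rule eventually_conj)
    then obtain n where n: "n2 (\<lambda>x. h n x - f x) < \<epsilon>" "\<And>i. n2 (\<lambda>x. avg (N n) (k n) (G i) x - G i x) < \<epsilon>"
      by (auto simp: eventually_sequentially)
    have Lh: "L2 (h n)" unfolding h_def by (rule L2_avg(1)[OF kern f])
    have hwk: "weak_pd i (h n) (avg (N n) (k n) (G i))" for i
      unfolding h_def by (rule weak_pd_avg[OF kern f G(1) fw])
    have b: "\<bar>ip u \<psi> - ip u' \<psi>\<bar> \<le> \<epsilon> * n2 \<psi>" if "L2 u" "L2 u'" "test \<psi>" "n2 (\<lambda>x. u' x - u x) < \<epsilon>" for u u' \<psi>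
    proof -
      have "\<bar>ip u \<psi> - ip u' \<psi>\<bar> = \<bar>ip (\<lambda>x. 1 * u x + (-1) * u' x) \<psi>\<bar>"
        using ip_lin_left[OF that(1,2) test_L2[OF that(3)], of 1 "-1"] by simp
      also have "\<dots> \<le> n2 (\<lambda>x. 1 * u x + (-1) * u' x) * n2 \<psi>" by (intro ip_bound L2_lin that test_L2)
      also have "\<dots> = n2 (\<lambda>x. u' x - u x) * n2 \<psi>" by (simp add: n2_minus_commute[of u u'])
      also have "\<dots> \<le> \<epsilon> * n2 \<psi>" using that(4) by (intro mult_right_mono) auto
      finally show ?thesis .
    qed
    have "regd (\<lambda>\<psi>. v \<psi> - ip (h n) \<psi>) \<epsilon>"
      unfolding regd_def
    proof (intro conjI allI impI)
      show "tlin (\<lambda>\<psi>. v \<psi> - ip (h n) \<psi>)"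
        using regdD(1)[OF v] Lh by (simp add: tlin_def ip_lin_right test_L2 algebra_simps)
      show "0 \<le> \<epsilon>" using e by simp
      fix \<psi> assume t: "test \<psi>"
      show "\<bar>v \<psi> - ip (h n) \<psi>\<bar> \<le> \<epsilon> * n2 \<psi>"
        unfolding ipf[OF t, symmetric] by (rule b[OF f Lh t n(1)])
      fix j
      have "v (pd j \<psi>) - ip (h n) (pd j \<psi>) = ip (avg (N n) (k n) (G j)) \<psi> - ip (G j) \<psi>"
        using fw[of j] hwk[of j] t by (simp add: ipf[OF test_pd[OF t], symmetric] weak_pd_ip)
      thus "\<bar>v (pd j \<psi>) - ip (h n) (pd j \<psi>)\<bar> \<le> \<epsilon> * n2 \<psi>"
        using b[OF G(1) L2_avg(1)[OF kern G(1)] t n(2), of j] by (simp add: abs_minus_commute)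
    qed
    thus "\<exists>\<phi>. test_on \<Omega> \<phi> \<and> regd (\<lambda>\<psi>. v \<psi> - ip \<phi> \<psi>) \<epsilon>" using hon by blast
  qed
qed

section \<open>Local parametrices near the boundary\<close>

lemma local_cone:
  assumes o: "open \<Omega>" and lip: "lipschitz_boundary \<Omega>" and x: "x \<in> closure \<Omega>"
  shows "\<exists>w \<rho> r s0. \<rho> > 0 \<and> r > 0 \<and> s0 > 0 \<and>
    (\<forall>y s a. y \<in> closure \<Omega> \<longrightarrow> y \<in> cball x r \<longrightarrow> 0 < s \<longrightarrow> s \<le> s0 \<longrightarrow> a \<in> ball w \<rho> \<longrightarrow> y + s *\<^sub>R a \<in> \<Omega>)"
proof (cases "x \<in> \<Omega>")
  case True
  then obtain e where e: "e > 0" "ball x e \<subseteq> \<Omega>" using o open_contains_ball by blast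
  have "y + s *\<^sub>R a \<in> \<Omega>" if y: "y \<in> cball x (e/2)" and s: "0 < s" "s \<le> e/2" and a: "a \<in> ball 0 1" for y a :: pt and s
  proof -
    have "norm (s *\<^sub>R a) < e / 2" using s a by (simp add: mult_le_less_imp_less[of s "e/2" "norm a" 1, simplified])
    moreover have "dist x (y + s *\<^sub>R a) \<le> dist x y + norm (s *\<^sub>R a)"
      by (metis add_diff_cancel_left' dist_norm dist_triangle norm_minus_commute)
    ultimately have "y + s *\<^sub>R a \<in> ball x e" using y by simp
    thus ?thesis using e(2) by blast
  qed
  thus ?thesis using e(1) by (intro exI[of _ 0] exI[of _ 1] exI[of _ "e/2"]) auto
next
  case False
  hence "x \<in> frontier \<Omega>" using x o by (simp add: frontier_def interior_open)
  then obtain r Q \<gamma> L where r: "r > 0" and Q: "orthogonal_matrix (Q::real^3^3)" and \<gamma>: "L-lipschitz_on UNIV (\<gamma>::real\<times>real \<Rightarrow> real)"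
    and \<Omega>: "\<And>y. y \<in> ball x r \<Longrightarrow> y \<in> \<Omega> \<longleftrightarrow> (Q *v y) $ 3 < \<gamma> ((Q *v y) $ 1, (Q *v y) $ 2)"
    using lip unfolding lipschitz_boundary_def by blast
  have L: "L \<ge> 0" using \<gamma> by (rule lipschitz_on_nonneg)
  define w where "w = transpose Q *v (- axis 3 1)"
  have Qw: "Q *v w = - axis 3 1"
    unfolding w_def matrix_vector_mul_assoc using Q by (simp add: orthogonal_matrix_def)
  define \<rho> where "\<rho> = 1 / (2 + 2 * L)"
  have \<rho>: "\<rho> > 0" "\<rho> * (1 + 2 * L) < 1" using L by (auto simp: \<rho>_def field_simps)
  define s0 where "s0 = r / (4 * (norm w + \<rho>))"
  have s0: "s0 > 0" unfolding s0_def using r \<rho> by (simp add: add_nonneg_pos)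
  define F where "F y = \<gamma> ((Q *v y) $ 1, (Q *v y) $ 2) - (Q *v y) $ 3" for y
  have cF: "continuous_on UNIV F"
  proof -
    have "continuous_on UNIV \<gamma>" using \<gamma> by (rule lipschitz_on_continuous_on)
    hence "continuous_on UNIV (\<lambda>y. \<gamma> ((Q *v y) $ 1, (Q *v y) $ 2))"
      by (rule continuous_on_compose2)
         (auto intro!: continuous_on_Pair continuous_on_component matrix_vector_mult_linear_continuous_on)
    thus ?thesis unfolding F_def[abs_def]
      by (intro continuous_on_diff) (auto intro!: continuous_on_component matrix_vector_mult_linear_continuous_on)
  qed
  have Fpos: "F y \<ge> 0" if y: "y \<in> closure \<Omega>" "y \<in> cball x (r/4)" for y
  proof -
    have "y \<in> ball x r" using y(2) r by simp
    hence "y \<in> closure (ball x r \<inter> \<Omega>)" using y(1) open_Int_closure_subset[OF open_ball, of x r \<Omega>] by blast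
    moreover have "closure (ball x r \<inter> \<Omega>) \<subseteq> {y. 0 \<le> F y}"
      using \<Omega> cF by (intro closure_minimal closed_Collect_le) (auto simp: F_def intro: less_imp_le continuous_on_const)
    ultimately show ?thesis by blast
  qed
  have "y + s *\<^sub>R a \<in> \<Omega>"
    if y: "y \<in> closure \<Omega>" "y \<in> cball x (r/4)" and s: "0 < s" "s \<le> s0" and a: "a \<in> ball w \<rho>" for y s a
  proof -
    define d where "d = Q *v a"
    have "norm (Q *v (a - w)) = norm (a - w)"
      using Q orthogonal_transformation_matrix[of "(*v) Q"] by (metis matrix_of_matrix_vector_mul matrix_vector_mul_linear orthogonal_transformation)
    hence nd: "norm (d + axis 3 1) < \<rho>" using a by (simp add: matrix_vector_mult_diff_distrib Qw d_def dist_norm norm_minus_commute)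
    have d3: "d $ 3 < - 1 + \<rho>" using component_le_norm_cart[of "d + axis 3 1" 3] nd by (simp add: axis_def)
    have d1: "\<bar>d $ 1\<bar> \<le> \<rho>" "\<bar>d $ 2\<bar> \<le> \<rho>"
      using component_le_norm_cart[of "d + axis 3 1" 1] component_le_norm_cart[of "d + axis 3 1" 2] nd by (simp_all add: axis_def)
    have "norm a \<le> norm w + \<rho>"
      using a norm_triangle_sub[of a w] by (simp add: dist_norm norm_minus_commute)
    hence "norm (s *\<^sub>R a) \<le> s0 * (norm w + \<rho>)" using s by (simp add: mult_mono)
    also have "\<dots> = r / 4"
    proof -
      have "norm w + \<rho> > 0" using \<rho>(1) by (simp add: add_nonneg_pos)
      thus ?thesis by (simp only: s0_def) (simp add: field_simps)
    qed
    finally have "norm (s *\<^sub>R a) \<le> r / 4" .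
    moreover have "dist x (y + s *\<^sub>R a) \<le> dist x y + norm (s *\<^sub>R a)"
      by (metis add_diff_cancel_left' dist_norm dist_triangle norm_minus_commute)
    ultimately have b: "y + s *\<^sub>R a \<in> ball x r" using y(2) r by simp
    let ?p = "((Q *v y) $ 1, (Q *v y) $ 2)" and ?q = "((Q *v (y + s *\<^sub>R a)) $ 1, (Q *v (y + s *\<^sub>R a)) $ 2)"
    have Qs: "Q *v (y + s *\<^sub>R a) = Q *v y + s *\<^sub>R d"
      by (simp add: d_def matrix_vector_right_distrib matrix_vector_mult_scaleR)
    have "dist ?p ?q \<le> \<bar>s * d $ 1\<bar> + \<bar>s * d $ 2\<bar>"
      by (simp add: Qs dist_prod_def dist_real_def sqrt_sum_squares_le_sum_abs[of "s * d $ 1" "s * d $ 2"])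
    also have "\<dots> \<le> s * (2 * \<rho>)" using d1 s by (simp add: abs_mult distrib_left[symmetric])
    finally have "L * dist ?p ?q \<le> L * (s * (2 * \<rho>))" using L by (rule mult_left_mono)
    moreover have "\<bar>\<gamma> ?p - \<gamma> ?q\<bar> \<le> L * dist ?p ?q"
      using lipschitz_onD[OF \<gamma>, of ?p ?q] by (simp add: dist_real_def)
    ultimately have "\<gamma> ?q \<ge> \<gamma> ?p - L * (s * (2 * \<rho>))" by linarith
    moreover have "(Q *v (y + s *\<^sub>R a)) $ 3 = (Q *v y) $ 3 + s * d $ 3" by (simp add: Qs)
    moreover have "s * d $ 3 < s * (- 1 + \<rho>)" using d3 s by simp
    moreover have "s * (\<rho> * (1 + 2 * L)) < s * 1" using \<rho>(2) s by simp
    hence "s * (- 1 + \<rho>) + L * (s * (2 * \<rho>)) < 0" by (simp add: algebra_simps)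
    ultimately have "(Q *v (y + s *\<^sub>R a)) $ 3 < \<gamma> ?q" using Fpos[OF y] unfolding F_def by linarith
    thus ?thesis using \<Omega>[OF b] by simp
  qed
  thus ?thesis using \<rho>(1) r s0
    by (intro exI[of _ w] exI[of _ \<rho>] exI[of _ "r/4"] exI[of _ s0]) auto
qed

text \<open>\<open>E\<close> maps \<open>H\<^sup>-\<^sup>1\<close> to \<open>H\<^sup>1\<close> and carries functionals supported in \<open>K\<close> into the closure of the
  test functions on \<open>\<Omega>\<close>; it is the limit of the transposes of the operators \<open>A N\<close>, which commute
  with derivatives.\<close>

definition local_op :: "pt set \<Rightarrow> pt set \<Rightarrow> (nat \<Rightarrow> fn \<Rightarrow> fn) \<Rightarrow> (distr \<Rightarrow> distr) \<Rightarrow> bool" where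
  "local_op \<Omega> K A E \<longleftrightarrow> (\<exists>B\<ge>0. \<forall>u C. hmd u C \<longrightarrow> regd (E u) (B * C)) \<and>
    (\<forall>u C. hmd u C \<longrightarrow> supp_in u K \<longrightarrow> appr \<Omega> (E u)) \<and>
    (\<forall>N \<phi>. test \<phi> \<longrightarrow> test (A N \<phi>)) \<and>
    (\<forall>N \<phi> i. test \<phi> \<longrightarrow> pd i (A N \<phi>) = A N (pd i \<phi>)) \<and>
    (\<forall>u C \<phi>. hmd u C \<longrightarrow> test \<phi> \<longrightarrow> (\<lambda>N. u (A N \<phi>)) \<longlonglongrightarrow> E u \<phi>)"

lemma local_opI:
  assumes B: "B \<ge> 0" "\<And>u C. hmd u C \<Longrightarrow> regd (E u) (B * C)"
    and t: "\<And>N \<phi>. test \<phi> \<Longrightarrow> test (A N \<phi>)" and p: "\<And>N \<phi> i. test \<phi> \<Longrightarrow> pd i (A N \<phi>) = A N (pd i \<phi>)"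
    and l: "\<And>u C \<phi>. hmd u C \<Longrightarrow> test \<phi> \<Longrightarrow> (\<lambda>N. u (A N \<phi>)) \<longlonglongrightarrow> E u \<phi>"
    and K: "compact K" "compact T" and s: "\<And>N \<phi> x. A N \<phi> x \<noteq> 0 \<Longrightarrow> \<exists>t\<in>T. \<phi> (x + t) \<noteq> 0"
    and \<rho>: "\<rho> > 0" "s0 > 0"
    and cone: "\<And>y t s a. y \<in> K \<Longrightarrow> t \<in> T \<Longrightarrow> 0 < s \<Longrightarrow> s \<le> s0 \<Longrightarrow> a \<in> ball w \<rho> \<Longrightarrow> (y + t) + s *\<^sub>R a \<in> \<Omega>"
  shows "local_op \<Omega> K A E"
proof -
  have "appr \<Omega> (E u)" if u: "hmd u C" and su: "supp_in u K" for u C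
  proof (rule appr_local[OF B(2)[OF u] _ _ \<rho>])
    show "compact {x + y | x y. x \<in> K \<and> y \<in> T}" by (rule compact_sums[OF K])
    show "z + s *\<^sub>R a \<in> \<Omega>" if "z \<in> {x + y | x y. x \<in> K \<and> y \<in> T}" "0 < s" "s \<le> s0" "a \<in> ball w \<rho>" for z s a
      using that cone by blast
    fix \<phi> assume f: "test \<phi>" and d: "tsupp \<phi> \<inter> {x + y | x y. x \<in> K \<and> y \<in> T} = {}"
    have "u (A N \<phi>) = 0" for N
    proof -
      have "tsupp (A N \<phi>) \<subseteq> {x - y | x y. x \<in> tsupp \<phi> \<and> y \<in> T}"
      proof (rule tsupp_subsetI)
        show "closed {x - y | x y. x \<in> tsupp \<phi> \<and> y \<in> T}"
          using f K by (intro compact_imp_closed compact_differences) (auto simp: test_def)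
        fix x assume x: "x \<notin> {x - y | x y. x \<in> tsupp \<phi> \<and> y \<in> T}"
        show "A N \<phi> x = 0"
        proof (rule ccontr)
          assume "A N \<phi> x \<noteq> 0"
          then obtain t where t: "t \<in> T" "\<phi> (x + t) \<noteq> 0" using s by blast
          hence "x + t \<in> tsupp \<phi>" using tsupp_outside by blast
          hence "(x + t) - t \<in> {x - y | x y. x \<in> tsupp \<phi> \<and> y \<in> T}" using t(1) by blast
          thus False using x by simp
        qed
      qed
      moreover have "{x - y | x y. x \<in> tsupp \<phi> \<and> y \<in> T} \<inter> K = {}"
      proof (rule ccontr)
        assume "{x - y | x y. x \<in> tsupp \<phi> \<and> y \<in> T} \<inter> K \<noteq> {}"
        then obtain x y where xy: "x \<in> tsupp \<phi>" "y \<in> T" "x - y \<in> K" by blast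
        hence "(x - y) + y \<in> {x + y | x y. x \<in> K \<and> y \<in> T}" by blast
        thus False using xy(1) d by auto
      qed
      ultimately have "tsupp (A N \<phi>) \<inter> K = {}" by blast
      thus ?thesis using su t[OF f] unfolding supp_in_def by blast
    qed
    thus "E u \<phi> = 0" using l[OF u f] LIMSEQ_unique tendsto_const by (metis (no_types, lifting) ext)
  qed
  thus ?thesis unfolding local_op_def using B t p l by blast
qed

lemma reach_segment:
  assumes D: "finite D" "D \<subseteq> cball w \<rho>" and t: "t \<in> reach D R" and h: "0 \<le> h" "h * (R * card D) \<le> s" and \<rho>: "\<rho> \<ge> 0"
  shows "h *\<^sub>R t \<in> (\<lambda>(\<tau>, a). \<tau> *\<^sub>R a) ` ({0..s} \<times> cball w \<rho>)"
proof -
  obtain v where v: "t = (\<Sum>e\<in>D. v e *\<^sub>R e)" "\<And>e. 0 \<le> v e \<and> v e \<le> R" using t by (auto simp: reach_def)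
  define W where "W = (\<Sum>e\<in>D. v e)"
  have W0: "W \<ge> 0" unfolding W_def using v(2) by (intro sum_nonneg) auto
  have "W \<le> (\<Sum>e\<in>D. R)" unfolding W_def using v(2) by (intro sum_mono) auto
  hence "h * W \<le> h * (R * card D)" using h(1) by (intro mult_left_mono) (auto simp: mult.commute)
  hence hW: "h * W \<in> {0..s}" using h W0 by auto
  show ?thesis
  proof (cases "W = 0")
    case True
    hence "v e = 0" if "e \<in> D" for e
      using that D(1) v(2) unfolding W_def by (subst (asm) sum_nonneg_eq_0_iff) auto
    hence "t = 0" using v(1) by simp
    thus ?thesis using hW True \<rho> by (intro image_eqI[of _ _ "(0, w)"]) auto
  next
    case False
    define a where "a = (\<Sum>e\<in>D. (v e / W) *\<^sub>R e)"
    have "a \<in> cball w \<rho>" unfolding a_def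
      by (rule convex_sum[OF D(1) convex_cball])
         (use False v(2) W0 D(2) in \<open>auto simp: sum_divide_distrib[symmetric] W_def[symmetric]\<close>)
    moreover have "h *\<^sub>R t = (h * W) *\<^sub>R a"
      using False by (simp add: a_def v(1) scaleR_sum_right)
    ultimately show ?thesis using hW by (intro image_eqI[of _ _ "(h * W, a)"]) auto
  qed
qed

lemma spanning_simplex:
  assumes c: "c \<noteq> 0"
  shows "spanning (insert w ((\<lambda>i. w + c *\<^sub>R axis i 1) ` UNIV))"
  unfolding spanning_def
proof
  fix i
  let ?D = "insert w ((\<lambda>i. w + c *\<^sub>R axis i 1) ` UNIV) :: pt set"
  let ?e = "w + c *\<^sub>R axis i 1"
  have ne: "?e \<noteq> w" using c by simp
  define v where "v e = (if e = ?e then 1 / c else if e = w then - 1 / c else 0)" for e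
  have "(\<Sum>e\<in>?D. v e *\<^sub>R e) = (\<Sum>e\<in>{?e, w}. v e *\<^sub>R e)"
    by (rule sum.mono_neutral_right) (auto simp: v_def)
  also have "\<dots> = (1 / c) *\<^sub>R ?e + (- 1 / c) *\<^sub>R w" using ne by (simp add: v_def)
  also have "\<dots> = axis i 1" using c by (simp add: scaleR_add_right)
  finally have "axis i 1 = (\<Sum>e\<in>?D. v e *\<^sub>R e)" by (rule sym)
  thus "\<exists>v. axis i 1 = (\<Sum>e\<in>?D. v e *\<^sub>R e)" by (rule exI[where x=v])
qed

lemma local_parametrices:
  assumes o: "open \<Omega>" and b: "bounded \<Omega>" and lip: "lipschitz_boundary \<Omega>" and x: "x \<in> closure \<Omega>"
  shows "\<exists>r>0. \<exists>m d A0 E0 A E. local_op \<Omega> (closure \<Omega> \<inter> cball x r) A0 E0 \<and>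
    (\<forall>i<m::nat. local_op \<Omega> (closure \<Omega> \<inter> cball x r) (A i) (E i)) \<and>
    (\<forall>u C \<phi>. hmd u C \<longrightarrow> test \<phi> \<longrightarrow>
       (\<lambda>N. E0 u \<phi> + (\<Sum>i<m. u (dd (d i) (dd (d i) (A i N \<phi>))))) \<longlonglongrightarrow> u \<phi>)"
proof -
  obtain w \<rho> r s0 where c: "\<rho> > 0" "r > 0" "s0 > 0"
    and cone: "\<And>y s a. y \<in> closure \<Omega> \<Longrightarrow> y \<in> cball x r \<Longrightarrow> 0 < s \<Longrightarrow> s \<le> s0 \<Longrightarrow> a \<in> ball w \<rho> \<Longrightarrow> y + s *\<^sub>R a \<in> \<Omega>"
    using local_cone[OF o lip x] by blast
  define K where "K = closure \<Omega> \<inter> cball x r"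
  have K: "compact K" unfolding K_def using b by (intro compact_Int_closed) (auto simp: compact_closure)
  define T where "T = (\<lambda>(\<tau>, a). \<tau> *\<^sub>R a) ` ({0..s0/2} \<times> cball w (\<rho>/2))"
  have T: "compact T" unfolding T_def case_prod_beta
    by (intro compact_continuous_image compact_Times continuous_intros) auto
  have coneT: "(y + t) + s *\<^sub>R a \<in> \<Omega>" if y: "y \<in> K" and t: "t \<in> T" and s: "0 < s" "s \<le> s0/2" and a: "a \<in> ball w \<rho>" for y t s a
  proof -
    obtain \<tau> a' where t': "t = \<tau> *\<^sub>R a'" "0 \<le> \<tau>" "\<tau> \<le> s0/2" "a' \<in> cball w (\<rho>/2)" using t by (auto simp: T_def)
    define e where "e = (\<tau> / (\<tau> + s)) *\<^sub>R a' + (s / (\<tau> + s)) *\<^sub>R a"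
    have p: "\<tau> + s > 0" using t'(2) s(1) by simp
    have a'b: "a' \<in> ball w \<rho>" using t'(4) c(1) by auto
    have "e \<in> ball w \<rho>" unfolding e_def
      by (rule convexD[OF convex_ball a'b a]) (use t'(2) s p in \<open>auto simp: add_divide_distrib[symmetric]\<close>)
    moreover have "\<tau> + s \<le> s0" using t'(3) s(2) by simp
    ultimately have "y + (\<tau> + s) *\<^sub>R e \<in> \<Omega>" using cone[of y "\<tau> + s" e] y p by (simp add: K_def)
    moreover have "(\<tau> + s) *\<^sub>R e = t + s *\<^sub>R a" using p by (simp add: e_def t'(1) scaleR_add_right)
    ultimately show ?thesis by (simp add: add.assoc)
  qed
  define D where "D = insert w ((\<lambda>i. w + (\<rho>/2) *\<^sub>R axis i (1::real)) ` UNIV)"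
  have D: "finite D" "spanning D" unfolding D_def using spanning_simplex[of "\<rho>/2" w] c(1) by auto
  have Dw: "D \<subseteq> cball w (\<rho>/2)" using c(1) by (auto simp: D_def dist_norm norm_axis_1)
  obtain m d P F cP cF where H: "(\<forall>i<m::nat. d i \<in> D) \<and> scf D cP P \<and> (\<forall>e\<in>D. cP e \<ge> (4::nat)) \<and>
    (\<forall>i<m. scf D (cF i) (F i) \<and> (\<forall>e\<in>D. cF i e \<ge> (4::nat))) \<and>
    (\<forall>h f x. test f \<longrightarrow> P h f x - P (2 * h) f x = (\<Sum>i<m. h\<^sup>2 * dd (d i) (dd (d i) (F i h f)) x)) \<and>
    (\<forall>h f. test f \<longrightarrow> (\<lambda>k. n2 (\<lambda>x. P (h / 2 ^ k) f x - f x)) \<longlonglongrightarrow> 0)"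
    using parametrix[OF D(1)] by (elim exE)
  have P: "scf D cP P" "\<forall>e\<in>D. cP e \<ge> 4"
    and F: "\<forall>i<m. scf D (cF i) (F i) \<and> (\<forall>e\<in>D. cF i e \<ge> 4)"
    and eq: "\<And>h f x. test f \<Longrightarrow> P h f x - P (2 * h) f x = (\<Sum>i<m. h\<^sup>2 * dd (d i) (dd (d i) (F i h f)) x)"
    and lim: "\<And>h f. test f \<Longrightarrow> (\<lambda>k. n2 (\<lambda>x. P (h / 2 ^ k) f x - f x)) \<longlonglongrightarrow> 0"
    using H by blast+
  obtain RP where RP: "RP \<ge> 0" "\<And>h f x. P h f x \<noteq> 0 \<Longrightarrow> \<exists>t\<in>reach D RP. f (x + h *\<^sub>R t) \<noteq> 0"
    using scf_supp[OF P(1) D(1)] by blast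
  have "\<forall>i<m. \<exists>R\<ge>0. \<forall>h f x. F i h f x \<noteq> 0 \<longrightarrow> (\<exists>t\<in>reach D R. f (x + h *\<^sub>R t) \<noteq> 0)"
    using F scf_supp[OF _ D(1)] by blast
  then obtain RF where RF: "\<And>i. i < m \<Longrightarrow> RF i \<ge> 0"
    "\<And>i h f x. i < m \<Longrightarrow> F i h f x \<noteq> 0 \<Longrightarrow> \<exists>t\<in>reach D (RF i). f (x + h *\<^sub>R t) \<noteq> 0" by metis
  define R where "R = RP + (\<Sum>i<m. RF i)"
  have "(\<Sum>i<m. RF i) \<ge> 0" using RF(1) by (intro sum_nonneg) auto
  hence R: "RP \<le> R" "R \<ge> 0" unfolding R_def using RP(1) by auto
  have RFR: "RF i \<le> R" if "i < m" for i
  proof -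
    have "RF i \<le> (\<Sum>i<m. RF i)" using that RF(1) by (intro member_le_sum) auto
    thus ?thesis using RP(1) by (simp add: R_def)
  qed
  define h where "h = s0 / 2 / (R * card D + 1)"
  have hp: "h > 0" unfolding h_def using c(3) R(2) by (simp add: add_nonneg_pos)
  have hR: "h * (R * card D) \<le> s0 / 2"
  proof -
    have "h * (R * card D) \<le> h * (R * card D + 1)" using hp by simp
    also have "\<dots> = s0 / 2"
    proof -
      have "R * card D + 1 > 0" using R(2) by (simp add: add_nonneg_pos)
      thus ?thesis by (simp only: h_def) (simp add: field_simps)
    qed
    finally show ?thesis .
  qed
  have inT: "h' *\<^sub>R t \<in> T" if "t \<in> reach D R'" "R' \<le> R" "0 \<le> h'" "h' \<le> h" for h' t R'
  proof -
    have "h' * (R * card D) \<le> h * (R * card D)" using that R(2) by (intro mult_right_mono) auto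
    thus ?thesis unfolding T_def using that reach_mono[OF that(2), of D] hR c(1)
      by (intro reach_segment[OF D(1) Dw, of t R]) auto
  qed
  have local_opP: "local_op \<Omega> K (\<lambda>N. P h) (\<lambda>u \<phi>. u (P h \<phi>))"
  proof -
    obtain B where B: "B \<ge> 0" "\<And>u C. hmd u C \<Longrightarrow> regd (\<lambda>\<phi>. u (P h \<phi>)) (B * C)"
      using scf_regd[OF D P(1), of h] P(2) hp by auto
    show ?thesis
    proof (rule local_opI[where ?s0.0="s0/2", OF B _ _ _ K T _ c(1) _ coneT])
      fix \<phi> x assume "P h \<phi> x \<noteq> 0"
      then obtain t where "t \<in> reach D RP" "\<phi> (x + h *\<^sub>R t) \<noteq> 0" using RP(2) by blast
      thus "\<exists>t\<in>T. \<phi> (x + t) \<noteq> 0" using inT[of t RP h] R(1) hp by auto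
    qed (use c(3) in \<open>auto simp: scf_test[OF P(1)] scf_pd[OF P(1)]\<close>)
  qed
  have local_opF: "local_op \<Omega> K (ms (F i) (h / 2)) (pot (F i) (h / 2))" if i: "i < m" for i
  proof -
    have Fi: "scf D (cF i) (F i)" "\<And>e. e \<in> D \<Longrightarrow> cF i e \<ge> 4" using F i by auto
    obtain B where B: "B \<ge> 0" "\<And>u C. hmd u C \<Longrightarrow> regd (pot (F i) (h / 2) u) (B * C)"
      using pot_regd[OF D Fi] by blast
    show ?thesis
    proof (rule local_opI[where ?s0.0="s0/2", OF B _ _ _ K T _ c(1) _ coneT])
      fix N \<phi> x assume "ms (F i) (h / 2) N \<phi> x \<noteq> 0"
      then obtain k where "F i (h / 2 / 2 ^ k) \<phi> x \<noteq> 0" unfolding ms_def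
        by (metis (mono_tags, lifting) mult_zero_right sum.neutral)
      then obtain t where t: "t \<in> reach D (RF i)" "\<phi> (x + (h / 2 / 2 ^ k) *\<^sub>R t) \<noteq> 0" using RF(2)[OF i] by blast
      have "(1::real) \<le> 2 ^ k" by simp
      hence "(1::real) \<le> 2 * 2 ^ k" by linarith
      hence "h * 1 \<le> h * (2 * 2 ^ k)" using hp by (intro mult_left_mono) auto
      hence "h / 2 / 2 ^ k \<le> h" by (simp add: field_simps)
      hence "(h / 2 / 2 ^ k) *\<^sub>R t \<in> T" by (intro inT[OF t(1) RFR[OF i]]) (use hp in auto)
      thus "\<exists>t\<in>T. \<phi> (x + t) \<noteq> 0" using t(2) by blast
    qed (use c(3) in \<open>auto simp: test_ms[OF Fi(1)] pd_ms[OF Fi(1)] pot_lim[OF Fi(1)]\<close>)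
  qed
  have main: "(\<lambda>N. u (P h \<phi>) + (\<Sum>i<m. u (dd (d i) (dd (d i) (ms (F i) (h / 2) N \<phi>))))) \<longlonglongrightarrow> u \<phi>"
    if u: "hmd u C" and f: "test \<phi>" for u C \<phi>
  proof -
    have tele: "P (h / 2 ^ N) \<phi> y = P h \<phi> y + (\<Sum>i<m. dd (d i) (dd (d i) (ms (F i) (h / 2) N \<phi>)) y)" for N y
    proof -
      have dms: "dd e (dd e (ms (F i) (h / 2) N \<phi>)) y = (\<Sum>k<N. (h / 2 / 2 ^ k)\<^sup>2 * dd e (dd e (F i (h / 2 / 2 ^ k) \<phi>)) y)"
        if i: "i < m" for i e
      proof -
        have Fi: "scf D (cF i) (F i)" using F i by auto
        have l: "dd e (\<lambda>x. \<Sum>k<N. a k * g k x) = (\<lambda>x. \<Sum>k<N. a k * dd e (g k) x)" if "\<And>k. test (g k)" for a g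
          using that unfolding dd_def[abs_def]
          by (auto simp: fun_eq_iff pd_sum pd_cmult smooth_cmult test_smooth intro: sum_swap_mult)
        show ?thesis unfolding ms_def[abs_def] by (simp add: l scf_test[OF Fi f] test_dd)
      qed
      have "P (h / 2 ^ N) \<phi> y - P h \<phi> y = (\<Sum>k<N. P (h / 2 ^ Suc k) \<phi> y - P (h / 2 ^ k) \<phi> y)"
        using sum_lessThan_telescope[of "\<lambda>k. P (h / 2 ^ k) \<phi> y" N] by simp
      also have "\<dots> = (\<Sum>k<N. \<Sum>i<m. (h / 2 / 2 ^ k)\<^sup>2 * dd (d i) (dd (d i) (F i (h / 2 / 2 ^ k) \<phi>)) y)"
      proof (intro sum.cong refl)
        fix k
        have 1: "h / 2 ^ Suc k = h / 2 / 2 ^ k" and 2: "2 * (h / 2 / 2 ^ k) = h / 2 ^ k" by simp_all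
        show "P (h / 2 ^ Suc k) \<phi> y - P (h / 2 ^ k) \<phi> y
          = (\<Sum>i<m. (h / 2 / 2 ^ k)\<^sup>2 * dd (d i) (dd (d i) (F i (h / 2 / 2 ^ k) \<phi>)) y)"
          using eq[OF f, of "h / 2 / 2 ^ k" y] unfolding 1 2 .
      qed
      also have "\<dots> = (\<Sum>i<m. dd (d i) (dd (d i) (ms (F i) (h / 2) N \<phi>)) y)"
        by (subst sum.swap) (simp add: dms)
      finally show ?thesis by simp
    qed
    have tF: "test (dd (d i) (dd (d i) (ms (F i) (h / 2) N \<phi>)))" if "i < m" for i N
      using F that f by (intro test_dd test_ms) auto
    have tP: "test (P s \<phi>)" for s by (rule scf_test[OF P(1) f])
    have uN: "u (P (h / 2 ^ N) \<phi>) = u (P h \<phi>) + (\<Sum>i<m. u (dd (d i) (dd (d i) (ms (F i) (h / 2) N \<phi>))))" for N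
    proof -
      have "P (h / 2 ^ N) \<phi> = (\<lambda>y. P h \<phi> y + (\<Sum>i<m. dd (d i) (dd (d i) (ms (F i) (h / 2) N \<phi>)) y))"
        using tele by blast
      moreover have "u (\<lambda>y. P h \<phi> y + (\<Sum>i<m. dd (d i) (dd (d i) (ms (F i) (h / 2) N \<phi>)) y))
        = u (P h \<phi>) + u (\<lambda>y. \<Sum>i<m. dd (d i) (dd (d i) (ms (F i) (h / 2) N \<phi>)) y)"
        by (intro tlin_add hmdD(1)[OF u] tP test_sum) (auto intro: tF)
      moreover have "u (\<lambda>y. \<Sum>i<m. dd (d i) (dd (d i) (ms (F i) (h / 2) N \<phi>)) y)
        = (\<Sum>i<m. u (dd (d i) (dd (d i) (ms (F i) (h / 2) N \<phi>))))"
        by (intro tlin_sum hmdD(1)[OF u]) (auto intro: tF)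
      ultimately show ?thesis by simp
    qed
    have z: "(\<lambda>N. C * (n2 (\<lambda>x. P (h / 2 ^ N) \<phi> x - \<phi> x) + (\<Sum>i\<in>UNIV. n2 (\<lambda>x. P (h / 2 ^ N) (pd i \<phi>) x - pd i \<phi> x)))) \<longlonglongrightarrow> C * (0 + (\<Sum>i\<in>(UNIV::3 set). 0))"
      by (intro tendsto_intros lim f test_pd)
    have "(\<lambda>N. u (P (h / 2 ^ N) \<phi>) - u \<phi>) \<longlonglongrightarrow> 0"
    proof (rule tendsto_0_le[where K=1, OF _ always_eventually])
      show "(\<lambda>N. C * (n2 (\<lambda>x. P (h / 2 ^ N) \<phi> x - \<phi> x) + (\<Sum>i\<in>UNIV. n2 (\<lambda>x. P (h / 2 ^ N) (pd i \<phi>) x - pd i \<phi> x)))) \<longlonglongrightarrow> 0"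
        using z by simp
      show "\<forall>N. norm (u (P (h / 2 ^ N) \<phi>) - u \<phi>) \<le> norm (C * (n2 (\<lambda>x. P (h / 2 ^ N) \<phi> x - \<phi> x) + (\<Sum>i\<in>UNIV. n2 (\<lambda>x. P (h / 2 ^ N) (pd i \<phi>) x - pd i \<phi> x)))) * 1"
      proof
        fix N
        let ?g = "\<lambda>x. P (h / 2 ^ N) \<phi> x - \<phi> x"
        have g: "test ?g" by (intro test_diff tP f)
        have pg: "pd i ?g = (\<lambda>x. P (h / 2 ^ N) (pd i \<phi>) x - pd i \<phi> x)" for i
          using pd_lin[OF test_smooth[OF tP] test_smooth[OF f], of i 1 _ "-1"] by (simp add: scf_pd[OF P(1) f])
        have "\<bar>u (P (h / 2 ^ N) \<phi>) - u \<phi>\<bar> = \<bar>u ?g\<bar>" using tlin_diff[OF hmdD(1)[OF u] tP f] by simp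
        also have "\<dots> \<le> C * h1t ?g" by (rule hmdD(3)[OF u g])
        also have "\<dots> \<le> C * (n2 ?g + (\<Sum>i\<in>UNIV. n2 (pd i ?g)))"
          by (intro mult_left_mono h1t_le hmdD(2)[OF u])
        finally show "norm (u (P (h / 2 ^ N) \<phi>) - u \<phi>) \<le> norm (C * (n2 ?g + (\<Sum>i\<in>UNIV. n2 (\<lambda>x. P (h / 2 ^ N) (pd i \<phi>) x - pd i \<phi> x)))) * 1"
          unfolding pg by simp
      qed
    qed
    hence "(\<lambda>N. u (P (h / 2 ^ N) \<phi>)) \<longlonglongrightarrow> u \<phi>" by (simp add: LIM_zero_iff)
    thus ?thesis unfolding uN .
  qed
  show ?thesis unfolding K_def[symmetric]
    apply (rule exI[of _ r], intro conjI c(2))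
    apply (rule exI[of _ m], rule exI[of _ d], rule exI[of _ "\<lambda>N. P h"], rule exI[of _ "\<lambda>u \<phi>. u (P h \<phi>)"])
    apply (rule exI[of _ "\<lambda>i. ms (F i) (h / 2)"], rule exI[of _ "\<lambda>i. pot (F i) (h / 2)"])
    using local_opP local_opF main K_def by simp
qed

section \<open>The algebraic identity for a pure second derivative\<close>

lemma levi_simps:
  "levi i i k = 0" "levi i k i = 0" "levi k i i = 0"
  "levi 1 2 3 = 1" "levi 2 3 1 = 1" "levi 3 1 2 = 1"
  "levi 1 3 2 = -1" "levi 3 2 1 = -1" "levi 2 1 3 = -1"
  by (auto simp: levi_def)

lemma dcurl_expand: "dcurl T i j \<phi> = (\<Sum>k\<in>UNIV. \<Sum>l\<in>UNIV. levi j k l * - T i l (pd k \<phi>))"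
  by (simp add: dcurl_def dderiv_def)

lemma dinc_expand: "dinc T i j \<phi> = (\<Sum>k\<in>UNIV. \<Sum>l\<in>UNIV. levi j k l *
    (\<Sum>a\<in>UNIV. \<Sum>b\<in>UNIV. levi i a b * T l b (pd a (pd k \<phi>))))"
  by (simp add: dinc_def dcurl_expand dtrans_def sum_negf)

lemma ddiv_expand: "ddiv T i \<phi> = - (\<Sum>j\<in>UNIV. T i j (pd j \<phi>))"
  by (simp add: ddiv_def dderiv_def sum_negf)

lemma ddivdiv_expand: "ddivdiv T \<phi> = (\<Sum>i\<in>UNIV. \<Sum>j\<in>UNIV. T i j (pd j (pd i \<phi>)))"
  by (simp add: ddivdiv_def dderiv_def ddiv_expand sum_negf)

definition curlpot :: "pt \<Rightarrow> (3 \<Rightarrow> distr) \<Rightarrow> 3 \<Rightarrow> 3 \<Rightarrow> distr" where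
  "curlpot d V i l = (\<lambda>\<phi>. 2 * d $ i * (\<Sum>p\<in>UNIV. \<Sum>q\<in>UNIV. levi l p q * d $ q * V p \<phi>))"

definition incpot :: "pt \<Rightarrow> (3 \<Rightarrow> 3 \<Rightarrow> distr) \<Rightarrow> 3 \<Rightarrow> 3 \<Rightarrow> distr" where
  "incpot d u i j = (\<lambda>\<phi>. \<Sum>c\<in>UNIV. \<Sum>p\<in>UNIV. \<Sum>f\<in>UNIV. \<Sum>q\<in>UNIV. levi i c p * levi j f q * d $ c * d $ f * u p q \<phi>)"

lemma dd_dd_expand:
  assumes "test \<psi>"
  shows "dd d (dd d \<psi>) = (\<lambda>x. \<Sum>k\<in>UNIV. \<Sum>l\<in>UNIV. (d $ k * d $ l) * pd k (pd l \<psi>) x)"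
proof
  fix x
  have "pd k (dd d \<psi>) x = (\<Sum>l\<in>UNIV. d $ l * pd k (pd l \<psi>) x)" for k
    unfolding dd_def[abs_def] using assms
    by (simp add: pd_sum pd_cmult smooth_cmult test_smooth test_pd)
  thus "dd d (dd d \<psi>) x = (\<Sum>k\<in>UNIV. \<Sum>l\<in>UNIV. (d $ k * d $ l) * pd k (pd l \<psi>) x)"
    by (simp add: dd_def[of d "dd d \<psi>"] sum_distrib_left mult.assoc)
qed

text \<open>For a vector \<open>d\<close>, \<open>\<partial>\<^sub>d\<^sup>2 u = d d\<^sup>T div div u + sym curl (2 d \<otimes> (div u \<times> d)) + inc (d \<times> u \<times> d)\<close>;
  the second potential is trace-free since \<open>div u \<times> d\<close> is orthogonal to \<open>d\<close>.\<close>

lemma second_derivative_decomposition: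
  assumes u: "\<And>i j. tlin (u i j)" and sy: "\<And>i j \<phi>. test \<phi> \<Longrightarrow> u i j \<phi> = u j i \<phi>" and t: "test \<psi>"
  shows "u i j (dd d (dd d \<psi>)) = d $ i * d $ j * ddivdiv u \<psi>
    + dsym (dcurl (curlpot d (ddiv u))) i j \<psi> + dinc (incpot d u) i j \<psi>"
proof -
  have e: "u i j (dd d (dd d \<psi>)) = (\<Sum>k\<in>UNIV. \<Sum>l\<in>UNIV. (d $ k * d $ l) * u i j (pd k (pd l \<psi>)))" for i j
    unfolding dd_dd_expand[OF t]
    by (subst tlin_sum[OF u] | simp add: tlin_cmult[OF u] tlin_sum[OF u] test_sum test_cmult test_pd t)+
  have c: "pd 2 (pd 1 \<psi>) = pd 1 (pd 2 \<psi>)" "pd 3 (pd 1 \<psi>) = pd 1 (pd 3 \<psi>)" "pd 3 (pd 2 \<psi>) = pd 2 (pd 3 \<psi>)"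
    by (rule pd_commute[OF t])+
  have s: "u 2 1 (pd k (pd l \<psi>)) = u 1 2 (pd k (pd l \<psi>))" "u 3 1 (pd k (pd l \<psi>)) = u 1 3 (pd k (pd l \<psi>))"
    "u 3 2 (pd k (pd l \<psi>)) = u 2 3 (pd k (pd l \<psi>))" for k l
    by (rule sy; intro test_pd t)+
  let ?T = "curlpot d (ddiv u)"
  have "\<forall>i j. 2 * u i j (dd d (dd d \<psi>)) = 2 * (d $ i * d $ j * ddivdiv u \<psi>)
    + (dcurl ?T i j \<psi> + dcurl ?T j i \<psi>) + 2 * dinc (incpot d u) i j \<psi>"
    unfolding e dcurl_expand dinc_expand ddivdiv_expand curlpot_def incpot_def ddiv_expand
    unfolding forall_3 sum_3 levi_simps c s
    by (simp add: c s levi_simps algebra_simps)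
  hence "2 * u i j (dd d (dd d \<psi>)) = 2 * (d $ i * d $ j * ddivdiv u \<psi>)
    + (dcurl ?T i j \<psi> + dcurl ?T j i \<psi>) + 2 * dinc (incpot d u) i j \<psi>" by blast
  thus ?thesis by (simp add: dsym_def field_simps)
qed

section \<open>Localisation and the decomposition of functionals\<close>

lemma hmd_lin:
  assumes u: "hmd u C" and v: "hmd v D" shows "hmd (\<lambda>\<phi>. a * u \<phi> + b * v \<phi>) (\<bar>a\<bar> * C + \<bar>b\<bar> * D)"
proof -
  have "tlin (\<lambda>\<phi>. a * u \<phi> + b * v \<phi>)"
    using hmdD(1)[OF u] hmdD(1)[OF v] by (simp add: tlin_def algebra_simps)
  moreover have "\<bar>a * u \<phi> + b * v \<phi>\<bar> \<le> (\<bar>a\<bar> * C + \<bar>b\<bar> * D) * h1t \<phi>" if t: "test \<phi>" for \<phi>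
  proof -
    have "\<bar>a * u \<phi> + b * v \<phi>\<bar> \<le> \<bar>a\<bar> * \<bar>u \<phi>\<bar> + \<bar>b\<bar> * \<bar>v \<phi>\<bar>" by (metis abs_mult abs_triangle_ineq)
    also have "\<dots> \<le> \<bar>a\<bar> * (C * h1t \<phi>) + \<bar>b\<bar> * (D * h1t \<phi>)"
      by (intro add_mono mult_left_mono hmdD(3)[OF u t] hmdD(3)[OF v t]) auto
    finally show ?thesis by (simp add: algebra_simps)
  qed
  ultimately show ?thesis using hmdD(2)[OF u] hmdD(2)[OF v] by (simp add: hmd_def hm1_le_def)
qed

lemma hmd_add: "hmd u C \<Longrightarrow> hmd v D \<Longrightarrow> hmd (\<lambda>\<phi>. u \<phi> + v \<phi>) (C + D)"
  using hmd_lin[of u C v D 1 1] by simp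

lemma hmd_zero: "hmd (\<lambda>_. 0) 0" by (simp add: hmd_def tlin_def hm1_le_def)

lemma hmd_sum: "(\<And>i. i \<in> I \<Longrightarrow> hmd (u i) (C i)) \<Longrightarrow> hmd (\<lambda>\<phi>. \<Sum>i\<in>I. u i \<phi>) (\<Sum>i\<in>I. C i)"
  by (induction I rule: infinite_finite_induct) (auto simp: hmd_zero intro: hmd_add)

lemma tlin_cong: "tlin u \<Longrightarrow> (\<And>\<phi>. test \<phi> \<Longrightarrow> v \<phi> = u \<phi>) \<Longrightarrow> tlin v"
  by (simp add: tlin_def test_lin)

lemma hmd_cong: "hmd u C \<Longrightarrow> (\<And>\<phi>. test \<phi> \<Longrightarrow> v \<phi> = u \<phi>) \<Longrightarrow> hmd v C"
  using tlin_cong[of u v] by (auto simp: hmd_def hm1_le_def)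

lemma hmd_mono: "hmd u C \<Longrightarrow> C \<le> D \<Longrightarrow> hmd u D"
  unfolding hmd_def hm1_le_def by (meson h1t_nonneg mult_right_mono order_trans)

lemma regd_cong: "regd u C \<Longrightarrow> (\<And>\<phi>. test \<phi> \<Longrightarrow> v \<phi> = u \<phi>) \<Longrightarrow> regd v C"
  using tlin_cong[of u v] by (auto simp: regd_def test_pd)

lemma n2_test_mult:
  assumes "test \<theta>" obtains B where "B \<ge> 0" "\<And>f. L2 f \<Longrightarrow> n2 (\<lambda>x. \<theta> x * f x) \<le> B * n2 f"
proof -
  obtain B where B: "\<And>x. \<bar>\<theta> x\<bar> \<le> B" "B > 0" using test_bounded[OF assms] by blast
  have "n2 (\<lambda>x. \<theta> x * f x) \<le> B * n2 f" if f: "L2 f" for f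
  proof -
    have "l2sq (\<lambda>x. \<theta> x * f x) \<le> l2sq (\<lambda>x. B * f x)"
      unfolding l2sq_def
    proof (rule integral_mono)
      fix x
      have "(\<theta> x)\<^sup>2 \<le> B\<^sup>2" using B(1)[of x] by (metis abs_ge_zero power2_abs power_mono)
      thus "(\<theta> x * f x)\<^sup>2 \<le> (B * f x)\<^sup>2" by (simp add: power_mult_distrib mult_right_mono)
    qed (intro L2_integrable L2_test_mult L2_cmult assms f)+
    hence "n2 (\<lambda>x. \<theta> x * f x) \<le> n2 (\<lambda>x. B * f x)" unfolding n2_def by (rule real_sqrt_le_mono)
    thus ?thesis using B(2) by (simp add: n2_cmult)
  qed
  thus ?thesis using that[of B] B(2) by simp
qed

lemma h1t_test_mult:
  assumes \<theta>: "test \<theta>" shows "\<exists>c\<ge>0. \<forall>\<phi>. test \<phi> \<longrightarrow> h1t (\<lambda>x. \<theta> x * \<phi> x) \<le> c * h1t \<phi>"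
proof -
  obtain B where B: "B \<ge> 0" "\<And>f. L2 f \<Longrightarrow> n2 (\<lambda>x. \<theta> x * f x) \<le> B * n2 f" using n2_test_mult[OF \<theta>] by blast
  have "\<exists>B\<ge>0. \<forall>f. L2 f \<longrightarrow> n2 (\<lambda>x. pd i \<theta> x * f x) \<le> B * n2 f" for i using n2_test_mult[OF test_pd[OF \<theta>]] by metis
  then obtain B' where B': "\<And>i. B' i \<ge> 0" "\<And>i f. L2 f \<Longrightarrow> n2 (\<lambda>x. pd i \<theta> x * f x) \<le> B' i * n2 f" by metis
  define c where "c = B + (\<Sum>i\<in>(UNIV::3 set). B + B' i)"
  have "h1t (\<lambda>x. \<theta> x * \<phi> x) \<le> c * h1t \<phi>" if t: "test \<phi>" for \<phi>
  proof -
    have "h1t (\<lambda>x. \<theta> x * \<phi> x) \<le> n2 (\<lambda>x. \<theta> x * \<phi> x) + (\<Sum>i\<in>UNIV. n2 (pd i (\<lambda>x. \<theta> x * \<phi> x)))" by (rule h1t_le)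
    also have "\<dots> \<le> B * h1t \<phi> + (\<Sum>i\<in>UNIV. (B + B' i) * h1t \<phi>)"
    proof (intro add_mono sum_mono)
      show "n2 (\<lambda>x. \<theta> x * \<phi> x) \<le> B * h1t \<phi>"
        using B(2)[OF test_L2[OF t]] mult_left_mono[OF n2_le_h1t B(1)] order_trans by blast
      fix i
      have "n2 (pd i (\<lambda>x. \<theta> x * \<phi> x)) \<le> n2 (\<lambda>x. \<theta> x * pd i \<phi> x) + n2 (\<lambda>x. pd i \<theta> x * \<phi> x)"
        unfolding pd_mult[OF test_smooth[OF \<theta>] test_smooth[OF t]]
        by (intro n2_triangle test_L2 test_mult test_smooth test_pd \<theta> t)
      also have "\<dots> \<le> B * n2 (pd i \<phi>) + B' i * n2 \<phi>" by (intro add_mono B(2) B'(2) test_L2 test_pd t)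
      also have "\<dots> \<le> B * h1t \<phi> + B' i * h1t \<phi>"
        by (intro add_mono mult_left_mono n2_le_h1t n2_pd_le_h1t B(1) B'(1))
      finally show "n2 (pd i (\<lambda>x. \<theta> x * \<phi> x)) \<le> (B + B' i) * h1t \<phi>" by (simp add: distrib_right)
    qed
    also have "\<dots> = c * h1t \<phi>" by (simp only: c_def sum_distrib_right distrib_right)
    finally show ?thesis .
  qed
  moreover have "c \<ge> 0" unfolding c_def using B(1) B'(1) by (intro add_nonneg_nonneg sum_nonneg) auto
  ultimately show ?thesis by blast
qed

lemma hmd_mult:
  assumes \<theta>: "test \<theta>" shows "\<exists>c\<ge>0. \<forall>u C. hmd u C \<longrightarrow> hmd (\<lambda>\<phi>. u (\<lambda>x. \<theta> x * \<phi> x)) (c * C)"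
proof -
  obtain c where c: "c \<ge> 0" "\<And>\<phi>. test \<phi> \<Longrightarrow> h1t (\<lambda>x. \<theta> x * \<phi> x) \<le> c * h1t \<phi>" using h1t_test_mult[OF \<theta>] by blast
  have m: "test (\<lambda>x. \<theta> x * \<phi> x)" if "test \<phi>" for \<phi> using test_mult[OF test_smooth[OF \<theta>] that] .
  have "hmd (\<lambda>\<phi>. u (\<lambda>x. \<theta> x * \<phi> x)) (c * C)" if u: "hmd u C" for u C
    unfolding hmd_def hm1_le_def
  proof (intro conjI allI impI)
    have "u (\<lambda>x. \<theta> x * (a * \<phi> x + b * \<psi> x)) = a * u (\<lambda>x. \<theta> x * \<phi> x) + b * u (\<lambda>x. \<theta> x * \<psi> x)"
      if "test \<phi>" "test \<psi>" for \<phi> \<psi> a b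
      using tlinD[OF hmdD(1)[OF u] m[OF that(1)] m[OF that(2)], of a b] by (simp add: algebra_simps)
    thus "tlin (\<lambda>\<phi>. u (\<lambda>x. \<theta> x * \<phi> x))" by (simp add: tlin_def)
    show "0 \<le> c * C" using c(1) hmdD(2)[OF u] by simp
    fix \<phi> assume t: "test \<phi>"
    have "\<bar>u (\<lambda>x. \<theta> x * \<phi> x)\<bar> \<le> C * h1t (\<lambda>x. \<theta> x * \<phi> x)" by (rule hmdD(3)[OF u m[OF t]])
    also have "\<dots> \<le> C * (c * h1t \<phi>)" by (intro mult_left_mono c(2)[OF t] hmdD(2)[OF u])
    finally show "\<bar>u (\<lambda>x. \<theta> x * \<phi> x)\<bar> \<le> c * C * h1t \<phi>" by (simp add: mult_ac)
  qed
  thus ?thesis using c(1) by blast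
qed

definition cut :: "fn \<Rightarrow> (3 \<Rightarrow> 3 \<Rightarrow> distr) \<Rightarrow> 3 \<Rightarrow> 3 \<Rightarrow> distr" where
  "cut \<theta> \<sigma> i j = (\<lambda>\<phi>. \<sigma> i j (\<lambda>x. \<theta> x * \<phi> x))"

lemma dd_norm_ge:
  "hm1norm (\<sigma> i j) \<le> dd_norm \<sigma>" "hm1norm (ddiv \<sigma> i) \<le> dd_norm \<sigma>" "hm1norm (ddivdiv \<sigma>) \<le> dd_norm \<sigma>"
proof -
  let ?A = "\<Sum>i\<in>UNIV. \<Sum>j\<in>UNIV. (hm1norm (\<sigma> i j))\<^sup>2" and ?B = "\<Sum>i\<in>UNIV. (hm1norm (ddiv \<sigma> i))\<^sup>2" and ?C = "(hm1norm (ddivdiv \<sigma>))\<^sup>2"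
  have 0: "?A \<ge> 0" "?B \<ge> 0" "?C \<ge> 0" by (auto intro!: sum_nonneg)
  have b: "x \<le> dd_norm \<sigma>" if "x\<^sup>2 \<le> ?A + ?B + ?C" for x
    unfolding dd_norm_def by (rule order_trans[OF abs_ge_self]) (use real_sqrt_le_mono[OF that] in simp)
  have "(hm1norm (\<sigma> i j))\<^sup>2 \<le> (\<Sum>j\<in>UNIV. (hm1norm (\<sigma> i j))\<^sup>2)" by (rule member_le_sum) auto
  also have "\<dots> \<le> ?A" by (rule member_le_sum[where f="\<lambda>i. \<Sum>j\<in>UNIV. (hm1norm (\<sigma> i j))\<^sup>2"]) (auto intro: sum_nonneg)
  finally show "hm1norm (\<sigma> i j) \<le> dd_norm \<sigma>" using 0 by (intro b) linarith
  have "(hm1norm (ddiv \<sigma> i))\<^sup>2 \<le> ?B" by (rule member_le_sum) auto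
  thus "hm1norm (ddiv \<sigma> i) \<le> dd_norm \<sigma>" using 0 by (intro b) linarith
  show "hm1norm (ddivdiv \<sigma>) \<le> dd_norm \<sigma>" using 0 by (intro b) linarith
qed

lemma Hhat_hmd:
  assumes "Hhat_dd \<Omega> \<sigma>"
  shows "hmd (\<sigma> i j) (dd_norm \<sigma>)" "hmd (ddiv \<sigma> i) (dd_norm \<sigma>)" "hmd (ddivdiv \<sigma>) (dd_norm \<sigma>)"
proof -
  show "hmd (\<sigma> i j) (dd_norm \<sigma>)"
    by (rule hmd_mono[OF Hm1_hmd dd_norm_ge(1)]) (use assms in \<open>auto simp: Hhat_dd_def Htm1_def\<close>)
  show "hmd (ddiv \<sigma> i) (dd_norm \<sigma>)"
    by (rule hmd_mono[OF Hm1_hmd dd_norm_ge(2)]) (use assms in \<open>auto simp: Hhat_dd_def Htm1_def\<close>)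
  show "hmd (ddivdiv \<sigma>) (dd_norm \<sigma>)"
    by (rule hmd_mono[OF Hm1_hmd dd_norm_ge(3)]) (use assms in \<open>auto simp: Hhat_dd_def Htm1_def\<close>)
qed

lemma Hhat_sym: "Hhat_dd \<Omega> \<sigma> \<Longrightarrow> test \<phi> \<Longrightarrow> \<sigma> i j \<phi> = \<sigma> j i \<phi>"
  unfolding Hhat_dd_def by blast

lemma Hhat_supp: "Hhat_dd \<Omega> \<sigma> \<Longrightarrow> supp_in (\<sigma> i j) (closure \<Omega>)"
  unfolding Hhat_dd_def Htm1_def by blast

definition source_op :: "pt set \<Rightarrow> pt set \<Rightarrow> ((3 \<Rightarrow> 3 \<Rightarrow> distr) \<Rightarrow> distr) \<Rightarrow> bool" where
  "source_op \<Omega> K U \<longleftrightarrow> (\<exists>c\<ge>0. \<forall>\<sigma>. Hhat_dd \<Omega> \<sigma> \<longrightarrow> hmd (U \<sigma>) (c * dd_norm \<sigma>)) \<and>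
    (\<forall>\<sigma>. Hhat_dd \<Omega> \<sigma> \<longrightarrow> supp_in (U \<sigma>) K) \<and>
    (\<forall>\<sigma> \<tau> a b \<phi>. test \<phi> \<longrightarrow> U (mlin a \<sigma> b \<tau>) \<phi> = a * U \<sigma> \<phi> + b * U \<tau> \<phi>)"

lemma source_op_hmd: "source_op \<Omega> K U \<Longrightarrow> Hhat_dd \<Omega> \<sigma> \<Longrightarrow> \<exists>C. hmd (U \<sigma>) C"
  unfolding source_op_def by blast

lemma cut_ddiv:
  assumes \<sigma>: "Hhat_dd \<Omega> \<sigma>" and \<theta>: "test \<theta>" and t: "test \<phi>"
  shows "ddiv (cut \<theta> \<sigma>) i \<phi> = ddiv \<sigma> i (\<lambda>x. \<theta> x * \<phi> x) + (\<Sum>j\<in>UNIV. \<sigma> i j (\<lambda>x. pd j \<theta> x * \<phi> x))"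
proof -
  have "\<sigma> i j (pd j (\<lambda>x. \<theta> x * \<phi> x)) = \<sigma> i j (\<lambda>x. \<theta> x * pd j \<phi> x) + \<sigma> i j (\<lambda>x. pd j \<theta> x * \<phi> x)" for j
    unfolding pd_mult[OF test_smooth[OF \<theta>] test_smooth[OF t]]
    by (intro tlin_add hmdD(1)[OF Hhat_hmd(1)[OF \<sigma>]] test_mult test_smooth test_pd \<theta> t)
  thus ?thesis by (simp add: ddiv_expand cut_def sum.distrib)
qed

lemma cut_ddivdiv:
  assumes \<sigma>: "Hhat_dd \<Omega> \<sigma>" and \<theta>: "test \<theta>" and t: "test \<phi>"
  shows "ddivdiv (cut \<theta> \<sigma>) \<phi> = ddivdiv \<sigma> (\<lambda>x. \<theta> x * \<phi> x) + (\<Sum>i\<in>UNIV. 2 * ddiv \<sigma> i (\<lambda>x. pd i \<theta> x * \<phi> x))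
    + (\<Sum>i\<in>UNIV. \<Sum>j\<in>UNIV. \<sigma> i j (\<lambda>x. pd i (pd j \<theta>) x * \<phi> x))"
proof -
  note tl = hmdD(1)[OF Hhat_hmd(1)[OF \<sigma>]] hmdD(1)[OF Hhat_hmd(2)[OF \<sigma>]]
  have 1: "ddiv \<sigma> i (pd i (\<lambda>x. \<theta> x * \<phi> x)) = ddiv \<sigma> i (\<lambda>x. \<theta> x * pd i \<phi> x) + ddiv \<sigma> i (\<lambda>x. pd i \<theta> x * \<phi> x)" for i
    unfolding pd_mult[OF test_smooth[OF \<theta>] test_smooth[OF t]]
    by (intro tlin_add tl test_mult test_smooth test_pd \<theta> t)
  have 2: "\<sigma> i j (pd i (\<lambda>x. pd j \<theta> x * \<phi> x)) = \<sigma> i j (\<lambda>x. pd j \<theta> x * pd i \<phi> x) + \<sigma> i j (\<lambda>x. pd i (pd j \<theta>) x * \<phi> x)" for i j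
    unfolding pd_mult[OF test_smooth[OF test_pd[OF \<theta>]] test_smooth[OF t]]
    by (intro tlin_add tl test_mult test_smooth test_pd \<theta> t)
  have 3: "(\<Sum>i\<in>UNIV. \<sigma> i j (pd i \<psi>)) = - ddiv \<sigma> j \<psi>" if "test \<psi>" for j \<psi>
    using Hhat_sym[OF \<sigma> test_pd[OF that]] by (simp add: ddiv_expand)
  have "ddivdiv (cut \<theta> \<sigma>) \<phi> = - (\<Sum>i\<in>UNIV. ddiv (cut \<theta> \<sigma>) i (pd i \<phi>))"
    by (simp add: ddivdiv_def dderiv_def sum_negf)
  also have "\<dots> = - (\<Sum>i\<in>UNIV. ddiv \<sigma> i (\<lambda>x. \<theta> x * pd i \<phi> x)) - (\<Sum>i\<in>UNIV. \<Sum>j\<in>UNIV. \<sigma> i j (\<lambda>x. pd j \<theta> x * pd i \<phi> x))"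
    by (simp add: cut_ddiv[OF \<sigma> \<theta> test_pd[OF t]] sum.distrib)
  also have "(\<Sum>i\<in>UNIV. ddiv \<sigma> i (\<lambda>x. \<theta> x * pd i \<phi> x)) = - ddivdiv \<sigma> (\<lambda>x. \<theta> x * \<phi> x) - (\<Sum>i\<in>UNIV. ddiv \<sigma> i (\<lambda>x. pd i \<theta> x * \<phi> x))"
    using 1 by (simp add: ddivdiv_def dderiv_def sum.distrib sum_negf)
  also have "(\<Sum>i\<in>UNIV. \<Sum>j\<in>UNIV. \<sigma> i j (\<lambda>x. pd j \<theta> x * pd i \<phi> x))
    = (\<Sum>i\<in>UNIV. \<Sum>j\<in>UNIV. \<sigma> i j (pd i (\<lambda>x. pd j \<theta> x * \<phi> x))) - (\<Sum>i\<in>UNIV. \<Sum>j\<in>UNIV. \<sigma> i j (\<lambda>x. pd i (pd j \<theta>) x * \<phi> x))"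
    by (simp add: 2 sum.distrib)
  also have "(\<Sum>i\<in>UNIV. \<Sum>j\<in>UNIV. \<sigma> i j (pd i (\<lambda>x. pd j \<theta> x * \<phi> x))) = - (\<Sum>j\<in>UNIV. ddiv \<sigma> j (\<lambda>x. pd j \<theta> x * \<phi> x))"
    by (subst sum.swap) (simp add: 3 test_mult test_smooth test_pd \<theta> t sum_negf)
  finally show ?thesis by (simp add: sum_distrib_left[symmetric])
qed

lemma supp_in_cut:
  assumes \<sigma>: "supp_in u F" and \<theta>: "test \<theta>" "tsupp \<theta> \<subseteq> B" and t: "test \<phi>" "tsupp \<phi> \<inter> (F \<inter> B) = {}"
  shows "u (\<lambda>x. \<theta> x * \<phi> x) = 0"
proof -
  have "tsupp (\<lambda>x. \<theta> x * \<phi> x) \<subseteq> tsupp \<theta> \<inter> tsupp \<phi>"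
    by (rule tsupp_subsetI) (auto simp: closed_tsupp closed_Int tsupp_outside)
  hence "tsupp (\<lambda>x. \<theta> x * \<phi> x) \<inter> F = {}" using \<theta>(2) t(2) by blast
  thus ?thesis using \<sigma> test_mult[OF test_smooth[OF \<theta>(1)] t(1)] unfolding supp_in_def by blast
qed

lemma source_op_cut:
  assumes \<theta>: "test \<theta>" "tsupp \<theta> \<subseteq> B"
  shows "source_op \<Omega> (closure \<Omega> \<inter> B) (\<lambda>\<sigma>. cut \<theta> \<sigma> i j)" "source_op \<Omega> (closure \<Omega> \<inter> B) (\<lambda>\<sigma>. ddiv (cut \<theta> \<sigma>) i)"
    "source_op \<Omega> (closure \<Omega> \<inter> B) (\<lambda>\<sigma>. ddivdiv (cut \<theta> \<sigma>))"
proof -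
  have "\<exists>c\<ge>0. \<forall>u C. hmd u C \<longrightarrow> hmd (\<lambda>\<phi>. u (\<lambda>x. \<theta> x * \<phi> x)) (c * C)" by (rule hmd_mult[OF \<theta>(1)])
  then obtain c0 where c0: "c0 \<ge> 0" "\<And>u C. hmd u C \<Longrightarrow> hmd (\<lambda>\<phi>. u (\<lambda>x. \<theta> x * \<phi> x)) (c0 * C)" by blast
  have "\<forall>j. \<exists>c\<ge>0. \<forall>u C. hmd u C \<longrightarrow> hmd (\<lambda>\<phi>. u (\<lambda>x. pd j \<theta> x * \<phi> x)) (c * C)"
    using hmd_mult[OF test_pd[OF \<theta>(1)]] by blast
  then obtain c1 where c1: "\<And>j. c1 j \<ge> 0" "\<And>j u C. hmd u C \<Longrightarrow> hmd (\<lambda>\<phi>. u (\<lambda>x. pd j \<theta> x * \<phi> x)) (c1 j * C)" by metis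
  have "\<forall>i j. \<exists>c\<ge>0. \<forall>u C. hmd u C \<longrightarrow> hmd (\<lambda>\<phi>. u (\<lambda>x. pd i (pd j \<theta>) x * \<phi> x)) (c * C)"
    using hmd_mult[OF test_pd[OF test_pd[OF \<theta>(1)]]] by blast
  then obtain c2 where c2: "\<And>i j. c2 i j \<ge> 0" "\<And>i j u C. hmd u C \<Longrightarrow> hmd (\<lambda>\<phi>. u (\<lambda>x. pd i (pd j \<theta>) x * \<phi> x)) (c2 i j * C)" by metis
  have s: "supp_in (cut \<theta> \<sigma> i j) (closure \<Omega> \<inter> B)" if "Hhat_dd \<Omega> \<sigma>" for \<sigma> i j
    unfolding supp_in_def cut_def using supp_in_cut[OF Hhat_supp[OF that] \<theta>] by blast
  have d: "tsupp (pd k \<phi>) \<inter> S = {}" if "tsupp \<phi> \<inter> S = {}" for k \<phi> S using tsupp_pd[of k \<phi>] that by blast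
  show "source_op \<Omega> (closure \<Omega> \<inter> B) (\<lambda>\<sigma>. cut \<theta> \<sigma> i j)"
    unfolding source_op_def using c0 Hhat_hmd(1) s by (auto simp: cut_def mlin_def)
  show "source_op \<Omega> (closure \<Omega> \<inter> B) (\<lambda>\<sigma>. ddiv (cut \<theta> \<sigma>) i)"
    unfolding source_op_def
  proof (intro conjI allI impI)
    have "hmd (ddiv (cut \<theta> \<sigma>) i) ((c0 + (\<Sum>j\<in>UNIV. c1 j)) * dd_norm \<sigma>)" if \<sigma>: "Hhat_dd \<Omega> \<sigma>" for \<sigma>
    proof -
      have "hmd (\<lambda>\<phi>. ddiv \<sigma> i (\<lambda>x. \<theta> x * \<phi> x) + (\<Sum>j\<in>UNIV. \<sigma> i j (\<lambda>x. pd j \<theta> x * \<phi> x)))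
        (c0 * dd_norm \<sigma> + (\<Sum>j\<in>UNIV. c1 j * dd_norm \<sigma>))"
        by (intro hmd_add hmd_sum c0(2) c1(2) Hhat_hmd[OF \<sigma>])
      hence "hmd (ddiv (cut \<theta> \<sigma>) i) (c0 * dd_norm \<sigma> + (\<Sum>j\<in>UNIV. c1 j * dd_norm \<sigma>))"
        by (rule hmd_cong) (rule cut_ddiv[OF \<sigma> \<theta>(1)])
      thus ?thesis by (simp add: sum_distrib_right[symmetric] distrib_right)
    qed
    moreover have "c0 + (\<Sum>j\<in>UNIV. c1 j) \<ge> 0" using c0(1) c1(1) by (intro add_nonneg_nonneg sum_nonneg)
    ultimately show "\<exists>c\<ge>0. \<forall>\<sigma>. Hhat_dd \<Omega> \<sigma> \<longrightarrow> hmd (ddiv (cut \<theta> \<sigma>) i) (c * dd_norm \<sigma>)" by blast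
    show "supp_in (ddiv (cut \<theta> \<sigma>) i) (closure \<Omega> \<inter> B)" if "Hhat_dd \<Omega> \<sigma>" for \<sigma>
      unfolding supp_in_def ddiv_expand using s[OF that] d test_pd unfolding supp_in_def
      by (metis (no_types, lifting) add.inverse_neutral sum.neutral)
  qed (simp add: ddiv_expand cut_def mlin_def sum.distrib sum_distrib_left)
  show "source_op \<Omega> (closure \<Omega> \<inter> B) (\<lambda>\<sigma>. ddivdiv (cut \<theta> \<sigma>))"
    unfolding source_op_def
  proof (intro conjI allI impI)
    let ?c = "c0 + (\<Sum>i\<in>UNIV. 2 * c1 i) + (\<Sum>i\<in>UNIV. \<Sum>j\<in>UNIV. c2 i j)"
    have "hmd (ddivdiv (cut \<theta> \<sigma>)) (?c * dd_norm \<sigma>)" if \<sigma>: "Hhat_dd \<Omega> \<sigma>" for \<sigma>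
    proof -
      have m: "hmd (\<lambda>\<phi>. 2 * ddiv \<sigma> i (\<lambda>x. pd i \<theta> x * \<phi> x)) (2 * (c1 i * dd_norm \<sigma>))" for i
        using hmd_add[OF c1(2)[OF Hhat_hmd(2)[OF \<sigma>]] c1(2)[OF Hhat_hmd(2)[OF \<sigma>]], of i i i i] by (simp only: mult_2)
      have "hmd (\<lambda>\<phi>. ddivdiv \<sigma> (\<lambda>x. \<theta> x * \<phi> x) + (\<Sum>i\<in>UNIV. 2 * ddiv \<sigma> i (\<lambda>x. pd i \<theta> x * \<phi> x))
          + (\<Sum>i\<in>UNIV. \<Sum>j\<in>UNIV. \<sigma> i j (\<lambda>x. pd i (pd j \<theta>) x * \<phi> x)))
        (c0 * dd_norm \<sigma> + (\<Sum>i\<in>UNIV. 2 * (c1 i * dd_norm \<sigma>)) + (\<Sum>i\<in>UNIV. \<Sum>j\<in>UNIV. c2 i j * dd_norm \<sigma>))"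
        by (intro hmd_add hmd_sum c0(2) m c2(2) Hhat_hmd[OF \<sigma>])
      hence "hmd (ddivdiv (cut \<theta> \<sigma>)) (c0 * dd_norm \<sigma> + (\<Sum>i\<in>UNIV. 2 * (c1 i * dd_norm \<sigma>)) + (\<Sum>i\<in>UNIV. \<Sum>j\<in>UNIV. c2 i j * dd_norm \<sigma>))"
        by (rule hmd_cong) (rule cut_ddivdiv[OF \<sigma> \<theta>(1)])
      thus ?thesis by (simp add: sum_distrib_right distrib_right mult.assoc)
    qed
    moreover have "?c \<ge> 0" using c0(1) c1(1) c2(1) by (intro add_nonneg_nonneg sum_nonneg mult_nonneg_nonneg) auto
    ultimately show "\<exists>c\<ge>0. \<forall>\<sigma>. Hhat_dd \<Omega> \<sigma> \<longrightarrow> hmd (ddivdiv (cut \<theta> \<sigma>)) (c * dd_norm \<sigma>)" by blast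
    show "supp_in (ddivdiv (cut \<theta> \<sigma>)) (closure \<Omega> \<inter> B)" if "Hhat_dd \<Omega> \<sigma>" for \<sigma>
      unfolding supp_in_def
    proof (intro allI impI)
      fix \<phi> assume t: "test \<phi>" "tsupp \<phi> \<inter> (closure \<Omega> \<inter> B) = {}"
      have "cut \<theta> \<sigma> i j (pd j (pd i \<phi>)) = 0" for i j
        using s[OF that] d[OF d[OF t(2)]] test_pd[OF test_pd[OF t(1)]] unfolding supp_in_def by blast
      thus "ddivdiv (cut \<theta> \<sigma>) \<phi> = 0" by (simp add: ddivdiv_expand)
    qed
  qed (simp add: ddivdiv_expand cut_def mlin_def sum.distrib sum_distrib_left)
qed

definition potential_op :: "pt set \<Rightarrow> ((3 \<Rightarrow> 3 \<Rightarrow> distr) \<Rightarrow> distr) \<Rightarrow> bool" where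
  "potential_op \<Omega> S \<longleftrightarrow> (\<exists>K\<ge>0. \<forall>\<sigma>. Hhat_dd \<Omega> \<sigma> \<longrightarrow> regd (S \<sigma>) (K * dd_norm \<sigma>)) \<and>
    (\<forall>\<sigma>. Hhat_dd \<Omega> \<sigma> \<longrightarrow> appr \<Omega> (S \<sigma>)) \<and>
    (\<forall>\<sigma> \<tau> a b \<phi>. Hhat_dd \<Omega> \<sigma> \<longrightarrow> Hhat_dd \<Omega> \<tau> \<longrightarrow> test \<phi> \<longrightarrow> S (mlin a \<sigma> b \<tau>) \<phi> = a * S \<sigma> \<phi> + b * S \<tau> \<phi>)"

lemma potential_op_zero: "potential_op \<Omega> (\<lambda>\<sigma> \<phi>. 0)"
  unfolding potential_op_def using regd_zero appr_zero by (auto intro!: exI[of _ 0])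

lemma potential_op_lin:
  assumes S: "potential_op \<Omega> S" and S': "potential_op \<Omega> S'" shows "potential_op \<Omega> (\<lambda>\<sigma> \<phi>. s * S \<sigma> \<phi> + t * S' \<sigma> \<phi>)"
  unfolding potential_op_def
proof (intro conjI allI impI)
  obtain K K' where K: "K \<ge> 0" "\<And>\<sigma>. Hhat_dd \<Omega> \<sigma> \<Longrightarrow> regd (S \<sigma>) (K * dd_norm \<sigma>)"
    and K': "K' \<ge> 0" "\<And>\<sigma>. Hhat_dd \<Omega> \<sigma> \<Longrightarrow> regd (S' \<sigma>) (K' * dd_norm \<sigma>)"
    using S S' unfolding potential_op_def by blast
  have "regd (\<lambda>\<phi>. s * S \<sigma> \<phi> + t * S' \<sigma> \<phi>) ((\<bar>s\<bar> * K + \<bar>t\<bar> * K') * dd_norm \<sigma>)" if "Hhat_dd \<Omega> \<sigma>" for \<sigma>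
    using regd_lin[OF K(2)[OF that] K'(2)[OF that], of s t] by (simp add: distrib_right mult.assoc)
  moreover have "\<bar>s\<bar> * K + \<bar>t\<bar> * K' \<ge> 0" using K K' by simp
  ultimately show "\<exists>K\<ge>0. \<forall>\<sigma>. Hhat_dd \<Omega> \<sigma> \<longrightarrow> regd (\<lambda>\<phi>. s * S \<sigma> \<phi> + t * S' \<sigma> \<phi>) (K * dd_norm \<sigma>)" by blast
  show "appr \<Omega> (\<lambda>\<phi>. s * S \<sigma> \<phi> + t * S' \<sigma> \<phi>)" if "Hhat_dd \<Omega> \<sigma>" for \<sigma>
    using S S' that unfolding potential_op_def by (intro appr_lin) blast+
  show "s * S (mlin a \<sigma> b \<tau>) \<phi> + t * S' (mlin a \<sigma> b \<tau>) \<phi> = a * (s * S \<sigma> \<phi> + t * S' \<sigma> \<phi>) + b * (s * S \<tau> \<phi> + t * S' \<tau> \<phi>)"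
    if "Hhat_dd \<Omega> \<sigma>" "Hhat_dd \<Omega> \<tau>" "test \<phi>" for \<sigma> \<tau> a b \<phi>
    using S S' that unfolding potential_op_def by (simp add: algebra_simps)
qed

lemma potential_op_add: "potential_op \<Omega> S \<Longrightarrow> potential_op \<Omega> S' \<Longrightarrow> potential_op \<Omega> (\<lambda>\<sigma> \<phi>. S \<sigma> \<phi> + S' \<sigma> \<phi>)"
  using potential_op_lin[of \<Omega> S S' 1 1] by simp

lemma potential_op_cmult: "potential_op \<Omega> S \<Longrightarrow> potential_op \<Omega> (\<lambda>\<sigma> \<phi>. s * S \<sigma> \<phi>)"
  using potential_op_lin[of \<Omega> S S s 0] by simp

lemma potential_op_sum: "(\<And>i. i \<in> I \<Longrightarrow> potential_op \<Omega> (S i)) \<Longrightarrow> potential_op \<Omega> (\<lambda>\<sigma> \<phi>. \<Sum>i\<in>I. S i \<sigma> \<phi>)"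
  by (induction I rule: infinite_finite_induct) (auto simp: potential_op_zero intro: potential_op_add)

lemma local_opD:
  assumes "local_op \<Omega> K A E"
  shows "\<exists>B\<ge>0. \<forall>u C. hmd u C \<longrightarrow> regd (E u) (B * C)"
    "hmd u C \<Longrightarrow> supp_in u K \<Longrightarrow> appr \<Omega> (E u)" "test \<phi> \<Longrightarrow> test (A N \<phi>)"
    "test \<phi> \<Longrightarrow> pd i (A N \<phi>) = A N (pd i \<phi>)" "hmd u C \<Longrightarrow> test \<phi> \<Longrightarrow> (\<lambda>N. u (A N \<phi>)) \<longlonglongrightarrow> E u \<phi>"
  using assms unfolding local_op_def by auto

lemma potential_op_base:
  assumes L: "local_op \<Omega> K A E" and U: "source_op \<Omega> K U" shows "potential_op \<Omega> (\<lambda>\<sigma>. E (U \<sigma>))"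
  unfolding potential_op_def
proof (intro conjI allI impI)
  obtain c where c: "c \<ge> 0" "\<And>\<sigma>. Hhat_dd \<Omega> \<sigma> \<Longrightarrow> hmd (U \<sigma>) (c * dd_norm \<sigma>)" using U unfolding source_op_def by blast
  obtain B where B: "B \<ge> 0" "\<And>u C. hmd u C \<Longrightarrow> regd (E u) (B * C)" using local_opD(1)[OF L] by blast
  have "regd (E (U \<sigma>)) ((B * c) * dd_norm \<sigma>)" if "Hhat_dd \<Omega> \<sigma>" for \<sigma>
    using B(2)[OF c(2)[OF that]] by (simp add: mult.assoc)
  thus "\<exists>K\<ge>0. \<forall>\<sigma>. Hhat_dd \<Omega> \<sigma> \<longrightarrow> regd (E (U \<sigma>)) (K * dd_norm \<sigma>)"
    using B(1) c(1) by (intro exI[of _ "B * c"]) auto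
  show "appr \<Omega> (E (U \<sigma>))" if "Hhat_dd \<Omega> \<sigma>" for \<sigma>
    using local_opD(2)[OF L c(2)[OF that]] U that unfolding source_op_def by blast
  fix \<sigma> \<tau> a b \<phi> assume \<sigma>: "Hhat_dd \<Omega> \<sigma>" and \<tau>: "Hhat_dd \<Omega> \<tau>" and t: "test \<phi>"
  have e: "U (mlin a \<sigma> b \<tau>) \<psi> = a * U \<sigma> \<psi> + b * U \<tau> \<psi>" if "test \<psi>" for \<psi>
    using U that unfolding source_op_def by blast
  have h: "hmd (U (mlin a \<sigma> b \<tau>)) (\<bar>a\<bar> * (c * dd_norm \<sigma>) + \<bar>b\<bar> * (c * dd_norm \<tau>))"
    by (rule hmd_cong[OF hmd_lin[OF c(2)[OF \<sigma>] c(2)[OF \<tau>]] e])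
  have "(\<lambda>N. a * U \<sigma> (A N \<phi>) + b * U \<tau> (A N \<phi>)) \<longlonglongrightarrow> a * E (U \<sigma>) \<phi> + b * E (U \<tau>) \<phi>"
    by (intro tendsto_intros local_opD(5)[OF L c(2)[OF \<sigma>] t] local_opD(5)[OF L c(2)[OF \<tau>] t])
  moreover have "(\<lambda>N. U (mlin a \<sigma> b \<tau>) (A N \<phi>)) \<longlonglongrightarrow> E (U (mlin a \<sigma> b \<tau>)) \<phi>" by (rule local_opD(5)[OF L h t])
  ultimately show "E (U (mlin a \<sigma> b \<tau>)) \<phi> = a * E (U \<sigma>) \<phi> + b * E (U \<tau>) \<phi>"
    using e local_opD(3)[OF L t] LIMSEQ_unique by simp
qed

lemma dcurl_lim:
  assumes L: "local_op \<Omega> K A E" and T: "\<And>i l \<psi>. test \<psi> \<Longrightarrow> (\<lambda>N. T i l (A N \<psi>)) \<longlonglongrightarrow> T' i l \<psi>" and t: "test \<psi>"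
  shows "(\<lambda>N. dcurl T i j (A N \<psi>)) \<longlonglongrightarrow> dcurl T' i j \<psi>"
  unfolding dcurl_expand local_opD(4)[OF L t] by (intro tendsto_intros T test_pd t)

lemma dinc_lim:
  assumes L: "local_op \<Omega> K A E" and T: "\<And>i l \<psi>. test \<psi> \<Longrightarrow> (\<lambda>N. T i l (A N \<psi>)) \<longlonglongrightarrow> T' i l \<psi>" and t: "test \<psi>"
  shows "(\<lambda>N. dinc T i j (A N \<psi>)) \<longlonglongrightarrow> dinc T' i j \<psi>"
  unfolding dinc_def
  by (rule dcurl_lim[OF L _ t]) (simp add: dtrans_def dcurl_lim[OF L T])

lemma dcurl_sum: "dcurl (\<lambda>i j \<phi>. \<Sum>a\<in>I. T a i j \<phi>) i j \<phi> = (\<Sum>a\<in>I. dcurl (T a) i j \<phi>)"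
proof -
  have "(\<Sum>a\<in>I. dcurl (T a) i j \<phi>) = (\<Sum>k\<in>UNIV. \<Sum>a\<in>I. \<Sum>l\<in>UNIV. levi j k l * - T a i l (pd k \<phi>))"
    unfolding dcurl_expand by (rule sum.swap)
  also have "\<dots> = (\<Sum>k\<in>UNIV. \<Sum>l\<in>UNIV. \<Sum>a\<in>I. levi j k l * - T a i l (pd k \<phi>))"
    by (intro sum.cong refl sum.swap)
  finally show ?thesis by (simp add: dcurl_expand sum_negf sum_distrib_left)
qed

lemma dsym_dcurl_sum: "dsym (dcurl (\<lambda>i j \<phi>. \<Sum>a\<in>I. T a i j \<phi>)) i j \<phi> = (\<Sum>a\<in>I. dsym (dcurl (T a)) i j \<phi>)"
  by (simp add: dsym_def dcurl_sum sum.distrib[symmetric] sum_divide_distrib)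

lemma dinc_sum: "dinc (\<lambda>i j \<phi>. \<Sum>a\<in>I. T a i j \<phi>) i j \<phi> = (\<Sum>a\<in>I. dinc (T a) i j \<phi>)"
proof -
  have "dtrans (dcurl (\<lambda>i j \<phi>. \<Sum>a\<in>I. T a i j \<phi>)) = (\<lambda>i j \<phi>. \<Sum>a\<in>I. dtrans (dcurl (T a)) i j \<phi>)"
    by (simp add: fun_eq_iff dtrans_def dcurl_sum)
  thus ?thesis by (simp add: dinc_def dcurl_sum)
qed

definition split_by :: "pt set \<Rightarrow> ((3 \<Rightarrow> 3 \<Rightarrow> distr) \<Rightarrow> 3 \<Rightarrow> 3 \<Rightarrow> distr) \<Rightarrow> ((3 \<Rightarrow> 3 \<Rightarrow> distr) \<Rightarrow> 3 \<Rightarrow> 3 \<Rightarrow> distr)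
    \<Rightarrow> ((3 \<Rightarrow> 3 \<Rightarrow> distr) \<Rightarrow> 3 \<Rightarrow> 3 \<Rightarrow> distr) \<Rightarrow> ((3 \<Rightarrow> 3 \<Rightarrow> distr) \<Rightarrow> 3 \<Rightarrow> 3 \<Rightarrow> distr) \<Rightarrow> bool" where
  "split_by \<Omega> R s0 s1 s2 \<longleftrightarrow> (\<forall>i j. potential_op \<Omega> (\<lambda>\<sigma>. s0 \<sigma> i j) \<and> potential_op \<Omega> (\<lambda>\<sigma>. s1 \<sigma> i j) \<and> potential_op \<Omega> (\<lambda>\<sigma>. s2 \<sigma> i j)) \<and>
    (\<forall>\<sigma>. Hhat_dd \<Omega> \<sigma> \<longrightarrow> (\<forall>i j \<phi>. test \<phi> \<longrightarrow> s0 \<sigma> i j \<phi> = s0 \<sigma> j i \<phi> \<and> s2 \<sigma> i j \<phi> = s2 \<sigma> j i \<phi> \<and>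
      (\<Sum>i\<in>UNIV. s1 \<sigma> i i \<phi>) = 0 \<and>
      R \<sigma> i j \<phi> = s0 \<sigma> i j \<phi> + dsym (dcurl (s1 \<sigma>)) i j \<phi> + dinc (s2 \<sigma>) i j \<phi>))"

definition splits :: "pt set \<Rightarrow> ((3 \<Rightarrow> 3 \<Rightarrow> distr) \<Rightarrow> 3 \<Rightarrow> 3 \<Rightarrow> distr) \<Rightarrow> bool" where
  "splits \<Omega> R \<longleftrightarrow> (\<exists>s0 s1 s2. split_by \<Omega> R s0 s1 s2)"

lemma splits_sum:
  assumes "\<And>a. a \<in> I \<Longrightarrow> splits \<Omega> (R a)" shows "splits \<Omega> (\<lambda>\<sigma> i j \<phi>. \<Sum>a\<in>I. R a \<sigma> i j \<phi>)"
proof -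
  obtain s0 s1 s2 where S: "\<And>a. a \<in> I \<Longrightarrow> split_by \<Omega> (R a) (s0 a) (s1 a) (s2 a)"
    using assms unfolding splits_def by metis
  have s: "potential_op \<Omega> (\<lambda>\<sigma>. s0 a \<sigma> i j) \<and> potential_op \<Omega> (\<lambda>\<sigma>. s1 a \<sigma> i j) \<and> potential_op \<Omega> (\<lambda>\<sigma>. s2 a \<sigma> i j)" if "a \<in> I" for a i j
    using S[OF that] unfolding split_by_def by blast
  have e: "s0 a \<sigma> i j \<phi> = s0 a \<sigma> j i \<phi> \<and> s2 a \<sigma> i j \<phi> = s2 a \<sigma> j i \<phi> \<and>
      (\<Sum>i\<in>UNIV. s1 a \<sigma> i i \<phi>) = 0 \<and>
      R a \<sigma> i j \<phi> = s0 a \<sigma> i j \<phi> + dsym (dcurl (s1 a \<sigma>)) i j \<phi> + dinc (s2 a \<sigma>) i j \<phi>"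
    if "a \<in> I" "Hhat_dd \<Omega> \<sigma>" "test \<phi>" for a \<sigma> i j \<phi>
    using S[OF that(1)] that(2,3) unfolding split_by_def by blast
  define S0 where "S0 \<sigma> i j = (\<lambda>\<phi>. \<Sum>a\<in>I. s0 a \<sigma> i j \<phi>)" for \<sigma> i j
  define S1 where "S1 \<sigma> i j = (\<lambda>\<phi>. \<Sum>a\<in>I. s1 a \<sigma> i j \<phi>)" for \<sigma> i j
  define S2 where "S2 \<sigma> i j = (\<lambda>\<phi>. \<Sum>a\<in>I. s2 a \<sigma> i j \<phi>)" for \<sigma> i j
  show ?thesis unfolding splits_def split_by_def
  proof (rule exI[of _ S0], rule exI[of _ S1], rule exI[of _ S2], intro conjI allI impI)
    fix i j
    show "potential_op \<Omega> (\<lambda>\<sigma>. S0 \<sigma> i j)" "potential_op \<Omega> (\<lambda>\<sigma>. S1 \<sigma> i j)" "potential_op \<Omega> (\<lambda>\<sigma>. S2 \<sigma> i j)"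
      unfolding S0_def S1_def S2_def using s by (auto intro!: potential_op_sum)
  next
    fix \<sigma> i j \<phi> assume \<sigma>: "Hhat_dd \<Omega> \<sigma>" and t: "test \<phi>"
    show "S0 \<sigma> i j \<phi> = S0 \<sigma> j i \<phi>" "S2 \<sigma> i j \<phi> = S2 \<sigma> j i \<phi>"
      unfolding S0_def S2_def using e[OF _ \<sigma> t] by (auto intro!: sum.cong)
    show "(\<Sum>i\<in>UNIV. S1 \<sigma> i i \<phi>) = 0" unfolding S1_def using e[OF _ \<sigma> t] by (subst sum.swap) auto
    show "(\<Sum>a\<in>I. R a \<sigma> i j \<phi>) = S0 \<sigma> i j \<phi> + dsym (dcurl (S1 \<sigma>)) i j \<phi> + dinc (S2 \<sigma>) i j \<phi>"
      unfolding S0_def S1_def[abs_def] S2_def[abs_def] dsym_dcurl_sum dinc_sum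
      using e[OF _ \<sigma> t] by (simp add: sum.distrib)
  qed
qed

lemma curlpot_trace: "(\<Sum>i\<in>UNIV. curlpot d V i i \<phi>) = 0"
  by (simp add: curlpot_def sum_3 levi_simps algebra_simps)

lemma incpot_sym:
  assumes "\<And>p q. u p q \<phi> = u q p \<phi>" shows "incpot d u i j \<phi> = incpot d u j i \<phi>"
proof -
  have s: "u 2 1 \<phi> = u 1 2 \<phi>" "u 3 1 \<phi> = u 1 3 \<phi>" "u 3 2 \<phi> = u 2 3 \<phi>" by (rule assms)+
  have "\<forall>i j. incpot d u i j \<phi> = incpot d u j i \<phi>"
    unfolding incpot_def forall_3 sum_3 levi_simps s by (simp add: s levi_simps algebra_simps)
  thus ?thesis by blast
qed

lemma splits_cut:
  assumes L0: "local_op \<Omega> (closure \<Omega> \<inter> B) A0 E0" and L: "\<And>n. n < m \<Longrightarrow> local_op \<Omega> (closure \<Omega> \<inter> B) (A n) (E n)"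
    and lim: "\<And>u C \<phi>. hmd u C \<Longrightarrow> test \<phi> \<Longrightarrow>
       (\<lambda>N. E0 u \<phi> + (\<Sum>n<m. u (dd (d n) (dd (d n) (A n N \<phi>))))) \<longlonglongrightarrow> u \<phi>"
    and \<theta>: "test \<theta>" "tsupp \<theta> \<subseteq> B"
  shows "splits \<Omega> (cut \<theta>)"
proof -
  note ok = source_op_cut[OF \<theta>, of \<Omega>]
  define s0 where "s0 \<sigma> i j = (\<lambda>\<phi>. E0 (cut \<theta> \<sigma> i j) \<phi> + (\<Sum>n<m. (d n $ i * d n $ j) * E n (ddivdiv (cut \<theta> \<sigma>)) \<phi>))" for \<sigma> i j
  define t1 where "t1 n \<sigma> = curlpot (d n) (\<lambda>p. E n (ddiv (cut \<theta> \<sigma>) p))" for n \<sigma>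
  define t2 where "t2 n \<sigma> = incpot (d n) (\<lambda>p q. E n (cut \<theta> \<sigma> p q))" for n \<sigma>
  define s1 where "s1 \<sigma> i j = (\<lambda>\<phi>. \<Sum>n<m. t1 n \<sigma> i j \<phi>)" for \<sigma> i j
  define s2 where "s2 \<sigma> i j = (\<lambda>\<phi>. \<Sum>n<m. t2 n \<sigma> i j \<phi>)" for \<sigma> i j
  show ?thesis unfolding splits_def split_by_def
  proof (rule exI[of _ s0], rule exI[of _ s1], rule exI[of _ s2], intro conjI allI impI)
    fix i j
    show "potential_op \<Omega> (\<lambda>\<sigma>. s0 \<sigma> i j)" unfolding s0_def
      by (intro potential_op_add potential_op_sum potential_op_cmult potential_op_base[OF L0 ok(1)] potential_op_base[OF L ok(3)]) auto
    show "potential_op \<Omega> (\<lambda>\<sigma>. s1 \<sigma> i j)" unfolding s1_def t1_def curlpot_def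
      by (intro potential_op_sum potential_op_cmult potential_op_base[OF L ok(2)]) auto
    show "potential_op \<Omega> (\<lambda>\<sigma>. s2 \<sigma> i j)" unfolding s2_def t2_def incpot_def
      by (intro potential_op_sum potential_op_cmult potential_op_base[OF L ok(1)]) auto
  next
    fix \<sigma> i j \<phi> assume \<sigma>: "Hhat_dd \<Omega> \<sigma>" and t: "test \<phi>"
    have hm: "\<exists>C. hmd (cut \<theta> \<sigma> p q) C" "\<exists>C. hmd (ddiv (cut \<theta> \<sigma>) p) C" "\<exists>C. hmd (ddivdiv (cut \<theta> \<sigma>)) C" for p q
      using source_op_hmd[OF ok(1) \<sigma>] source_op_hmd[OF ok(2) \<sigma>] source_op_hmd[OF ok(3) \<sigma>] by auto
    have sy: "cut \<theta> \<sigma> p q \<psi> = cut \<theta> \<sigma> q p \<psi>" if "test \<psi>" for p q \<psi>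
      unfolding cut_def by (rule Hhat_sym[OF \<sigma> test_mult[OF test_smooth[OF \<theta>(1)] that]])
    have Esy: "E' (cut \<theta> \<sigma> p q) \<psi> = E' (cut \<theta> \<sigma> q p) \<psi>" if "test \<psi>" "local_op \<Omega> (closure \<Omega> \<inter> B) A' E'" for p q \<psi> A' E'
    proof -
      obtain C C' where C: "hmd (cut \<theta> \<sigma> p q) C" "hmd (cut \<theta> \<sigma> q p) C'" using hm(1) by blast
      have "(\<lambda>N. cut \<theta> \<sigma> p q (A' N \<psi>)) = (\<lambda>N. cut \<theta> \<sigma> q p (A' N \<psi>))"
        using sy[OF local_opD(3)[OF that(2,1)]] by blast
      thus ?thesis using local_opD(5)[OF that(2) C(1) that(1)] local_opD(5)[OF that(2) C(2) that(1)] LIMSEQ_unique by metis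
    qed
    show "s0 \<sigma> i j \<phi> = s0 \<sigma> j i \<phi>" unfolding s0_def using Esy[OF t L0, of i j] by (simp add: mult.commute)
    show "s2 \<sigma> i j \<phi> = s2 \<sigma> j i \<phi>" unfolding s2_def t2_def
      by (intro sum.cong refl incpot_sym Esy[OF t L]) auto
    show "(\<Sum>i\<in>UNIV. s1 \<sigma> i i \<phi>) = 0" unfolding s1_def t1_def by (subst sum.swap) (simp add: curlpot_trace)
    have step: "(\<lambda>N. cut \<theta> \<sigma> i j (dd (d n) (dd (d n) (A n N \<phi>)))) \<longlonglongrightarrow>
      (d n $ i * d n $ j) * E n (ddivdiv (cut \<theta> \<sigma>)) \<phi> + dsym (dcurl (t1 n \<sigma>)) i j \<phi> + dinc (t2 n \<sigma>) i j \<phi>"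
      if n: "n < m" for n
    proof -
      note Ln = L[OF n]
      have l0: "(\<lambda>N. ddivdiv (cut \<theta> \<sigma>) (A n N \<psi>)) \<longlonglongrightarrow> E n (ddivdiv (cut \<theta> \<sigma>)) \<psi>" if "test \<psi>" for \<psi>
        using hm(3) local_opD(5)[OF Ln _ that] by blast
      have l1: "(\<lambda>N. ddiv (cut \<theta> \<sigma>) p (A n N \<psi>)) \<longlonglongrightarrow> E n (ddiv (cut \<theta> \<sigma>) p) \<psi>" if "test \<psi>" for p \<psi>
        using hm(2)[of p] local_opD(5)[OF Ln _ that] by blast
      have l2: "(\<lambda>N. cut \<theta> \<sigma> p q (A n N \<psi>)) \<longlonglongrightarrow> E n (cut \<theta> \<sigma> p q) \<psi>" if "test \<psi>" for p q \<psi>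
        using hm(1)[of p q] local_opD(5)[OF Ln _ that] by blast
      have m1: "(\<lambda>N. curlpot (d n) (ddiv (cut \<theta> \<sigma>)) i l (A n N \<psi>)) \<longlonglongrightarrow> t1 n \<sigma> i l \<psi>" if "test \<psi>" for i l \<psi>
        unfolding t1_def curlpot_def by (intro tendsto_intros l1 that)
      have m2: "(\<lambda>N. incpot (d n) (cut \<theta> \<sigma>) i l (A n N \<psi>)) \<longlonglongrightarrow> t2 n \<sigma> i l \<psi>" if "test \<psi>" for i l \<psi>
        unfolding t2_def incpot_def by (intro tendsto_intros l2 that)
      have tl: "tlin (cut \<theta> \<sigma> p q)" for p q using hm(1) hmdD(1) by blast
      have "(\<lambda>N. (d n $ i * d n $ j) * ddivdiv (cut \<theta> \<sigma>) (A n N \<phi>)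
          + dsym (dcurl (curlpot (d n) (ddiv (cut \<theta> \<sigma>)))) i j (A n N \<phi>) + dinc (incpot (d n) (cut \<theta> \<sigma>)) i j (A n N \<phi>))
        \<longlonglongrightarrow> (d n $ i * d n $ j) * E n (ddivdiv (cut \<theta> \<sigma>)) \<phi> + dsym (dcurl (t1 n \<sigma>)) i j \<phi> + dinc (t2 n \<sigma>) i j \<phi>"
        unfolding dsym_def by (intro tendsto_intros l0 t dcurl_lim[OF Ln m1] dinc_lim[OF Ln m2]) auto
      thus ?thesis using second_derivative_decomposition[of "cut \<theta> \<sigma>", OF tl sy local_opD(3)[OF Ln t]] by simp
    qed
    obtain C where C: "hmd (cut \<theta> \<sigma> i j) C" using hm(1) by blast
    have "(\<lambda>N. E0 (cut \<theta> \<sigma> i j) \<phi> + (\<Sum>n<m. cut \<theta> \<sigma> i j (dd (d n) (dd (d n) (A n N \<phi>))))) \<longlonglongrightarrow>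
      E0 (cut \<theta> \<sigma> i j) \<phi> + (\<Sum>n<m. (d n $ i * d n $ j) * E n (ddivdiv (cut \<theta> \<sigma>)) \<phi> + dsym (dcurl (t1 n \<sigma>)) i j \<phi> + dinc (t2 n \<sigma>) i j \<phi>)"
      by (intro tendsto_intros step) auto
    from LIMSEQ_unique[OF lim[OF C t] this]
    have "cut \<theta> \<sigma> i j \<phi> = s0 \<sigma> i j \<phi> + (\<Sum>n<m. dsym (dcurl (t1 n \<sigma>)) i j \<phi>) + (\<Sum>n<m. dinc (t2 n \<sigma>) i j \<phi>)"
      by (simp add: s0_def sum.distrib)
    also have "\<dots> = s0 \<sigma> i j \<phi> + dsym (dcurl (s1 \<sigma>)) i j \<phi> + dinc (s2 \<sigma>) i j \<phi>"
      unfolding s1_def[abs_def] s2_def[abs_def] dsym_dcurl_sum dinc_sum ..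
    finally show "cut \<theta> \<sigma> i j \<phi> = s0 \<sigma> i j \<phi> + dsym (dcurl (s1 \<sigma>)) i j \<phi> + dinc (s2 \<sigma>) i j \<phi>" .
  qed
qed

lemma splits_id:
  assumes o: "open \<Omega>" and b: "bounded \<Omega>" and lip: "lipschitz_boundary \<Omega>"
  shows "splits \<Omega> (\<lambda>\<sigma>. \<sigma>)"
proof -
  define ok where "ok x r \<longleftrightarrow> (\<exists>m d A0 E0 A E. local_op \<Omega> (closure \<Omega> \<inter> cball x r) A0 E0 \<and>
    (\<forall>i<m::nat. local_op \<Omega> (closure \<Omega> \<inter> cball x r) (A i) (E i)) \<and>
    (\<forall>u C \<phi>. hmd u C \<longrightarrow> test \<phi> \<longrightarrow>
       (\<lambda>N. E0 u \<phi> + (\<Sum>i<m. u (dd (d i) (dd (d i) (A i N \<phi>))))) \<longlonglongrightarrow> u \<phi>))" for x r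
  have "\<forall>x\<in>closure \<Omega>. \<exists>r>0. ok x r" unfolding ok_def using local_parametrices[OF o b lip] by blast
  then obtain r where r: "\<And>x. x \<in> closure \<Omega> \<Longrightarrow> r x > 0" "\<And>x. x \<in> closure \<Omega> \<Longrightarrow> ok x (r x)" by metis
  have "compact (closure \<Omega>)" using b by (simp add: compact_closure)
  from partition_of_unity[OF this, of r] r(1)
  obtain I \<theta> V where H: "finite I \<and> I \<subseteq> closure \<Omega> \<and> (\<forall>a\<in>I. test (\<theta> a) \<and> tsupp (\<theta> a) \<subseteq> cball a (r a)) \<and>
    open V \<and> closure \<Omega> \<subseteq> V \<and> (\<forall>x\<in>V. (\<Sum>a\<in>I. \<theta> a x) = 1)" by blast
  have "splits \<Omega> (cut (\<theta> a))" if a: "a \<in> I" for a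
  proof -
    have "ok a (r a)" using r(2) a H by blast
    thus ?thesis unfolding ok_def using splits_cut a H by (elim exE conjE) blast
  qed
  hence "splits \<Omega> (\<lambda>\<sigma> i j \<phi>. \<Sum>a\<in>I. cut (\<theta> a) \<sigma> i j \<phi>)" by (rule splits_sum)
  moreover have "(\<Sum>a\<in>I. cut (\<theta> a) \<sigma> i j \<phi>) = \<sigma> i j \<phi>" if \<sigma>: "Hhat_dd \<Omega> \<sigma>" and t: "test \<phi>" for \<sigma> i j \<phi>
  proof -
    note tl = hmdD(1)[OF Hhat_hmd(1)[OF \<sigma>]]
    have tt: "test (\<lambda>x. \<theta> a x * \<phi> x)" if "a \<in> I" for a using H that t by (intro test_mult test_smooth) auto
    have ts: "test (\<lambda>x. \<Sum>a\<in>I. \<theta> a x * \<phi> x)" by (intro test_sum tt)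
    have "tsupp (\<lambda>x. \<phi> x - (\<Sum>a\<in>I. \<theta> a x * \<phi> x)) \<subseteq> - V"
      by (rule tsupp_subsetI) (use H in \<open>auto simp: sum_distrib_right[symmetric]\<close>)
    hence "\<sigma> i j (\<lambda>x. \<phi> x - (\<Sum>a\<in>I. \<theta> a x * \<phi> x)) = 0"
      using Hhat_supp[OF \<sigma>, of i j] test_diff[OF t ts] H unfolding supp_in_def by blast
    hence "\<sigma> i j \<phi> = \<sigma> i j (\<lambda>x. \<Sum>a\<in>I. \<theta> a x * \<phi> x)" using tlin_diff[OF tl t ts] by simp
    also have "\<dots> = (\<Sum>a\<in>I. cut (\<theta> a) \<sigma> i j \<phi>)" unfolding cut_def by (rule tlin_sum[OF tl tt])
    finally show ?thesis ..
  qed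
  ultimately show ?thesis unfolding splits_def split_by_def by simp
qed

section \<open>Density of test functions\<close>

lemma potential_op_bdd_lin_op:
  assumes g: "\<And>i j. potential_op \<Omega> (\<lambda>\<sigma>. s \<sigma> i j)"
    and P: "\<And>\<sigma>. Hhat_dd \<Omega> \<sigma> \<Longrightarrow> AE x in lborel. P (\<lambda>i j. rep (s \<sigma> i j) x)"
  shows "bdd_lin_op \<Omega> P (\<lambda>\<sigma> i j. rep (s \<sigma> i j))"
proof -
  have "\<forall>i j. \<exists>K\<ge>0. \<forall>\<sigma>. Hhat_dd \<Omega> \<sigma> \<longrightarrow> regd (s \<sigma> i j) (K * dd_norm \<sigma>)" using g unfolding potential_op_def by blast
  then obtain K where K: "\<And>i j. K i j \<ge> 0" "\<And>i j \<sigma>. Hhat_dd \<Omega> \<sigma> \<Longrightarrow> regd (s \<sigma> i j) (K i j * dd_norm \<sigma>)" by metis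
  show ?thesis unfolding bdd_lin_op_def
  proof (intro conjI allI impI)
    show "H01 \<Omega> (rep (s \<sigma> i j))" if "Hhat_dd \<Omega> \<sigma>" for \<sigma> i j
      using g[of i j] that unfolding potential_op_def by (intro appr_H01[OF K(2)[OF that]]) blast
    show "AE x in lborel. P (\<lambda>i j. rep (s \<sigma> i j) x)" if "Hhat_dd \<Omega> \<sigma>" for \<sigma> by (rule P[OF that])
    show "AE x in lborel. rep (s (mlin a \<sigma> b \<tau>) i j) x = a * rep (s \<sigma> i j) x + b * rep (s \<tau> i j) x"
      if \<sigma>: "Hhat_dd \<Omega> \<sigma>" and \<tau>: "Hhat_dd \<Omega> \<tau>" for \<sigma> \<tau> a b i j
    proof -
      have e: "s (mlin a \<sigma> b \<tau>) i j \<phi> = a * s \<sigma> i j \<phi> + b * s \<tau> i j \<phi>" if "test \<phi>" for \<phi>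
        using g[of i j] \<sigma> \<tau> that unfolding potential_op_def by blast
      show ?thesis
        by (rule rep_lin_AE[OF K(2)[OF \<sigma>] K(2)[OF \<tau>] regd_cong[OF regd_lin[OF K(2)[OF \<sigma>] K(2)[OF \<tau>]] e] e])
    qed
    have "h1norm (rep (s \<sigma> i j)) \<le> (2 * (\<Sum>i\<in>UNIV. \<Sum>j\<in>UNIV. K i j)) * dd_norm \<sigma>" if \<sigma>: "Hhat_dd \<Omega> \<sigma>" for \<sigma> i j
    proof -
      have "K i j \<le> (\<Sum>j\<in>UNIV. K i j)" by (rule member_le_sum) (use K(1) in auto)
      also have "\<dots> \<le> (\<Sum>i\<in>UNIV. \<Sum>j\<in>UNIV. K i j)"
        by (rule member_le_sum[where f="\<lambda>i. \<Sum>j\<in>UNIV. K i j"]) (use K(1) in \<open>auto intro: sum_nonneg\<close>)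
      finally have "K i j * dd_norm \<sigma> \<le> (\<Sum>i\<in>UNIV. \<Sum>j\<in>UNIV. K i j) * dd_norm \<sigma>"
        using hmdD(2)[OF Hhat_hmd(3)[OF \<sigma>]] by (rule mult_right_mono)
      thus ?thesis using rep_props(4)[OF K(2)[OF \<sigma>], of i j] by simp
    qed
    thus "\<exists>C. \<forall>\<sigma>. Hhat_dd \<Omega> \<sigma> \<longrightarrow> (\<forall>i j. h1norm (rep (s \<sigma> i j)) \<le> C * dd_norm \<sigma>)" by blast
  qed
qed

lemma div_curl_zero:
  assumes "test \<psi>" shows "(\<Sum>j\<in>UNIV. dcurl r i j (pd j \<psi>)) = 0"
proof -
  have c: "pd 2 (pd 1 \<psi>) = pd 1 (pd 2 \<psi>)" "pd 3 (pd 1 \<psi>) = pd 1 (pd 3 \<psi>)" "pd 3 (pd 2 \<psi>) = pd 2 (pd 3 \<psi>)"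
    by (rule pd_commute[OF assms])+
  show ?thesis unfolding dcurl_expand sum_3 levi_simps c by simp
qed

lemma div_inc_zero:
  assumes "test \<psi>" shows "(\<Sum>j\<in>UNIV. dinc r i j (pd j \<psi>)) = 0"
  unfolding dinc_def by (rule div_curl_zero[OF assms])

lemma div_inc_zero':
  assumes t: "test \<psi>" shows "(\<Sum>i\<in>UNIV. dinc r i j (pd i \<psi>)) = 0"
proof -
  have "(\<Sum>i\<in>UNIV. \<Sum>a\<in>UNIV. \<Sum>b\<in>UNIV. levi i a b * r l b (pd a (pd k (pd i \<psi>)))) = 0" for k l
  proof -
    have e: "pd a (pd k (pd i \<psi>)) = pd a (pd i (pd k \<psi>))" for a i by (simp add: pd_commute[OF t, of k])
    have c: "pd 2 (pd 1 (pd k \<psi>)) = pd 1 (pd 2 (pd k \<psi>))" "pd 3 (pd 1 (pd k \<psi>)) = pd 1 (pd 3 (pd k \<psi>))"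
      "pd 3 (pd 2 (pd k \<psi>)) = pd 2 (pd 3 (pd k \<psi>))" by (rule pd_commute[OF test_pd[OF t]])+
    show ?thesis unfolding e sum_3 levi_simps c by simp
  qed
  note z = this
  have "(\<Sum>i\<in>UNIV. dinc r i j (pd i \<psi>)) = (\<Sum>k\<in>UNIV. \<Sum>i\<in>UNIV. \<Sum>l\<in>UNIV. levi j k l *
    (\<Sum>a\<in>UNIV. \<Sum>b\<in>UNIV. levi i a b * r l b (pd a (pd k (pd i \<psi>)))))"
    unfolding dinc_expand by (rule sum.swap)
  also have "\<dots> = (\<Sum>k\<in>UNIV. \<Sum>l\<in>UNIV. \<Sum>i\<in>UNIV. levi j k l *
    (\<Sum>a\<in>UNIV. \<Sum>b\<in>UNIV. levi i a b * r l b (pd a (pd k (pd i \<psi>)))))"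
    by (intro sum.cong refl sum.swap)
  also have "\<dots> = 0" by (simp add: sum_distrib_left[symmetric] z)
  finally show ?thesis .
qed

lemma levi_abs: "\<bar>levi i j k\<bar> \<le> 1" by (simp add: levi_def)

lemma sum3_abs: "(\<And>k. \<bar>f k\<bar> \<le> D) \<Longrightarrow> \<bar>\<Sum>k\<in>(UNIV::3 set). f k\<bar> \<le> 3 * (D::real)"
proof -
  assume "\<And>k. \<bar>f k\<bar> \<le> D"
  hence "(\<Sum>k\<in>UNIV. \<bar>f k\<bar>) \<le> (\<Sum>k\<in>(UNIV::3 set). D)" by (intro sum_mono)
  thus ?thesis by (intro order_trans[OF sum_abs]) simp
qed

lemma half_abs: "\<bar>x\<bar> \<le> D \<Longrightarrow> \<bar>y\<bar> \<le> D \<Longrightarrow> \<bar>(x + y) / 2\<bar> \<le> (D::real)"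
  using abs_triangle_ineq[of x y] by (simp add: abs_divide)

lemma levi_mult_abs: "\<bar>t\<bar> \<le> D \<Longrightarrow> \<bar>levi i j k * t\<bar> \<le> D"
  using mult_mono[OF levi_abs[of i j k], of "\<bar>t\<bar>" D] by (simp add: abs_mult)

lemma dcurl_abs: "(\<And>k l. \<bar>r i l (pd k \<phi>)\<bar> \<le> D) \<Longrightarrow> \<bar>dcurl r i j \<phi>\<bar> \<le> 9 * D"
  unfolding dcurl_expand
  by (rule order_trans[OF sum3_abs[OF sum3_abs[OF levi_mult_abs]]]) auto

lemma dinc_abs:
  assumes "\<And>k l a b. \<bar>r l b (pd a (pd k \<phi>))\<bar> \<le> D" shows "\<bar>dinc r i j \<phi>\<bar> \<le> 81 * D"
  unfolding dinc_expand
  by (rule order_trans[OF sum3_abs[OF sum3_abs[OF levi_mult_abs[OF sum3_abs[OF sum3_abs[OF levi_mult_abs[OF assms]]]]]]]) simp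

lemma error_bounds:
  assumes r0: "\<And>i j. regd (r0 i j) \<delta>" and r1: "\<And>i j. regd (r1 i j) \<delta>" and r2: "\<And>i j. regd (r2 i j) \<delta>"
    and e: "\<And>i j \<phi>. test \<phi> \<Longrightarrow> e i j \<phi> = r0 i j \<phi> + dsym (dcurl r1) i j \<phi> + dinc r2 i j \<phi>"
    and t: "test \<psi>"
  shows "\<bar>e i j \<psi>\<bar> \<le> 100 * \<delta> * h1t \<psi>" "\<bar>\<Sum>j\<in>UNIV. e i j (pd j \<psi>)\<bar> \<le> 100 * \<delta> * h1t \<psi>"
    "\<bar>\<Sum>j\<in>UNIV. e j i (pd j \<psi>)\<bar> \<le> 100 * \<delta> * h1t \<psi>" "\<bar>ddivdiv e \<psi>\<bar> \<le> 100 * \<delta> * h1t \<psi>"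
proof -
  define D where "D = \<delta> * h1t \<psi>"
  have \<delta>: "\<delta> \<ge> 0" using regdD(2)[OF r0] .
  have D: "D \<ge> 0" unfolding D_def using \<delta> h1t_nonneg by simp
  have b0: "\<bar>r \<psi>\<bar> \<le> D" if "regd r \<delta>" for r
    unfolding D_def using regdD(3)[OF that t] mult_left_mono[OF n2_le_h1t \<delta>] order_trans by blast
  have b1: "\<bar>r (pd k \<psi>)\<bar> \<le> D" if "regd r \<delta>" for r k
    unfolding D_def using regdD(4)[OF that t] mult_left_mono[OF n2_le_h1t \<delta>] order_trans by blast
  have b2: "\<bar>r (pd k (pd l \<psi>))\<bar> \<le> D" if "regd r \<delta>" for r k l
    unfolding D_def using regdD(4)[OF that test_pd[OF t]] mult_left_mono[OF n2_pd_le_h1t \<delta>] order_trans by blast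
  have c1: "\<bar>dcurl r1 i j \<psi>\<bar> \<le> 9 * D" for i j by (rule dcurl_abs) (rule b1[OF r1])
  have c2: "\<bar>dcurl r1 i j (pd m \<psi>)\<bar> \<le> 9 * D" for i j m by (rule dcurl_abs) (rule b2[OF r1])
  have s1: "\<bar>dsym (dcurl r1) i j \<psi>\<bar> \<le> 9 * D" for i j unfolding dsym_def by (intro half_abs c1)
  have s2: "\<bar>dsym (dcurl r1) i j (pd m \<psi>)\<bar> \<le> 9 * D" for i j m
    unfolding dsym_def by (intro half_abs c2)
  have i1: "\<bar>dinc r2 i j \<psi>\<bar> \<le> 81 * D" for i j by (rule dinc_abs) (rule b2[OF r2])
  have "\<bar>e i j \<psi>\<bar> \<le> 100 * D" using b0[OF r0, of i j] s1[of i j] i1[of i j] D unfolding e[OF t] by linarith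
  thus "\<bar>e i j \<psi>\<bar> \<le> 100 * \<delta> * h1t \<psi>" by (simp add: D_def mult.assoc)
  have a: "\<bar>r0 p q (pd m \<psi>) + dsym (dcurl r1) p q (pd m \<psi>)\<bar> \<le> 10 * D" for p q m
    using b1[OF r0, of p q m] s2[of p q m] by linarith
  have "(\<Sum>j\<in>UNIV. e i j (pd j \<psi>)) = (\<Sum>j\<in>UNIV. r0 i j (pd j \<psi>) + dsym (dcurl r1) i j (pd j \<psi>)) + (\<Sum>j\<in>UNIV. dinc r2 i j (pd j \<psi>))"
    by (simp add: e test_pd t sum.distrib)
  hence "\<bar>\<Sum>j\<in>UNIV. e i j (pd j \<psi>)\<bar> \<le> 3 * (10 * D)"
    unfolding div_inc_zero[OF t] using sum3_abs[OF a, of "\<lambda>j. i" "\<lambda>j. j" "\<lambda>j. j"] by simp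
  hence "\<bar>\<Sum>j\<in>UNIV. e i j (pd j \<psi>)\<bar> \<le> 100 * D" using D by linarith
  thus "\<bar>\<Sum>j\<in>UNIV. e i j (pd j \<psi>)\<bar> \<le> 100 * \<delta> * h1t \<psi>" by (simp add: D_def mult.assoc)
  have "(\<Sum>j\<in>UNIV. e j i (pd j \<psi>)) = (\<Sum>j\<in>UNIV. r0 j i (pd j \<psi>) + dsym (dcurl r1) j i (pd j \<psi>)) + (\<Sum>j\<in>UNIV. dinc r2 j i (pd j \<psi>))"
    by (simp add: e test_pd t sum.distrib)
  hence "\<bar>\<Sum>j\<in>UNIV. e j i (pd j \<psi>)\<bar> \<le> 3 * (10 * D)"
    unfolding div_inc_zero'[OF t] using sum3_abs[OF a, of "\<lambda>j. j" "\<lambda>j. i" "\<lambda>j. j"] by simp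
  hence "\<bar>\<Sum>j\<in>UNIV. e j i (pd j \<psi>)\<bar> \<le> 100 * D" using D by linarith
  thus "\<bar>\<Sum>j\<in>UNIV. e j i (pd j \<psi>)\<bar> \<le> 100 * \<delta> * h1t \<psi>" by (simp add: D_def mult.assoc)
  have dz: "(\<Sum>i\<in>UNIV. \<Sum>j\<in>UNIV. dcurl r1 i j (pd j (pd i \<psi>))) = 0"
    using div_curl_zero[OF test_pd[OF t]] by simp
  have dz': "(\<Sum>i\<in>UNIV. \<Sum>j\<in>UNIV. dcurl r1 j i (pd j (pd i \<psi>))) = 0"
  proof -
    have "(\<Sum>i\<in>UNIV. \<Sum>j\<in>UNIV. dcurl r1 j i (pd j (pd i \<psi>))) = (\<Sum>j\<in>UNIV. \<Sum>i\<in>UNIV. dcurl r1 j i (pd j (pd i \<psi>)))"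
      by (rule sum.swap)
    also have "\<dots> = (\<Sum>j\<in>UNIV. \<Sum>i\<in>UNIV. dcurl r1 j i (pd i (pd j \<psi>)))"
      by (intro sum.cong refl arg_cong[where f="dcurl r1 _ _"] pd_commute[OF t])
    finally show ?thesis by (simp add: div_curl_zero[OF test_pd[OF t]])
  qed
  have "(\<Sum>i\<in>UNIV. \<Sum>j\<in>UNIV. dsym (dcurl r1) i j (pd j (pd i \<psi>))) = 
    ((\<Sum>i\<in>UNIV. \<Sum>j\<in>UNIV. dcurl r1 i j (pd j (pd i \<psi>))) + (\<Sum>i\<in>UNIV. \<Sum>j\<in>UNIV. dcurl r1 j i (pd j (pd i \<psi>)))) / 2"
    by (simp add: dsym_def sum.distrib sum_divide_distrib add_divide_distrib)
  hence z: "(\<Sum>i\<in>UNIV. \<Sum>j\<in>UNIV. dsym (dcurl r1) i j (pd j (pd i \<psi>))) = 0" unfolding dz dz' by simp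
  have "ddivdiv e \<psi> = (\<Sum>i\<in>UNIV. \<Sum>j\<in>UNIV. r0 i j (pd j (pd i \<psi>))) + (\<Sum>i\<in>UNIV. \<Sum>j\<in>UNIV. dsym (dcurl r1) i j (pd j (pd i \<psi>)))
      + (\<Sum>i\<in>UNIV. \<Sum>j\<in>UNIV. dinc r2 i j (pd j (pd i \<psi>)))"
    by (simp add: ddivdiv_expand e test_pd t sum.distrib)
  also have "\<dots> = (\<Sum>i\<in>UNIV. \<Sum>j\<in>UNIV. r0 i j (pd j (pd i \<psi>)))"
    unfolding z by (simp add: div_inc_zero[OF test_pd[OF t]])
  finally have "\<bar>ddivdiv e \<psi>\<bar> \<le> 3 * (3 * D)" using sum3_abs[OF sum3_abs[OF b2[OF r0]]] by simp
  hence "\<bar>ddivdiv e \<psi>\<bar> \<le> 100 * D" using D by linarith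
  thus "\<bar>ddivdiv e \<psi>\<bar> \<le> 100 * \<delta> * h1t \<psi>" by (simp add: D_def mult.assoc)
qed

lemma test_on_test: "test_on \<Omega> f \<Longrightarrow> test f" by (simp add: test_on_def)

lemma test_on_pd: "test_on \<Omega> f \<Longrightarrow> test_on \<Omega> (pd k f)"
  using tsupp_pd[of k f] test_pd by (auto simp: test_on_def)

lemma test_on_cmult: "test_on \<Omega> f \<Longrightarrow> test_on \<Omega> (\<lambda>x. c * f x)"
  using test_on_lin[of \<Omega> f f c 0] by simp

lemma test_on_add: "test_on \<Omega> f \<Longrightarrow> test_on \<Omega> g \<Longrightarrow> test_on \<Omega> (\<lambda>x. f x + g x)"
  using test_on_lin[of \<Omega> f g 1 1] by simp

lemma test_on_sum: "(\<And>i. i \<in> I \<Longrightarrow> test_on \<Omega> (f i)) \<Longrightarrow> test_on \<Omega> (\<lambda>x. \<Sum>i\<in>I. f i x)"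
  by (induction I rule: infinite_finite_induct) (auto simp: test_on_zero intro: test_on_add)

lemma ip_sum_left:
  assumes "\<And>i. i \<in> I \<Longrightarrow> L2 (f i)" "L2 g"
  shows "ip (\<lambda>x. \<Sum>i\<in>I. f i x) g = (\<Sum>i\<in>I. ip (f i) g)"
  using ip_sum_right[OF assms] by (simp add: ip_commute[of g])

lemma ip_cmult_left: "L2 f \<Longrightarrow> L2 g \<Longrightarrow> ip (\<lambda>x. c * f x) g = c * ip f g"
  using ip_lin_left[of f f g c 0] by simp

lemma ip_parts: "test f \<Longrightarrow> test g \<Longrightarrow> ip f (pd i g) = - ip (pd i f) g"
  using test_weak_pd[of f i] by (simp add: weak_pd_ip)

definition tcurl :: "(3 \<Rightarrow> 3 \<Rightarrow> fn) \<Rightarrow> 3 \<Rightarrow> 3 \<Rightarrow> fn" where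
  "tcurl F i j = (\<lambda>x. \<Sum>k\<in>UNIV. \<Sum>l\<in>UNIV. levi j k l * pd k (F i l) x)"

lemma test_on_tcurl: "(\<And>i j. test_on \<Omega> (F i j)) \<Longrightarrow> test_on \<Omega> (tcurl F i j)"
  unfolding tcurl_def by (intro test_on_sum test_on_cmult test_on_pd)

lemma dcurl_ip:
  assumes F: "\<And>i j. test (F i j)" and t: "test \<psi>"
  shows "dcurl (\<lambda>i j. ip (F i j)) i j \<psi> = ip (tcurl F i j) \<psi>"
proof -
  have "ip (tcurl F i j) \<psi> = (\<Sum>k\<in>UNIV. \<Sum>l\<in>UNIV. levi j k l * ip (pd k (F i l)) \<psi>)"
    unfolding tcurl_def
    by (simp add: ip_sum_left ip_cmult_left test_L2 test_sum test_cmult test_pd F t)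
  thus ?thesis by (simp add: dcurl_expand ip_parts[OF F t])
qed

lemma dcurl_cong: "(\<And>i j \<phi>. test \<phi> \<Longrightarrow> T i j \<phi> = T' i j \<phi>) \<Longrightarrow> test \<psi> \<Longrightarrow> dcurl T i j \<psi> = dcurl T' i j \<psi>"
  by (simp add: dcurl_expand test_pd)

lemma dinc_cong: "(\<And>i j \<phi>. test \<phi> \<Longrightarrow> T i j \<phi> = T' i j \<phi>) \<Longrightarrow> test \<psi> \<Longrightarrow> dinc T i j \<psi> = dinc T' i j \<psi>"
  unfolding dinc_def by (rule dcurl_cong) (auto simp: dtrans_def intro: dcurl_cong)

lemma dinc_ip:
  assumes F: "\<And>i j. test (F i j)" and t: "test \<psi>"
  shows "dinc (\<lambda>i j. ip (F i j)) i j \<psi> = ip (tcurl (\<lambda>i j. tcurl F j i) i j) \<psi>"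
proof -
  have tc: "test (tcurl F i j)" for i j unfolding tcurl_def by (intro test_sum test_cmult test_pd F)
  have "dinc (\<lambda>i j. ip (F i j)) i j \<psi> = dcurl (\<lambda>i j. ip (tcurl F j i)) i j \<psi>"
    unfolding dinc_def by (rule dcurl_cong[OF _ t]) (simp add: dtrans_def dcurl_ip[OF F])
  thus ?thesis by (simp add: dcurl_ip[OF tc t])
qed

lemma dcurl_diff: "dcurl (\<lambda>i j \<phi>. T i j \<phi> - T' i j \<phi>) i j \<phi> = dcurl T i j \<phi> - dcurl T' i j \<phi>"
  by (simp add: dcurl_expand sum_subtractf[symmetric] algebra_simps)

lemma dinc_diff: "dinc (\<lambda>i j \<phi>. T i j \<phi> - T' i j \<phi>) i j \<phi> = dinc T i j \<phi> - dinc T' i j \<phi>"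
proof -
  have "dtrans (dcurl (\<lambda>i j \<phi>. T i j \<phi> - T' i j \<phi>)) = (\<lambda>i j \<phi>. dtrans (dcurl T) i j \<phi> - dtrans (dcurl T') i j \<phi>)"
    by (simp add: fun_eq_iff dtrans_def dcurl_diff)
  thus ?thesis by (simp add: dinc_def dcurl_diff)
qed

lemma Hhat_imp_Htilde:
  assumes sp: "split_by \<Omega> (\<lambda>\<sigma>. \<sigma>) s0 s1 s2" and \<sigma>: "Hhat_dd \<Omega> \<sigma>"
  shows "Htilde_dd \<Omega> \<sigma>"
  unfolding Htilde_dd_def
proof (intro allI impI)
  fix \<epsilon> :: real assume \<epsilon>: "\<epsilon> > 0"
  define \<delta> where "\<delta> = \<epsilon> / 400"
  have \<delta>: "\<delta> > 0" using \<epsilon> by (simp add: \<delta>_def)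
  have ap: "appr \<Omega> (s0 \<sigma> i j)" "appr \<Omega> (s1 \<sigma> i j)" "appr \<Omega> (s2 \<sigma> i j)" for i j
    using sp \<sigma> unfolding split_by_def potential_op_def by blast+
  have de: "\<sigma> i j \<phi> = s0 \<sigma> i j \<phi> + dsym (dcurl (s1 \<sigma>)) i j \<phi> + dinc (s2 \<sigma>) i j \<phi>" if "test \<phi>" for i j \<phi>
    using sp \<sigma> that unfolding split_by_def by blast
  have ch: "\<exists>f. \<forall>i j. test_on \<Omega> (f i j) \<and> regd (\<lambda>\<psi>. s i j \<psi> - ip (f i j) \<psi>) \<delta>"
    if "\<And>i j. appr \<Omega> (s i j)" for s :: "3 \<Rightarrow> 3 \<Rightarrow> distr"
  proof -
    have "\<forall>i j. \<exists>\<phi>. test_on \<Omega> \<phi> \<and> regd (\<lambda>\<psi>. s i j \<psi> - ip \<phi> \<psi>) \<delta>"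
      using that \<delta> unfolding appr_def by blast
    hence "\<forall>i. \<exists>f. \<forall>j. test_on \<Omega> (f j) \<and> regd (\<lambda>\<psi>. s i j \<psi> - ip (f j) \<psi>) \<delta>"
      by (intro allI choice) blast
    thus ?thesis by (rule choice)
  qed
  obtain f0 where f0: "\<forall>i j. test_on \<Omega> (f0 i j) \<and> regd (\<lambda>\<psi>. s0 \<sigma> i j \<psi> - ip (f0 i j) \<psi>) \<delta>"
    using ch[of "s0 \<sigma>", OF ap(1)] by blast
  obtain f1 where f1: "\<forall>i j. test_on \<Omega> (f1 i j) \<and> regd (\<lambda>\<psi>. s1 \<sigma> i j \<psi> - ip (f1 i j) \<psi>) \<delta>"
    using ch[of "s1 \<sigma>", OF ap(2)] by blast
  obtain f2 where f2: "\<forall>i j. test_on \<Omega> (f2 i j) \<and> regd (\<lambda>\<psi>. s2 \<sigma> i j \<psi> - ip (f2 i j) \<psi>) \<delta>"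
    using ch[of "s2 \<sigma>", OF ap(3)] by blast
  have f: "test_on \<Omega> (f0 i j)" "test_on \<Omega> (f1 i j)" "test_on \<Omega> (f2 i j)" for i j
    using f0 f1 f2 by blast+
  have r: "regd (\<lambda>\<psi>. s0 \<sigma> i j \<psi> - ip (f0 i j) \<psi>) \<delta>" "regd (\<lambda>\<psi>. s1 \<sigma> i j \<psi> - ip (f1 i j) \<psi>) \<delta>"
    "regd (\<lambda>\<psi>. s2 \<sigma> i j \<psi> - ip (f2 i j) \<psi>) \<delta>" for i j
    using f0 f1 f2 by blast+
  note tf = test_on_test[OF f(1)] test_on_test[OF f(2)] test_on_test[OF f(3)]
  define C where "C = tcurl f1"
  define G where "G = tcurl (\<lambda>i j. tcurl f2 j i)"
  have C: "test_on \<Omega> (C i j)" and G: "test_on \<Omega> (G i j)" for i j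
    unfolding C_def G_def by (intro test_on_tcurl f)+
  define F where "F i j = (\<lambda>x. f0 i j x + (1/2 * (C i j x + C j i x) + G i j x))" for i j
  have F: "test_on \<Omega> (F i j)" for i j unfolding F_def by (intro test_on_add test_on_cmult[of _ "\<lambda>x. C i j x + C j i x"] f C G)
  define \<Phi> where "\<Phi> i j = (\<lambda>x. 1/2 * (F i j x + F j i x))" for i j
  have \<Phi>: "test_on \<Omega> (\<Phi> i j)" for i j unfolding \<Phi>_def by (intro test_on_cmult test_on_add F)
  define r0 where "r0 i j = (\<lambda>\<psi>. s0 \<sigma> i j \<psi> - ip (f0 i j) \<psi>)" for i j
  define r1 where "r1 i j = (\<lambda>\<psi>. s1 \<sigma> i j \<psi> - ip (f1 i j) \<psi>)" for i j
  define r2 where "r2 i j = (\<lambda>\<psi>. s2 \<sigma> i j \<psi> - ip (f2 i j) \<psi>)" for i j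
  define e where "e i j = (\<lambda>\<psi>. \<sigma> i j \<psi> - ip (F i j) \<psi>)" for i j
  have ipF: "ip (F i j) \<psi> = ip (f0 i j) \<psi> + ((ip (C i j) \<psi> + ip (C j i) \<psi>) / 2 + ip (G i j) \<psi>)" if t: "test \<psi>" for i j \<psi>
  proof -
    note L = test_L2[OF test_on_test[OF f(1)]] test_L2[OF test_on_test[OF C]] test_L2[OF test_on_test[OF G]] test_L2[OF t]
    have "F i j = (\<lambda>x. 1 * f0 i j x + 1 * (1/2 * (1 * C i j x + 1 * C j i x) + 1 * G i j x))" by (simp add: F_def)
    thus ?thesis by (simp only: ip_lin_left L L2_lin) simp
  qed
  have e: "e i j \<psi> = r0 i j \<psi> + dsym (dcurl r1) i j \<psi> + dinc r2 i j \<psi>" if t: "test \<psi>" for i j \<psi>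
    unfolding e_def de[OF t] ipF[OF t] r0_def r1_def[abs_def] r2_def[abs_def] dsym_def dcurl_diff dinc_diff
      dcurl_ip[OF tf(2) t] dinc_ip[OF tf(3) t] C_def G_def by (simp add: field_simps)
  have eb: "\<bar>e i j \<psi>\<bar> \<le> 100 * \<delta> * h1t \<psi>" "\<bar>\<Sum>j\<in>UNIV. e i j (pd j \<psi>)\<bar> \<le> 100 * \<delta> * h1t \<psi>"
    "\<bar>\<Sum>j\<in>UNIV. e j i (pd j \<psi>)\<bar> \<le> 100 * \<delta> * h1t \<psi>" "\<bar>ddivdiv e \<psi>\<bar> \<le> 100 * \<delta> * h1t \<psi>" if t: "test \<psi>" for i j \<psi>
    by (rule error_bounds[OF r(1)[folded r0_def] r(2)[folded r1_def] r(3)[folded r2_def] _ t], erule e)+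
  define E where "E = (\<lambda>i j \<phi>. \<sigma> i j \<phi> - matdist \<Phi> i j \<phi>)"
  have E: "E i j \<psi> = (e i j \<psi> + e j i \<psi>) / 2" if t: "test \<psi>" for i j \<psi>
  proof -
    note L = test_L2[OF test_on_test[OF F]] test_L2[OF t]
    have "\<Phi> i j = (\<lambda>x. 1/2 * F i j x + 1/2 * F j i x)" by (simp add: \<Phi>_def fun_eq_iff)
    hence "ip (\<Phi> i j) \<psi> = 1/2 * ip (F i j) \<psi> + 1/2 * ip (F j i) \<psi>" by (simp only: ip_lin_left L)
    moreover have "matdist \<Phi> i j \<psi> = ip (\<Phi> i j) \<psi>" by (simp add: matdist_def fdist_def ip_def)
    ultimately show ?thesis using Hhat_sym[OF \<sigma> t, of i j] by (simp add: E_def e_def)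
  qed
  have b: "100 * \<delta> * h1t \<psi> = \<epsilon> / 4 * h1t \<psi>" for \<psi> by (simp add: \<delta>_def)
  have "dd_within E \<epsilon>"
    unfolding dd_within_def
  proof (rule exI[of _ "\<lambda>_ _. \<epsilon> / 4"], rule exI[of _ "\<lambda>_. \<epsilon> / 4"], rule exI[of _ "\<epsilon> / 4"], intro conjI allI)
    show "0 \<le> \<epsilon> / 4" "0 \<le> \<epsilon> / 4" "0 \<le> \<epsilon> / 4" using \<epsilon> by auto
    show "hm1_le (E i j) (\<epsilon> / 4)" for i j unfolding hm1_le_def
    proof (intro allI impI)
      fix \<psi> assume t: "test \<psi>"
      show "\<bar>E i j \<psi>\<bar> \<le> \<epsilon> / 4 * h1t \<psi>"
        unfolding E[OF t] by (rule half_abs[OF eb(1)[OF t, of i j, unfolded b] eb(1)[OF t, of j i, unfolded b]])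
    qed
    show "hm1_le (ddiv E i) (\<epsilon> / 4)" for i unfolding hm1_le_def
    proof (intro allI impI)
      fix \<psi> assume t: "test \<psi>"
      have "ddiv E i \<psi> = - (((\<Sum>j\<in>UNIV. e i j (pd j \<psi>)) + (\<Sum>j\<in>UNIV. e j i (pd j \<psi>))) / 2)"
        by (simp add: ddiv_expand E test_pd t sum.distrib sum_negf sum_divide_distrib[symmetric])
      thus "\<bar>ddiv E i \<psi>\<bar> \<le> \<epsilon> / 4 * h1t \<psi>"
        using half_abs[OF eb(2)[OF t, of i, unfolded b] eb(3)[OF t, of i, unfolded b]] by simp
    qed
    show "hm1_le (ddivdiv E) (\<epsilon> / 4)" unfolding hm1_le_def
    proof (intro allI impI)
      fix \<psi> assume t: "test \<psi>"
      have sw: "(\<Sum>i\<in>UNIV. \<Sum>j\<in>UNIV. e j i (pd j (pd i \<psi>))) = ddivdiv e \<psi>"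
      proof -
        have "(\<Sum>i\<in>UNIV. \<Sum>j\<in>UNIV. e j i (pd j (pd i \<psi>))) = (\<Sum>j\<in>UNIV. \<Sum>i\<in>UNIV. e j i (pd j (pd i \<psi>)))"
          by (rule sum.swap)
        also have "\<dots> = (\<Sum>j\<in>UNIV. \<Sum>i\<in>UNIV. e j i (pd i (pd j \<psi>)))"
          by (intro sum.cong refl arg_cong[where f="e _ _"] pd_commute[OF t])
        finally show ?thesis by (simp add: ddivdiv_expand)
      qed
      have "ddivdiv E \<psi> = (ddivdiv e \<psi> + (\<Sum>i\<in>UNIV. \<Sum>j\<in>UNIV. e j i (pd j (pd i \<psi>)))) / 2"
        by (simp add: ddivdiv_expand E test_pd t sum.distrib sum_divide_distrib[symmetric])
      thus "\<bar>ddivdiv E \<psi>\<bar> \<le> \<epsilon> / 4 * h1t \<psi>" using eb(4)[OF t] unfolding b sw by simp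
    qed
    have "13 * (\<epsilon> / 4)\<^sup>2 \<le> \<epsilon>\<^sup>2" by (simp add: power2_eq_square)
    thus "(\<Sum>i\<in>(UNIV::3 set). \<Sum>j\<in>(UNIV::3 set). (\<epsilon> / 4)\<^sup>2) + (\<Sum>i\<in>(UNIV::3 set). (\<epsilon> / 4)\<^sup>2) + (\<epsilon> / 4)\<^sup>2 \<le> \<epsilon>\<^sup>2" by simp
  qed
  moreover have "test_sym_on \<Omega> \<Phi>" unfolding test_sym_on_def using \<Phi> by (simp add: \<Phi>_def add.commute)
  ultimately show "\<exists>\<Phi>. test_sym_on \<Omega> \<Phi> \<and> dd_within (\<lambda>i j \<phi>. \<sigma> i j \<phi> - matdist \<Phi> i j \<phi>) \<epsilon>"
    unfolding E_def by blast
qed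

lemma eps_zero: "(\<And>\<epsilon>. \<epsilon> > 0 \<Longrightarrow> \<bar>x\<bar> \<le> \<epsilon> * M) \<Longrightarrow> M \<ge> 0 \<Longrightarrow> x = (0::real)"
proof (rule ccontr)
  assume h: "\<And>\<epsilon>. \<epsilon> > 0 \<Longrightarrow> \<bar>x\<bar> \<le> \<epsilon> * M" and M: "M \<ge> 0" and x: "x \<noteq> 0"
  define q where "q = \<bar>x\<bar> / (2 * (M + 1))"
  have "q > 0" using x M by (simp add: q_def)
  moreover have "q * M < \<bar>x\<bar>"
  proof -
    have "q * M \<le> q * (M + 1)" using \<open>q > 0\<close> by simp
    also have "\<dots> = \<bar>x\<bar> / 2" using M by (simp add: q_def field_simps)
    also have "\<dots> < \<bar>x\<bar>" using x by simp
    finally show ?thesis .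
  qed
  ultimately show False using h[of q] by linarith
qed

lemma Htm1_closed:
  assumes a: "\<And>\<epsilon>. \<epsilon> > 0 \<Longrightarrow> \<exists>w. test_on \<Omega> w \<and> hm1_le (\<lambda>\<phi>. u \<phi> - ip w \<phi>) \<epsilon>"
  shows "Htm1 \<Omega> u"
proof -
  have tl: "tlin u" unfolding tlin_def
  proof (intro allI impI)
    fix \<phi> \<psi> :: fn and a b assume t: "test \<phi>" "test \<psi>"
    define z where "z = (\<lambda>x. a * \<phi> x + b * \<psi> x)"
    have t': "test z" unfolding z_def by (rule test_lin[OF t])
    have "u z - (a * u \<phi> + b * u \<psi>) = 0"
    proof (rule eps_zero)
      show "h1t z + \<bar>a\<bar> * h1t \<phi> + \<bar>b\<bar> * h1t \<psi> \<ge> 0" by (simp add: h1t_nonneg)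
      fix \<epsilon> :: real assume "\<epsilon> > 0"
      then obtain w where w: "test_on \<Omega> w" "\<And>\<phi>. test \<phi> \<Longrightarrow> \<bar>u \<phi> - ip w \<phi>\<bar> \<le> \<epsilon> * h1t \<phi>"
        using assms unfolding hm1_le_def by blast
      have "ip w z = a * ip w \<phi> + b * ip w \<psi>" unfolding z_def by (intro ip_lin_right test_L2 t test_on_test[OF w(1)])
      hence "u z - (a * u \<phi> + b * u \<psi>) = (u z - ip w z) - a * (u \<phi> - ip w \<phi>) - b * (u \<psi> - ip w \<psi>)"
        by (simp add: algebra_simps)
      moreover have "\<bar>p - q - m\<bar> \<le> \<bar>p\<bar> + \<bar>q\<bar> + \<bar>m\<bar>" for p q m :: real by linarith
      ultimately have "\<bar>u z - (a * u \<phi> + b * u \<psi>)\<bar> \<le> \<bar>u z - ip w z\<bar> + \<bar>a * (u \<phi> - ip w \<phi>)\<bar> + \<bar>b * (u \<psi> - ip w \<psi>)\<bar>"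
        by (simp only:)
      also have "\<dots> \<le> \<epsilon> * h1t z + \<bar>a\<bar> * (\<epsilon> * h1t \<phi>) + \<bar>b\<bar> * (\<epsilon> * h1t \<psi>)"
        unfolding abs_mult by (intro add_mono mult_left_mono w(2) t t') auto
      finally show "\<bar>u z - (a * u \<phi> + b * u \<psi>)\<bar> \<le> \<epsilon> * (h1t z + \<bar>a\<bar> * h1t \<phi> + \<bar>b\<bar> * h1t \<psi>)"
        by (simp add: algebra_simps)
    qed
    thus "u (\<lambda>x. a * \<phi> x + b * \<psi> x) = a * u \<phi> + b * u \<psi>" by (simp add: z_def)
  qed
  obtain w where w: "test_on \<Omega> w" "\<And>\<phi>. test \<phi> \<Longrightarrow> \<bar>u \<phi> - ip w \<phi>\<bar> \<le> 1 * h1t \<phi>"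
    using a[of 1] unfolding hm1_le_def by auto
  have "hm1_le u (1 + n2 w)" unfolding hm1_le_def
  proof (intro allI impI)
    fix \<phi> assume t: "test \<phi>"
    have "\<bar>ip w \<phi>\<bar> \<le> n2 w * n2 \<phi>" by (intro ip_bound test_L2 t test_on_test[OF w(1)])
    also have "\<dots> \<le> n2 w * h1t \<phi>" by (intro mult_left_mono n2_le_h1t) simp
    finally show "\<bar>u \<phi>\<bar> \<le> (1 + n2 w) * h1t \<phi>" using w(2)[OF t] by (simp add: distrib_right)
  qed
  moreover have "supp_in u (closure \<Omega>)" unfolding supp_in_def
  proof (intro allI impI)
    fix \<phi> assume t: "test \<phi>" and s: "tsupp \<phi> \<inter> closure \<Omega> = {}"
    show "u \<phi> = 0"
    proof (rule eps_zero[OF _ h1t_nonneg[of \<phi>]])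
      fix \<epsilon> :: real assume "\<epsilon> > 0"
      then obtain w where w: "test_on \<Omega> w" "hm1_le (\<lambda>\<phi>. u \<phi> - ip w \<phi>) \<epsilon>" using a by blast
      have "w x * \<phi> x = 0" for x
      proof (cases "x \<in> tsupp w")
        case True
        hence "x \<notin> tsupp \<phi>" using w(1) s closure_subset[of \<Omega>] by (auto simp: test_on_def)
        thus ?thesis by (simp add: tsupp_outside)
      qed (simp add: tsupp_outside)
      hence "(\<lambda>x. w x * \<phi> x) = (\<lambda>_. 0)" by blast
      hence "ip w \<phi> = 0" by (simp add: ip_def)
      thus "\<bar>u \<phi>\<bar> \<le> \<epsilon> * h1t \<phi>" using w(2) t unfolding hm1_le_def by force
    qed
  qed
  ultimately show ?thesis using tl unfolding Htm1_def Hm1_def tlin_def by blast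
qed

lemma hm1_le_mono: "hm1_le u C \<Longrightarrow> C \<le> D \<Longrightarrow> hm1_le u D"
  unfolding hm1_le_def by (meson h1t_nonneg mult_right_mono order_trans)

lemma Htilde_imp_Hhat:
  assumes H: "Htilde_dd \<Omega> \<sigma>" shows "Hhat_dd \<Omega> \<sigma>"
proof -
  have ex: "\<exists>\<Phi>. test_sym_on \<Omega> \<Phi> \<and> (\<forall>i j. hm1_le (\<lambda>\<phi>. \<sigma> i j \<phi> - ip (\<Phi> i j) \<phi>) \<epsilon>) \<and>
      (\<forall>i. hm1_le (\<lambda>\<phi>. ddiv \<sigma> i \<phi> - ip (\<lambda>x. \<Sum>j\<in>UNIV. pd j (\<Phi> i j) x) \<phi>) \<epsilon>) \<and>
      hm1_le (\<lambda>\<phi>. ddivdiv \<sigma> \<phi> - ip (\<lambda>x. \<Sum>i\<in>UNIV. \<Sum>j\<in>UNIV. pd i (pd j (\<Phi> i j)) x) \<phi>) \<epsilon>"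
    if \<epsilon>: "\<epsilon> > 0" for \<epsilon>
  proof -
    obtain \<Phi> where \<Phi>: "test_sym_on \<Omega> \<Phi>" "dd_within (\<lambda>i j \<phi>. \<sigma> i j \<phi> - matdist \<Phi> i j \<phi>) \<epsilon>"
      using H \<epsilon> unfolding Htilde_dd_def by blast
    define E where "E = (\<lambda>i j \<phi>. \<sigma> i j \<phi> - matdist \<Phi> i j \<phi>)"
    obtain a b c where ab: "\<And>i j. 0 \<le> a i j \<and> hm1_le (E i j) (a i j)" "\<And>i. 0 \<le> b i \<and> hm1_le (ddiv E i) (b i)"
      "0 \<le> c" "hm1_le (ddivdiv E) c" "(\<Sum>i\<in>UNIV. \<Sum>j\<in>UNIV. (a i j)\<^sup>2) + (\<Sum>i\<in>UNIV. (b i)\<^sup>2) + c\<^sup>2 \<le> \<epsilon>\<^sup>2"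
      using \<Phi>(2) unfolding dd_within_def E_def by blast
    have p: "(\<Sum>i\<in>UNIV. \<Sum>j\<in>UNIV. (a i j)\<^sup>2) \<ge> 0" "(\<Sum>i\<in>UNIV. (b i)\<^sup>2) \<ge> 0" "c\<^sup>2 \<ge> 0" by (auto intro!: sum_nonneg)
    have le: "x \<le> \<epsilon>" if "x\<^sup>2 \<le> \<epsilon>\<^sup>2" for x using power2_le_imp_le[OF that] \<epsilon> by simp
    have "a i j \<le> \<epsilon>" for i j
    proof -
      have "(a i j)\<^sup>2 \<le> (\<Sum>j\<in>UNIV. (a i j)\<^sup>2)" by (rule member_le_sum) auto
      also have "\<dots> \<le> (\<Sum>i\<in>UNIV. \<Sum>j\<in>UNIV. (a i j)\<^sup>2)"
        by (rule member_le_sum[where f="\<lambda>i. \<Sum>j\<in>UNIV. (a i j)\<^sup>2"]) (auto intro: sum_nonneg)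
      finally show ?thesis using ab(5) p by (intro le) linarith
    qed
    hence Ea: "hm1_le (E i j) \<epsilon>" for i j using ab(1) hm1_le_mono by blast
    have "b i \<le> \<epsilon>" for i
    proof -
      have "(b i)\<^sup>2 \<le> (\<Sum>i\<in>UNIV. (b i)\<^sup>2)" by (rule member_le_sum) auto
      thus ?thesis using ab(5) p by (intro le) linarith
    qed
    hence Eb: "hm1_le (ddiv E i) \<epsilon>" for i using ab(2) hm1_le_mono by blast
    have "c \<le> \<epsilon>" using ab(5) p by (intro le) linarith
    hence Ec: "hm1_le (ddivdiv E) \<epsilon>" using ab(4) hm1_le_mono by blast
    have t\<Phi>: "test (\<Phi> i j)" for i j using \<Phi>(1) test_on_test unfolding test_sym_on_def by blast
    have m: "E i j \<phi> = \<sigma> i j \<phi> - ip (\<Phi> i j) \<phi>" for i j \<phi> by (simp add: E_def matdist_def fdist_def ip_def)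
    have d1: "ddiv E i \<phi> = ddiv \<sigma> i \<phi> - ip (\<lambda>x. \<Sum>j\<in>UNIV. pd j (\<Phi> i j) x) \<phi>" if t: "test \<phi>" for i \<phi>
    proof -
      have "ip (\<lambda>x. \<Sum>j\<in>UNIV. pd j (\<Phi> i j) x) \<phi> = (\<Sum>j\<in>UNIV. ip (pd j (\<Phi> i j)) \<phi>)"
        by (intro ip_sum_left test_L2 test_pd t\<Phi> t)
      thus ?thesis by (simp add: ddiv_expand m sum_subtractf sum_negf sum.distrib ip_parts[OF t\<Phi> t])
    qed
    have d2: "ddivdiv E \<phi> = ddivdiv \<sigma> \<phi> - ip (\<lambda>x. \<Sum>i\<in>UNIV. \<Sum>j\<in>UNIV. pd i (pd j (\<Phi> i j)) x) \<phi>" if t: "test \<phi>" for \<phi>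
    proof -
      have "ip (\<lambda>x. \<Sum>i\<in>UNIV. \<Sum>j\<in>UNIV. pd i (pd j (\<Phi> i j)) x) \<phi> = (\<Sum>i\<in>UNIV. ip (\<lambda>x. \<Sum>j\<in>UNIV. pd i (pd j (\<Phi> i j)) x) \<phi>)"
        by (intro ip_sum_left test_L2 test_sum test_pd t\<Phi> t)
      also have "\<dots> = (\<Sum>i\<in>UNIV. \<Sum>j\<in>UNIV. ip (pd i (pd j (\<Phi> i j))) \<phi>)"
        by (intro sum.cong refl ip_sum_left test_L2 test_pd t\<Phi> t)
      finally show ?thesis
        by (simp add: ddivdiv_expand m sum_subtractf ip_parts[OF t\<Phi> test_pd[OF t]] ip_parts[OF test_pd[OF t\<Phi>] t])
    qed
    show ?thesis using \<Phi>(1) Ea Eb Ec d1 d2 unfolding m[abs_def] hm1_le_def by (intro exI[of _ \<Phi>]) auto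
  qed
  have on: "test_on \<Omega> (\<Phi> i j)" if "test_sym_on \<Omega> \<Phi>" for \<Phi> i j using that unfolding test_sym_on_def by blast
  have "Htm1 \<Omega> (\<sigma> i j)" for i j
    by (rule Htm1_closed) (use ex on in blast)
  moreover have "Htm1 \<Omega> (ddiv \<sigma> i)" for i
  proof (rule Htm1_closed)
    fix \<epsilon> :: real assume "\<epsilon> > 0"
    then obtain \<Phi> where \<Phi>: "test_sym_on \<Omega> \<Phi>" "hm1_le (\<lambda>\<phi>. ddiv \<sigma> i \<phi> - ip (\<lambda>x. \<Sum>j\<in>UNIV. pd j (\<Phi> i j) x) \<phi>) \<epsilon>"
      using ex by blast
    have "test_on \<Omega> (\<lambda>x. \<Sum>j\<in>UNIV. pd j (\<Phi> i j) x)" by (intro test_on_sum test_on_pd on[OF \<Phi>(1)])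
    thus "\<exists>w. test_on \<Omega> w \<and> hm1_le (\<lambda>\<phi>. ddiv \<sigma> i \<phi> - ip w \<phi>) \<epsilon>" using \<Phi>(2) by blast
  qed
  moreover have "Htm1 \<Omega> (ddivdiv \<sigma>)"
  proof (rule Htm1_closed)
    fix \<epsilon> :: real assume "\<epsilon> > 0"
    then obtain \<Phi> where \<Phi>: "test_sym_on \<Omega> \<Phi>" "hm1_le (\<lambda>\<phi>. ddivdiv \<sigma> \<phi> - ip (\<lambda>x. \<Sum>i\<in>UNIV. \<Sum>j\<in>UNIV. pd i (pd j (\<Phi> i j)) x) \<phi>) \<epsilon>"
      using ex by blast
    have "test_on \<Omega> (\<lambda>x. \<Sum>i\<in>UNIV. \<Sum>j\<in>UNIV. pd i (pd j (\<Phi> i j)) x)" by (intro test_on_sum test_on_pd on[OF \<Phi>(1)])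
    thus "\<exists>w. test_on \<Omega> w \<and> hm1_le (\<lambda>\<phi>. ddivdiv \<sigma> \<phi> - ip w \<phi>) \<epsilon>" using \<Phi>(2) by blast
  qed
  moreover have "\<sigma> i j \<phi> = \<sigma> j i \<phi>" if t: "test \<phi>" for i j \<phi>
  proof -
    have "\<sigma> i j \<phi> - \<sigma> j i \<phi> = 0"
    proof (rule eps_zero)
      show "2 * h1t \<phi> \<ge> 0" by (simp add: h1t_nonneg)
      fix \<epsilon> :: real assume "\<epsilon> > 0"
      then obtain \<Phi> where \<Phi>: "test_sym_on \<Omega> \<Phi>" "\<And>i j. hm1_le (\<lambda>\<phi>. \<sigma> i j \<phi> - ip (\<Phi> i j) \<phi>) \<epsilon>" using ex by blast
      have "\<Phi> i j = \<Phi> j i" using \<Phi>(1) unfolding test_sym_on_def by blast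
      moreover have "\<bar>\<sigma> i j \<phi> - ip (\<Phi> i j) \<phi>\<bar> \<le> \<epsilon> * h1t \<phi>" "\<bar>\<sigma> j i \<phi> - ip (\<Phi> j i) \<phi>\<bar> \<le> \<epsilon> * h1t \<phi>"
        using \<Phi>(2)[of i j] \<Phi>(2)[of j i] t unfolding hm1_le_def by auto
      ultimately show "\<bar>\<sigma> i j \<phi> - \<sigma> j i \<phi>\<bar> \<le> \<epsilon> * (2 * h1t \<phi>)" by simp
    qed
    thus ?thesis by simp
  qed
  ultimately show ?thesis unfolding Hhat_dd_def by blast
qed

theorem mainTheorem13:
  fixes \<Omega> :: "(real^3) set"
  assumes "open \<Omega>" and "bounded \<Omega>" and "connected \<Omega>" and "simply_connected \<Omega>"
    and "lipschitz_boundary \<Omega>" and "connected (frontier \<Omega>)"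
  shows "(\<exists>S0 S1 S2.
            bdd_lin_op \<Omega> is_sym S0 \<and> bdd_lin_op \<Omega> is_tracefree S1 \<and> bdd_lin_op \<Omega> is_sym S2 \<and>
            (\<forall>\<sigma>. Hhat_dd \<Omega> \<sigma> \<longrightarrow> (\<forall>i j \<phi>. test \<phi> \<longrightarrow>
               \<sigma> i j \<phi> = matdist (S0 \<sigma>) i j \<phi> + dsym (dcurl (matdist (S1 \<sigma>))) i j \<phi>
                          + dinc (matdist (S2 \<sigma>)) i j \<phi>)))
         \<and> (\<forall>\<sigma>. Hhat_dd \<Omega> \<sigma> \<longleftrightarrow> Htilde_dd \<Omega> \<sigma>)"
proof -
  obtain s0 s1 s2 where sp: "split_by \<Omega> (\<lambda>\<sigma>. \<sigma>) s0 s1 s2"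
    using splits_id[OF assms(1,2,5)] unfolding splits_def by blast
  have g: "potential_op \<Omega> (\<lambda>\<sigma>. s0 \<sigma> i j)" "potential_op \<Omega> (\<lambda>\<sigma>. s1 \<sigma> i j)" "potential_op \<Omega> (\<lambda>\<sigma>. s2 \<sigma> i j)" for i j
    using sp unfolding split_by_def by blast+
  have p: "s0 \<sigma> i j \<phi> = s0 \<sigma> j i \<phi>" "s2 \<sigma> i j \<phi> = s2 \<sigma> j i \<phi>" "(\<Sum>i\<in>UNIV. s1 \<sigma> i i \<phi>) = 0"
    "\<sigma> i j \<phi> = s0 \<sigma> i j \<phi> + dsym (dcurl (s1 \<sigma>)) i j \<phi> + dinc (s2 \<sigma>) i j \<phi>"
    if "Hhat_dd \<Omega> \<sigma>" "test \<phi>" for \<sigma> i j \<phi>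
    using sp that unfolding split_by_def by blast+
  have reg: "\<exists>K. regd (S \<sigma>) K" if "potential_op \<Omega> S" "Hhat_dd \<Omega> \<sigma>" for S \<sigma> using that unfolding potential_op_def by blast
  have symm: "AE x in lborel. is_sym (\<lambda>i j. rep (s \<sigma> i j) x)"
    if "\<And>i j. potential_op \<Omega> (\<lambda>\<sigma>. s \<sigma> i j)" "\<And>i j \<phi>. test \<phi> \<Longrightarrow> s \<sigma> i j \<phi> = s \<sigma> j i \<phi>" "Hhat_dd \<Omega> \<sigma>" for s \<sigma>
  proof -
    have "AE x in lborel. rep (s \<sigma> i j) x = rep (s \<sigma> j i) x" for i j
      using reg[OF that(1)[of i j] that(3)] reg[OF that(1)[of j i] that(3)] rep_AE that(2) by blast
    thus ?thesis unfolding is_sym_def by (simp add: AE_all_countable)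
  qed
  have trace: "AE x in lborel. is_tracefree (\<lambda>i j. rep (s1 \<sigma> i j) x)" if \<sigma>: "Hhat_dd \<Omega> \<sigma>" for \<sigma>
    unfolding is_tracefree_def
  proof (rule L2_AE_eqI[OF L2_sum L2_zero])
    have r: "L2 (rep (s1 \<sigma> i i))" "test \<phi> \<Longrightarrow> ip (rep (s1 \<sigma> i i)) \<phi> = s1 \<sigma> i i \<phi>" for i \<phi>
      using reg[OF g(2) \<sigma>, of i i] rep_props(2,3) by metis+
    show "L2 (rep (s1 \<sigma> i i))" for i by (rule r)
    fix \<phi> assume t: "test \<phi>"
    have "ip (\<lambda>x. \<Sum>i\<in>UNIV. rep (s1 \<sigma> i i) x) \<phi> = (\<Sum>i\<in>UNIV. s1 \<sigma> i i \<phi>)"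
      by (simp add: ip_sum_left r test_L2 t)
    thus "ip (\<lambda>x. \<Sum>i\<in>UNIV. rep (s1 \<sigma> i i) x) \<phi> = ip (\<lambda>_. 0) \<phi>" using p(3)[OF \<sigma> t] by (simp add: ip_def)
  qed
  have md: "matdist (\<lambda>i j. rep (s \<sigma> i j)) i j \<phi> = s \<sigma> i j \<phi>"
    if "\<And>i j. potential_op \<Omega> (\<lambda>\<sigma>. s \<sigma> i j)" "Hhat_dd \<Omega> \<sigma>" "test \<phi>" for s \<sigma> i j \<phi>
    using reg[OF that(1)[of i j] that(2)] rep_props(2)[OF _ that(3)]
    by (auto simp: matdist_def fdist_def ip_def)
  have "\<sigma> i j \<phi> = matdist (\<lambda>i j. rep (s0 \<sigma> i j)) i j \<phi> + dsym (dcurl (matdist (\<lambda>i j. rep (s1 \<sigma> i j)))) i j \<phi>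
      + dinc (matdist (\<lambda>i j. rep (s2 \<sigma> i j))) i j \<phi>" if \<sigma>: "Hhat_dd \<Omega> \<sigma>" and t: "test \<phi>" for \<sigma> i j \<phi>
  proof -
    have "dcurl (matdist (\<lambda>i j. rep (s1 \<sigma> i j))) i j \<phi> = dcurl (s1 \<sigma>) i j \<phi>" for i j
      by (rule dcurl_cong[OF md[of s1, OF g(2) \<sigma>] t])
    moreover have "dinc (matdist (\<lambda>i j. rep (s2 \<sigma> i j))) i j \<phi> = dinc (s2 \<sigma>) i j \<phi>"
      by (rule dinc_cong[OF md[of s2, OF g(3) \<sigma>] t])
    ultimately show ?thesis using p(4)[OF \<sigma> t, of i j] md[of s0, OF g(1) \<sigma> t, of i j] by (simp add: dsym_def)
  qed
  moreover have "bdd_lin_op \<Omega> is_sym (\<lambda>\<sigma> i j. rep (s0 \<sigma> i j))"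
    by (rule potential_op_bdd_lin_op[where s=s0, OF g(1) symm[OF g(1)]]) (auto intro: p(1))
  moreover have "bdd_lin_op \<Omega> is_tracefree (\<lambda>\<sigma> i j. rep (s1 \<sigma> i j))"
    by (rule potential_op_bdd_lin_op[where s=s1, OF g(2) trace])
  moreover have "bdd_lin_op \<Omega> is_sym (\<lambda>\<sigma> i j. rep (s2 \<sigma> i j))"
    by (rule potential_op_bdd_lin_op[where s=s2, OF g(3) symm[OF g(3)]]) (auto intro: p(2))
  moreover have "\<forall>\<sigma>. Hhat_dd \<Omega> \<sigma> \<longleftrightarrow> Htilde_dd \<Omega> \<sigma>"
    using Hhat_imp_Htilde[OF sp] Htilde_imp_Hhat by blast
  ultimately show ?thesis by blast
qed

end
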